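(* For any simple modules $V,W$ in $\mathscr{C}^0$, we have $$\Lambda(V,W)=2\,\mathrm{zero}_{z=1}(d_{V,W}(z))+\mathscr{N}(V,W).$$ In particular, for a left pre-commutative pair $(V,W)$ of simple modules in $\mathscr{C}^0$, we have $\Lambda(V,W)=\mathscr{N}(V,W)$.
   Context: Let $\mathfrak{g}$ be a finite-dimensional complex simple Lie algebra with Cartan matrix $C=(c_{ij})_{i,j\in I}$, $C^{-1}=(\widetilde c_{ij})_{i,j\in I}$, and dual Coxeter number $h^\vee$; $r=1$ if $\mathfrak{g}$ is simply-laced, $r=2$ for $B_n,C_n,F_4$, $r=3$ for $G_2$; $d_i\in\{1,r\}$ are the relatively prime positive integers with $d_ic_{ij}=d_jc_{ji}$; $i\sim j$ means $c_{ij}<0$. Fix $\epsilon:I\to\{0,1\}$ with $\epsilon_i\equiv\epsilon_j+\min(d_i,d_j)\pmod2$ whenever $i\sim j$, and put $\widehat I=\{(i,p)\in I\times\mathbb{Z}\mid p-\epsilon_i\in2\mathbb{Z}\}$. Quantum Cartan matrix: $C_{ii}(z)=z^{d_i}+z^{-d_i}$, $C_{ij}(z)=[c_{ij}]_z=(z^{c_{ij}}-z^{-c_{ij}})/(z-z^{-1})$ for $i\ne j$; $\widetilde C(z)=C(z)^{-1}$, $\widetilde C_{ij}(z)=\sum_{u\in\mathbb{Z}}\widetilde c_{ij}(u)z^u$ (Laurent expansion at $z=0$). Quantum affine algebra: $q$ is an indeterminate, $\mathbf{k}=\overline{\mathbb{Q}(q)}$ the algebraic closure inside $\bigcup_{m\ge1}\overline{\mathbb{Q}}((q^{1/m}))$,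 $q_i=q^{d_i/r}$, $q_s=q^{1/r}$. $U_q'(\widehat{\mathfrak{g}})$ is the Drinfeld–Jimbo quantum affine algebra (no degree operator) of the untwisted affine Lie algebra over $\mathbf{k}$ with generators $e_i,f_i,K_i^{\pm1}$ ($i\in I\sqcup\{0\}$, $d_0=r$), $K_ie_jK_i^{-1}=q_i^{c_{ij}}e_j$, and coproduct $e_i\mapsto e_i\otimes K_i^{-1}+1\otimes e_i$, $f_i\mapsto f_i\otimes1+K_i\otimes f_i$, $K_i\mapsto K_i\otimes K_i$. $\mathscr{C}$ is the category of finite-dimensional modules on which each $K_i$ is diagonalizable with eigenvalues in $q_i^{\mathbb{Z}}$; these are modules over the quantum loop algebra $U_q(L\mathfrak{g})$ with Drinfeld generators $k_i^{\pm1},x^\pm_{i,k},h_{i,l}$; $x_i^\pm(z)=\sum_kx^\pm_{i,k}z^k$, $\phi_i^\pm(z)=k_i^{\pm1}\exp(\pm(q_i-q_i^{-1})\sum_{l\ge1}h_{i,\pm l}z^{\pm l})$. Simple objects are $L(P)$, $P\in(1+z\mathbf{k}[z])^I$, having an $\ell$-highest weight vector $v\ne0$ (unique up to scalar) with $x_i^+(z)v=0$, $\phi_i^\pm(z)v=q_i^{\deg P_i}[P_i(q_i^{-1}z)/P_i(q_iz)]^\pm v$ (expansion at $z^{\pm1}=0$). $\pi_{i,a}=((1-az)^{\delta_{ij}})_{j\in I}$. For $(i,p)\in\widehat I$ identify $Y_{i,p}=\pi_{i,q_s^p}$; $\mathcal{M}^+$ is the monoid of monomials in the $Y_{i,p}$,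 $(i,p)\in\widehat I$, and $\mathscr{C}^0\subset\mathscr{C}$ is the Serre subcategory with simple objects $\{L(m)\mid m\in\mathcal{M}^+\}$. The pairing $\mathscr{N}$: for monomials $m=\prod Y_{i,p}^{u_{i,p}(m)}$, $m'=\prod Y_{j,s}^{u_{j,s}(m')}$ in $\mathcal{M}^+$ put $\mathscr{N}(L(m),L(m'))=\sum u_{i,p}(m)u_{j,s}(m')\mathscr{N}(i,p;j,s)$ with $\mathscr{N}(i,p;j,s)=\widetilde c_{ij}(p-s-d_i)-\widetilde c_{ij}(p-s+d_i)-\widetilde c_{ij}(s-p-d_i)+\widetilde c_{ij}(s-p+d_i)$. R-matrices: $W_z=W\otimes\mathbf{k}[z^{\pm1}]$ with $k_i$ acting on $W$, $x^\pm_{i,k}(w\otimes f)=x^\pm_{i,k}w\otimes z^kf$, $h_{i,l}(w\otimes f)=h_{i,l}w\otimes z^lf$. For simple $V,W$ with $\ell$-highest weight vectors $v,w$ and $w_z=w\otimes1$, $R^{\mathrm{norm}}_{V,W_z}$ is the unique $U_q(L\mathfrak{g})\otimes\mathbf{k}(z)$-isomorphism $(V\otimes W_z)\otimes_{\mathbf{k}[z^{\pm1}]}\mathbf{k}(z)\to(W_z\otimes V)\otimes_{\mathbf{k}[z^{\pm1}]}\mathbf{k}(z)$ with $v\otimes w_z\mapsto w_z\otimes v$; $d_{V,W}(z)$ is the monic polynomial of smallest degree such that $d_{V,W}(z)R^{\mathrm{norm}}_{V,W_z}$ maps $V\otimes W_z$ into $W_z\otimes V$. The universal R-matrix $R^{\mathrm{univ}}_{V,W_z}(v'\otimes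 w')=q^{\langle\lambda,\mu\rangle}\sum_\nu E_\nu w'\otimes F_\nu v'$ (for weight vectors with $K_iv'=q_i^{\lambda_i}v'$, $K_iw'=q_i^{\mu_i}w'$, $\langle\lambda,\mu\rangle=\sum_{i,j\in I}d_i\widetilde c_{ij}\lambda_i\mu_j$, and $\{E_\nu\},\{F_\nu\}$ dual bases of $U_q^+(\widehat{\mathfrak g})$, $U_q^-(\widehat{\mathfrak g})$, the subalgebras generated by the $e_i$ and by the $f_i$ respectively) converges $z$-adically, and the universal coefficient $a_{V,W}(z)\in\mathbf{k}[[z]]^\times$ is defined by $R^{\mathrm{univ}}_{V,W_z}(v\otimes w_z)=a_{V,W}(z)\,w_z\otimes v$. Known facts (Frenkel–Reshetikhin) that determine it: $a_{L(P_1P_2),L(P_3)}=a_{L(P_1),L(P_3)}a_{L(P_2),L(P_3)}$, $a_{L(P_1),L(P_2P_3)}=a_{L(P_1),L(P_2)}a_{L(P_1),L(P_3)}$, and $a_{L(\pi_{i,a}),L(\pi_{j,b})}(z)=q_i^{\widetilde c_{ij}}\prod_{u\ge0}\Bigl(\frac{1-q_s^{u-d_i}(b/a)z}{1-q_s^{u+d_i}(b/a)z}\Bigr)^{\widetilde c_{ij}(u)}$. Invariant $\Lambda$: let $\varphi(z)=\prod_{k\ge0}(1-q^{2kh^\vee}z)$ and let $\mathcal{G}\subset\mathbf{k}((z))^\times$ be the group of elements $f(z)=cz^m\prod_{a\in\mathbf{k}^\times}\varphi(az)^{\mu_a}$ ($c\in\mathbf{k}^\times$, $m\in\mathbb{Z}$,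 $\mu_a\in\mathbb{Z}$ almost all zero); it contains $\mathbf{k}(z)^\times$ and all $a_{V,W}(z)$. Put $\mathrm{Deg}(f)=\sum_{a\in\{q^{2kh^\vee}\mid k\le0\}}\mu_a-\sum_{a\in\{q^{2kh^\vee}\mid k>0\}}\mu_a$. For simple $V,W$, $\Lambda(V,W)=\mathrm{Deg}(d_{V,W}(z)/a_{V,W}(z))$. $\mathrm{zero}_{z=1}(f)$ is the order of zero of $f$ at $z=1$. An ordered pair $(V,W)$ is left pre-commutative if $\mathrm{zero}_{z=1}(d_{V,W}(z))=0$. *)

theory Defs
  imports
    "HOL-Algebra.Algebraic_Closure_Type"
    "HOL-Computational_Algebra.Computational_Algebra"
    "HOL-Library.Poly_Mapping"
    "HOL-Library.Multiset"
    "HOL-Combinatorics.Permutations"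
    "Jordan_Normal_Form.Matrix"
begin

section \<open>The base field\<close>

type_synonym kk = "rat poly fract alg_closure"

definition q_gen :: kk where
  "q_gen = to_ac (Fract [:0, 1:] 1)"

text \<open>
  Embedding \<open>kk\<close> into the field of Puiseux series in \<open>q\<close> provides two things: the fractional powers
  of \<open>q\<close>, and the \<open>q\<close>-adic valuation, with respect to which infinite products converge. Every pair
  with the following properties comes from such an embedding over the rational functions in \<open>q\<close>,
  and conversely.
\<close>

definition puiseux_data :: "(rat \<Rightarrow> kk) \<Rightarrow> (kk \<Rightarrow> rat) \<Rightarrow> bool" where
  "puiseux_data qpow val \<longleftrightarrow>
     qpow 1 = q_gen \<and> (\<forall>x y. qpow (x + y) = qpow x * qpow y) \<and>
     (\<forall>x y. x \<noteq> 0 \<longrightarrow> y \<noteq> 0 \<longrightarrow> val (x * y) = val x + val y) \<and>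
     (\<forall>x y. x \<noteq> 0 \<longrightarrow> y \<noteq> 0 \<longrightarrow> x + y \<noteq> 0 \<longrightarrow> min (val x) (val y) \<le> val (x + y)) \<and>
     val q_gen = 1 \<and> (\<forall>c. c \<noteq> 0 \<longrightarrow> val (to_ac (Fract [:c:] 1)) = 0)"

section \<open>Cartan data\<close>

text \<open>
  Finite-dimensional complex simple Lie algebras are given by their Cartan--Killing type, with the
  Dynkin diagrams labelled as in Bourbaki; \<open>I = {1..n}\<close>, and \<open>0\<close> is the additional affine node.
\<close>

datatype cartan_type = TypeA nat | TypeB nat | TypeC nat | TypeD nat | TypeE nat | TypeF4 | TypeG2

fun is_simple_type :: "cartan_type \<Rightarrow> bool" where
  "is_simple_type (TypeA n) \<longleftrightarrow> 1 \<le> n"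
| "is_simple_type (TypeB n) \<longleftrightarrow> 2 \<le> n"
| "is_simple_type (TypeC n) \<longleftrightarrow> 3 \<le> n"
| "is_simple_type (TypeD n) \<longleftrightarrow> 4 \<le> n"
| "is_simple_type (TypeE n) \<longleftrightarrow> n \<in> {6, 7, 8}"
| "is_simple_type TypeF4 \<longleftrightarrow> True"
| "is_simple_type TypeG2 \<longleftrightarrow> True"

fun lie_rank :: "cartan_type \<Rightarrow> nat" where
  "lie_rank (TypeA n) = n"
| "lie_rank (TypeB n) = n"
| "lie_rank (TypeC n) = n"
| "lie_rank (TypeD n) = n"
| "lie_rank (TypeE n) = n"
| "lie_rank TypeF4 = 4"
| "lie_rank TypeG2 = 2"

fun lacing :: "cartan_type \<Rightarrow> nat" where
  "lacing (TypeB n) = 2"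
| "lacing (TypeC n) = 2"
| "lacing TypeF4 = 2"
| "lacing TypeG2 = 3"
| "lacing (TypeA n) = 1"
| "lacing (TypeD n) = 1"
| "lacing (TypeE n) = 1"

fun dual_coxeter :: "cartan_type \<Rightarrow> nat" where
  "dual_coxeter (TypeA n) = n + 1"
| "dual_coxeter (TypeB n) = 2 * n - 1"
| "dual_coxeter (TypeC n) = n + 1"
| "dual_coxeter (TypeD n) = 2 * n - 2"
| "dual_coxeter (TypeE n) = (if n = 6 then 12 else if n = 7 then 18 else 30)"
| "dual_coxeter TypeF4 = 9"
| "dual_coxeter TypeG2 = 4"

text \<open>The edges \<open>i < j\<close> of the Dynkin diagram.\<close>

fun dynkin_edge :: "cartan_type \<Rightarrow> nat \<Rightarrow> nat \<Rightarrow> bool" where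
  "dynkin_edge (TypeD n) i j \<longleftrightarrow> (j = i + 1 \<and> j < n) \<or> (i = n - 2 \<and> j = n)"
| "dynkin_edge (TypeE n) i j \<longleftrightarrow> (i, j) = (1, 3) \<or> (i, j) = (2, 4) \<or> (3 \<le> i \<and> j = i + 1)"
| "dynkin_edge \<gg> i j \<longleftrightarrow> j = i + 1"

text \<open>
  A sequence of simple roots all of whose initial segments sum to a root and whose total sum is the
  highest root \<open>\<theta>\<close>. Its multiplicities are thus the coefficients of \<open>\<theta>\<close>.
\<close>

fun theta_word :: "cartan_type \<Rightarrow> nat list" where
  "theta_word (TypeA n) = [1..<n + 1]"
| "theta_word (TypeB n) = [1..<n + 1] @ rev [2..<n + 1]"
| "theta_word (TypeC n) = [1..<n + 1] @ rev [1..<n]"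
| "theta_word (TypeD n) = [1..<n + 1] @ rev [2..<n - 1]"
| "theta_word (TypeE n) =
     (if n = 6 then [6,5,4,3,2,4,5,1,3,4,2]
      else if n = 7 then [7,6,5,4,3,2,4,5,6,1,3,4,5,2,4,3,1]
      else [8,7,6,5,4,3,2,4,5,6,7,1,3,4,5,6,2,4,5,3,4,1,3,2,4,5,6,7,8])"
| "theta_word TypeF4 = [4,3,2,3,4,1,2,3,3,2,1]"
| "theta_word TypeG2 = [2,1,1,1,2]"

fun symmetrizer :: "cartan_type \<Rightarrow> nat \<Rightarrow> nat" where
  "symmetrizer (TypeB n) i = (if i = n then 1 else 2)"
| "symmetrizer (TypeC n) i = (if i = 0 \<or> i = n then 2 else 1)"
| "symmetrizer TypeF4 i = (if i \<le> 2 then 2 else 1)"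
| "symmetrizer TypeG2 i = (if i = 1 then 1 else 3)"
| "symmetrizer \<gg> i = 1"

text \<open>
  \<open>(\<alpha>\<^sub>i, \<alpha>\<^sub>j) = d\<^sub>i c\<^sub>i\<^sub>j\<close> equals \<open>- max d\<^sub>i d\<^sub>j\<close> for adjacent nodes \<open>i\<close>, \<open>j\<close>. The affine entries are
  those of \<open>\<alpha>\<^sub>0 = \<delta> - \<theta>\<close>, with \<open>d\<^sub>0 = r\<close>.
\<close>

definition cartan :: "cartan_type \<Rightarrow> nat \<Rightarrow> nat \<Rightarrow> int" where
  "cartan \<gg> i j =
     (let d = symmetrizer \<gg> in
      if i = j then 2
      else if dynkin_edge \<gg> i j \<or> dynkin_edge \<gg> j i then - int (max (d i) (d j) div d i)
      else 0)"

definition affine_cartan :: "cartan_type \<Rightarrow> nat \<Rightarrow> nat \<Rightarrow> int" where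
  "affine_cartan \<gg> i j =
     (if i = 0 \<and> j = 0 then 2
      else if j = 0 then - (\<Sum>t\<leftarrow>theta_word \<gg>. cartan \<gg> i t)
      else if i = 0 then - ((\<Sum>t\<leftarrow>theta_word \<gg>. int (symmetrizer \<gg> t) * cartan \<gg> t j) div int (lacing \<gg>))
      else cartan \<gg> i j)"

definition inverse_on :: "nat set \<Rightarrow> (nat \<Rightarrow> nat \<Rightarrow> 'a) \<Rightarrow> nat \<Rightarrow> nat \<Rightarrow> 'a :: field" where
  "inverse_on I A = (THE B.
     (\<forall>i\<in>I. \<forall>j\<in>I. (\<Sum>k\<in>I. A i k * B k j) = (if i = j then 1 else 0)) \<and>
     (\<forall>i j. i \<notin> I \<or> j \<notin> I \<longrightarrow> B i j = 0))"

definition cartan_inverse :: "cartan_type \<Rightarrow> nat \<Rightarrow> nat \<Rightarrow> rat" where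
  "cartan_inverse \<gg> = inverse_on {1..lie_rank \<gg>} (\<lambda>i j. of_int (cartan \<gg> i j))"

definition quantum_cartan :: "cartan_type \<Rightarrow> nat \<Rightarrow> nat \<Rightarrow> rat fls" where
  "quantum_cartan \<gg> i j =
     (let d = int (symmetrizer \<gg> i); c = cartan \<gg> i j in
      if i = j then fls_X_intpow d + fls_X_intpow (- d)
      else (fls_X_intpow c - fls_X_intpow (- c)) / (fls_X_intpow 1 - fls_X_intpow (- 1)))"

text \<open>
  Inverting over the field of Laurent series gives the expansion at \<open>z = 0\<close> of the inverse over the
  rational functions. The coefficients of this expansion are integers.
\<close>

definition quantum_cartan_inverse :: "cartan_type \<Rightarrow> nat \<Rightarrow> nat \<Rightarrow> int \<Rightarrow> int" where
  "quantum_cartan_inverse \<gg> i j u =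
     \<lfloor>fls_nth (inverse_on {1..lie_rank \<gg>} (quantum_cartan \<gg>) i j) u\<rfloor>"

definition parity_function :: "cartan_type \<Rightarrow> (nat \<Rightarrow> int) \<Rightarrow> bool" where
  "parity_function \<gg> \<epsilon> \<longleftrightarrow>
     (\<forall>i\<in>{1..lie_rank \<gg>}. \<epsilon> i \<in> {0, 1}) \<and>
     (\<forall>i\<in>{1..lie_rank \<gg>}. \<forall>j\<in>{1..lie_rank \<gg>}. cartan \<gg> i j < 0 \<longrightarrow>
        \<epsilon> i mod 2 = (\<epsilon> j + int (min (symmetrizer \<gg> i) (symmetrizer \<gg> j))) mod 2)"

definition I_hat :: "cartan_type \<Rightarrow> (nat \<Rightarrow> int) \<Rightarrow> (nat \<times> int) set" where
  "I_hat \<gg> \<epsilon> = {(i, p). i \<in> {1..lie_rank \<gg>} \<and> even (p - \<epsilon> i)}"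

text \<open>
  Monomials in the \<open>Y\<^sub>i\<^sub>,\<^sub>p\<close> are multisets of pairs \<open>(i, p)\<close>, so that \<open>u\<^sub>i\<^sub>,\<^sub>p(m) = count m (i, p)\<close>.
\<close>

definition monomials :: "cartan_type \<Rightarrow> (nat \<Rightarrow> int) \<Rightarrow> (nat \<times> int) multiset set" where
  "monomials \<gg> \<epsilon> = {m. set_mset m \<subseteq> I_hat \<gg> \<epsilon>}"

fun pairing_Y :: "cartan_type \<Rightarrow> nat \<times> int \<Rightarrow> nat \<times> int \<Rightarrow> int" where
  "pairing_Y \<gg> (i, p) (j, s) =
     (let c = quantum_cartan_inverse \<gg> i j; d = int (symmetrizer \<gg> i) in
      c (p - s - d) - c (p - s + d) - c (s - p - d) + c (s - p + d))"

definition pairing_monomial ::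
  "cartan_type \<Rightarrow> (nat \<times> int) multiset \<Rightarrow> (nat \<times> int) multiset \<Rightarrow> int" where
  "pairing_monomial \<gg> m m' =
     (\<Sum>x\<in>set_mset m. \<Sum>y\<in>set_mset m'. int (count m x) * int (count m' y) * pairing_Y \<gg> x y)"

section \<open>Free associative algebras\<close>

datatype 'a free_monoid = Word (letters: "'a list")

instantiation free_monoid :: (type) monoid_add
begin

definition zero_free_monoid :: "'a free_monoid" where
  "0 = Word []"

definition plus_free_monoid :: "'a free_monoid \<Rightarrow> 'a free_monoid \<Rightarrow> 'a free_monoid" where
  "u + w = Word (letters u @ letters w)"

instance
  by standard (simp_all add: zero_free_monoid_def plus_free_monoid_def)

end

text \<open>
  Generators of the quantum loop algebra: the Chevalley generators \<open>e\<^sub>i, f\<^sub>i, K\<^sub>i, K\<^sub>i\<^sup>-\<^sup>1\<close> for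
  \<open>0 \<le> i \<le> n\<close> and the Drinfeld generators \<open>x\<^sup>+\<^sub>i\<^sub>,\<^sub>k, x\<^sup>-\<^sub>i\<^sub>,\<^sub>k, h\<^sub>i\<^sub>,\<^sub>l\<close> for \<open>1 \<le> i \<le> n\<close>; the Drinfeld
  generator \<open>k\<^sub>i\<close> is \<open>K\<^sub>i\<close>.
\<close>

datatype gen =
    Chev_E nat | Chev_F nat | Chev_K nat | Chev_Kinv nat
  | Drin_Xp nat int | Drin_Xm nat int | Drin_H nat int

type_synonym free_alg = "(gen free_monoid, kk) poly_mapping"

definition gn :: "gen \<Rightarrow> free_alg" where
  "gn g = Poly_Mapping.single (Word [g]) 1"

definition scal :: "kk \<Rightarrow> free_alg" where
  "scal c = Poly_Mapping.single 0 c"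

definition two_sided_ideal :: "'a :: ring_1 set \<Rightarrow> 'a set" where
  "two_sided_ideal S = \<Inter>{J. S \<subseteq> J \<and> 0 \<in> J \<and> (\<forall>x\<in>J. \<forall>y\<in>J. x + y \<in> J) \<and>
     (\<forall>x\<in>J. \<forall>a. a * x \<in> J \<and> x * a \<in> J)}"

definition qint :: "kk \<Rightarrow> int \<Rightarrow> kk" where
  "qint a m = (a powi m - a powi (- m)) / (a - inverse a)"

definition qfact :: "kk \<Rightarrow> nat \<Rightarrow> kk" where
  "qfact a m = (\<Prod>k=1..m. qint a (int k))"

definition qbinom :: "kk \<Rightarrow> nat \<Rightarrow> nat \<Rightarrow> kk" where
  "qbinom a m k = qfact a m / (qfact a k * qfact a (m - k))"

section \<open>Finite-dimensional representations\<close>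

text \<open>Representations are given by matrices with respect to a basis.\<close>

record loop_rep =
  rep_dim :: nat
  rep_gen :: "gen \<Rightarrow> kk mat"

definition word_mat :: "loop_rep \<Rightarrow> gen list \<Rightarrow> kk mat" where
  "word_mat V gs = foldr (\<lambda>g M. rep_gen V g * M) gs (1\<^sub>m (rep_dim V))"

definition act :: "loop_rep \<Rightarrow> free_alg \<Rightarrow> kk mat" where
  "act V x = mat (rep_dim V) (rep_dim V)
     (\<lambda>ij. \<Sum>w\<in>Poly_Mapping.keys x. Poly_Mapping.lookup x w * word_mat V (letters w) $$ ij)"

definition kron_vec :: "'a :: times vec \<Rightarrow> 'a vec \<Rightarrow> 'a vec" where
  "kron_vec v w = vec (dim_vec v * dim_vec w)
     (\<lambda>k. v $ (k div dim_vec w) * w $ (k mod dim_vec w))"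

definition kron_mat :: "'a :: times mat \<Rightarrow> 'a mat \<Rightarrow> 'a mat" where
  "kron_mat A B = mat (dim_row A * dim_row B) (dim_col A * dim_col B)
     (\<lambda>(i, j). A $$ (i div dim_row B, j div dim_col B) * B $$ (i mod dim_row B, j mod dim_col B))"

type_synonym kz = "kk poly fract"

definition kz_const :: "kk \<Rightarrow> kz" where
  "kz_const c = Fract [:c:] 1"

definition kz_z :: kz where
  "kz_z = Fract [:0, 1:] 1"

definition laurent_polys :: "kz set" where
  "laurent_polys = {f. \<exists>p n. f = Fract p (monom 1 n)}"

text \<open>
  The degree with respect to the loop parameter; \<open>e\<^sub>0\<close> and \<open>f\<^sub>0\<close> have degree \<open>1\<close> and \<open>-1\<close>, since
  they are expressions in Drinfeld generators of these total degrees.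
\<close>

fun loop_degree :: "gen \<Rightarrow> int" where
  "loop_degree (Chev_E i) = (if i = 0 then 1 else 0)"
| "loop_degree (Chev_F i) = (if i = 0 then - 1 else 0)"
| "loop_degree (Chev_K i) = 0"
| "loop_degree (Chev_Kinv i) = 0"
| "loop_degree (Drin_Xp i k) = k"
| "loop_degree (Drin_Xm i k) = k"
| "loop_degree (Drin_H i l) = l"

text \<open>The modules \<open>V \<otimes> k(z)\<close> and \<open>W\<^sub>z \<otimes> k(z)\<close>, the latter tensored over Laurent polynomials.\<close>

definition gen_const :: "loop_rep \<Rightarrow> gen \<Rightarrow> kz mat" where
  "gen_const V g = map_mat kz_const (rep_gen V g)"

definition gen_affinized :: "loop_rep \<Rightarrow> gen \<Rightarrow> kz mat" where
  "gen_affinized W g = (kz_z powi loop_degree g) \<cdot>\<^sub>m map_mat kz_const (rep_gen W g)"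

fun coproduct_act :: "nat \<Rightarrow> nat \<Rightarrow> (gen \<Rightarrow> kz mat) \<Rightarrow> (gen \<Rightarrow> kz mat) \<Rightarrow> gen \<Rightarrow> kz mat" where
  "coproduct_act a b A B (Chev_E i) =
     kron_mat (A (Chev_E i)) (B (Chev_Kinv i)) + kron_mat (1\<^sub>m a) (B (Chev_E i))"
| "coproduct_act a b A B (Chev_F i) =
     kron_mat (A (Chev_F i)) (1\<^sub>m b) + kron_mat (A (Chev_K i)) (B (Chev_F i))"
| "coproduct_act a b A B (Chev_K i) = kron_mat (A (Chev_K i)) (B (Chev_K i))"
| "coproduct_act a b A B (Chev_Kinv i) = kron_mat (A (Chev_Kinv i)) (B (Chev_Kinv i))"

locale quantum_loop_algebra =
  fixes \<gg> :: cartan_type and qpow :: "rat \<Rightarrow> kk" and val :: "kk \<Rightarrow> rat"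
  assumes simple_type: "is_simple_type \<gg>"
    and puiseux: "puiseux_data qpow val"
begin

abbreviation "nodes \<equiv> {1..lie_rank \<gg>}"

abbreviation "affine_nodes \<equiv> {0..lie_rank \<gg>}"

abbreviation "d \<equiv> symmetrizer \<gg>"

abbreviation "r \<equiv> lacing \<gg>"

abbreviation "ct \<equiv> quantum_cartan_inverse \<gg>"

definition qs :: kk where
  "qs = qpow (1 / of_nat r)"

definition qi :: "nat \<Rightarrow> kk" where
  "qi i = qs ^ d i"

section \<open>Quantum affine and quantum loop algebra\<close>

abbreviation "gE i \<equiv> gn (Chev_E i)"

abbreviation "gF i \<equiv> gn (Chev_F i)"

abbreviation "gK i \<equiv> gn (Chev_K i)"

abbreviation "gKinv i \<equiv> gn (Chev_Kinv i)"

abbreviation "gH i l \<equiv> gn (Drin_H i l)"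

text \<open>\<open>x\<^sup>+\<^sub>i\<^sub>,\<^sub>k\<close> for \<open>\<sigma> = 1\<close> and \<open>x\<^sup>-\<^sub>i\<^sub>,\<^sub>k\<close> for \<open>\<sigma> = -1\<close>\<close>

abbreviation x_gen :: "int \<Rightarrow> nat \<Rightarrow> int \<Rightarrow> free_alg" where
  "x_gen \<sigma> i k \<equiv> gn (if \<sigma> = 1 then Drin_Xp i k else Drin_Xm i k)"

definition chevalley_relations :: "free_alg set" where
  "chevalley_relations =
     {gK i * gKinv i - 1 | i. i \<in> affine_nodes} \<union>
     {gKinv i * gK i - 1 | i. i \<in> affine_nodes} \<union>
     {gK i * gK j - gK j * gK i | i j. i \<in> affine_nodes \<and> j \<in> affine_nodes} \<union>
     {gK i * gE j - scal (qi i powi affine_cartan \<gg> i j) * gE j * gK i | i j.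
        i \<in> affine_nodes \<and> j \<in> affine_nodes} \<union>
     {gK i * gF j - scal (qi i powi (- affine_cartan \<gg> i j)) * gF j * gK i | i j.
        i \<in> affine_nodes \<and> j \<in> affine_nodes} \<union>
     {gE i * gF j - gF j * gE i
        - (if i = j then scal (inverse (qi i - inverse (qi i))) * (gK i - gKinv i) else 0) | i j.
        i \<in> affine_nodes \<and> j \<in> affine_nodes} \<union>
     {(\<Sum>k\<le>s. scal ((- 1) ^ k * qbinom (qi i) s k) * x i ^ (s - k) * x j * x i ^ k) | i j s x.
        i \<in> affine_nodes \<and> j \<in> affine_nodes \<and> i \<noteq> j \<and> s = nat (1 - affine_cartan \<gg> i j) \<and>
        x \<in> {\<lambda>i. gE i, \<lambda>i. gF i}}"

text \<open>
  \<open>\<phi>_coeff \<sigma> i m\<close> is the coefficient of \<open>z\<^sup>\<sigma>\<^sup>m\<close> in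
  \<open>k\<^sub>i\<^sup>\<sigma> exp (\<sigma> (q\<^sub>i - q\<^sub>i\<^sup>-\<^sup>1) \<Sum>\<^sub>l\<^sub>\<ge>\<^sub>1 h\<^sub>i\<^sub>,\<^sub>\<sigma>\<^sub>l z\<^sup>\<sigma>\<^sup>l)\<close>, for \<open>\<sigma> = 1\<close> or \<open>\<sigma> = -1\<close>.
\<close>

definition h_series :: "int \<Rightarrow> nat \<Rightarrow> free_alg fps" where
  "h_series \<sigma> i = Abs_fps (\<lambda>l. if l = 0 then 0
     else scal (of_int \<sigma> * (qi i - inverse (qi i))) * gH i (\<sigma> * int l))"

definition \<phi>_coeff :: "int \<Rightarrow> nat \<Rightarrow> nat \<Rightarrow> free_alg" where
  "\<phi>_coeff \<sigma> i m = (if \<sigma> = 1 then gK i else gKinv i) *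
     (\<Sum>t\<le>m. scal (1 / fact t) * fps_nth (h_series \<sigma> i ^ t) m)"

definition \<phi>_mode :: "int \<Rightarrow> nat \<Rightarrow> int \<Rightarrow> free_alg" where
  "\<phi>_mode \<sigma> i k = (if 0 \<le> \<sigma> * k then \<phi>_coeff \<sigma> i (nat (\<sigma> * k)) else 0)"

definition drinfeld_relations :: "free_alg set" where
  "drinfeld_relations =
     {gK i * gH j l - gH j l * gK i | i j l. i \<in> nodes \<and> j \<in> nodes \<and> l \<noteq> 0} \<union>
     {gH i l * gH j m - gH j m * gH i l | i j l m. i \<in> nodes \<and> j \<in> nodes \<and> l \<noteq> 0 \<and> m \<noteq> 0} \<union>
     {gK i * x_gen \<sigma> j m - scal (qi i powi (\<sigma> * cartan \<gg> i j)) * x_gen \<sigma> j m * gK i | \<sigma> i j m.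
        \<sigma> \<in> {1, - 1} \<and> i \<in> nodes \<and> j \<in> nodes} \<union>
     {gH i l * x_gen \<sigma> j m - x_gen \<sigma> j m * gH i l
        - scal (of_int \<sigma> * qint (qi i) (l * cartan \<gg> i j) / of_int l) * x_gen \<sigma> j (l + m) | \<sigma> i j l m.
        \<sigma> \<in> {1, - 1} \<and> i \<in> nodes \<and> j \<in> nodes \<and> l \<noteq> 0} \<union>
     {x_gen \<sigma> i (m + 1) * x_gen \<sigma> j l
        - scal (qi i powi (\<sigma> * cartan \<gg> i j)) * x_gen \<sigma> j l * x_gen \<sigma> i (m + 1)
        - scal (qi i powi (\<sigma> * cartan \<gg> i j)) * x_gen \<sigma> i m * x_gen \<sigma> j (l + 1)
        + x_gen \<sigma> j (l + 1) * x_gen \<sigma> i m | \<sigma> i j m l.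
        \<sigma> \<in> {1, - 1} \<and> i \<in> nodes \<and> j \<in> nodes} \<union>
     {x_gen 1 i m * x_gen (- 1) j l - x_gen (- 1) j l * x_gen 1 i m
        - (if i = j then scal (inverse (qi i - inverse (qi i)))
             * (\<phi>_mode 1 i (m + l) - \<phi>_mode (- 1) i (m + l)) else 0) | i j m l.
        i \<in> nodes \<and> j \<in> nodes} \<union>
     {(\<Sum>\<pi> | \<pi> permutes {..<s}. \<Sum>k\<le>s. scal ((- 1) ^ k * qbinom (qi i) s k) *
          (\<Prod>a\<leftarrow>[0..<k]. x_gen \<sigma> i (ms (\<pi> a))) * x_gen \<sigma> j m *
          (\<Prod>a\<leftarrow>[k..<s]. x_gen \<sigma> i (ms (\<pi> a)))) | \<sigma> i j s m (ms :: nat \<Rightarrow> int).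
        \<sigma> \<in> {1, - 1} \<and> i \<in> nodes \<and> j \<in> nodes \<and> i \<noteq> j \<and> s = nat (1 - cartan \<gg> i j)}"

text \<open>
  The identification of the two presentations (Drinfeld, Beck, Jing): the central element
  \<open>K\<^sub>\<delta> = K\<^sub>0 K\<^sub>\<theta>\<close> acts trivially, and \<open>e\<^sub>0\<close> is an iterated \<open>q\<close>-commutator times \<open>K\<^sub>0\<close>. This fixes \<open>f\<^sub>0\<close>.
  The scalar in front of the iterated commutator may be chosen freely: changing it amounts to
  rescaling the spectral parameters of all modules by a common factor.
\<close>

definition q_bracket :: "free_alg \<Rightarrow> nat \<Rightarrow> free_alg" where
  "q_bracket a i = x_gen (- 1) i 0 * a - gKinv i * a * gK i * x_gen (- 1) i 0"

definition identification_relations :: "free_alg set" where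
  "identification_relations =
     {x_gen 1 i 0 - gE i | i. i \<in> nodes} \<union>
     {x_gen (- 1) i 0 - gF i | i. i \<in> nodes} \<union>
     {gK 0 * (\<Prod>i\<leftarrow>theta_word \<gg>. gK i) - 1} \<union>
     {gE 0 - foldl q_bracket (x_gen (- 1) (hd (theta_word \<gg>)) 1) (tl (theta_word \<gg>)) * gK 0}"

definition loop_relations :: "free_alg set" where
  "loop_relations = chevalley_relations \<union> drinfeld_relations \<union> identification_relations"

definition chevalley_gens :: "gen set" where
  "chevalley_gens = (\<Union>i\<in>affine_nodes. {Chev_E i, Chev_F i, Chev_K i, Chev_Kinv i})"

definition gens :: "gen set" where
  "gens = chevalley_gens \<union>
     (\<Union>i\<in>nodes. range (Drin_Xp i) \<union> range (Drin_Xm i) \<union> Drin_H i ` (- {0}))"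

section \<open>The category of modules and its simple objects\<close>

definition is_module :: "loop_rep \<Rightarrow> bool" where
  "is_module V \<longleftrightarrow>
     (\<forall>g\<in>gens. rep_gen V g \<in> carrier_mat (rep_dim V) (rep_dim V)) \<and>
     (\<forall>x\<in>loop_relations. act V x = 0\<^sub>m (rep_dim V) (rep_dim V))"

definition in_C :: "loop_rep \<Rightarrow> bool" where
  "in_C V \<longleftrightarrow> is_module V \<and>
     (\<forall>i\<in>affine_nodes. \<exists>D. similar_mat (rep_gen V (Chev_K i)) D \<and> diagonal_mat D \<and>
        (\<forall>a<rep_dim V. D $$ (a, a) \<in> range (\<lambda>m :: int. qi i powi m)))"

definition is_submodule :: "loop_rep \<Rightarrow> kk vec set \<Rightarrow> bool" where
  "is_submodule V S \<longleftrightarrow> S \<subseteq> carrier_vec (rep_dim V) \<and> 0\<^sub>v (rep_dim V) \<in> S \<and>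
     (\<forall>v\<in>S. \<forall>w\<in>S. v + w \<in> S) \<and> (\<forall>c. \<forall>v\<in>S. c \<cdot>\<^sub>v v \<in> S) \<and>
     (\<forall>g\<in>gens. \<forall>v\<in>S. rep_gen V g *\<^sub>v v \<in> S)"

definition is_simple :: "loop_rep \<Rightarrow> bool" where
  "is_simple V \<longleftrightarrow> in_C V \<and> 0 < rep_dim V \<and>
     (\<forall>S. is_submodule V S \<longrightarrow> S = {0\<^sub>v (rep_dim V)} \<or> S = carrier_vec (rep_dim V))"

definition isomorphic :: "loop_rep \<Rightarrow> loop_rep \<Rightarrow> bool" where
  "isomorphic V W \<longleftrightarrow> rep_dim V = rep_dim W \<and>
     (\<exists>T \<in> carrier_mat (rep_dim W) (rep_dim V). invertible_mat T \<and>
        (\<forall>g\<in>gens. T * rep_gen V g = rep_gen W g * T))"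

definition drinfeld_polys :: "(nat \<Rightarrow> kk poly) set" where
  "drinfeld_polys = {P. \<forall>i\<in>nodes. Polynomial.coeff (P i) 0 = 1}"

text \<open>
  The expansion of \<open>P (q\<^sub>i\<^sup>-\<^sup>1 z) / P (q\<^sub>i z)\<close> at \<open>z\<^sup>-\<^sup>1 = 0\<close> is obtained by reversing the coefficients of
  numerator and denominator, which have the same degree.
\<close>

definition l_highest_weight_vector :: "loop_rep \<Rightarrow> (nat \<Rightarrow> kk poly) \<Rightarrow> kk vec \<Rightarrow> bool" where
  "l_highest_weight_vector V P v \<longleftrightarrow> P \<in> drinfeld_polys \<and>
     v \<in> carrier_vec (rep_dim V) \<and> v \<noteq> 0\<^sub>v (rep_dim V) \<and>
     (\<forall>i\<in>nodes. \<forall>k. rep_gen V (Drin_Xp i k) *\<^sub>v v = 0\<^sub>v (rep_dim V)) \<and>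
     (\<forall>i\<in>nodes. let num = P i \<circ>\<^sub>p [:0, inverse (qi i):]; den = P i \<circ>\<^sub>p [:0, qi i:];
                     c = qi i ^ Polynomial.degree (P i) in
        \<forall>m. act V (\<phi>_coeff 1 i m) *\<^sub>v v =
              (c * fps_nth (fps_of_poly num / fps_of_poly den) m) \<cdot>\<^sub>v v \<and>
            act V (\<phi>_coeff (- 1) i m) *\<^sub>v v =
              (c * fps_nth (fps_of_poly (reflect_poly num) / fps_of_poly (reflect_poly den)) m) \<cdot>\<^sub>v v)"

definition L :: "(nat \<Rightarrow> kk poly) \<Rightarrow> loop_rep" where
  "L P = (SOME V. is_simple V \<and> (\<exists>v. l_highest_weight_vector V P v))"

definition fundamental_poly :: "nat \<Rightarrow> kk \<Rightarrow> nat \<Rightarrow> kk poly" where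
  "fundamental_poly i a = (\<lambda>j. if j = i then [:1, - a:] else 1)"

definition monomial_poly :: "(nat \<times> int) multiset \<Rightarrow> nat \<Rightarrow> kk poly" where
  "monomial_poly m = (\<lambda>j. \<Prod>(i, p)\<in>#m. fundamental_poly i (qs powi p) j)"

definition simple_in_C0 :: "(nat \<Rightarrow> int) \<Rightarrow> loop_rep \<Rightarrow> bool" where
  "simple_in_C0 \<epsilon> V \<longleftrightarrow>
     is_simple V \<and> (\<exists>m\<in>monomials \<gg> \<epsilon>. isomorphic V (L (monomial_poly m)))"

definition monomial_of :: "(nat \<Rightarrow> int) \<Rightarrow> loop_rep \<Rightarrow> (nat \<times> int) multiset" where
  "monomial_of \<epsilon> V = (SOME m. m \<in> monomials \<gg> \<epsilon> \<and> isomorphic V (L (monomial_poly m)))"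

definition pairing_N :: "(nat \<Rightarrow> int) \<Rightarrow> loop_rep \<Rightarrow> loop_rep \<Rightarrow> int" where
  "pairing_N \<epsilon> V W = pairing_monomial \<gg> (monomial_of \<epsilon> V) (monomial_of \<epsilon> W)"

section \<open>Normalized R-matrices and their denominators\<close>

definition is_Rnorm :: "loop_rep \<Rightarrow> loop_rep \<Rightarrow> kz mat \<Rightarrow> bool" where
  "is_Rnorm V W R \<longleftrightarrow>
     R \<in> carrier_mat (rep_dim W * rep_dim V) (rep_dim V * rep_dim W) \<and> invertible_mat R \<and>
     (\<forall>g\<in>chevalley_gens.
        R * coproduct_act (rep_dim V) (rep_dim W) (gen_const V) (gen_affinized W) g =
        coproduct_act (rep_dim W) (rep_dim V) (gen_affinized W) (gen_const V) g * R) \<and>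
     (\<exists>P Q v w. l_highest_weight_vector V P v \<and> l_highest_weight_vector W Q w \<and>
        R *\<^sub>v map_vec kz_const (kron_vec v w) = map_vec kz_const (kron_vec w v))"

definition Rnorm :: "loop_rep \<Rightarrow> loop_rep \<Rightarrow> kz mat" where
  "Rnorm V W = (THE R. is_Rnorm V W R)"

definition clears_denominators :: "loop_rep \<Rightarrow> loop_rep \<Rightarrow> kk poly \<Rightarrow> bool" where
  "clears_denominators V W p \<longleftrightarrow>
     (\<forall>i < rep_dim W * rep_dim V. \<forall>j < rep_dim V * rep_dim W.
        Fract p 1 * Rnorm V W $$ (i, j) \<in> laurent_polys)"

definition denominator :: "loop_rep \<Rightarrow> loop_rep \<Rightarrow> kk poly" where
  "denominator V W = (THE p. Polynomial.lead_coeff p = 1 \<and> clears_denominators V W p \<and>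
     (\<forall>p'. Polynomial.lead_coeff p' = 1 \<longrightarrow> clears_denominators V W p' \<longrightarrow>
        Polynomial.degree p \<le> Polynomial.degree p'))"

definition left_pre_commutative :: "loop_rep \<Rightarrow> loop_rep \<Rightarrow> bool" where
  "left_pre_commutative V W \<longleftrightarrow> order 1 (denominator V W) = 0"

section \<open>The universal R-matrix and the universal coefficient\<close>

text \<open>
  Words in \<open>e\<^sub>0, \<dots>, e\<^sub>n\<close> and in \<open>f\<^sub>0, \<dots>, f\<^sub>n\<close> are represented by the lists of their indices. This is
  the pairing of the positive and the negative part for which the canonical element intertwines
  the given coproduct and its opposite. If \<open>\<partial>\<^sub>i\<close> is the skew derivation with \<open>\<partial>\<^sub>i e\<^sub>j = \<delta>\<^sub>i\<^sub>j\<close> and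
  \<open>\<partial>\<^sub>i (x y) = \<partial>\<^sub>i x y + x' \<partial>\<^sub>i y\<close>, where \<open>x' = K\<^sub>i\<^sup>-\<^sup>1 x K\<^sub>i\<close>, then
  \<open>(x, f\<^sub>i y) = (\<partial>\<^sub>i x, y) / (q\<^sub>i - q\<^sub>i\<^sup>-\<^sup>1)\<close>; in particular \<open>(e\<^sub>i, f\<^sub>j) = \<delta>\<^sub>i\<^sub>j / (q\<^sub>i - q\<^sub>i\<^sup>-\<^sup>1)\<close>.
\<close>

fun word_pairing :: "nat list \<Rightarrow> nat list \<Rightarrow> kk" where
  "word_pairing w [] = (if w = [] then 1 else 0)"
| "word_pairing w (i # u) =
     (\<Sum>t<length w. if w ! t = i
        then qi i powi (- (\<Sum>s<t. affine_cartan \<gg> i (w ! s)))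
               * word_pairing (take t w @ drop (Suc t) w) u
        else 0) / (qi i - inverse (qi i))"

fun chev_index :: "gen \<Rightarrow> nat" where
  "chev_index (Chev_E i) = i"
| "chev_index (Chev_F i) = i"

definition hopf_pairing :: "free_alg \<Rightarrow> free_alg \<Rightarrow> kk" where
  "hopf_pairing x y = (\<Sum>w\<in>Poly_Mapping.keys x. \<Sum>u\<in>Poly_Mapping.keys y.
     Poly_Mapping.lookup x w * Poly_Mapping.lookup y u *
     word_pairing (map chev_index (letters w)) (map chev_index (letters u)))"

text \<open>
  Homogeneous components of the free algebras covering the positive part (for \<open>g = Chev_E\<close>) and the
  negative part (for \<open>g = Chev_F\<close>); the multiset \<open>\<beta>\<close> of affine nodes stands for \<open>\<Sum>\<^sub>i\<^sub>\<in>\<^sub>\<beta> \<alpha>\<^sub>i\<close>.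
\<close>

definition half_component :: "(nat \<Rightarrow> gen) \<Rightarrow> nat multiset \<Rightarrow> free_alg set" where
  "half_component g \<beta> =
     {x. \<forall>w\<in>Poly_Mapping.keys x. \<exists>is. letters w = map g is \<and> mset is = \<beta>}"

text \<open>
  Dual bases of the homogeneous components of weights \<open>\<beta>\<close> and \<open>-\<beta>\<close> in the positive and negative
  part, i.e. modulo the defining ideal of the quantum affine algebra. Linear independence follows
  from duality, as the pairing vanishes on this ideal.
\<close>

definition dual_bases ::
  "nat multiset \<Rightarrow> nat \<Rightarrow> (nat \<Rightarrow> free_alg) \<Rightarrow> (nat \<Rightarrow> free_alg) \<Rightarrow> bool" where
  "dual_bases \<beta> N b b' \<longleftrightarrow>
     (\<forall>\<nu><N. b \<nu> \<in> half_component Chev_E \<beta> \<and> b' \<nu> \<in> half_component Chev_F \<beta>) \<and>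
     (\<forall>\<nu><N. \<forall>\<nu>'<N. hopf_pairing (b \<nu>) (b' \<nu>') = (if \<nu> = \<nu>' then 1 else 0)) \<and>
     (\<forall>x\<in>half_component Chev_E \<beta>. \<exists>c. x - (\<Sum>\<nu><N. scal (c \<nu>) * b \<nu>) \<in> two_sided_ideal chevalley_relations) \<and>
     (\<forall>y\<in>half_component Chev_F \<beta>. \<exists>c. y - (\<Sum>\<nu><N. scal (c \<nu>) * b' \<nu>) \<in> two_sided_ideal chevalley_relations)"

definition canonical_term ::
  "loop_rep \<Rightarrow> loop_rep \<Rightarrow> kk vec \<Rightarrow> kk vec \<Rightarrow> nat multiset \<Rightarrow> kk vec" where
  "canonical_term V W v w \<beta> =
     (case SOME (N, b, b'). dual_bases \<beta> N b b' of (N, b, b') \<Rightarrow>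
        vec (rep_dim W * rep_dim V)
          (\<lambda>k. \<Sum>\<nu><N. kron_vec (act W (b \<nu>) *\<^sub>v w) (act V (b' \<nu>) *\<^sub>v v) $ k))"

definition weight_vector :: "loop_rep \<Rightarrow> (nat \<Rightarrow> int) \<Rightarrow> kk vec \<Rightarrow> bool" where
  "weight_vector V \<mu> v \<longleftrightarrow> v \<in> carrier_vec (rep_dim V) \<and>
     (\<forall>i\<in>nodes. rep_gen V (Chev_K i) *\<^sub>v v = (qi i powi \<mu> i) \<cdot>\<^sub>v v)"

definition weight_form :: "(nat \<Rightarrow> int) \<Rightarrow> (nat \<Rightarrow> int) \<Rightarrow> rat" where
  "weight_form \<kappa> \<mu> =
     (\<Sum>i\<in>nodes. \<Sum>j\<in>nodes. of_nat (d i) * cartan_inverse \<gg> i j * of_int (\<kappa> i) * of_int (\<mu> j))"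

text \<open>
  The coefficient of \<open>z\<^sup>N\<close> in \<open>R\<^sup>u\<^sup>n\<^sup>i\<^sup>v\<^sub>V\<^sub>,\<^sub>W\<^sub>z (v \<otimes> w)\<close> for vectors \<open>v\<close>, \<open>w\<close> of weights \<open>\<kappa>\<close>, \<open>\<mu>\<close>: elements of
  weight \<open>\<beta>\<close> in the positive part act on \<open>w \<otimes> 1\<close> in \<open>W\<^sub>z\<close> with the factor \<open>z\<^sup>N\<close>, where \<open>N\<close> is the
  multiplicity of \<open>\<alpha>\<^sub>0\<close> in \<open>\<beta>\<close>. Only finitely many \<open>\<beta>\<close> contribute to it. The power of \<open>q\<close> is taken with
  base \<open>q\<^sub>s\<close>, the \<open>r\<close>-th root of \<open>q\<close>: as \<open>K\<^sub>i\<close> has eigenvalue \<open>q\<^sub>s\<close> to the power \<open>d\<^sub>i \<mu>\<^sub>i\<close> and \<open>weight_form\<close> takes the value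
  \<open>d\<^sub>i \<mu>\<^sub>i\<close> on \<open>(\<alpha>\<^sub>i, \<mu>)\<close>, this is what makes the universal R-matrix an intertwiner.
\<close>

definition Runiv_coeff ::
  "loop_rep \<Rightarrow> loop_rep \<Rightarrow> (nat \<Rightarrow> int) \<Rightarrow> (nat \<Rightarrow> int) \<Rightarrow> kk vec \<Rightarrow> kk vec \<Rightarrow> nat \<Rightarrow> kk vec" where
  "Runiv_coeff V W \<kappa> \<mu> v w N =
     qpow (weight_form \<kappa> \<mu> / of_nat r) \<cdot>\<^sub>v
     vec (rep_dim W * rep_dim V)
       (\<lambda>k. Sum_any (\<lambda>\<beta>. if set_mset \<beta> \<subseteq> affine_nodes \<and> count \<beta> 0 = N
                           then canonical_term V W v w \<beta> $ k else 0))"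

definition universal_coeff :: "loop_rep \<Rightarrow> loop_rep \<Rightarrow> kk fps" where
  "universal_coeff V W = (THE a. \<exists>P Q v w \<kappa> \<mu>.
     l_highest_weight_vector V P v \<and> l_highest_weight_vector W Q w \<and>
     weight_vector V \<kappa> v \<and> weight_vector W \<mu> w \<and>
     (\<forall>N. Runiv_coeff V W \<kappa> \<mu> v w N = fps_nth a N \<cdot>\<^sub>v kron_vec w v))"

section \<open>Infinite products and the invariant \<open>\<Lambda>\<close>\<close>

definition val_limit :: "(nat \<Rightarrow> kk) \<Rightarrow> kk \<Rightarrow> bool" where
  "val_limit s l \<longleftrightarrow> (\<forall>B. \<exists>N0. \<forall>N\<ge>N0. s N = l \<or> B \<le> val (s N - l))"

definition has_infprod :: "(nat \<Rightarrow> kk fps) \<Rightarrow> kk fps \<Rightarrow> bool" where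
  "has_infprod f F \<longleftrightarrow> (\<forall>n. val_limit (\<lambda>N. fps_nth (\<Prod>k<N. f k) n) (fps_nth F n))"

definition \<phi>_series :: "kk fps" where
  "\<phi>_series = (THE F. has_infprod (\<lambda>k. 1 - fps_const (q_gen ^ (2 * k * dual_coxeter \<gg>)) * fps_X) F)"

definition G_element :: "kk \<Rightarrow> int \<Rightarrow> (kk \<Rightarrow> int) \<Rightarrow> kk fls" where
  "G_element c m \<mu> = fls_const c * fls_X_intpow m *
     (\<Prod>a | \<mu> a \<noteq> 0. fps_to_fls (fps_compose \<phi>_series (fps_const a * fps_X)) powi \<mu> a)"

definition Deg :: "kk fls \<Rightarrow> int" where
  "Deg f = (THE D. \<exists>c m \<mu>. c \<noteq> 0 \<and> finite {a. \<mu> a \<noteq> 0} \<and> \<mu> 0 = 0 \<and> f = G_element c m \<mu> \<and>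
     D = (\<Sum>a | \<mu> a \<noteq> 0 \<and> (\<exists>k\<le>0. a = q_gen powi (2 * k * int (dual_coxeter \<gg>))). \<mu> a)
       - (\<Sum>a | \<mu> a \<noteq> 0 \<and> (\<exists>k>0. a = q_gen powi (2 * k * int (dual_coxeter \<gg>))). \<mu> a))"

definition Lambda :: "loop_rep \<Rightarrow> loop_rep \<Rightarrow> int" where
  "Lambda V W =
     Deg (fps_to_fls (fps_of_poly (denominator V W)) / fps_to_fls (universal_coeff V W))"

text \<open>
  The theorem of Frenkel and Reshetikhin on the universal coefficients: multiplicativity, and the
  values on pairs of fundamental modules. It is a statement about \<open>universal_coeff\<close> as defined above,
  not part of the definition.
\<close>

definition frenkel_reshetikhin :: bool where
  "frenkel_reshetikhin \<longleftrightarrow>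
     (\<forall>P1\<in>drinfeld_polys. \<forall>P2\<in>drinfeld_polys. \<forall>P3\<in>drinfeld_polys.
        universal_coeff (L (\<lambda>i. P1 i * P2 i)) (L P3) =
          universal_coeff (L P1) (L P3) * universal_coeff (L P2) (L P3) \<and>
        universal_coeff (L P1) (L (\<lambda>i. P2 i * P3 i)) =
          universal_coeff (L P1) (L P2) * universal_coeff (L P1) (L P3)) \<and>
     (\<forall>i\<in>nodes. \<forall>j\<in>nodes. \<forall>a b. a \<noteq> 0 \<longrightarrow> b \<noteq> 0 \<longrightarrow>
        (\<exists>F. has_infprod (\<lambda>u.
               ((1 - fps_const (qs powi (int u - int (d i)) * (b / a)) * fps_X) /
                (1 - fps_const (qs powi (int u + int (d i)) * (b / a)) * fps_X))
               powi ct i j (int u)) F \<and>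
             universal_coeff (L (fundamental_poly i a)) (L (fundamental_poly j b)) =
               fps_const (qpow (of_nat (d i) / of_nat r * cartan_inverse \<gg> i j)) * F))"

end

end

theory Submission
  imports Defs "Jordan_Normal_Form.Char_Poly"
begin

text \<open>
  The map \<open>Deg\<close> is additive, and \<open>1 - a z = \<phi>(a z) / \<phi>(a q\<^sup>2\<^sup>h z)\<close> shows that the degree of a polynomial is twice
  its order of vanishing at \<open>1\<close>. It remains to see that \<open>a\<^sub>V\<^sub>,\<^sub>W\<close> has degree \<open>-\<N>(V, W)\<close>. By multiplicativity it
  suffices to consider fundamental modules. The coefficients of the inverse of the quantum Cartan matrix are
  periodic with period \<open>2 r h\<close> and antisymmetric, because \<open>C(z) Q(z) = 1 - z\<^sup>2\<^sup>r\<^sup>h\<close> for a matrix \<open>Q\<close> of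
  Laurent polynomials, which is given explicitly for each type. Periodicity turns the product of Frenkel and
  Reshetikhin into a finite product of quotients of series \<open>\<phi>(a z)\<close>, whose degree can be read off, and
  antisymmetry identifies the result with the four terms of \<open>\<N>\<close>.

  As \<open>V\<close> and \<open>W\<close> are only isomorphic to modules \<open>L(m)\<close>, universal coefficients have to be invariant under
  isomorphisms. For this, dual bases have to exist, which is the theorem that the radical of the pairing of free
  algebras is the ideal of the quantum Serre relations (Gabber and Kac, Lusztig), and only finitely many weights
  \<open>\<beta>\<close> may contribute to each coefficient, which holds because \<open>K\<^sub>i\<close> has finitely many eigenvalues and the Cartan
  matrix is invertible.
\<close>

section \<open>Free associative algebras\<close>

text \<open>The assumed theorem of Frenkel and Reshetikhin concerns the chosen modules
  \<open>L P\<close>, while \<open>universal_coeff\<close> rests on \<open>SOME\<close> dual bases,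
  a \<open>Sum_any\<close> over weights and a \<open>THE\<close>. A \<open>Sum_any\<close> of
  infinite support is 0, hence not linear, and \<open>SOME\<close> is informative only if dual bases
  exist. Once both points are settled, isomorphic pairs satisfy the defining predicate for the same
  series, so that the two \<open>THE\<close> agree. For the radical, no quantum group and no highest
  weight module is formed. All computations take place in the free algebra modulo an ideal that is
  closed under two families of skew derivations. The Casimir operator becomes a tensor given by
  recursion on words; on weight \<beta> it produces v to the power 2 (\<rho>, \<beta>) - (\<beta>,
  \<beta>). The period 2rh is dictated by \<phi>: as q_s to the power 2rh is q^(2h), the factors of
  the product whose exponents lie in one residue class modulo 2rh form one quotient of series
  \<phi>(a z).\<close>

type_synonym ('i, 'k) fa = "('i free_monoid, 'k) poly_mapping"

definition wrd :: "'i list \<Rightarrow> ('i, 'k :: field) fa" where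
  "wrd w = Poly_Mapping.single (Word w) 1"

definition sm :: "'k :: field \<Rightarrow> ('i, 'k) fa \<Rightarrow> ('i, 'k) fa" where
  "sm c x = Poly_Mapping.single 0 c * x"

lemma wrd_Nil [simp]: "wrd [] = 1"
  by (simp add: wrd_def zero_free_monoid_def[symmetric])

lemma wrd_append: "wrd (u @ w) = wrd u * wrd w"
  by (simp add: wrd_def mult_single plus_free_monoid_def)

lemma wrd_Cons: "wrd (i # w) = wrd [i] * wrd w"
  using wrd_append[of "[i]" w] by simp

lemma wrd_snoc: "wrd (w @ [i]) = wrd w * wrd [i]"
  by (rule wrd_append)

lemma lookup_wrd: "Poly_Mapping.lookup (wrd u) w = (if w = Word u then 1 else 0)"
  by (auto simp: wrd_def lookup_single when_def)

lemma keys_wrd [simp]: "Poly_Mapping.keys (wrd u :: ('i, 'k :: field) fa) = {Word u}"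
  by (simp add: wrd_def)

lemma lookup_sm [simp]: "Poly_Mapping.lookup (sm c x) w = c * Poly_Mapping.lookup x w"
  by (simp add: sm_def mult_map_scale_conv_mult[symmetric] Poly_Mapping.map.rep_eq when_def)

lemma sm_1 [simp]: "sm 1 x = x"
  by (simp add: sm_def)

lemma sm_0 [simp]: "sm 0 x = 0"
  by (simp add: sm_def)

lemma sm_zero [simp]: "sm c 0 = 0"
  by (simp add: sm_def)

lemma sm_add: "sm c (x + y) = sm c x + sm c y"
  by (simp add: sm_def distrib_left)

lemma sm_minus: "sm c (- x) = - sm c x"
  by (simp add: sm_def)

lemma sm_diff: "sm c (x - y) = sm c x - sm c y"
  by (simp add: sm_def right_diff_distrib)

lemma sm_add_left: "sm (c + d) x = sm c x + sm d x"
  by (simp add: sm_def single_add distrib_right)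

lemma sm_minus_left: "sm (- c) x = - sm c x"
  by (rule poly_mapping_eqI) (simp add: lookup_minus)

lemma sm_diff_left: "sm (c - d) x = sm c x - sm d x"
  by (rule poly_mapping_eqI) (simp add: lookup_minus left_diff_distrib)

lemma sm_sm [simp]: "sm c (sm d x) = sm (c * d) x"
  by (rule poly_mapping_eqI) (simp add: mult.assoc)

lemma sm_mult_left: "sm c x * y = sm c (x * y)"
  by (simp add: sm_def mult.assoc)

lemma fa_sum_monomials: "x = (\<Sum>w\<in>Poly_Mapping.keys x. sm (Poly_Mapping.lookup x w) (wrd (letters w)))"
  by (rule poly_mapping_eqI)
    (auto simp: lookup_sum lookup_wrd free_monoid.expand in_keys_iff if_distrib[of "(*) _"]
          cong: if_cong simp flip: sum.inter_filter)

lemma fa_induct [case_names zero add mono]: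
  assumes "P 0" "\<And>x y. P x \<Longrightarrow> P y \<Longrightarrow> P (x + y)" "\<And>c w. P (sm c (wrd w))"
  shows "P x"
proof -
  have "P (\<Sum>w\<in>A. sm (Poly_Mapping.lookup x w) (wrd (letters w)))" if "finite A" for A
    using that by (induction A) (auto simp: assms)
  from this[of "Poly_Mapping.keys x"] show ?thesis
    using fa_sum_monomials[of x] by simp
qed

lemma sm_mult_right: "x * sm c y = sm c (x * y)"
proof -
  have *: "x * Poly_Mapping.single 0 c = Poly_Mapping.single 0 c * x"
  proof (induction x rule: fa_induct)
    case (mono d w)
    show ?case
      by (simp add: mult_single mult.commute sm_def wrd_def)
  qed (simp_all add: distrib_left distrib_right)
  show ?thesis
    by (simp add: sm_def mult.assoc[symmetric] *)
qed

lemma fa_induct_wrd [case_names zero add scale wrd]: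
  assumes "P 0" "\<And>x y. P x \<Longrightarrow> P y \<Longrightarrow> P (x + y)" "\<And>c x. P x \<Longrightarrow> P (sm c x)" "\<And>w. P (wrd w)"
  shows "P x"
  by (induction x rule: fa_induct) (simp_all add: assms)

text \<open>Tailored to operators that are known through their effect on left multiplication by a
  letter, as skew derivations are.\<close>

lemma fa_induct_Cons [case_names zero add scale one Cons]:
  assumes "P 0" "\<And>x y. P x \<Longrightarrow> P y \<Longrightarrow> P (x + y)" "\<And>c x. P x \<Longrightarrow> P (sm c x)" "P 1"
    and "\<And>i x. P x \<Longrightarrow> P (wrd [i] * x)"
  shows "P x"
proof -
  have "P (wrd w)" for w
  proof (induction w)
    case (Cons i w)
    show ?case
      unfolding wrd_Cons[of i w] by (rule assms) (rule Cons)
  qed (simp add: assms)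
  thus ?thesis
    by (induction x rule: fa_induct_wrd) (simp_all add: assms)
qed

lemma sm_sum: "sm c (sum f A) = (\<Sum>a\<in>A. sm c (f a))"
  by (simp add: sm_def sum_distrib_left)

lemmas sm_simps = sm_add sm_diff sm_minus sm_mult_left sm_mult_right

definition flin :: "(('i, 'k :: field) fa \<Rightarrow> ('j, 'k) fa) \<Rightarrow> bool" where
  "flin f \<longleftrightarrow> (\<forall>x y. f (x + y) = f x + f y) \<and> (\<forall>c x. f (sm c x) = sm c (f x))"

lemma flinI: "(\<And>x y. f (x + y) = f x + f y) \<Longrightarrow> (\<And>c x. f (sm c x) = sm c (f x)) \<Longrightarrow> flin f"
  by (simp add: flin_def)

context
  fixes f :: "('i, 'k :: field) fa \<Rightarrow> ('j, 'k) fa"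
  assumes f: "flin f"
begin

lemma flin_add: "f (x + y) = f x + f y"
  using f by (simp add: flin_def)

lemma flin_sm: "f (sm c x) = sm c (f x)"
  using f by (simp add: flin_def)

lemma flin_0: "f 0 = 0"
  using flin_sm[of 0 0] by simp

lemma flin_minus: "f (- x) = - f x"
  using flin_add[of x "- x"] by (simp add: flin_0 add_eq_0_iff)

lemma flin_diff: "f (x - y) = f x - f y"
  using flin_add[of x "- y"] by (simp add: flin_minus)

lemma flin_sum: "f (sum g A) = (\<Sum>a\<in>A. f (g a))"
  by (induction A rule: infinite_finite_induct) (simp_all add: flin_0 flin_add)

end

definition lin :: "('i list \<Rightarrow> ('j, 'k :: field) fa) \<Rightarrow> ('i, 'k) fa \<Rightarrow> ('j, 'k) fa" where
  "lin f x = (\<Sum>w\<in>Poly_Mapping.keys x. sm (Poly_Mapping.lookup x w) (f (letters w)))"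

lemma lin_superset:
  assumes "finite A" "Poly_Mapping.keys x \<subseteq> A"
  shows "lin f x = (\<Sum>w\<in>A. sm (Poly_Mapping.lookup x w) (f (letters w)))"
  unfolding lin_def using assms
  by (intro sum.mono_neutral_left) (auto simp: in_keys_iff)

lemma flin_lin [simp]:
  fixes f :: "'i list \<Rightarrow> ('j, 'k :: field) fa"
  shows "flin (lin f)"
proof (rule flinI)
  fix x y :: "('i, 'k) fa"
  let ?A = "Poly_Mapping.keys x \<union> Poly_Mapping.keys y"
  show "lin f (x + y) = lin f x + lin f y"
    using Poly_Mapping.keys_add[of x y]
    by (simp add: lin_superset[of ?A] lookup_add sm_add_left sum.distrib)
next
  fix x :: "('i, 'k) fa" and c
  have "Poly_Mapping.keys (sm c x) \<subseteq> Poly_Mapping.keys x"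
    by (auto simp: in_keys_iff)
  thus "lin f (sm c x) = sm c (lin f x)"
    by (simp add: lin_superset[of "Poly_Mapping.keys x"] sm_sum)
qed

lemma lin_wrd [simp]: "lin f (wrd w) = f w"
  by (simp add: lin_def lookup_wrd)

lemmas lin_add = flin_add[OF flin_lin]
lemmas lin_sm = flin_sm[OF flin_lin]
lemmas lin_0 = flin_0[OF flin_lin]
lemmas lin_diff = flin_diff[OF flin_lin]
lemmas lin_minus = flin_minus[OF flin_lin]

section \<open>Skew derivations\<close>

lemmas fa_simps = lin_add lin_sm lin_0 lin_diff lin_minus sm_simps distrib_left distrib_right
  left_diff_distrib right_diff_distrib

text \<open>A symmetrizable generalized Cartan matrix with a parameter that is not a root of unity.
  The indices fill a whole type, which avoids membership conditions throughout; the affine nodes are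
  completed to such a family by \<open>ext_cartan\<close>.\<close>

locale cartan_form =
  fixes a :: "'i \<Rightarrow> 'i \<Rightarrow> int" and d :: "'i \<Rightarrow> nat" and v :: "'k :: field"
  assumes a_diag: "a i i = 2"
    and a_off: "i \<noteq> j \<Longrightarrow> a i j \<le> 0"
    and d_pos: "0 < d i"
    and a_sym: "int (d i) * a i j = int (d j) * a j i"
    and v_nz: "v \<noteq> 0"
    and v_root: "0 < n \<Longrightarrow> v ^ n \<noteq> 1"
begin

text \<open>
  \<open>p i j\<close> is \<open>v\<close> to the power \<open>(\<alpha>\<^sub>i, \<alpha>\<^sub>j)\<close>, \<open>twist i n\<close> is conjugation by \<open>K\<^sub>i\<^sup>n\<close>, and \<open>dL i\<close>, \<open>dR i\<close> are the
  skew derivations that split off a letter \<open>i\<close> to the left and to the right.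
\<close>

definition p :: "'i \<Rightarrow> 'i \<Rightarrow> 'k" where
  "p i j = v powi (int (d i) * a i j)"

definition P :: "'i \<Rightarrow> 'i list \<Rightarrow> 'k" where
  "P i w = (\<Prod>j\<leftarrow>w. p i j)"

text \<open>This is q_i - q_i^(-1), the denominator in the pairing of e_i with f_i.\<close>

definition c :: "'i \<Rightarrow> 'k" where
  "c i = v ^ d i - inverse (v ^ d i)"

abbreviation e :: "'i \<Rightarrow> ('i, 'k) fa" where
  "e i \<equiv> wrd [i]"

definition twist :: "'i \<Rightarrow> int \<Rightarrow> ('i, 'k) fa \<Rightarrow> ('i, 'k) fa" where
  "twist i n = lin (\<lambda>w. sm (P i w powi n) (wrd w))"

primrec dLw :: "'i \<Rightarrow> 'i list \<Rightarrow> ('i, 'k) fa" where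
  "dLw i [] = 0"
| "dLw i (j # w) = (if i = j then wrd w else 0) + sm (inverse (p i j)) (e j * dLw i w)"

text \<open>The recursion runs from the left although the letter is split off to the right: a
  leading \<open>i\<close> has to pass all of \<open>w\<close>, which costs the factor
  \<open>inverse (P i w)\<close>.\<close>

primrec dRw :: "'i \<Rightarrow> 'i list \<Rightarrow> ('i, 'k) fa" where
  "dRw i [] = 0"
| "dRw i (j # w) = e j * dRw i w + (if i = j then sm (inverse (P i w)) (wrd w) else 0)"

definition dL :: "'i \<Rightarrow> ('i, 'k) fa \<Rightarrow> ('i, 'k) fa" where
  "dL i = lin (dLw i)"

definition dR :: "'i \<Rightarrow> ('i, 'k) fa \<Rightarrow> ('i, 'k) fa" where
  "dR i = lin (dRw i)"

lemma powi_v_eq_1: "v powi n = 1 \<longleftrightarrow> n = 0"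
proof
  assume *: "v powi n = 1"
  show "n = 0"
  proof (rule ccontr)
    assume "n \<noteq> 0"
    hence "nat \<bar>n\<bar> > 0" by simp
    moreover have "v ^ nat \<bar>n\<bar> = 1"
      using * by (cases "n \<ge> 0") (auto simp: power_int_def power_inverse inverse_eq_iff_eq)
    ultimately show False using v_root by blast
  qed
qed simp

lemma p_nz [simp]: "p i j \<noteq> 0"
  by (simp add: p_def v_nz)

lemma p_sym: "p i j = p j i"
  by (simp add: p_def a_sym)

lemma P_Nil [simp]: "P i [] = 1"
  and P_Cons [simp]: "P i (j # w) = p i j * P i w"
  and P_append [simp]: "P i (u @ w) = P i u * P i w"
  by (simp_all add: P_def)

lemma P_nz [simp]: "P i w \<noteq> 0"
  by (induction w) simp_all

lemma c_nz [simp]: "c i \<noteq> 0"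
proof
  assume "c i = 0"
  hence "v ^ d i * v ^ d i = v ^ d i * inverse (v ^ d i)"
    by (simp add: c_def)
  hence "v ^ (d i + d i) = 1"
    using v_nz by (simp add: power_add)
  thus False
    using v_root[of "d i + d i"] d_pos[of i] by simp
qed

lemma flin_twist [simp]: "flin (twist i n)" and flin_dL [simp]: "flin (dL i)" and flin_dR [simp]: "flin (dR i)"
  by (simp_all add: twist_def dL_def dR_def)

lemmas op_lin [simp] =
  flin_0[OF flin_twist] flin_0[OF flin_dL] flin_0[OF flin_dR]
  flin_add[OF flin_twist] flin_add[OF flin_dL] flin_add[OF flin_dR]
  flin_diff[OF flin_twist] flin_diff[OF flin_dL] flin_diff[OF flin_dR]
  flin_minus[OF flin_twist] flin_minus[OF flin_dL] flin_minus[OF flin_dR]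
  flin_sm[OF flin_twist] flin_sm[OF flin_dL] flin_sm[OF flin_dR]

lemma twist_wrd: "twist i n (wrd w) = sm (P i w powi n) (wrd w)"
  by (simp add: twist_def)

lemma twist_1 [simp]: "twist i n 1 = 1"
  using twist_wrd[of i n "[]"] by simp

lemma twist_e: "twist i n (e j) = sm (p i j powi n) (e j)"
  by (simp add: twist_wrd)

lemma twist_mult: "twist i n (x * y) = twist i n x * twist i n y"
proof (induction x rule: fa_induct_wrd)
  case (wrd u)
  show ?case
    by (induction y rule: fa_induct_wrd)
      (simp_all add: fa_simps twist_wrd wrd_append[symmetric] power_int_mult_distrib mult.commute)
qed (simp_all add: fa_simps)

lemma twist_twist: "twist i n (twist j m x) = twist j m (twist i n x)"
  by (induction x rule: fa_induct_wrd) (simp_all add: twist_wrd mult.commute)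

lemma twist_add: "twist i n (twist i m x) = twist i (n + m) x"
  by (induction x rule: fa_induct_wrd) (simp_all add: twist_wrd power_int_add mult.commute)

lemma twist_zero [simp]: "twist i 0 x = x"
  by (induction x rule: fa_induct_wrd) (simp_all add: twist_wrd)

lemma dL_1 [simp]: "dL i 1 = 0" and dR_1 [simp]: "dR i 1 = 0"
  using lin_wrd[of "dLw i" "[]"] lin_wrd[of "dRw i" "[]"] by (simp_all add: dL_def dR_def)

lemma dL_e_mult: "dL i (e j * x) = (if i = j then x else 0) + sm (inverse (p i j)) (e j * dL i x)"
  by (induction x rule: fa_induct_wrd)
    (simp_all add: fa_simps sm_add dL_def mult.commute flip: wrd_Cons)

lemma dR_e_mult: "dR i (e j * x) = e j * dR i x + (if i = j then twist i (-1) x else 0)"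
  by (induction x rule: fa_induct_wrd)
    (simp_all add: fa_simps sm_add dR_def twist_wrd power_int_minus mult.commute flip: wrd_Cons)

lemma dL_e: "dL i (e j) = (if i = j then 1 else 0)"
  and dR_e: "dR i (e j) = (if i = j then 1 else 0)"
  using dL_e_mult[of i j 1] dR_e_mult[of i j 1] by simp_all

lemma dL_mult: "dL i (x * y) = dL i x * y + twist i (-1) x * dL i y"
  by (induction x rule: fa_induct_Cons)
    (simp_all add: fa_simps dL_e_mult twist_mult twist_e mult.assoc power_int_minus algebra_simps)

lemma dR_mult: "dR i (x * y) = x * dR i y + dR i x * twist i (-1) y"
  by (induction x rule: fa_induct_Cons)
    (simp_all add: fa_simps dR_e_mult twist_mult twist_e mult.assoc power_int_minus algebra_simps)

lemma dL_twist: "dL i (twist j n x) = sm (p i j powi n) (twist j n (dL i x))"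
  by (induction x rule: fa_induct_Cons)
    (simp_all add: fa_simps dL_e_mult twist_mult twist_e p_sym[of j] algebra_simps)

lemma dR_twist: "dR i (twist j n x) = sm (p i j powi n) (twist j n (dR i x))"
  by (induction x rule: fa_induct_Cons)
    (simp_all add: fa_simps dR_e_mult twist_mult twist_e p_sym[of j] twist_twist algebra_simps)

end

section \<open>The bilinear form\<close>

definition supp :: "('i list \<Rightarrow> bool) \<Rightarrow> ('i, 'k :: field) fa \<Rightarrow> bool" where
  "supp Q x \<longleftrightarrow> (\<forall>w\<in>Poly_Mapping.keys x. Q (letters w))"

lemma supp_0 [simp]: "supp Q 0"
  by (simp add: supp_def)

lemma supp_wrd [simp]: "supp Q (wrd w) \<longleftrightarrow> Q w"
  by (simp add: supp_def)

lemma supp_one [simp]: "supp Q 1 \<longleftrightarrow> Q []"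
  using supp_wrd[of Q "[]"] by simp

lemma supp_add: "supp Q x \<Longrightarrow> supp Q y \<Longrightarrow> supp Q (x + y)"
  using Poly_Mapping.keys_add[of x y] by (auto simp: supp_def)

lemma supp_sm: "supp Q x \<Longrightarrow> supp Q (sm c x)"
  by (auto simp: supp_def in_keys_iff)

lemma supp_diff: "supp Q x \<Longrightarrow> supp Q y \<Longrightarrow> supp Q (x - y)"
  using supp_add[of Q x "sm (-1) y"] supp_sm[of Q y "-1"] by (simp add: sm_minus_left)

lemma supp_sum: "(\<And>a. a \<in> A \<Longrightarrow> supp Q (f a)) \<Longrightarrow> supp Q (sum f A)"
  by (induction A rule: infinite_finite_induct) (auto intro: supp_add)

lemma supp_mono: "supp Q x \<Longrightarrow> (\<And>w. Q w \<Longrightarrow> Q' w) \<Longrightarrow> supp Q' x"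
  by (auto simp: supp_def)

lemma supp_lin: "supp Q x \<Longrightarrow> (\<And>w. Q w \<Longrightarrow> supp Q' (f w)) \<Longrightarrow> supp Q' (lin f x)"
  unfolding lin_def by (intro supp_sum supp_sm) (auto simp: supp_def)

lemma supp_mult:
  assumes "supp Q x" "supp Q' y" "\<And>u w. Q u \<Longrightarrow> Q' w \<Longrightarrow> Q'' (u @ w)"
  shows "supp Q'' (x * y)"
  using Poly_Mapping.keys_mult[of x y] assms unfolding supp_def plus_free_monoid_def by force

lemma supp_induct [consumes 1, case_names zero add scale wrd]:
  assumes "supp Q x"
    and "R 0" "\<And>x y. R x \<Longrightarrow> R y \<Longrightarrow> R (x + y)" "\<And>c x. R x \<Longrightarrow> R (sm c x)" "\<And>w. Q w \<Longrightarrow> R (wrd w)"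
  shows "R x"
proof -
  have "R (\<Sum>w\<in>A. sm (Poly_Mapping.lookup x w) (wrd (letters w)))"
    if "finite A" "A \<subseteq> Poly_Mapping.keys x" for A
    using that assms by (induction A) (auto simp: supp_def)
  from this[of "Poly_Mapping.keys x"] show ?thesis
    using fa_sum_monomials[of x] by simp
qed

abbreviation homog :: "'i multiset \<Rightarrow> ('i, 'k :: field) fa \<Rightarrow> bool" where
  "homog \<beta> \<equiv> supp (\<lambda>w. mset w = \<beta>)"

lemma lookup_wrd_0 [simp]: "Poly_Mapping.lookup (wrd u) 0 = (if u = [] then 1 else 0)"
  by (simp add: lookup_wrd zero_free_monoid_def)

lemma lookup_mult_0:
  fixes x y :: "('i, 'k :: field) fa"
  shows "Poly_Mapping.lookup (x * y) 0 = Poly_Mapping.lookup x 0 * Poly_Mapping.lookup y 0"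
proof (induction x rule: fa_induct_wrd)
  case (wrd u)
  show ?case
    by (induction y rule: fa_induct_wrd)
      (auto simp: fa_simps lookup_add wrd_append[symmetric])
qed (simp_all add: fa_simps lookup_add)

definition linf :: "('i list \<Rightarrow> 'k) \<Rightarrow> ('i, 'k :: field) fa \<Rightarrow> 'k" where
  "linf f x = (\<Sum>w\<in>Poly_Mapping.keys x. Poly_Mapping.lookup x w * f (letters w))"

lemma linf_superset:
  assumes "finite A" "Poly_Mapping.keys x \<subseteq> A"
  shows "linf f x = (\<Sum>w\<in>A. Poly_Mapping.lookup x w * f (letters w))"
  unfolding linf_def using assms
  by (intro sum.mono_neutral_left) (auto simp: in_keys_iff)

lemma linf_0 [simp]: "linf f 0 = 0"
  by (simp add: linf_def)

lemma linf_wrd [simp]: "linf f (wrd w) = f w"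
  by (simp add: linf_def lookup_wrd)

lemma linf_add: "linf f (x + y) = linf f x + linf f y"
proof -
  let ?A = "Poly_Mapping.keys x \<union> Poly_Mapping.keys y"
  show ?thesis
    using Poly_Mapping.keys_add[of x y]
    by (simp add: linf_superset[of ?A] lookup_add distrib_right sum.distrib)
qed

lemma linf_sm: "linf f (sm c x) = c * linf f x"
proof -
  have "Poly_Mapping.keys (sm c x) \<subseteq> Poly_Mapping.keys x"
    by (auto simp: in_keys_iff)
  thus ?thesis
    by (simp add: linf_superset[of "Poly_Mapping.keys x"] sum_distrib_left mult.assoc)
qed

context cartan_form
begin

lemma supp_dLw: "supp (\<lambda>w'. add_mset i (mset w') = mset w) (dLw i w)"
proof (induction w)
  case (Cons j w)
  have "supp (\<lambda>w'. add_mset i (mset w') = mset (j # w)) (e j * dLw i w)"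
    by (rule supp_mult[OF _ Cons, of "\<lambda>u. u = [j]"]) (auto simp: add_mset_commute)
  thus ?case
    by (auto intro!: supp_add supp_sm)
qed simp

lemma supp_dRw: "supp (\<lambda>w'. add_mset i (mset w') = mset w) (dRw i w)"
proof (induction w)
  case (Cons j w)
  have "supp (\<lambda>w'. add_mset i (mset w') = mset (j # w)) (e j * dRw i w)"
    by (rule supp_mult[OF _ Cons, of "\<lambda>u. u = [j]"]) (auto simp: add_mset_commute)
  thus ?case
    by (auto intro!: supp_add supp_sm)
qed simp

lemma supp_dL: "supp Q x \<Longrightarrow> (\<And>w w'. Q w \<Longrightarrow> add_mset i (mset w') = mset w \<Longrightarrow> Q' w') \<Longrightarrow> supp Q' (dL i x)"
  unfolding dL_def by (erule supp_lin) (rule supp_mono[OF supp_dLw], blast)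

lemma supp_dR: "supp Q x \<Longrightarrow> (\<And>w w'. Q w \<Longrightarrow> add_mset i (mset w') = mset w \<Longrightarrow> Q' w') \<Longrightarrow> supp Q' (dR i x)"
  unfolding dR_def by (erule supp_lin) (rule supp_mono[OF supp_dRw], blast)

lemma homog_dL: "homog (add_mset i \<beta>) x \<Longrightarrow> homog \<beta> (dL i x)"
  by (erule supp_dL) auto

lemma homog_dR: "homog (add_mset i \<beta>) x \<Longrightarrow> homog \<beta> (dR i x)"
  by (erule supp_dR) auto

lemma supp_False: "supp (\<lambda>_. False) x \<longleftrightarrow> x = 0"
  by (auto simp: supp_def)

lemma homog_dL_0: "homog \<beta> x \<Longrightarrow> i \<notin># \<beta> \<Longrightarrow> dL i x = 0"
  unfolding supp_False[symmetric] by (erule supp_dL) (metis union_single_eq_member)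

lemma homog_dR_0: "homog \<beta> x \<Longrightarrow> i \<notin># \<beta> \<Longrightarrow> dR i x = 0"
  unfolding supp_False[symmetric] by (erule supp_dR) (metis union_single_eq_member)

text \<open>The bilinear form of Lusztig and Kashiwara against a word: the letters of the word are
  stripped from the left end of x one after the other, and the constant term remains. For affine
  nodes this is \<open>word_pairing\<close>.\<close>

primrec word_form :: "'i list \<Rightarrow> ('i, 'k) fa \<Rightarrow> 'k" where
  "word_form [] x = Poly_Mapping.lookup x 0"
| "word_form (i # u) x = word_form u (dL i x) / c i"

lemma word_form_0 [simp]: "word_form u 0 = 0"
  and word_form_add: "word_form u (x + y) = word_form u x + word_form u y"
  and word_form_sm: "word_form u (sm k x) = k * word_form u x"
  by (induction u arbitrary: x y) (simp_all add: lookup_add add_divide_distrib)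

lemma word_form_sum: "word_form u (sum f A) = (\<Sum>a\<in>A. word_form u (f a))"
  by (induction A rule: infinite_finite_induct) (simp_all add: word_form_add)

lemma word_form_wt: "supp (\<lambda>w. mset w \<noteq> mset u) x \<Longrightarrow> word_form u x = 0"
proof (induction u arbitrary: x)
  case Nil
  thus ?case
    by (force simp: supp_def in_keys_iff zero_free_monoid_def)
next
  case (Cons i u)
  have "supp (\<lambda>w. mset w \<noteq> mset u) (dL i x)"
    by (rule supp_dL[OF Cons.prems]) auto
  thus ?case
    by (simp add: Cons.IH)
qed

lemma word_form_twist: "word_form u (twist i n x) = P i u powi n * word_form u x"
proof (induction u arbitrary: x)
  case Nil
  show ?case
    by (induction x rule: fa_induct_wrd)
      (auto simp: lookup_add twist_wrd algebra_simps)
next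
  case (Cons j u)
  show ?case
    by (simp add: dL_twist word_form_sm Cons.IH p_sym[of j] power_int_mult_distrib)
qed

definition form :: "('i, 'k) fa \<Rightarrow> ('i, 'k) fa \<Rightarrow> 'k" where
  "form x y = linf (\<lambda>u. word_form u x) y"

lemma form_wrd: "form x (wrd u) = word_form u x"
  and form_0 [simp]: "form x 0 = 0" "form 0 x = 0"
  and form_add: "form x (y + z) = form x y + form x z"
  and form_sm: "form x (sm k y) = k * form x y"
  proof -
  show "form x (wrd u) = word_form u x" "form x 0 = 0" "form x (y + z) = form x y + form x z" "form x (sm k y) = k * form x y"
    by (simp_all add: form_def linf_add linf_sm)
  show "form 0 x = 0"
    by (simp add: form_def linf_def)
qed

lemma form_add_left: "form (x + y) z = form x z + form y z"
  by (induction z rule: fa_induct_wrd) (simp_all add: form_add form_sm form_wrd word_form_add algebra_simps)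

lemma form_sm_left: "form (sm k x) z = k * form x z"
  by (induction z rule: fa_induct_wrd) (simp_all add: form_add form_sm form_wrd word_form_sm algebra_simps)

lemma form_diff: "form x (y - z) = form x y - form x z"
  using form_add[of x y "sm (-1) z"] by (simp add: sm_minus_left form_sm[of x "-1", unfolded sm_minus_left sm_1])

lemma form_diff_left: "form (x - y) z = form x z - form y z"
  using form_add_left[of x "sm (-1) y" z] by (simp add: sm_minus_left form_sm_left[of "-1", unfolded sm_minus_left sm_1])

lemma form_sum: "form x (sum f A) = (\<Sum>a\<in>A. form x (f a))"
  by (induction A rule: infinite_finite_induct) (simp_all add: form_add)

lemma form_sum_left: "form (sum f A) x = (\<Sum>a\<in>A. form (f a) x)"
  by (induction A rule: infinite_finite_induct) (simp_all add: form_add_left)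

lemmas form_simps = form_add form_sm form_add_left form_sm_left form_diff form_diff_left

lemma form_e_right: "form x (e i * y) = form (dL i x) y / c i"
  by (induction y rule: fa_induct_wrd)
    (simp_all add: fa_simps form_simps form_wrd add_divide_distrib flip: wrd_Cons)

lemma form_one: "form x 1 = Poly_Mapping.lookup x 0"
  using form_wrd[of x "[]"] by simp

lemma form_e_left: "form (e i * x) y = form x (dL i y) / c i"
proof (induction y arbitrary: x rule: fa_induct_Cons)
  case one
  show ?case
    by (simp add: form_one lookup_mult_0)
next
  case (Cons j y)
  show ?case
    by (auto simp: dL_e_mult form_e_right form_simps Cons.IH p_sym field_simps)
qed (simp_all add: fa_simps form_simps add_divide_distrib)

lemma form_e_left': "form (x * e i) y = form x (dR i y) / c i"
proof (induction y arbitrary: x rule: fa_induct_Cons)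
  case one
  show ?case
    by (simp add: form_one lookup_mult_0)
next
  case (Cons j y)
  \<comment> \<open>Conjugation by K_i is self-adjoint, because the form only pairs words of equal
    weight, on which it acts by the same scalar.\<close>
  have "form (twist i (-1) x) y = form x (twist i (-1) y)" for i
    by (induction y rule: fa_induct_wrd)
       (simp_all add: form_simps form_wrd word_form_twist twist_wrd)
  thus ?case
    by (auto simp: dR_e_mult dL_mult dL_e form_e_right form_simps Cons.IH field_simps)
qed (simp_all add: fa_simps form_simps add_divide_distrib)

lemma form_sym: "form x y = form y x"
proof (induction x arbitrary: y rule: fa_induct_Cons)
  case one
  show ?case
    by (induction y rule: fa_induct_Cons)
      (simp_all add: form_simps form_e_left form_one lookup_mult_0 form_e_right lookup_add)
qed (simp_all add: form_simps form_e_left form_e_right)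

lemma form_e_right': "form x (y * e i) = form (dR i x) y / c i"
  by (metis form_e_left' form_sym)

definition radical :: "('i, 'k) fa \<Rightarrow> bool" where
  "radical x \<longleftrightarrow> (\<forall>y. form x y = 0)"

text \<open>The skew derivations are adjoint to multiplication by e_i, so they preserve the radical
  while lowering the degree. This makes induction on the degree possible.\<close>

lemma radical_dL: "radical x \<Longrightarrow> radical (dL i x)"
  using form_e_right[of x i] by (auto simp: radical_def)

lemma radical_dR: "radical x \<Longrightarrow> radical (dR i x)"
  using form_e_right'[of x _ i] by (auto simp: radical_def)

lemma radical_const: "radical x \<Longrightarrow> Poly_Mapping.lookup x 0 = 0"
  using form_one[of x] by (simp add: radical_def)

end

section \<open>Serre elements\<close>

lemma flin_funpow:
  fixes f :: "('i, 'k :: field) fa \<Rightarrow> ('i, 'k) fa"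
  shows "flin f \<Longrightarrow> flin (f ^^ n)"
  by (induction n) (auto simp: flin_def)

context cartan_form
begin

text \<open>The adjoint action of e_i, with \<open>twist i 1\<close> as conjugation by K_i. It is a
  skew derivation, and the Serre relations say that a certain power of it kills e_j.\<close>

definition qad :: "'i \<Rightarrow> ('i, 'k) fa \<Rightarrow> ('i, 'k) fa" where
  "qad i z = e i * z - twist i 1 z * e i"

lemma flin_qad [simp]: "flin (qad i)"
  by (rule flinI) (simp_all add: qad_def fa_simps)

lemmas qad_lin [simp] = flin_0[OF flin_qad] flin_add[OF flin_qad] flin_diff[OF flin_qad] flin_sm[OF flin_qad]

lemmas funpow_qad_lin = flin_0[OF flin_funpow[OF flin_qad]] flin_add[OF flin_funpow[OF flin_qad]]
  flin_sm[OF flin_funpow[OF flin_qad]] flin_diff[OF flin_funpow[OF flin_qad]]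

lemma qad_mult: "qad i (y * z) = qad i y * z + twist i 1 y * qad i z"
  by (simp add: qad_def twist_mult algebra_simps)

lemma twist_qad: "twist i n (qad i z) = sm (p i i powi n) (qad i (twist i n z))"
  by (simp add: qad_def twist_mult twist_e sm_simps twist_twist[of i n])

lemma twist_funpow_qad: "twist i n ((qad i ^^ m) z) = sm ((p i i powi n) ^ m) ((qad i ^^ m) (twist i n z))"
  by (induction m) (simp_all add: twist_qad mult.commute)

lemma dL_qad_same: "dL i z = 0 \<Longrightarrow> dL i (qad i z) = 0"
  by (simp add: qad_def dL_mult dL_e dL_twist twist_add)

lemma dL_qad_other:
  "i \<noteq> j \<Longrightarrow> dL j (qad i z) = sm (inverse (p i j)) (e i * dL j z) - sm (p i j) (twist i 1 (dL j z) * e i)"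
  by (simp add: qad_def dL_mult dL_e dL_twist twist_e p_sym[of j] power_int_minus sm_simps)

text \<open>The commutation relation of quantum sl_2: up to normalization, \<open>qad i\<close>
  raises, \<open>dR i\<close> lowers, and the difference of twists plays the role of K_i^(-1) -
  K_i.\<close>

lemma dR_qad_same: "dR i (qad i z) = qad i (dR i z) + (twist i (-1) z - twist i 1 z)"
  by (simp add: qad_def dR_mult dR_e dR_twist twist_e power_int_minus sm_simps algebra_simps)

lemma dR_qad_other: "i \<noteq> j \<Longrightarrow> dR j (qad i z) = qad i (dR j z)"
  by (simp add: qad_def dR_mult dR_e dR_twist twist_e p_sym[of j] power_int_minus sm_simps)

definition serre :: "'i \<Rightarrow> 'i \<Rightarrow> ('i, 'k) fa" where
  "serre i j = (qad i ^^ nat (1 - a i j)) (e j)"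

lemma dL_funpow_qad_same: "i \<noteq> j \<Longrightarrow> dL i ((qad i ^^ m) (e j)) = 0"
  by (induction m) (simp_all add: dL_e dL_qad_same)

lemma twist_power: "twist i n (x ^ m) = twist i n x ^ m"
  by (induction m) (simp_all add: twist_mult)

lemma sm_power: "sm k x ^ m = sm (k ^ m) (x ^ m)"
  by (induction m) (simp_all add: sm_simps mult.commute)

text \<open>Only one letter j is present, so a power of e_i remains, and every \<open>qad i\<close>
  contributes one factor. The factor with l = \<open>- a i j\<close> vanishes since
  \<open>p i i ^ l\<close> is then \<open>p i j\<close> to the power -2; this is why
  \<open>serre\<close> has the exponent \<open>1 - a i j\<close>.\<close>

lemma dL_funpow_qad_other:
  assumes "i \<noteq> j"
  shows "dL j ((qad i ^^ m) (e j)) = sm (\<Prod>l<m. inverse (p i j) - p i j * p i i ^ l) (e i ^ m)"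
proof (induction m)
  case (Suc m)
  show ?case
    using assms
    by (simp add: dL_qad_other Suc twist_power twist_e sm_power sm_simps sm_diff_left power_commutes algebra_simps)
qed (simp add: dL_e)

lemma dL_serre: 
  assumes "i \<noteq> j"
  shows "dL k (serre i j) = 0"
proof (cases "k = j")
  case True
  let ?l = "nat (- a i j)"
  have "inverse (p i j) - p i j * p i i ^ ?l = 0"
    using a_off[OF assms]
    by (simp add: p_def a_diag v_nz power_int_add[symmetric] power_int_minus[symmetric]
        power_int_mult[symmetric] flip: power_int_of_nat)
  moreover have "?l < nat (1 - a i j)"
    using a_off[OF assms] by simp
  ultimately have eq: "(\<Prod>l<nat (1 - a i j). inverse (p i j) - p i j * p i i ^ l) = 0"
    by (meson finite_lessThan lessThan_iff prod_zero)
  thus ?thesis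
    unfolding serre_def True dL_funpow_qad_other[OF assms] eq by simp
next
  case False
  have "dL k ((qad i ^^ m) (e j)) = 0" if "k \<noteq> i" for m
    using that False by (induction m) (simp_all add: dL_e dL_qad_other)
  thus ?thesis
    using dL_funpow_qad_same[OF assms] by (cases "k = i") (simp_all add: serre_def)
qed

text \<open>The scalar that arises when the lowering operator \<open>dR i\<close> is moved past M
  raising operators, where t is the eigenvalue of K_i on the starting vector.\<close>

definition lowering_coeff :: "'i \<Rightarrow> 'k \<Rightarrow> nat \<Rightarrow> 'k" where
  "lowering_coeff i t M = (\<Sum>m<M. inverse (t * p i i ^ m) - t * p i i ^ m)"

lemma dR_funpow_qad_same:
  assumes "twist i 1 z = sm t z" "twist i (-1) z = sm (inverse t) z"
  shows "dR i ((qad i ^^ M) z) = (qad i ^^ M) (dR i z) + sm (lowering_coeff i t M) ((qad i ^^ (M - 1)) z)"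
proof (induction M)
  case (Suc M)
  have "sm (lowering_coeff i t M) (qad i ((qad i ^^ (M - 1)) z)) = sm (lowering_coeff i t M) ((qad i ^^ M) z)"
    by (cases M) (simp_all add: lowering_coeff_def)
  thus ?case
    by (simp add: dR_qad_same Suc twist_funpow_qad assms funpow_qad_lin lowering_coeff_def sm_add_left sm_diff_left
         power_int_minus power_inverse mult.commute)
qed (simp add: lowering_coeff_def)

text \<open>The quantum analogue of M (n + M - 1). It vanishes for M = 1 - n, which makes
  \<open>dR i\<close> kill the Serre elements, and it does not vanish for positive n and M, which
  serves for elements of positive weight in the radical.\<close>

lemma lowering_coeff_formula:
  fixes n :: int and i
  defines "h \<equiv> v ^ d i"
  shows "(h - inverse h) * lowering_coeff i (h powi n) M =
           - ((h ^ M - inverse (h ^ M)) * (h powi (n + int M - 1) - inverse (h powi (n + int M - 1))))"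
proof (induction M)
  case 0
  show ?case by (simp add: lowering_coeff_def)
next
  case (Suc M)
  have h: "h \<noteq> 0" by (simp add: h_def v_nz)
  have p: "p i i = h ^ 2"
    by (simp add: p_def h_def a_diag power_int_mult)
  define A B where "A = h powi n" and "B = h ^ M"
  have AB: "A \<noteq> 0" "B \<noteq> 0"
    using h by (simp_all add: A_def B_def)
  have 1: "h powi (n + int M - 1) = A * B * inverse h" "h powi (n + int (Suc M) - 1) = A * B"
    using h by (simp_all add: A_def B_def power_int_add power_int_diff field_simps)
  have 2: "lowering_coeff i A (Suc M) = lowering_coeff i A M + (inverse (A * B\<^sup>2) - A * B\<^sup>2)"
    by (simp add: lowering_coeff_def p B_def power_mult[symmetric] mult.commute)
  have "(h - inverse h) * lowering_coeff i A (Suc M) =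
      - ((B - inverse B) * (A * B * inverse h - inverse (A * B * inverse h)))
      + (h - inverse h) * (inverse (A * B\<^sup>2) - A * B\<^sup>2)"
    using Suc unfolding 2 1 A_def[symmetric] B_def[symmetric] by (simp add: distrib_left)
  also have "\<dots> = - ((h * B - inverse (h * B)) * (A * B - inverse (A * B)))"
    using h AB by (simp add: field_simps power2_eq_square)
  finally show ?case
    unfolding 1 A_def[symmetric] power_Suc B_def[symmetric] .
qed

lemma lowering_coeff_nz:
  assumes "n \<ge> 1" "M \<ge> 1"
  shows "lowering_coeff i ((v ^ d i) powi n) M \<noteq> 0"
proof -
  have *: "(v ^ d i) powi m - inverse ((v ^ d i) powi m) \<noteq> 0" if "m \<ge> 1" for m :: int
  proof
    assume "(v ^ d i) powi m - inverse ((v ^ d i) powi m) = 0"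
    hence "(v ^ d i) powi m * (v ^ d i) powi m = 1"
      using v_nz by (simp add: field_simps)
    hence "(v ^ d i) powi (m + m) = 1"
      using v_nz power_int_add[of "v ^ d i" m m] by simp
    hence "v powi (int (d i) * (m + m)) = 1"
      by (subst power_int_mult) simp
    thus False
      using that d_pos[of i] by (simp add: powi_v_eq_1)
  qed
  have "(v ^ d i - inverse (v ^ d i)) * lowering_coeff i ((v ^ d i) powi n) M \<noteq> 0"
    unfolding lowering_coeff_formula using *[of "int M"] *[of "n + int M - 1"] assms by simp
  thus ?thesis by simp
qed

lemma lowering_coeff_zero:
  assumes "n + int M = 1"
  shows "lowering_coeff i ((v ^ d i) powi n) M = 0"
proof -
  have "n + int M - 1 = 0" using assms by simp
  hence "c i * lowering_coeff i ((v ^ d i) powi n) M = 0"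
    unfolding c_def lowering_coeff_formula by simp
  thus ?thesis by simp
qed

text \<open>For k = i the lowering coefficient vanishes at the exponent of the Serre element. For
  other k, \<open>dR k\<close> commutes with \<open>qad i\<close> and turns e_j into a constant,
  which \<open>qad i\<close> kills.\<close>

lemma dR_serre: 
  assumes "i \<noteq> j"
  shows "dR k (serre i j) = 0"
proof (cases "k = i")
  case True
  have p: "p i j = (v ^ d i) powi a i j"
    by (simp add: p_def power_int_mult)
  have "lowering_coeff i ((v ^ d i) powi a i j) (nat (1 - a i j)) = 0"
    by (rule lowering_coeff_zero) (use a_off[OF assms] in simp)
  moreover have "dR i (serre i j) = (qad i ^^ nat (1 - a i j)) (dR i (e j)) +
      sm (lowering_coeff i (p i j) (nat (1 - a i j))) ((qad i ^^ (nat (1 - a i j) - 1)) (e j))"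
    unfolding serre_def by (rule dR_funpow_qad_same) (simp_all add: twist_e power_int_minus)
  ultimately show ?thesis
    using assms by (simp add: True dR_e funpow_qad_lin p)
next
  case False
  have *: "dR k ((qad i ^^ m) (e j)) = (qad i ^^ m) (dR k (e j))" for m
    using False by (induction m) (simp_all add: dR_qad_other)
  obtain m where m: "nat (1 - a i j) = Suc m"
    using a_off[OF assms] by (cases "nat (1 - a i j)") auto
  have "qad i (dR k (e j)) = 0"
    by (simp add: qad_def dR_e)
  thus ?thesis
    unfolding serre_def m * by (simp add: funpow_Suc_right funpow_qad_lin del: funpow.simps)
qed

inductive_set serre_ideal :: "('i, 'k) fa set" where
  gen: "i \<noteq> j \<Longrightarrow> x * serre i j * y \<in> serre_ideal"
| zero [simp]: "0 \<in> serre_ideal"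
| add: "x \<in> serre_ideal \<Longrightarrow> y \<in> serre_ideal \<Longrightarrow> x + y \<in> serre_ideal"

lemma serre_ideal_mult_left: "x \<in> serre_ideal \<Longrightarrow> z * x \<in> serre_ideal"
proof (induction rule: serre_ideal.induct)
  case (gen i j x y)
  show ?case
    using serre_ideal.gen[OF gen, of "z * x" y] by (simp add: mult.assoc)
qed (auto simp: distrib_left intro: serre_ideal.add)

lemma serre_ideal_mult_right: "x \<in> serre_ideal \<Longrightarrow> x * z \<in> serre_ideal"
proof (induction rule: serre_ideal.induct)
  case (gen i j x y)
  show ?case
    using serre_ideal.gen[OF gen, of x "y * z"] by (simp add: mult.assoc)
qed (auto simp: distrib_right intro: serre_ideal.add)

lemma serre_ideal_sm: "x \<in> serre_ideal \<Longrightarrow> sm k x \<in> serre_ideal"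
  by (simp add: sm_def serre_ideal_mult_left)

lemma serre_ideal_diff: "x \<in> serre_ideal \<Longrightarrow> y \<in> serre_ideal \<Longrightarrow> x - y \<in> serre_ideal"
  using serre_ideal.add[of x "sm (-1) y"] serre_ideal_sm[of y "-1"] by (simp add: sm_minus_left)

lemma serre_ideal_sum: "(\<And>k. k \<in> A \<Longrightarrow> f k \<in> serre_ideal) \<Longrightarrow> sum f A \<in> serre_ideal"
  by (induction A rule: infinite_finite_induct) (auto intro: serre_ideal.add)

lemma serre_ideal_sm_iff: "k \<noteq> 0 \<Longrightarrow> sm k x \<in> serre_ideal \<longleftrightarrow> x \<in> serre_ideal"
  using serre_ideal_sm[of x k] serre_ideal_sm[of "sm k x" "inverse k"] by auto

lemma twist_serre: "\<exists>t. twist k n (serre i j) = sm t (serre i j)"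
proof -
  have "\<exists>t. twist k n ((qad i ^^ m) (e j)) = sm t ((qad i ^^ m) (e j))" for m
  proof (induction m)
    case (Suc m)
    then obtain t where "twist k n ((qad i ^^ m) (e j)) = sm t ((qad i ^^ m) (e j))" ..
    hence "twist k n ((qad i ^^ Suc m) (e j)) = sm (p k i powi n * t) ((qad i ^^ Suc m) (e j))"
      by (simp add: qad_def twist_mult twist_e sm_simps twist_twist[of k n i] mult.commute)
    thus ?case ..
  qed (auto simp: twist_e)
  thus ?thesis by (simp add: serre_def)
qed

lemma serre_ideal_twist: "x \<in> serre_ideal \<Longrightarrow> twist k n x \<in> serre_ideal"
proof (induction rule: serre_ideal.induct)
  case (gen i j x y)
  obtain t where "twist k n (serre i j) = sm t (serre i j)" using twist_serre by blast
  thus ?case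
    using serre_ideal_sm[OF serre_ideal.gen[OF gen, of "twist k n x" "twist k n y"], of t] by (simp add: twist_mult sm_simps)
qed (auto intro: serre_ideal.add)

lemma serre_ideal_twist_iff: "twist k n x \<in> serre_ideal \<longleftrightarrow> x \<in> serre_ideal"
  using serre_ideal_twist[of x k n] serre_ideal_twist[of "twist k n x" k "-n"] by (auto simp: twist_add)

text \<open>In the Leibniz rule the term in which the Serre element itself is differentiated drops
  out.\<close>

lemma serre_ideal_dL: "x \<in> serre_ideal \<Longrightarrow> dL k x \<in> serre_ideal"
proof (induction rule: serre_ideal.induct)
  case (gen i j x y)
  have "twist k (-1) x * (twist k (-1) (serre i j) * dL k y) \<in> serre_ideal"
    using gen by (intro serre_ideal_mult_left serre_ideal_mult_right serre_ideal_twist) (use serre_ideal.gen[OF gen, of 1 1] in simp)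
  thus ?case
    using serre_ideal.gen[OF gen, of "dL k x" y] by (auto simp: dL_mult dL_serre[OF gen] mult.assoc twist_mult intro: serre_ideal.add)
qed (auto intro: serre_ideal.add)

lemma serre_ideal_dR: "x \<in> serre_ideal \<Longrightarrow> dR k x \<in> serre_ideal"
proof (induction rule: serre_ideal.induct)
  case (gen i j x y)
  have "dR k x * (twist k (-1) (serre i j)) * twist k (-1) y \<in> serre_ideal"
    using gen by (intro serre_ideal_mult_left serre_ideal_mult_right serre_ideal_twist) (use serre_ideal.gen[OF gen, of 1 1] in simp)
  thus ?case
    using serre_ideal.gen[OF gen, of x "dR k y"] by (auto simp: dR_mult dR_serre[OF gen] mult.assoc twist_mult intro: serre_ideal.add)
qed (auto intro: serre_ideal.add)

lemma serre_ideal_qad: "x \<in> serre_ideal \<Longrightarrow> qad i x \<in> serre_ideal"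
  unfolding qad_def by (intro serre_ideal_diff serre_ideal_mult_left serre_ideal_mult_right serre_ideal_twist)

lemma serre_ideal_funpow_qad: "x \<in> serre_ideal \<Longrightarrow> (qad i ^^ m) x \<in> serre_ideal"
  by (induction m) (auto intro: serre_ideal_qad)

text \<open>Local nilpotency of a skew derivation passes to products: with m + n derivatives, one of
  the two factors receives enough of them. The twist in the Leibniz rule only rescales.\<close>

lemma qad_nilpotent_mult:
  assumes "(qad i ^^ m) y \<in> serre_ideal" "(qad i ^^ n) z \<in> serre_ideal"
  shows "(qad i ^^ (m + n)) (y * z) \<in> serre_ideal"
  using assms
proof (induction "m + n" arbitrary: m n y z)
  case 0
  thus ?case by (auto intro: serre_ideal_mult_left)
next
  case (Suc l)
  show ?case
  proof (cases "m = 0 \<or> n = 0")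
    case True
    with Suc.prems show ?thesis
      by (auto intro!: serre_ideal_funpow_qad intro: serre_ideal_mult_left serre_ideal_mult_right)
  next
    case False
    then obtain m' n' where mn: "m = Suc m'" "n = Suc n'"
      by (cases m; cases n) auto
    have "(qad i ^^ (m' + n)) (qad i y * z) \<in> serre_ideal"
      using Suc.prems Suc.hyps(2) mn by (intro Suc.hyps(1)) (simp_all add: funpow_swap1)
    moreover have "(qad i ^^ (m + n')) (twist i 1 y * qad i z) \<in> serre_ideal"
    proof (rule Suc.hyps(1))
      have "twist i 1 ((qad i ^^ m) y) \<in> serre_ideal"
        using Suc.prems by (rule_tac serre_ideal_twist)
      thus "(qad i ^^ m) (twist i 1 y) \<in> serre_ideal"
        by (simp add: twist_funpow_qad serre_ideal_sm_iff)
    qed (use Suc.prems Suc.hyps(2) mn in \<open>simp_all add: funpow_swap1\<close>)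
    ultimately have "(qad i ^^ l) (qad i (y * z)) \<in> serre_ideal"
      using Suc.hyps(2) mn by (simp add: qad_mult funpow_qad_lin serre_ideal.add)
    thus ?thesis
      using Suc.hyps(2)[symmetric] by (simp add: funpow_swap1)
  qed
qed


section \<open>The radical of the bilinear form\<close>

text \<open>The part of the positive half on which \<open>qad i\<close> is locally nilpotent modulo
  the Serre ideal. It lies in the kernel of \<open>dL i\<close> and complements the powers of
  e_i.\<close>

inductive_set qad_alg :: "'i \<Rightarrow> ('i, 'k) fa set" for i where
  gen: "i \<noteq> j \<Longrightarrow> (qad i ^^ m) (e j) \<in> qad_alg i"
| one: "1 \<in> qad_alg i"
| add: "y \<in> qad_alg i \<Longrightarrow> z \<in> qad_alg i \<Longrightarrow> y + z \<in> qad_alg i"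
| scale: "y \<in> qad_alg i \<Longrightarrow> sm k y \<in> qad_alg i"
| mult: "y \<in> qad_alg i \<Longrightarrow> z \<in> qad_alg i \<Longrightarrow> y * z \<in> qad_alg i"

lemma qad_alg_0 [simp]: "0 \<in> qad_alg i"
  using qad_alg.scale[OF qad_alg.one, of 0] by simp

lemma qad_alg_twist: "y \<in> qad_alg i \<Longrightarrow> twist i n y \<in> qad_alg i"
  by (induction rule: qad_alg.induct)
    (auto simp: twist_mult twist_funpow_qad twist_e funpow_qad_lin intro: qad_alg.intros)

lemma qad_alg_dL: "y \<in> qad_alg i \<Longrightarrow> dL i y = 0"
  by (induction rule: qad_alg.induct) (auto simp: dL_mult dL_funpow_qad_same)

lemma qad_alg_nilpotent: "y \<in> qad_alg i \<Longrightarrow> \<exists>m. (qad i ^^ m) y \<in> serre_ideal"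
proof (induction rule: qad_alg.induct)
  case (gen j m)
  have "serre i j \<in> serre_ideal"
    using serre_ideal.gen[OF gen, of 1 1] by simp
  hence "(qad i ^^ m) ((qad i ^^ nat (1 - a i j)) (e j)) \<in> serre_ideal"
    unfolding serre_def by (rule serre_ideal_funpow_qad)
  hence "(qad i ^^ (m + nat (1 - a i j))) (e j) \<in> serre_ideal"
    by (simp add: funpow_add)
  hence "(qad i ^^ nat (1 - a i j)) ((qad i ^^ m) (e j)) \<in> serre_ideal"
    by (simp only: add.commute[of m] funpow_add comp_apply)
  thus ?case ..
next
  case one
  have "(qad i ^^ 1) 1 \<in> serre_ideal"
    by (simp add: qad_def)
  thus ?case by blast
next
  case (add y z)
  then obtain m n where "(qad i ^^ m) y \<in> serre_ideal" "(qad i ^^ n) z \<in> serre_ideal" by blast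
  hence "(qad i ^^ n) ((qad i ^^ m) y) \<in> serre_ideal" "(qad i ^^ m) ((qad i ^^ n) z) \<in> serre_ideal"
    by (simp_all add: serre_ideal_funpow_qad)
  hence "(qad i ^^ (n + m)) y \<in> serre_ideal" "(qad i ^^ (m + n)) z \<in> serre_ideal"
    by (simp_all add: funpow_add)
  hence "(qad i ^^ (n + m)) (y + z) \<in> serre_ideal"
    by (simp add: funpow_qad_lin add.commute[of m] serre_ideal.add)
  thus ?case by blast
next
  case (scale y k)
  thus ?case by (auto simp: funpow_qad_lin intro: serre_ideal_sm)
next
  case (mult y z)
  thus ?case using qad_nilpotent_mult by blast
qed

text \<open>Polynomials in e_i, written on the right, with coefficients in \<open>qad_alg i\<close>.
  All sufficiently large bounds are required to work, so that two such expressions can be added with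
  a common bound.\<close>

definition qad_span :: "'i \<Rightarrow> ('i, 'k) fa set" where
  "qad_span i = {x. \<exists>K y. (\<forall>k. y k \<in> qad_alg i) \<and> (\<forall>K'\<ge>K. x = (\<Sum>k<K'. y k * e i ^ k))}"

lemma qad_span_add: "x \<in> qad_span i \<Longrightarrow> x' \<in> qad_span i \<Longrightarrow> x + x' \<in> qad_span i"
proof -
  assume "x \<in> qad_span i" "x' \<in> qad_span i"
  then obtain K y K' y' where *: "\<forall>k. y k \<in> qad_alg i" "\<forall>N\<ge>K. x = (\<Sum>k<N. y k * e i ^ k)"
    "\<forall>k. y' k \<in> qad_alg i" "\<forall>N\<ge>K'. x' = (\<Sum>k<N. y' k * e i ^ k)"
    unfolding qad_span_def by blast
  have "x + x' = (\<Sum>k<N. (y k + y' k) * e i ^ k)" if "N \<ge> max K K'" for N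
    using *(2)[rule_format, of N] *(4)[rule_format, of N] that by (simp add: distrib_right sum.distrib)
  thus ?thesis
    unfolding qad_span_def using * qad_alg.add by (intro CollectI exI[of _ "max K K'"] exI[of _ "\<lambda>k. y k + y' k"]) auto
qed

lemma qad_span_gen:
  assumes "y \<in> qad_alg i"
  shows "y * e i ^ k \<in> qad_span i"
proof -
  have "y * e i ^ k = (\<Sum>l<N. (if l = k then y else 0) * e i ^ l)" if "N \<ge> Suc k" for N
    using that by (subst sum.remove[of _ k]) (auto intro!: sum.neutral)
  thus ?thesis
    unfolding qad_span_def using assms
    by (intro CollectI exI[of _ "Suc k"] exI[of _ "\<lambda>l. if l = k then y else 0"]) auto
qed

lemma qad_span_0: "0 \<in> qad_span i"
  using qad_span_gen[OF qad_alg_0, of i 0] by simp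

lemma qad_span_sum: "(\<And>k. k \<in> N \<Longrightarrow> f k \<in> qad_span i) \<Longrightarrow> sum f N \<in> qad_span i"
  by (induction N rule: infinite_finite_induct) (auto intro: qad_span_0 qad_span_add)

lemma qad_span_mult_left:
  assumes "z \<in> qad_alg i" "x \<in> qad_span i"
  shows "z * x \<in> qad_span i"
proof -
  obtain K y where y: "\<forall>k. y k \<in> qad_alg i" "x = (\<Sum>k<K. y k * e i ^ k)"
    using assms(2) unfolding qad_span_def by blast
  show ?thesis
    using y assms(1) by (auto simp: sum_distrib_left mult.assoc[symmetric] intro!: qad_span_sum qad_span_gen qad_alg.mult)
qed

lemma qad_span_mult_e_same:
  assumes "x \<in> qad_span i"
  shows "x * e i \<in> qad_span i"
proof -
  obtain K y where y: "\<forall>k. y k \<in> qad_alg i" "x = (\<Sum>k<K. y k * e i ^ k)"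
    using assms unfolding qad_span_def by blast
  have "y k * e i ^ k * e i \<in> qad_span i" for k
    using qad_span_gen[of "y k" i "Suc k"] y(1) by (simp add: mult.assoc power_commutes)
  thus ?thesis
    using y(2) by (auto simp: sum_distrib_right intro!: qad_span_sum)
qed

text \<open>Powers of e_i move to the right by e_i z = \<open>qad i z\<close> +
  \<open>twist i 1 z\<close> e_i, at the price of further iterates of \<open>qad i\<close>, which
  stay among the generators of the coefficients.\<close>

lemma qad_span_power_mult:
  assumes "i \<noteq> j"
  shows "e i ^ k * (qad i ^^ m) (e j) \<in> qad_span i"
proof (induction k arbitrary: m)
  case 0
  show ?case
    using qad_span_gen[OF qad_alg.gen[OF assms, of m], of 0] by simp
next
  case (Suc k)
  let ?z = "(qad i ^^ m) (e j)"
  obtain t where t: "twist i 1 ?z = sm t ?z"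
    by (simp add: twist_funpow_qad twist_e funpow_qad_lin)
  have "e i ^ Suc k * ?z = e i ^ k * (e i * ?z)"
    by (simp add: power_commutes mult.assoc[symmetric])
  also have "e i * ?z = (qad i ^^ Suc m) (e j) + sm t (?z * e i)"
    by (simp add: qad_def t sm_simps)
  finally have "e i ^ Suc k * ?z = e i ^ k * (qad i ^^ Suc m) (e j) + sm t 1 * (e i ^ k * ?z * e i)"
    by (simp add: distrib_left sm_simps mult.assoc)
  thus ?case
    using Suc[of "Suc m"] Suc[of m] by (auto intro!: qad_span_add qad_span_mult_e_same qad_span_mult_left qad_alg.scale qad_alg.one)
qed

lemma qad_span_mult_e:
  assumes "x \<in> qad_span i"
  shows "x * e j \<in> qad_span i"
proof (cases "i = j")
  case False
  obtain K y where y: "\<forall>k. y k \<in> qad_alg i" "x = (\<Sum>k<K. y k * e i ^ k)"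
    using assms unfolding qad_span_def by blast
  have "y k * (e i ^ k * e j) \<in> qad_span i" for k
    using y(1) qad_span_power_mult[OF False, of k 0] by (rule_tac qad_span_mult_left) auto
  thus ?thesis
    using y(2) by (auto simp: sum_distrib_right mult.assoc intro!: qad_span_sum)
qed (use assms qad_span_mult_e_same in auto)

lemma qad_span_UNIV: "x \<in> qad_span i"
proof (induction x rule: fa_induct_wrd)
  case (scale k x)
  thus ?case
    using qad_span_mult_left[OF qad_alg.scale[OF qad_alg.one], of x i k] by (simp add: sm_simps)
next
  case (wrd w)
  show ?case
  proof (induction w rule: rev_induct)
    case Nil
    show ?case using qad_span_gen[OF qad_alg.one, of i 0] by simp
  qed (simp add: wrd_snoc qad_span_mult_e)
qed (auto intro: qad_span_0 qad_span_add)

text \<open>The scalar is a geometric sum in q_i^(-2), a quantum integer up to a power of q_i, and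
  nonzero because v is not a root of unity.\<close>

lemma dL_power: "\<exists>t\<noteq>0. dL i (e i ^ Suc k) = sm t (e i ^ k)"
proof -
  define r where "r = inverse (p i i)"
  have "dL i (e i ^ k) = sm (\<Sum>l<k. r ^ l) (e i ^ (k - 1))" for k
  proof (induction k)
    case (Suc k)
    have "dL i (e i ^ Suc k) = e i ^ k + sm r (e i * dL i (e i ^ k))"
      by (simp add: dL_e_mult r_def)
    also have "\<dots> = sm (1 + r * (\<Sum>l<k. r ^ l)) (e i ^ k)"
      unfolding Suc by (cases k) (simp_all add: sm_simps sm_add_left distrib_left)
    finally show ?case
      by (simp add: sum.lessThan_Suc_shift sum_distrib_left del: sum.lessThan_Suc)
  qed simp
  moreover have "(\<Sum>l<Suc k. r ^ l) \<noteq> 0"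
  proof
    assume "(\<Sum>l<Suc k. r ^ l) = 0"
    hence "r ^ Suc k = 1"
      using one_diff_power_eq[of r "Suc k"] by simp
    hence "v powi (- (int (d i) * 2 * int (Suc k))) = 1"
      by (simp only: r_def p_def a_diag power_int_minus[symmetric] power_int_power' minus_mult_left)
    thus False
      using d_pos[of i] unfolding powi_v_eq_1 by simp
  qed
  ultimately show ?thesis by (metis diff_Suc_1)
qed

lemma funpow_dL_qad_alg_power:
  assumes "y \<in> qad_alg i"
  shows "m \<le> k \<Longrightarrow> \<exists>t\<noteq>0. (dL i ^^ m) (y * e i ^ k) = sm t (twist i (- int m) y * e i ^ (k - m))"
proof (induction m)
  case 0
  show ?case by (rule exI[of _ 1]) simp
next
  case (Suc m)
  then obtain t where t: "t \<noteq> 0" "(dL i ^^ m) (y * e i ^ k) = sm t (twist i (- int m) y * e i ^ (k - m))"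
    by auto
  obtain l where l: "k - m = Suc l" "k - Suc m = l"
    using Suc.prems by (metis Suc_diff_Suc Suc_le_lessD)
  obtain s where s: "s \<noteq> 0" "dL i (e i ^ Suc l) = sm s (e i ^ l)"
    using dL_power by blast
  have "(dL i ^^ Suc m) (y * e i ^ k) = sm (t * s) (twist i (- int (Suc m)) y * e i ^ l)"
    using qad_alg_dL[OF qad_alg_twist[OF assms, of "- int m"]] s
    by (simp add: t(2) l dL_mult twist_add sm_simps del: power_Suc)
  thus ?case
    using t s l by (intro exI[of _ "t * s"]) simp
qed

lemma funpow_dL_qad_alg_power_0:
  assumes "y \<in> qad_alg i" "k < m"
  shows "(dL i ^^ m) (y * e i ^ k) = 0"
proof -
  have 1: "(dL i ^^ Suc k) (y * e i ^ k) = 0"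
    using funpow_dL_qad_alg_power[OF assms(1), of k k] qad_alg_dL[OF qad_alg_twist[OF assms(1), of "- int k"]]
    by auto
  have "(dL i ^^ n) 0 = 0" for n
    by (induction n) simp_all
  moreover obtain n where "m = n + Suc k"
    using assms(2) by (metis add.commute less_iff_Suc_add add_Suc_right)
  ultimately show ?thesis
    using 1 by (simp only: funpow_add comp_apply)
qed

lemma serre_ideal_funpow_dL: "x \<in> serre_ideal \<Longrightarrow> (dL i ^^ m) x \<in> serre_ideal"
  by (induction m) (auto intro: serre_ideal_dL)

lemmas funpow_dL_lin = flin_add[OF flin_funpow[OF flin_dL]] flin_diff[OF flin_funpow[OF flin_dL]]
  flin_sum[OF flin_funpow[OF flin_dL]]

text \<open>The leading coefficient is isolated by the K-th power of \<open>dL i\<close>, which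
  kills all lower terms and returns it up to a twist and a nonzero scalar. So all coefficients of
  positive powers of e_i lie in the ideal, from the top downwards.\<close>

lemma qad_alg_mod_serre_ideal_aux:
  assumes "\<forall>k. y k \<in> qad_alg i" "\<forall>m\<ge>1. (dL i ^^ m) (\<Sum>k<K. y k * e i ^ k) \<in> serre_ideal"
  shows "\<exists>z\<in>qad_alg i. (\<Sum>k<K. y k * e i ^ k) - z \<in> serre_ideal"
  using assms(2)
proof (induction K)
  case 0
  show ?case by (rule bexI[of _ 0]) auto
next
  case (Suc K)
  show ?case
  proof (cases "K = 0")
    case True
    thus ?thesis using assms(1) by (intro bexI[of _ "y 0"]) auto
  next
    case False
    obtain t where t: "t \<noteq> 0" "(dL i ^^ K) (y K * e i ^ K) = sm t (twist i (- int K) (y K) * e i ^ (K - K))"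
      using funpow_dL_qad_alg_power[of "y K" i K K] assms(1) by blast
    have "(dL i ^^ K) (\<Sum>k<K. y k * e i ^ k) = 0"
      using assms(1) by (auto simp: funpow_dL_lin funpow_dL_qad_alg_power_0 intro!: sum.neutral)
    hence "sm t (twist i (- int K) (y K)) \<in> serre_ideal"
      using Suc.prems False t by (auto simp: funpow_dL_lin dest!: spec[of _ K])
    hence serre_ideal: "y K * e i ^ K \<in> serre_ideal"
      using t(1) by (simp add: serre_ideal_sm_iff serre_ideal_twist_iff serre_ideal_mult_right)
    have "(dL i ^^ m) (\<Sum>k<K. y k * e i ^ k) \<in> serre_ideal" if "m \<ge> 1" for m
      using serre_ideal_diff[OF Suc.prems[rule_format, OF that] serre_ideal_funpow_dL[OF serre_ideal, of m i]] by (simp add: funpow_dL_lin)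
    then obtain z where z: "z \<in> qad_alg i" "(\<Sum>k<K. y k * e i ^ k) - z \<in> serre_ideal"
      using Suc.IH by blast
    thus ?thesis
      using serre_ideal.add[OF z(2) serre_ideal] by (intro bexI[of _ z]) (simp_all add: algebra_simps)
  qed
qed

lemma qad_alg_mod_serre_ideal:
  assumes "\<And>m. m \<ge> 1 \<Longrightarrow> (dL i ^^ m) x \<in> serre_ideal"
  shows "\<exists>z\<in>qad_alg i. x - z \<in> serre_ideal"
proof -
  obtain K y where y: "\<forall>k. y k \<in> qad_alg i" "x = (\<Sum>k<K. y k * e i ^ k)"
    using qad_span_UNIV[of x i] unfolding qad_span_def by blast
  show ?thesis
    using qad_alg_mod_serre_ideal_aux[OF y(1), of K] assms y(2) by blast
qed

text \<open>The value of the simple coroot of i on \<beta>, hence the exponent of q_i in the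
  eigenvalue of K_i on weight \<beta>.\<close>

definition coroot_wt :: "'i \<Rightarrow> 'i multiset \<Rightarrow> int" where
  "coroot_wt i \<beta> = (\<Sum>j\<in>#\<beta>. a i j)"

lemma P_coroot_wt: "P i w = (v ^ d i) powi coroot_wt i (mset w)"
  by (induction w) (simp_all add: coroot_wt_def p_def power_int_add v_nz power_int_mult)

lemma twist_homog: "homog \<beta> x \<Longrightarrow> twist i n x = sm (((v ^ d i) powi coroot_wt i \<beta>) powi n) x"
  by (erule supp_induct) (auto simp: sm_add twist_wrd P_coroot_wt mult.commute)

text \<open>
  The first half of the argument of Gabber and Kac, for \<open>x\<close> of minimal degree in the radical. As
  \<open>dL i x\<close> is in the ideal, \<open>x\<close> is congruent to an element of \<open>qad_alg i\<close>, on which \<open>qad i\<close> is locally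
  nilpotent. As \<open>dR i x\<close> is in the ideal as well, \<open>dR i\<close> undoes \<open>qad i\<close> up to the factors \<open>lowering_coeff\<close>, which
  do not vanish if \<open>x\<close> has positive weight.
\<close>

lemma coroot_wt_nonpos:
  assumes "homog \<beta> x" "radical x" "x \<notin> serre_ideal"
    and "\<And>\<gamma> y. size \<gamma> < size \<beta> \<Longrightarrow> homog \<gamma> y \<Longrightarrow> radical y \<Longrightarrow> y \<in> serre_ideal"
  shows "coroot_wt i \<beta> \<le> 0"
proof (rule ccontr)
  assume pos: "\<not> coroot_wt i \<beta> \<le> 0"
  have dL: "dL i x \<in> serre_ideal" and dR: "dR i x \<in> serre_ideal"
  proof -
    have "dL i x \<in> serre_ideal \<and> dR i x \<in> serre_ideal"
    proof (cases "i \<in># \<beta>")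
      case True
      then obtain \<gamma> where "\<beta> = add_mset i \<gamma>" by (metis insert_DiffM)
      thus ?thesis
        using assms(1,2) assms(4)[of \<gamma>] by (auto intro: homog_dL homog_dR radical_dL radical_dR)
    qed (use assms(1) homog_dL_0 homog_dR_0 in auto)
    thus "dL i x \<in> serre_ideal" "dR i x \<in> serre_ideal" by auto
  qed
  have "(dL i ^^ m) x \<in> serre_ideal" if "m \<ge> 1" for m
    using that dL by (cases m) (auto simp: funpow_Suc_right serre_ideal_funpow_dL simp del: funpow.simps)
  then obtain z where z: "z \<in> qad_alg i" "x - z \<in> serre_ideal"
    using qad_alg_mod_serre_ideal by blast
  then obtain M where "(qad i ^^ M) z \<in> serre_ideal"
    using qad_alg_nilpotent by blast
  from serre_ideal.add[OF serre_ideal_funpow_qad[OF z(2), of M i] this] have M: "(qad i ^^ M) x \<in> serre_ideal"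
    by (simp add: funpow_qad_lin)
  \<comment> \<open>Descending in M: \<open>dR i\<close> applied to the next higher power gives,
    modulo the ideal, a nonzero multiple of this power.\<close>
  have "(qad i ^^ M) x \<in> serre_ideal \<Longrightarrow> x \<in> serre_ideal" for M
  proof (induction M)
    case (Suc M)
    let ?t = "(v ^ d i) powi coroot_wt i \<beta>"
    have "dR i ((qad i ^^ Suc M) x) \<in> serre_ideal"
      using Suc.prems by (rule serre_ideal_dR)
    hence "(qad i ^^ Suc M) (dR i x) + sm (lowering_coeff i ?t (Suc M)) ((qad i ^^ M) x) \<in> serre_ideal"
      using twist_homog[OF assms(1), of i] dR_funpow_qad_same[of i x ?t "Suc M"] by (simp add: power_int_minus)
    hence "sm (lowering_coeff i ?t (Suc M)) ((qad i ^^ M) x) \<in> serre_ideal"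
      using serre_ideal_diff[OF _ serre_ideal_funpow_qad[OF dR, of "Suc M" i]] by fastforce
    thus ?case
      using Suc.IH lowering_coeff_nz[of "coroot_wt i \<beta>" "Suc M" i] pos by (simp add: serre_ideal_sm_iff)
  qed simp
  thus False using M assms(3) by blast
qed

end

interpretation fa: vector_space "sm :: 'k :: field \<Rightarrow> ('i, 'k) fa \<Rightarrow> ('i, 'k) fa"
  by unfold_locales (simp_all add: sm_add sm_add_left)

context cartan_form
begin

section \<open>Dual families in a weight space of the free algebra\<close>

lemma form_wt:
  assumes "homog \<beta> x" "homog \<gamma> y" "\<beta> \<noteq> \<gamma>"
  shows "form x y = 0"
  using assms(2)
proof (induction rule: supp_induct)
  case (wrd w)
  show ?case
    unfolding form_wrd using wrd assms(1,3) by (intro word_form_wt) (auto elim: supp_mono)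
qed (simp_all add: form_simps)

lemma form_wrd_twist: "form (wrd u) (twist i n y) = P i u powi n * form (wrd u) y"
  using form_sym[of "wrd u"] by (simp add: form_wrd word_form_twist)

lemma radical_homI:
  assumes "homog \<gamma> x" "\<And>y. homog \<gamma> y \<Longrightarrow> form x y = 0"
  shows "radical x"
proof -
  have "form x y = 0" for y
  proof (induction y rule: fa_induct_wrd)
    case (wrd w)
    show ?case
      using assms form_wt[OF assms(1), of "mset w" "wrd w"] by (cases "mset w = \<gamma>") auto
  qed (simp_all add: form_simps)
  thus ?thesis by (simp add: radical_def)
qed

definition dual_fam :: "'i multiset \<Rightarrow> nat \<Rightarrow> (nat \<Rightarrow> ('i, 'k) fa) \<Rightarrow> (nat \<Rightarrow> ('i, 'k) fa) \<Rightarrow> bool" where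
  "dual_fam \<gamma> N b b' \<longleftrightarrow> (\<forall>\<nu><N. homog \<gamma> (b \<nu>) \<and> homog \<gamma> (b' \<nu>)) \<and>
     (\<forall>\<mu><N. \<forall>\<nu><N. form (b \<mu>) (b' \<nu>) = (if \<mu> = \<nu> then 1 else 0))"

lemma dual_fam_form_sum:
  assumes "dual_fam \<gamma> N b b'" "\<nu> < N"
  shows "form (\<Sum>\<mu><N. sm (f \<mu>) (b \<mu>)) (b' \<nu>) = f \<nu>" "form (b \<nu>) (\<Sum>\<mu><N. sm (f \<mu>) (b' \<mu>)) = f \<nu>"
  using assms
  by (simp_all add: dual_fam_def form_sum form_sum_left form_sm form_sm_left if_distrib[of "(*) _"] cong: if_cong)

lemma finite_words: "finite {w :: 'i list. mset w = \<gamma>}"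
  by (rule finite_subset[OF _ finite_lists_length_eq[of "set_mset \<gamma>" "size \<gamma>"]]) auto

text \<open>Biorthogonality forces linear independence, and a weight space is spanned by its
  finitely many words. The bound permits the choice of a dual family of maximal size.\<close>

lemma dual_fam_bound:
  assumes "dual_fam \<gamma> N b b'"
  shows "N \<le> card {w :: 'i list. mset w = \<gamma>}"
proof -
  let ?T = "wrd ` {w. mset w = \<gamma>} :: ('i, 'k) fa set"
  have inj: "inj_on b {..<N}"
    using assms unfolding dual_fam_def by (intro inj_onI) (metis lessThan_iff zero_neq_one)
  have "b ` {..<N} \<subseteq> fa.span ?T"
  proof safe
    fix \<nu> assume "\<nu> < N"
    hence "homog \<gamma> (b \<nu>)"
      using assms by (simp add: dual_fam_def)
    thus "b \<nu> \<in> fa.span ?T"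
      by (induction rule: supp_induct) (auto intro: fa.span_zero fa.span_add fa.span_scale fa.span_base)
  qed
  moreover have "fa.independent (b ` {..<N})"
  proof (rule fa.independent_if_scalars_zero)
    fix f x assume *: "(\<Sum>x\<in>b ` {..<N}. sm (f x) x) = 0" "x \<in> b ` {..<N}"
    then obtain \<nu> where \<nu>: "x = b \<nu>" "\<nu> < N" by auto
    have "(\<Sum>\<mu><N. sm (f (b \<mu>)) (b \<mu>)) = 0"
      using *(1) inj by (simp add: sum.reindex)
    thus "f x = 0"
      using dual_fam_form_sum(1)[OF assms \<nu>(2), of "\<lambda>\<mu>. f (b \<mu>)"] \<nu>(1) by simp
  qed simp
  ultimately have "card (b ` {..<N}) \<le> card ?T"
    using fa.independent_span_bound[of ?T "b ` {..<N}"] finite_words by blast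
  moreover have "card (b ` {..<N}) = N"
    using inj by (simp add: card_image)
  ultimately show ?thesis
    using card_image_le[OF finite_words[of \<gamma>], of "wrd :: 'i list \<Rightarrow> ('i, 'k) fa"] by linarith
qed

lemma dual_fam_extend:
  assumes fam: "dual_fam \<gamma> N b b'" and x: "homog \<gamma> x" "\<And>\<nu>. \<nu> < N \<Longrightarrow> form x (b' \<nu>) = 0"
    and y: "homog \<gamma> y" "\<And>\<nu>. \<nu> < N \<Longrightarrow> form (b \<nu>) y = 0" and xy: "form x y \<noteq> 0"
  shows "dual_fam \<gamma> (Suc N) (b(N := sm (inverse (form x y)) x)) (b'(N := y))"
  using assms unfolding dual_fam_def by (auto simp: less_Suc_eq form_simps intro: supp_sm)

text \<open>In a dual family of maximal size, the parts of two elements that are orthogonal to it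
  cannot pair to a nonzero number, since they could be appended. So these parts lie in the radical,
  and the family consists of dual bases modulo the radical.\<close>

lemma dual_fam_exists:
  obtains N b b' where "dual_fam \<gamma> N b b'"
    "\<And>x. homog \<gamma> x \<Longrightarrow> radical (x - (\<Sum>\<nu><N. sm (form x (b' \<nu>)) (b \<nu>)))"
    "\<And>y. homog \<gamma> y \<Longrightarrow> radical (y - (\<Sum>\<nu><N. sm (form (b \<nu>) y) (b' \<nu>)))"
proof -
  define Ns where "Ns = {N. \<exists>b b'. dual_fam \<gamma> N b b'}"
  have "0 \<in> Ns" by (auto simp: Ns_def dual_fam_def)
  moreover have fin: "finite Ns"
    by (rule finite_subset[of _ "{..card {w :: 'i list. mset w = \<gamma>}}"]) (auto simp: Ns_def dual_fam_bound)
  ultimately have "Max Ns \<in> Ns" by (intro Max_in) auto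
  then obtain b b' where fam: "dual_fam \<gamma> (Max Ns) b b'" by (auto simp: Ns_def)
  define N where "N = Max Ns"
  note fam = fam[folded N_def]
  have max: "\<not> dual_fam \<gamma> (Suc N) c c'" for c c'
    using Max_ge[OF fin, of "Suc N"] by (auto simp: Ns_def N_def)
  define prx where "prx x = x - (\<Sum>\<nu><N. sm (form x (b' \<nu>)) (b \<nu>))" for x
  define pry where "pry y = y - (\<Sum>\<nu><N. sm (form (b \<nu>) y) (b' \<nu>))" for y
  have homog: "homog \<gamma> x \<Longrightarrow> homog \<gamma> (prx x)" "homog \<gamma> x \<Longrightarrow> homog \<gamma> (pry x)" for x
    using fam unfolding prx_def pry_def dual_fam_def by (auto intro!: supp_diff supp_sum supp_sm)
  have prx: "form (prx x) (b' \<nu>) = 0" and pry: "form (b \<nu>) (pry x) = 0" if "\<nu> < N" for x \<nu>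
    using dual_fam_form_sum[OF fam that] by (simp_all add: prx_def pry_def form_simps)
  have 0: "form (prx x) (pry y) = 0" if "homog \<gamma> x" "homog \<gamma> y" for x y
    using dual_fam_extend[OF fam homog(1)[OF that(1)] prx homog(2)[OF that(2)] pry] max by blast
  have "form (prx x) (pry y) = form (prx x) y" for x y
    unfolding pry_def[of y] form_diff form_sum form_sm using prx by simp
  moreover have "form (prx x) (pry y) = form x (pry y)" for x y
    unfolding prx_def[of x] form_diff_left form_sum_left form_sm_left using pry by simp
  ultimately have "radical (prx x)" "radical (pry x)" if "homog \<gamma> x" for x
    using that 0 homog by (auto intro!: radical_homI[of \<gamma>]) (metis form_sym)
  thus thesis
    using that[OF fam] by (simp add: prx_def pry_def)
qed

section \<open>Commutators with the f_j and the Casimir tensor\<close>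

text \<open>In the quantum group, \<open>fcomm j\<close> is a multiple of the commutator with \<open>f\<^sub>j\<close>.\<close>

definition fcomm :: "'i \<Rightarrow> ('i, 'k) fa \<Rightarrow> ('i, 'k) fa" where
  "fcomm j x = dL j x - twist j (-1) (dR j x)"

lemma flin_fcomm [simp]: "flin (fcomm j)"
  by (rule flinI) (simp_all add: fcomm_def fa_simps)

lemmas fcomm_lin = flin_0[OF flin_fcomm] flin_add[OF flin_fcomm] flin_diff[OF flin_fcomm] flin_sm[OF flin_fcomm]

lemma fcomm_e_mult:
  "fcomm j (e i * y) = sm (inverse (p i j)) (e i * fcomm j y) + (if i = j then y - twist j (-2) y else 0)"
  by (simp add: fcomm_def dL_e_mult dR_e_mult twist_mult twist_e twist_add p_sym[of j] power_int_minus sm_simps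
      algebra_simps)

lemma fcomm_twist: "fcomm j (twist i n x) = sm (p i j powi n) (twist i n (fcomm j x))"
  by (simp add: fcomm_def dL_twist dR_twist p_sym[of j] sm_simps twist_twist[of i n])

primrec fcomm_word :: "'i list \<Rightarrow> ('i, 'k) fa \<Rightarrow> ('i, 'k) fa" where
  "fcomm_word [] y = y"
| "fcomm_word (j # t) y = fcomm j (fcomm_word t y)"

definition fcomm_act :: "('i, 'k) fa \<Rightarrow> ('i, 'k) fa \<Rightarrow> ('i, 'k) fa" where
  "fcomm_act T y = lin (\<lambda>t. fcomm_word t y) T"

lemma fcomm_act_lin: "fcomm_act 0 y = 0" "fcomm_act (T + U) y = fcomm_act T y + fcomm_act U y" "fcomm_act (sm k T) y = sm k (fcomm_act T y)"
  "fcomm_act (T - U) y = fcomm_act T y - fcomm_act U y" "fcomm_act (wrd t) y = fcomm_word t y"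
  by (simp_all add: fcomm_act_def lin_0 lin_add lin_sm lin_diff)

lemma fcomm_act_one: "fcomm_act 1 y = y"
  using fcomm_act_lin(5)[of "[]"] by simp

lemma fcomm_act_e_mult: "fcomm_act (e j * T) y = fcomm j (fcomm_act T y)"
  by (induction T rule: fa_induct_wrd) (simp_all add: fa_simps fcomm_act_lin fcomm_lin flip: wrd_Cons)

text \<open>Moving e_i through an element T of the negative half: T survives up to a twist, or loses
  an i at its right or at its left end. The recursion of \<open>casimir_sum\<close> consists of the
  same three kinds of terms, with words in place of T.\<close>

lemma fcomm_act_e: "fcomm_act T (e i * y) =
  e i * fcomm_act (twist i (-1) T) y + fcomm_act (dR i T) y - twist i (-2) (fcomm_act (twist i (-1) (dL i T)) y)"
proof (induction T rule: fa_induct_Cons)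
  case (Cons j T)
  define x1 x2 x3 where "x1 = fcomm_act (twist i (-1) T) y" and "x2 = fcomm_act (dR i T) y" and "x3 = fcomm_act (twist i (-1) (dL i T)) y"
  have "fcomm_act (e j * T) (e i * y) = sm (inverse (p i j)) (e i * fcomm j x1) + (if i = j then x1 - twist j (-2) x1 else 0)
      + fcomm j x2 - sm (p i j powi (-2)) (twist i (-2) (fcomm j x3))"
    unfolding fcomm_act_e_mult Cons x1_def[symmetric] x2_def[symmetric] x3_def[symmetric]
    by (simp add: fcomm_lin fcomm_e_mult fcomm_twist)
  moreover have "fcomm_act (twist i (-1) (e j * T)) y = sm (inverse (p i j)) (fcomm j x1)"
    by (simp add: twist_mult twist_e sm_mult_left fcomm_act_lin fcomm_act_e_mult x1_def power_int_minus)
  moreover have "fcomm_act (dR i (e j * T)) y = fcomm j x2 + (if i = j then x1 else 0)"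
    by (simp add: dR_e_mult fcomm_act_lin fcomm_act_e_mult x1_def x2_def)
  moreover have "fcomm_act (twist i (-1) (dL i (e j * T))) y = (if i = j then x1 else 0) + sm (p i j powi (-2)) (fcomm j x3)"
    by (simp add: dL_e_mult fcomm_act_lin fcomm_act_e_mult x1_def x3_def twist_mult twist_e sm_mult_left power_int_minus
        power_int_numeral power2_eq_square)
  ultimately show ?case
    by (simp add: sm_mult_right)
qed (simp_all add: fa_simps fcomm_act_lin fcomm_act_one)

text \<open>
  \<open>casimir_sum w f\<close> is the sum of \<open>f u z\<close> over the terms \<open>u \<otimes> z\<close> of a tensor \<open>\<Gamma> w\<close> that plays the role of the quantum
  Casimir element: contracting its first factor with an element \<open>y\<close> gives \<open>fcomm_act y (wrd w)\<close> (see \<open>casimir_sum_form\<close>),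
  whereas multiplying its factors with the weights \<open>casimir_coeff u\<close> gives a multiple of \<open>w\<close> (see \<open>casimir_sum_casimir_eigenvalue\<close>).
\<close>

primrec casimir_sum :: "'i list \<Rightarrow> ('i list \<Rightarrow> 'i list \<Rightarrow> ('i, 'k) fa) \<Rightarrow> ('i, 'k) fa" where
  "casimir_sum [] f = f [] []"
| "casimir_sum (i # w) f = casimir_sum w (\<lambda>u z. sm (inverse (P i u)) (f u (i # z)) + sm (c i) (f (u @ [i]) z)
     - sm (c i * inverse (P i u) * inverse (P i z) ^ 2) (f (i # u) z))"

lemma casimir_sum_cong:
  "(\<And>u z. mset u + mset z = mset w \<Longrightarrow> f u z = g u z) \<Longrightarrow> casimir_sum w f = casimir_sum w g"
proof (induction w arbitrary: f g)
  case (Cons i w)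
  show ?case
    unfolding casimir_sum.simps using Cons.prems by (intro Cons.IH arg_cong2[of _ _ _ _ "(-)"] arg_cong2[of _ _ _ _ "(+)"]) auto
qed simp

lemma casimir_sum_flin:
  assumes "flin h"
  shows "casimir_sum w (\<lambda>u z. h (f u z)) = h (casimir_sum w f)"
proof (induction w arbitrary: f)
  case (Cons i w)
  show ?case
    unfolding casimir_sum.simps Cons[symmetric] by (simp add: flin_add[OF assms] flin_diff[OF assms] flin_sm[OF assms])
qed simp

lemma casimir_sum_add: "casimir_sum w (\<lambda>u z. f u z + g u z) = casimir_sum w f + casimir_sum w g"
proof (induction w arbitrary: f g)
  case (Cons i w)
  show ?case
    unfolding casimir_sum.simps Cons.IH[symmetric] by (rule casimir_sum_cong) (simp add: sm_simps)
qed simp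

lemma casimir_sum_diff: "casimir_sum w (\<lambda>u z. f u z - g u z) = casimir_sum w f - casimir_sum w g"
proof (induction w arbitrary: f g)
  case (Cons i w)
  show ?case
    unfolding casimir_sum.simps Cons.IH[symmetric] by (rule casimir_sum_cong) (simp add: sm_simps)
qed simp

lemma casimir_sum_0: "casimir_sum w (\<lambda>u z. 0) = 0"
  by (induction w) simp_all

lemma casimir_sum_sum: "casimir_sum w (\<lambda>u z. \<Sum>a\<in>S. f a u z) = (\<Sum>a\<in>S. casimir_sum w (f a))"
  by (induction S rule: infinite_finite_induct) (simp_all add: casimir_sum_0 casimir_sum_add)

lemma casimir_sum_serre_ideal: "(\<And>u z. mset u + mset z = mset w \<Longrightarrow> f u z \<in> serre_ideal) \<Longrightarrow> casimir_sum w f \<in> serre_ideal"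
proof (induction w arbitrary: f)
  case (Cons i w)
  show ?case
    unfolding casimir_sum.simps using Cons.prems by (intro Cons.IH serre_ideal_diff serre_ideal.add serre_ideal_sm) auto
qed simp

lemma flin_e_mult: "flin (\<lambda>x. e i * x)"
  by (rule flinI) (simp_all add: fa_simps)

lemma casimir_sum_form: "casimir_sum w (\<lambda>u z. sm (form (wrd u) T) (wrd z)) = fcomm_act T (wrd w)"
proof (induction w arbitrary: T)
  case Nil
  show ?case
  proof (induction T rule: fa_induct_Cons)
    case (add T U)
    from this[symmetric] show ?case
      by (simp add: form_simps fcomm_act_lin sm_add_left)
  next
    case (scale k T)
    from this[symmetric] show ?case
      by (simp add: form_simps fcomm_act_lin)
  next
    case (Cons j T)
    from this[symmetric] show ?case
      by (simp add: fcomm_act_e_mult form_e_right fcomm_def)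
  qed (simp_all add: fcomm_act_lin fcomm_act_one form_one)
next
  case (Cons i w)
  have "casimir_sum (i # w) (\<lambda>u z. sm (form (wrd u) T) (wrd z)) =
    casimir_sum w (\<lambda>u z. e i * sm (form (wrd u) (twist i (-1) T)) (wrd z) + sm (form (wrd u) (dR i T)) (wrd z)
      - twist i (-2) (sm (form (wrd u) (twist i (-1) (dL i T))) (wrd z)))"
    \<comment> \<open>The three terms match one by one: appending i to u at the right or at the left
      is adjoint to \<open>dR i\<close> or \<open>dL i\<close>, and the factor
      \<open>inverse (P i u)\<close> is adjoint to a twist of T.\<close>
    unfolding casimir_sum.simps
  proof (rule casimir_sum_cong)
    fix u z :: "'i list"
    have 1: "form (wrd (u @ [i])) T = form (wrd u) (dR i T) / c i"
      by (simp add: wrd_snoc form_e_left')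
    have 2: "form (wrd (i # u)) T = form (wrd u) (dL i T) / c i"
      by (simp add: wrd_Cons[of i u] form_e_left)
    show "sm (inverse (P i u)) (sm (form (wrd u) T) (wrd (i # z))) + sm (c i) (sm (form (wrd (u @ [i])) T) (wrd z))
        - sm (c i * inverse (P i u) * inverse (P i z) ^ 2) (sm (form (wrd (i # u)) T) (wrd z)) =
       e i * sm (form (wrd u) (twist i (-1) T)) (wrd z) + sm (form (wrd u) (dR i T)) (wrd z)
      - twist i (-2) (sm (form (wrd u) (twist i (-1) (dL i T))) (wrd z))"
      unfolding 1 2 form_wrd_twist wrd_Cons[of i z]
      by (simp add: sm_simps twist_wrd power_int_minus power_int_numeral field_simps)
  qed
  also have "\<dots> = fcomm_act T (wrd (i # w))"
    unfolding casimir_sum_diff casimir_sum_add casimir_sum_flin[OF flin_twist] casimir_sum_flin[OF flin_e_mult] Cons wrd_Cons[of i w] fcomm_act_e ..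
  finally show ?case .
qed

text \<open>The recursion is forced by a cancellation: with these weights the first two of the three
  terms of \<open>casimir_sum\<close> both end in the word u i z and cancel, and the third one
  yields the eigenvalue.\<close>

primrec casimir_coeff :: "'i list \<Rightarrow> 'k" where
  "casimir_coeff [] = 1"
| "casimir_coeff (i # u) = - (inverse (P i u) * inverse (c i) * casimir_coeff u)"

lemma casimir_coeff_swap: "casimir_coeff (i # j # u) = casimir_coeff (j # i # u)"
  by (simp add: p_sym[of i] mult.commute mult.left_commute)

lemma P_mset: "mset u = mset w \<Longrightarrow> P i u = P i w"
  by (simp add: P_coroot_wt)

lemma casimir_coeff_snoc: "casimir_coeff (u @ [i]) = casimir_coeff (i # u)"
proof (induction u)
  case (Cons j u)
  have "casimir_coeff ((j # u) @ [i]) = casimir_coeff (j # i # u)"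
    using Cons by (simp add: mult.commute)
  thus ?case by (simp only: casimir_coeff_swap)
qed simp

text \<open>The weights depend on the content of the word only, by the symmetry of \<open>p\<close>.
  They are therefore constant on each weight space and can be taken out of an expansion in a dual
  family.\<close>

lemma casimir_coeff_mset: "mset u = mset w \<Longrightarrow> casimir_coeff u = casimir_coeff w"
proof (induction u arbitrary: w)
  case (Cons i u)
  then obtain w1 w2 where w: "w = w1 @ i # w2"
    by (metis list.set_intros(1) set_mset_mset split_list)
  have "casimir_coeff (w1 @ i # w2) = casimir_coeff (i # w1 @ w2)"
  proof (induction w1)
    case (Cons j w1)
    have "P j (w1 @ i # w2) = P j (i # w1 @ w2)"
      by (rule P_mset) simp
    hence "casimir_coeff ((j # w1) @ i # w2) = casimir_coeff (j # i # w1 @ w2)"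
      using Cons by simp
    also have "\<dots> = casimir_coeff (i # j # w1 @ w2)" by (rule casimir_coeff_swap)
    finally show ?case by simp
  qed simp
  moreover have "mset u = mset (w1 @ w2)"
    using Cons.prems w by simp
  ultimately show ?case
    using Cons.IH[of "w1 @ w2"] P_mset[of u "w1 @ w2"] w by simp
qed simp

primrec casimir_eigenvalue :: "'i list \<Rightarrow> 'k" where
  "casimir_eigenvalue [] = 1"
| "casimir_eigenvalue (i # w) = inverse (P i w) ^ 2 * casimir_eigenvalue w"

lemma casimir_sum_casimir_eigenvalue: "casimir_sum w (\<lambda>u z. sm (casimir_coeff u) (wrd (u @ z))) = sm (casimir_eigenvalue w) (wrd w)"
proof (induction w)
  case (Cons i w)
  have "casimir_sum (i # w) (\<lambda>u z. sm (casimir_coeff u) (wrd (u @ z))) =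
    casimir_sum w (\<lambda>u z. e i * twist i (-2) (sm (casimir_coeff u) (wrd (u @ z))))"
    unfolding casimir_sum.simps
  proof (rule casimir_sum_cong)
    fix u z :: "'i list"
    have *: "wrd ((i # u) @ z) = e i * wrd (u @ z)"
      using wrd_Cons[of i "u @ z"] by simp
    show "sm (inverse (P i u)) (sm (casimir_coeff u) (wrd (u @ i # z))) + sm (c i) (sm (casimir_coeff (u @ [i])) (wrd ((u @ [i]) @ z)))
        - sm (c i * inverse (P i u) * inverse (P i z) ^ 2) (sm (casimir_coeff (i # u)) (wrd ((i # u) @ z))) =
       e i * twist i (-2) (sm (casimir_coeff u) (wrd (u @ z)))"
      unfolding * casimir_coeff_snoc
      by (simp add: sm_simps twist_wrd power_int_minus power_int_numeral field_simps sm_minus_left power2_eq_square)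
  qed
  also have "\<dots> = e i * twist i (-2) (sm (casimir_eigenvalue w) (wrd w))"
    unfolding casimir_sum_flin[OF flin_twist] casimir_sum_flin[OF flin_e_mult] Cons ..
  also have "\<dots> = sm (casimir_eigenvalue (i # w)) (wrd (i # w))"
    unfolding wrd_Cons[of i w] by (simp add: twist_wrd sm_simps power_int_minus power_int_numeral field_simps)
  finally show ?case .
qed simp

text \<open>For a single letter, appending it to the empty word at either end gives the same result,
  with opposite signs; longer words reduce to this case. So the tensor has no term whose second
  factor is trivial.\<close>

lemma casimir_sum_top: "w \<noteq> [] \<Longrightarrow> casimir_sum w (\<lambda>u z. if z = [] then f u else 0) = 0"
proof (induction w arbitrary: f)
  case (Cons i w)
  have "casimir_sum (i # w) (\<lambda>u z. if z = [] then f u else 0) =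
    casimir_sum w (\<lambda>u z. if z = [] then sm (c i) (f (u @ [i])) - sm (c i * inverse (P i u)) (f (i # u)) else 0)"
    unfolding casimir_sum.simps by (rule casimir_sum_cong) simp
  also have "\<dots> = 0"
    using Cons.IH by (cases "w = []") simp_all
  finally show ?case .
qed simp

text \<open>The norm (\<beta>, \<beta>) in the normalization where (\<alpha>, \<alpha>) is 2 d_i for
  the simple root of i. Then (\<rho>, \<alpha>) is d_i, and \<open>rho2 \<beta>\<close> is 2
  (\<rho>, \<beta>).\<close>

definition bil :: "'i multiset \<Rightarrow> int" where
  "bil \<beta> = (\<Sum>i\<in>#\<beta>. int (d i) * coroot_wt i \<beta>)"

definition rho2 :: "'i multiset \<Rightarrow> int" where
  "rho2 \<beta> = (\<Sum>i\<in>#\<beta>. 2 * int (d i))"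

text \<open>Every pair of letters contributes minus twice its inner product. This completes to
  -(\<beta>, \<beta>) up to the diagonal terms 2 d_i, which sum up to \<open>rho2\<close>.\<close>

lemma casimir_eigenvalue_eq: "casimir_eigenvalue w = v powi (rho2 (mset w) - bil (mset w))"
proof (induction w)
  case (Cons i w)
  have "(\<Sum>j\<in>#\<gamma>. int (d j) * a j i) = int (d i) * coroot_wt i \<gamma>" for \<gamma>
    by (induction \<gamma>) (simp_all add: coroot_wt_def a_sym[of i] distrib_left)
  hence "bil (mset (i # w)) = bil (mset w) + 2 * (int (d i) * coroot_wt i (mset w)) + 2 * int (d i)"
    by (simp add: bil_def coroot_wt_def a_diag distrib_left sum_mset.distrib)
  moreover have "P i w = v powi (int (d i) * coroot_wt i (mset w))"
    by (simp add: P_coroot_wt power_int_mult)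
  moreover have pd: "v powi (x - y) = v powi x / v powi y" for x y
    using v_nz by (simp add: power_int_diff)
  ultimately have "casimir_eigenvalue (i # w) = v powi (rho2 (mset w) - bil (mset w) - (int (d i) * coroot_wt i (mset w))
     - (int (d i) * coroot_wt i (mset w)))"
    unfolding pd[of "_ - _ - _"] pd[of "rho2 (mset w) - bil (mset w)"] using Cons
    by (simp add: power2_eq_square field_simps)
  also have "rho2 (mset w) - bil (mset w) - (int (d i) * coroot_wt i (mset w)) - (int (d i) * coroot_wt i (mset w))
     = rho2 (mset (i # w)) - bil (mset (i # w))"
    using \<open>bil (mset (i # w)) = _\<close> by (simp add: rho2_def)
  finally show ?case .
qed (simp add: rho2_def bil_def)

section \<open>The radical is contained in the Serre ideal\<close>

lemma serre_ideal_fcomm: "x \<in> serre_ideal \<Longrightarrow> fcomm j x \<in> serre_ideal"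
  unfolding fcomm_def by (intro serre_ideal_diff serre_ideal_twist serre_ideal_dL serre_ideal_dR)

lemma serre_ideal_fcomm_word: "x \<in> serre_ideal \<Longrightarrow> fcomm_word t x \<in> serre_ideal"
  by (induction t) (auto intro: serre_ideal_fcomm)

lemma fcomm_word_snoc: "fcomm_word (t @ [j]) x = fcomm_word t (fcomm j x)"
  by (induction t) simp_all

lemma fcomm_act_serre_ideal:
  assumes "\<And>j. fcomm j x \<in> serre_ideal" "homog \<gamma> T" "\<gamma> \<noteq> {#}"
  shows "fcomm_act T x \<in> serre_ideal"
  using assms(2)
proof (induction rule: supp_induct)
  case (wrd w)
  thus ?case
    using assms(1,3) by (cases w rule: rev_cases) (auto simp: fcomm_act_lin fcomm_word_snoc intro: serre_ideal_fcomm_word)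
qed (auto simp: fcomm_act_lin intro: serre_ideal.add serre_ideal_sm)

text \<open>
  Let \<open>x\<close> be a counterexample of minimal degree \<open>\<beta>\<close>. Expanding the first factors of \<open>\<Gamma> x\<close> in dual families
  and using that all \<open>fcomm j x\<close> are in the ideal, one finds that \<open>x\<close> is congruent to its multiple by the
  eigenvalue \<open>casimir_eigenvalue\<close>. So \<open>casimir_eigenvalue\<close> is \<open>1\<close>, that is, \<open>(\<beta>, \<beta>) = 2 (\<rho>, \<beta>) > 0\<close>. But \<open>(\<beta>, \<beta>) \<le> 0\<close> by \<open>coroot_wt_nonpos\<close>.
\<close>

theorem radical_imp_serre_ideal: "homog \<beta> x \<Longrightarrow> radical x \<Longrightarrow> x \<in> serre_ideal"
proof (induction "size \<beta>" arbitrary: \<beta> x rule: less_induct)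
  case less
  have IH: "y \<in> serre_ideal" if "size \<gamma> < size \<beta>" "homog \<gamma> y" "radical y" for \<gamma> y
    using less.hyps that by blast
  show ?case
  proof (rule ccontr)
    assume x: "x \<notin> serre_ideal"
    have \<beta>: "\<beta> \<noteq> {#}"
    proof
      assume "\<beta> = {#}"
      with less.prems(1) have "homog {#} x" by simp
      hence "x = sm (Poly_Mapping.lookup x 0) 1"
      proof (induction rule: supp_induct)
        case (add x y)
        thus ?case by (metis lookup_add sm_add_left)
      next
        case (scale k x)
        thus ?case by (metis lookup_sm sm_sm)
      qed simp_all
      thus False using x radical_const[OF less.prems(2)] by simp
    qed
    have fcomm: "fcomm j x \<in> serre_ideal" for j
    proof (cases "j \<in># \<beta>")
      case True
      then obtain \<gamma> where \<gamma>: "\<beta> = add_mset j \<gamma>" by (metis insert_DiffM)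
      hence "dL j x \<in> serre_ideal" "dR j x \<in> serre_ideal"
        using less.prems IH[of \<gamma>] by (auto intro: homog_dL homog_dR radical_dL radical_dR)
      thus ?thesis by (simp add: fcomm_def serre_ideal_diff serre_ideal_twist)
    next
      case False
      thus ?thesis using less.prems(1) homog_dL_0 homog_dR_0 by (simp add: fcomm_def)
    qed
    \<comment> \<open>The components of a dual family are packed into one tuple, so that a single
      application of choice provides families for all weights at once.\<close>
    define Q where "Q \<gamma> t \<longleftrightarrow> (case t of (N, b, b') \<Rightarrow> dual_fam \<gamma> N b b' \<and>
      (\<forall>y. homog \<gamma> y \<longrightarrow> radical (y - (\<Sum>\<nu><N. sm (form y (b' \<nu>)) (b \<nu>)))))" for \<gamma> t
    have "\<exists>t. Q \<gamma> t" for \<gamma>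
    proof (rule dual_fam_exists[of \<gamma>])
      fix N b b'
      assume "dual_fam \<gamma> N b b'" "\<And>y. homog \<gamma> y \<Longrightarrow> radical (y - (\<Sum>\<nu><N. sm (form y (b' \<nu>)) (b \<nu>)))"
      hence "Q \<gamma> (N, b, b')" by (simp add: Q_def)
      thus "\<exists>t. Q \<gamma> t" ..
    qed
    then obtain t where t: "\<And>\<gamma>. Q \<gamma> (t \<gamma>)"
      using choice[of Q] by auto
    define N b b' where "N \<gamma> = fst (t \<gamma>)" and "b \<gamma> = fst (snd (t \<gamma>))" and "b' \<gamma> = snd (snd (t \<gamma>))" for \<gamma>
    have fam: "dual_fam \<gamma> (N \<gamma>) (b \<gamma>) (b' \<gamma>)"
      and fam_radical: "homog \<gamma> y \<Longrightarrow> radical (y - (\<Sum>\<nu><N \<gamma>. sm (form y (b' \<gamma> \<nu>)) (b \<gamma> \<nu>)))" for \<gamma> y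
      using t[of \<gamma>] by (simp_all add: Q_def N_def b_def b'_def split: prod.splits)
    define S where "S = {\<gamma>. \<gamma> \<subset># \<beta> \<and> \<gamma> \<noteq> {#}}"
    have "S \<subseteq> mset ` {w. set w \<subseteq> set_mset \<beta> \<and> length w \<le> size \<beta>}"
    proof
      fix \<gamma> assume "\<gamma> \<in> S"
      moreover obtain w where "\<gamma> = mset w" using ex_mset by metis
      ultimately show "\<gamma> \<in> mset ` {w. set w \<subseteq> set_mset \<beta> \<and> length w \<le> size \<beta>}"
        using mset_subset_size[of \<gamma> \<beta>] mset_subset_eqD[of \<gamma> \<beta>]
        by (intro image_eqI[of _ _ w]) (auto simp: S_def subset_mset.less_imp_le)
    qed
    hence fin: "finite S"
      by (rule finite_subset) (auto intro: finite_lists_length_le)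
    define casimir_coeff_wt where "casimir_coeff_wt \<gamma> = casimir_coeff (SOME w. mset w = \<gamma>)" for \<gamma>
    have casimir_coeff_wt: "casimir_coeff_wt (mset u) = casimir_coeff u" for u
      unfolding casimir_coeff_wt_def by (rule casimir_coeff_mset) (rule someI[of _ u], simp)
    define rest where "rest y = (\<Sum>\<gamma>\<in>S. \<Sum>\<nu><N \<gamma>. sm (casimir_coeff_wt \<gamma>) (b \<gamma> \<nu> * fcomm_act (b' \<gamma> \<nu>) y))" for y
    have approx: "sm (casimir_eigenvalue w) (wrd w) - (rest (wrd w) + wrd w) \<in> serre_ideal" if w: "mset w = \<beta>" for w
    proof -
      \<comment> \<open>The terms of the tensor are sorted by their first factor u. If u has full
        weight, z is empty and the terms cancel by \<open>casimir_sum_top\<close>; if u is empty, w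
        itself remains. For the weights in \<open>S\<close> between these, u is replaced by its
        expansion in the dual family: the error lies in the radical, hence in the ideal by
        minimality of the degree.\<close>
      let ?f1 = "\<lambda>u z :: 'i list. if z = [] then sm (casimir_coeff u) (wrd u) else 0"
      let ?f2 = "\<lambda>u z. \<Sum>\<gamma>\<in>S. \<Sum>\<nu><N \<gamma>. sm (casimir_coeff_wt \<gamma>) (b \<gamma> \<nu> * sm (form (wrd u) (b' \<gamma> \<nu>)) (wrd z))"
      let ?f3 = "\<lambda>u z. sm (form (wrd u) 1) (wrd z)"
      have "casimir_sum w (\<lambda>u z. sm (casimir_coeff u) (wrd (u @ z)) - (?f1 u z + ?f2 u z + ?f3 u z)) \<in> serre_ideal"
      proof (rule casimir_sum_serre_ideal)
        fix u z :: "'i list" assume uz: "mset u + mset z = mset w"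
        have inner0: "(\<Sum>\<nu><N \<gamma>. sm (casimir_coeff_wt \<gamma>) (b \<gamma> \<nu> * sm (form (wrd u) (b' \<gamma> \<nu>)) (wrd z))) = 0"
          if "\<gamma> \<noteq> mset u" for \<gamma>
        proof -
          have "form (wrd u) (b' \<gamma> \<nu>) = 0" if "\<nu> < N \<gamma>" for \<nu>
          proof (rule form_wt)
            show "homog (mset u) (wrd u)" by simp
            show "homog \<gamma> (b' \<gamma> \<nu>)" using fam[of \<gamma>] that by (simp add: dual_fam_def)
          qed (use \<open>\<gamma> \<noteq> mset u\<close> in simp)
          thus ?thesis by (auto intro!: sum.neutral)
        qed
        show "sm (casimir_coeff u) (wrd (u @ z)) - (?f1 u z + ?f2 u z + ?f3 u z) \<in> serre_ideal"
        proof (cases "mset u \<in> S")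
          case True
          hence *: "u \<noteq> []" "z \<noteq> []"
            using uz w by (auto simp: S_def)
          have sz: "size (mset u) < size \<beta>"
            using True mset_subset_size[of "mset u" \<beta>] by (simp add: S_def)
          have "?f2 u z = (\<Sum>\<nu><N (mset u). sm (casimir_coeff_wt (mset u)) (b (mset u) \<nu> * sm (form (wrd u) (b' (mset u) \<nu>)) (wrd z)))"
            unfolding sum.remove[OF fin True] using inner0 by simp
          hence "sm (casimir_coeff u) (wrd (u @ z)) - (?f1 u z + ?f2 u z + ?f3 u z) =
            sm (casimir_coeff u) ((wrd u - (\<Sum>\<nu><N (mset u). sm (form (wrd u) (b' (mset u) \<nu>)) (b (mset u) \<nu>))) * wrd z)"
            using * by (simp add: casimir_coeff_wt wrd_append form_one left_diff_distrib sm_diff sm_sum sum_distrib_right sm_simps mult.commute)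
          moreover have "wrd u - (\<Sum>\<nu><N (mset u). sm (form (wrd u) (b' (mset u) \<nu>)) (b (mset u) \<nu>)) \<in> serre_ideal"
          proof (rule IH[OF sz])
            show "homog (mset u) (wrd u - (\<Sum>\<nu><N (mset u). sm (form (wrd u) (b' (mset u) \<nu>)) (b (mset u) \<nu>)))"
              using fam[of "mset u"] by (auto simp: dual_fam_def intro!: supp_diff supp_sum supp_sm)
          qed (rule fam_radical, simp)
          ultimately show ?thesis
            by (simp only: serre_ideal_sm serre_ideal_mult_right)
        next
          case False
          hence "?f2 u z = 0"
            using inner0 by (metis (no_types, lifting) sum.neutral)
          moreover have "u = [] \<and> z \<noteq> [] \<or> u \<noteq> [] \<and> z = []"
          proof -
            have "u = [] \<or> z = []"
            proof (rule ccontr)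
              assume "\<not> (u = [] \<or> z = [])"
              hence "mset u \<subset># \<beta>"
                using uz w by (metis mset_subset_eq_add_left subset_mset.le_imp_less_or_eq
                    add_cancel_right_right mset_zero_iff)
              thus False using False \<open>\<not> (u = [] \<or> z = [])\<close> by (auto simp: S_def)
            qed
            thus ?thesis using uz w \<beta> by auto
          qed
          ultimately show ?thesis
            by (auto simp: form_one)
        qed
      qed
      moreover have "casimir_sum w (\<lambda>u z. sm (casimir_coeff u) (wrd (u @ z)) - (?f1 u z + ?f2 u z + ?f3 u z)) =
         sm (casimir_eigenvalue w) (wrd w) - (casimir_sum w ?f1 + rest (wrd w) + wrd w)"
      proof -
        have "casimir_sum w ?f2 = rest (wrd w)"
          unfolding casimir_sum_sum rest_def
        proof (intro sum.cong refl)
          fix \<gamma> \<nu>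
          have "flin (\<lambda>y. sm (casimir_coeff_wt \<gamma>) (b \<gamma> \<nu> * y))"
            by (rule flinI) (simp_all add: sm_simps distrib_left mult.commute)
          from casimir_sum_flin[OF this] show "casimir_sum w (\<lambda>u z. sm (casimir_coeff_wt \<gamma>) (b \<gamma> \<nu> * sm (form (wrd u) (b' \<gamma> \<nu>)) (wrd z))) =
              sm (casimir_coeff_wt \<gamma>) (b \<gamma> \<nu> * fcomm_act (b' \<gamma> \<nu>) (wrd w))"
            by (simp add: casimir_sum_form)
        qed
        thus ?thesis
          unfolding casimir_sum_diff casimir_sum_add casimir_sum_form casimir_sum_casimir_eigenvalue fcomm_act_one by simp
      qed
      moreover have "casimir_sum w ?f1 = 0"
        using w \<beta> by (intro casimir_sum_top) auto
      ultimately show ?thesis by simp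
    qed
    let ?k = "v powi (rho2 \<beta> - bil \<beta>)"
    have fcomm_act_add: "fcomm_act T (y + z) = fcomm_act T y + fcomm_act T z" and fcomm_act_sm: "fcomm_act T (sm k y) = sm k (fcomm_act T y)" for T y z k
    proof -
      have "fcomm_word t (y + z) = fcomm_word t y + fcomm_word t z" "fcomm_word t (sm k y) = sm k (fcomm_word t y)" for t
        by (induction t) (simp_all add: fcomm_lin)
      thus "fcomm_act T (y + z) = fcomm_act T y + fcomm_act T z" "fcomm_act T (sm k y) = sm k (fcomm_act T y)"
        by (induction T rule: fa_induct_wrd) (simp_all add: fcomm_act_lin sm_simps mult.commute algebra_simps)
    qed
    have rest_lin: "rest (y + z) = rest y + rest z" "rest (sm k y) = sm k (rest y)" "rest 0 = 0" for y z k
      using fcomm_act_sm[of _ 0 0]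
      by (simp_all add: rest_def fcomm_act_add fcomm_act_sm distrib_left sm_simps sum.distrib sm_sum mult.commute)
    have "sm ?k x - (rest x + x) \<in> serre_ideal"
      using less.prems(1)
    proof (induction rule: supp_induct)
      case (add y z)
      from serre_ideal.add[OF this] show ?case
        by (simp add: rest_lin sm_simps algebra_simps)
    next
      case (scale k y)
      from serre_ideal_sm[OF this, of k] show ?case
        by (simp add: rest_lin sm_simps mult.commute)
    next
      case (wrd w)
      thus ?case using approx[of w] casimir_eigenvalue_eq[of w] by simp
    qed (simp add: rest_lin)
    \<comment> \<open>Every summand contains \<open>fcomm_act\<close> of an element of nonzero
      weight, and the \<open>fcomm\<close> that acts first already sends x into the ideal.\<close>
    moreover have "rest x \<in> serre_ideal"
      unfolding rest_def
    proof (intro serre_ideal_sum serre_ideal_sm serre_ideal_mult_left)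
      fix \<gamma> \<nu> assume "\<gamma> \<in> S" "\<nu> \<in> {..<N \<gamma>}"
      thus "fcomm_act (b' \<gamma> \<nu>) x \<in> serre_ideal"
        using fam[of \<gamma>] by (intro fcomm_act_serre_ideal[of x \<gamma>] fcomm) (auto simp: S_def dual_fam_def)
    qed
    ultimately have "sm ?k x - (rest x + x) + rest x \<in> serre_ideal"
      by (rule serre_ideal.add)
    hence "sm (?k - 1) x \<in> serre_ideal"
      by (simp add: sm_diff_left)
    hence "?k = 1"
      using x serre_ideal_sm_iff[of "?k - 1" x] by auto
    hence "rho2 \<beta> = bil \<beta>"
      by (simp add: powi_v_eq_1)
    moreover have "bil \<gamma> \<le> 0" if "\<And>i. coroot_wt i \<beta> \<le> 0" "\<gamma> = \<beta>" for \<gamma>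
    proof -
      have "(\<Sum>i\<in>#\<delta>. int (d i) * coroot_wt i \<beta>) \<le> 0" for \<delta>
        by (induction \<delta>) (auto simp: that(1) mult_nonneg_nonpos intro!: add_nonpos_nonpos)
      thus ?thesis by (simp add: bil_def that(2))
    qed
    moreover have "coroot_wt i \<beta> \<le> 0" for i
      using coroot_wt_nonpos[OF less.prems x] IH by blast
    moreover have "rho2 \<beta> > 0"
    proof -
      have "rho2 (add_mset i \<gamma>) > 0" for i \<gamma>
        unfolding rho2_def using d_pos[of i] by (induction \<gamma>) auto
      thus ?thesis using \<beta> by (cases \<beta>) auto
    qed
    ultimately show False by force
  qed
qed

end

section \<open>The inverse of the quantum Cartan matrix\<close>

definition zpow :: "int \<Rightarrow> rat fls" where
  "zpow k = fls_X_intpow k"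

lemma zpow_mult: "zpow a * zpow b = zpow (a + b)"
  by (simp add: zpow_def fls_X_intpow_times_fls_X_intpow)

lemma zpow_0 [simp]: "zpow 0 = 1"
  by (simp add: zpow_def)

lemma nth_zpow: "fls_nth (zpow a) u = (if u = a then 1 else 0)"
  by (auto simp: zpow_def)

lemma nth_zpow_mult: "fls_nth (zpow a * f) u = fls_nth f (u - a)"
  by (simp add: zpow_def fls_X_intpow_times_conv_shift)

lemma zpow_inj: "zpow a = zpow b \<longleftrightarrow> a = b"
  by (metis nth_zpow zero_neq_one)

definition simple_nodes :: "cartan_type \<Rightarrow> nat set" where
  "simple_nodes \<gg> = {1..lie_rank \<gg>}"

lemma finite_simple_nodes [simp]: "finite (simple_nodes \<gg>)"
  by (simp add: simple_nodes_def)

definition off_entry :: "cartan_type \<Rightarrow> nat \<Rightarrow> nat \<Rightarrow> nat" where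
  "off_entry \<gg> i k = nat (- cartan \<gg> i k)"

lemma symmetrizer_pos: "0 < symmetrizer \<gg> i"
  by (cases \<gg>) auto

lemma cartan_offdiag: "i \<noteq> k \<Longrightarrow> cartan \<gg> i k = - int (off_entry \<gg> i k)"
  by (simp add: off_entry_def cartan_def Let_def)

lemma cartan_diag: "cartan \<gg> i i = 2"
  by (simp add: cartan_def)

text \<open>This makes the recursion of the quantum Cartan matrix causal: the exponents occurring in
  entry (i, k) are at most \<open>off_entry\<close> - 1, hence less than d_k.\<close>

lemma off_entry_le: "i \<noteq> k \<Longrightarrow> off_entry \<gg> i k \<le> symmetrizer \<gg> k"
proof -
  assume "i \<noteq> k"
  let ?d = "symmetrizer \<gg>"
  have "max (?d i) (?d k) div ?d i \<le> ?d k"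
  proof (cases "?d k \<le> ?d i")
    case True
    thus ?thesis using symmetrizer_pos[of \<gg> i] symmetrizer_pos[of \<gg> k] by (simp add: max_def)
  next
    case False
    thus ?thesis by (simp add: max_def)
  qed
  thus ?thesis
    using \<open>i \<noteq> k\<close> by (auto simp: off_entry_def cartan_def Let_def zdiv_int[symmetric])
qed

lemma quantum_cartan_diag:
  "quantum_cartan \<gg> i i = zpow (int (symmetrizer \<gg> i)) + zpow (- int (symmetrizer \<gg> i))"
  by (simp add: quantum_cartan_def zpow_def Let_def)

lemma zpow_geometric: "(zpow 1 - zpow (-1)) * (\<Sum>l<m. zpow (int m - 1 - 2 * int l)) = zpow (int m) - zpow (- int m)"
proof -
  have "(\<Sum>l<m. zpow (k - 2 * int l) - zpow (k - 2 * int (Suc l))) = zpow k - zpow (k - 2 * int m)" for k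
    using sum_lessThan_telescope'[of "\<lambda>l. zpow (k - 2 * int l)" m] by simp
  from this[of "int m"] show ?thesis
    by (simp add: sum_distrib_left left_diff_distrib zpow_mult algebra_simps)
qed

lemma quantum_cartan_offdiag:
  assumes "i \<noteq> k"
  shows "quantum_cartan \<gg> i k = - (\<Sum>l<off_entry \<gg> i k. zpow (int (off_entry \<gg> i k) - 1 - 2 * int l))"
proof -
  let ?m = "off_entry \<gg> i k"
  have nz: "zpow 1 - zpow (-1) \<noteq> 0"
    using zpow_inj[of 1 "-1"] by simp
  have "quantum_cartan \<gg> i k = (zpow (- int ?m) - zpow (int ?m)) / (zpow 1 - zpow (-1))"
    using assms by (simp add: quantum_cartan_def zpow_def Let_def cartan_offdiag)
  also have "zpow (- int ?m) - zpow (int ?m) = - ((zpow 1 - zpow (-1)) * (\<Sum>l<?m. zpow (int ?m - 1 - 2 * int l)))"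
    by (simp add: zpow_geometric)
  finally show ?thesis using nz by simp
qed

text \<open>The quantum Cartan matrix, acting on coefficient sequences.\<close>

definition qc_seq :: "cartan_type \<Rightarrow> (nat \<Rightarrow> int \<Rightarrow> rat) \<Rightarrow> nat \<Rightarrow> int \<Rightarrow> rat" where
  "qc_seq \<gg> y i u = y i (u - int (symmetrizer \<gg> i)) + y i (u + int (symmetrizer \<gg> i))
     - (\<Sum>k\<in>simple_nodes \<gg> - {i}. \<Sum>l<off_entry \<gg> i k. y k (u - (int (off_entry \<gg> i k) - 1 - 2 * int l)))"

lemma nth_qc_sum:
  assumes "i \<in> simple_nodes \<gg>"
  shows "fls_nth (\<Sum>k\<in>simple_nodes \<gg>. quantum_cartan \<gg> i k * f k) u = qc_seq \<gg> (\<lambda>k. fls_nth (f k)) i u"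
proof -
  have "fls_nth (quantum_cartan \<gg> i k * f k) u =
      - (\<Sum>l<off_entry \<gg> i k. fls_nth (f k) (u - (int (off_entry \<gg> i k) - 1 - 2 * int l)))" if "k \<noteq> i" for k
    using that by (simp add: quantum_cartan_offdiag sum_distrib_right fls_nth_sum nth_zpow_mult)
  thus ?thesis
    unfolding qc_seq_def using assms
    by (subst sum.remove[of _ i])
       (simp_all add: fls_nth_sum quantum_cartan_diag distrib_right nth_zpow_mult sum_negf)
qed

text \<open>
  The equation at \<open>(i, u)\<close> determines \<open>y i (u + d\<^sub>i)\<close> from values \<open>y k v\<close> with \<open>v - d\<^sub>k < u\<close>.
\<close>

lemma qc_seq_induct:
  assumes bound: "\<And>k v. k \<in> simple_nodes \<gg> \<Longrightarrow> v < B \<Longrightarrow> y k v = 0"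
    and P: "0 \<in> P" "\<And>x z. x \<in> P \<Longrightarrow> z \<in> P \<Longrightarrow> x + z \<in> P" "\<And>x. x \<in> P \<Longrightarrow> - x \<in> P"
    and eq: "\<And>i u. i \<in> simple_nodes \<gg> \<Longrightarrow> u \<le> U \<Longrightarrow> qc_seq \<gg> y i u \<in> P"
    and k: "k \<in> simple_nodes \<gg>" "v - int (symmetrizer \<gg> k) \<le> U"
  shows "y k v \<in> P"
proof -
  define D where "D = Max (symmetrizer \<gg> ` simple_nodes \<gg>)"
  have D: "symmetrizer \<gg> k \<le> D" if "k \<in> simple_nodes \<gg>" for k
    using that by (auto simp: D_def)
  have sum_P: "(\<And>a. a \<in> S \<Longrightarrow> g a \<in> P) \<Longrightarrow> sum g S \<in> P" for g :: "nat \<Rightarrow> rat" and S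
    by (induction S rule: infinite_finite_induct) (auto intro: P)
  \<comment> \<open>Induction on v - d_k, counted from B - D - 1: at that level and below all values
    vanish by \<open>bound\<close>, since D is the largest d_k. The subgroup \<open>P\<close> will
    be zero, for uniqueness, or the integers, for integrality.\<close>
  have main: "k \<in> simple_nodes \<gg> \<Longrightarrow> v - int (symmetrizer \<gg> k) = B - int D + int n - 1 \<Longrightarrow>
      v - int (symmetrizer \<gg> k) \<le> U \<Longrightarrow> y k v \<in> P" for n k v
  proof (induction n arbitrary: k v rule: less_induct)
    case (less n)
    let ?d = "int (symmetrizer \<gg> k)"
    let ?u = "v - ?d"
    have IH: "y k' v' \<in> P" if "k' \<in> simple_nodes \<gg>" "v' - int (symmetrizer \<gg> k') < ?u" for k' v'
    proof (cases "v' - int (symmetrizer \<gg> k') < B - int D")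
      case True
      thus ?thesis using bound[of k' v'] D[of k'] that P by force
    next
      case False
      thus ?thesis
        using less.prems that by (intro less.IH[of "nat (v' - int (symmetrizer \<gg> k') - (B - int D) + 1)"]) auto
    qed
    have "qc_seq \<gg> y k ?u \<in> P"
      using less.prems eq by blast
    moreover have "y k (?u - ?d) \<in> P"
      using less.prems(1) symmetrizer_pos[of \<gg> k] by (intro IH) auto
    moreover have "(\<Sum>k'\<in>simple_nodes \<gg> - {k}. \<Sum>l<off_entry \<gg> k k'.
        y k' (?u - (int (off_entry \<gg> k k') - 1 - 2 * int l))) \<in> P"
      using off_entry_le[of k _ \<gg>] by (intro sum_P IH) force+
    ultimately have "qc_seq \<gg> y k ?u + - y k (?u - ?d) + (\<Sum>k'\<in>simple_nodes \<gg> - {k}. \<Sum>l<off_entry \<gg> k k'.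
        y k' (?u - (int (off_entry \<gg> k k') - 1 - 2 * int l))) \<in> P"
      by (intro P)
    thus ?case by (simp add: qc_seq_def)
  qed
  show ?thesis
  proof (cases "v - int (symmetrizer \<gg> k) < B - int D")
    case True
    thus ?thesis using bound[of k v] D[of k] k P by force
  next
    case False
    thus ?thesis
      using k by (intro main[of k v "nat (v - int (symmetrizer \<gg> k) - (B - int D) + 1)"]) auto
  qed
qed

lemma qc_seq_0:
  assumes "\<And>k v. k \<in> simple_nodes \<gg> \<Longrightarrow> v < B \<Longrightarrow> y k v = 0"
    and "\<And>i u. i \<in> simple_nodes \<gg> \<Longrightarrow> u \<le> U \<Longrightarrow> qc_seq \<gg> y i u = 0"
    and "k \<in> simple_nodes \<gg>" "v - int (symmetrizer \<gg> k) \<le> U"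
  shows "y k v = 0"
  using qc_seq_induct[of \<gg> B y "{0}" U k v] assms by simp

lemma qc_seq_diff: "qc_seq \<gg> (\<lambda>k v. y k v - y' k v) i u = qc_seq \<gg> y i u - qc_seq \<gg> y' i u"
  by (simp add: qc_seq_def sum_subtractf)

lemma fls_lower_bound:
  fixes f :: "nat \<Rightarrow> rat fls"
  assumes "finite K"
  obtains B where "\<And>k v. k \<in> K \<Longrightarrow> v < B \<Longrightarrow> fls_nth (f k) v = 0"
proof -
  have "\<exists>B. \<forall>k\<in>K. \<forall>v<B. fls_nth (f k) v = 0"
    using assms
  proof (induction K)
    case (insert k K)
    then obtain B where "\<forall>k\<in>K. \<forall>v<B. fls_nth (f k) v = 0" by blast
    thus ?case
      by (intro exI[of _ "min B (fls_subdegree (f k))"]) auto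
  qed auto
  thus thesis using that by blast
qed

definition laurent_poly :: "rat fls \<Rightarrow> bool" where
  "laurent_poly f \<longleftrightarrow> (\<exists>B. \<forall>u. fls_nth f u \<noteq> 0 \<longrightarrow> \<bar>u\<bar> \<le> B)"

text \<open>
  Such \<open>Q\<close> makes the coefficients of \<open>C(z)\<^sup>-\<^sup>1 = Q(z) / (1 - z\<^sup>l)\<close> periodic. Since \<open>C(z)\<close> is invariant under
  \<open>z \<mapsto> z\<^sup>-\<^sup>1\<close>, it also makes them antisymmetric.
\<close>

locale qc_certificate =
  fixes \<gg> :: cartan_type and l :: int and Q :: "nat \<Rightarrow> nat \<Rightarrow> rat fls"
  assumes l_pos: "0 < l"
    and poly: "\<And>i j. i \<in> simple_nodes \<gg> \<Longrightarrow> j \<in> simple_nodes \<gg> \<Longrightarrow> laurent_poly (Q i j)"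
    and inv: "\<And>i j. i \<in> simple_nodes \<gg> \<Longrightarrow> j \<in> simple_nodes \<gg> \<Longrightarrow>
      (\<Sum>k\<in>simple_nodes \<gg>. quantum_cartan \<gg> i k * Q k j) = (if i = j then 1 - zpow l else 0)"
begin

abbreviation I :: "nat set" where "I \<equiv> simple_nodes \<gg>"

definition Binv :: "nat \<Rightarrow> nat \<Rightarrow> rat fls" where
  "Binv i j = (if i \<in> I \<and> j \<in> I then Q i j / (1 - zpow l) else 0)"

lemma one_minus_zpow_nz: "1 - zpow l \<noteq> 0"
  using zpow_inj[of 0 l] l_pos by simp

lemma Binv_inverse: "i \<in> I \<Longrightarrow> j \<in> I \<Longrightarrow> (\<Sum>k\<in>I. quantum_cartan \<gg> i k * Binv k j) = (if i = j then 1 else 0)"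
  using inv[of i j] one_minus_zpow_nz
  by (simp add: Binv_def sum_divide_distrib[symmetric] split: if_splits)

text \<open>The difference of two inverses solves the homogeneous recursion. As finitely many
  Laurent series have a common lower bound for their orders, \<open>qc_seq_0\<close>
  applies.\<close>

lemma inverse_on_eq: "inverse_on I (quantum_cartan \<gg>) = Binv"
  unfolding inverse_on_def
proof (rule the_equality)
  fix B' assume B': "(\<forall>i\<in>I. \<forall>j\<in>I. (\<Sum>k\<in>I. quantum_cartan \<gg> i k * B' k j) = (if i = j then 1 else 0)) \<and>
     (\<forall>i j. i \<notin> I \<or> j \<notin> I \<longrightarrow> B' i j = 0)"
  have "B' k j = Binv k j" if "k \<in> I" "j \<in> I" for k j
  proof -
    define y where "y k = B' k j - Binv k j" for k
    obtain b where b: "\<And>k v. k \<in> I \<Longrightarrow> v < b \<Longrightarrow> fls_nth (y k) v = 0"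
      using fls_lower_bound[OF finite_simple_nodes] by blast
    have "(\<Sum>k\<in>I. quantum_cartan \<gg> i k * y k) = 0" if "i \<in> I" for i
      using that B' Binv_inverse[of i j] \<open>j \<in> I\<close> by (auto simp: y_def right_diff_distrib sum_subtractf)
    hence "qc_seq \<gg> (\<lambda>k. fls_nth (y k)) i u = 0" if "i \<in> I" for i u
      using nth_qc_sum[OF that, of y u] that by simp
    hence "fls_nth (y k) v = 0" for v
      using b \<open>k \<in> I\<close> qc_seq_0[of \<gg> b "\<lambda>k. fls_nth (y k)" "v - int (symmetrizer \<gg> k)" k v] by auto
    hence "y k = 0" by (intro fls_eqI) simp
    thus ?thesis by (simp add: y_def)
  qed
  thus "B' = Binv"
    using B' by (intro ext) (auto simp: Binv_def)
qed (use Binv_inverse in \<open>auto simp: Binv_def\<close>)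

section \<open>Support, integrality, periodicity and antisymmetry of one column of the
  inverse\<close>

context
  fixes j assumes j: "j \<in> I"
begin

abbreviation "qs k u \<equiv> fls_nth (Q k j) u"
abbreviation "bs k u \<equiv> fls_nth (Binv k j) u"

lemma qc_seq_Q: "i \<in> I \<Longrightarrow> qc_seq \<gg> qs i u = (if i = j then (if u = 0 then 1 else 0) - (if u = l then 1 else 0) else 0)"
  using nth_qc_sum[of i \<gg> "\<lambda>k. Q k j" u] inv[of i j] j
  by (auto simp: nth_zpow)

lemma qc_seq_B: "i \<in> I \<Longrightarrow> qc_seq \<gg> bs i u = (if i = j \<and> u = 0 then 1 else 0)"
  using nth_qc_sum[of i \<gg> "\<lambda>k. Binv k j" u] Binv_inverse[of i j] j
  by (auto split: if_splits)

lemma Q_low: "k \<in> I \<Longrightarrow> v < int (symmetrizer \<gg> k) \<Longrightarrow> qs k v = 0"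
proof -
  assume k: "k \<in> I" "v < int (symmetrizer \<gg> k)"
  obtain b where b: "\<And>k v. k \<in> I \<Longrightarrow> v < b \<Longrightarrow> qs k v = 0"
    using fls_lower_bound[OF finite_simple_nodes, of \<gg> "\<lambda>k. Q k j"] by blast
  show ?thesis
    using k l_pos by (intro qc_seq_0[of \<gg> b qs "-1" k v] b) (auto simp: qc_seq_Q)
qed

lemma B_low: "k \<in> I \<Longrightarrow> v < int (symmetrizer \<gg> k) \<Longrightarrow> bs k v = 0"
proof -
  assume k: "k \<in> I" "v < int (symmetrizer \<gg> k)"
  obtain b where b: "\<And>k v. k \<in> I \<Longrightarrow> v < b \<Longrightarrow> bs k v = 0"
    using fls_lower_bound[OF finite_simple_nodes, of \<gg> "\<lambda>k. Binv k j"] by blast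
  show ?thesis
    using k by (intro qc_seq_0[of \<gg> b bs "-1" k v] b) (auto simp: qc_seq_B)
qed

lemma B_Ints: "k \<in> I \<Longrightarrow> bs k v \<in> \<int>"
proof -
  assume k: "k \<in> I"
  obtain b where b: "\<And>k v. k \<in> I \<Longrightarrow> v < b \<Longrightarrow> bs k v = 0"
    using fls_lower_bound[OF finite_simple_nodes, of \<gg> "\<lambda>k. Binv k j"] by blast
  show ?thesis
    by (rule qc_seq_induct[of \<gg> b bs \<int> "v - int (symmetrizer \<gg> k)" k v])
       (auto simp: qc_seq_B k b)
qed

text \<open>Both C(z) and, up to the sign and the factor z^l, the right-hand side 1 - z^l are
  invariant under inversion of z. So the reflected column with opposite sign solves the same
  equation. It is bounded below because Q consists of Laurent polynomials, and uniqueness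
  applies.\<close>

lemma Q_antisym: "k \<in> I \<Longrightarrow> qs k (l - v) = - qs k v"
proof -
  assume k: "k \<in> I"
  obtain b where b: "\<And>k v. k \<in> I \<Longrightarrow> v < b \<Longrightarrow> qs k v = 0"
    using fls_lower_bound[OF finite_simple_nodes, of \<gg> "\<lambda>k. Q k j"] by blast
  have upper: "\<exists>B. \<forall>k\<in>K. \<forall>v>B. qs k v = 0" if "finite K" "K \<subseteq> I" for K
    using that
  proof (induction K)
    case (insert k K)
    then obtain B where B: "\<forall>k\<in>K. \<forall>v>B. qs k v = 0" by blast
    obtain B' where "\<And>u. qs k u \<noteq> 0 \<Longrightarrow> \<bar>u\<bar> \<le> B'"
      using poly[of k j] insert.prems j unfolding laurent_poly_def by blast
    hence "qs k v = 0" if "v > B'" for v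
      using that by (meson abs_le_D1 not_le)
    thus ?case
      using B by (intro exI[of _ "max B B'"]) auto
  qed auto
  obtain B where B: "\<And>k v. k \<in> I \<Longrightarrow> v > B \<Longrightarrow> qs k v = 0"
    using upper[OF finite_simple_nodes order_refl] by blast
  define y where "y k v = - qs k (l - v)" for k v
  have "qc_seq \<gg> y i u = - qc_seq \<gg> qs i (l - u)" if "i \<in> I" for i u
  proof -
    have "(\<Sum>n<m. y k (u - (int m - 1 - 2 * int n))) = - (\<Sum>n<m. qs k (l - u - (int m - 1 - 2 * int n)))" for m k
    proof -
      have "(\<Sum>n<m. y k (u - (int m - 1 - 2 * int n))) = (\<Sum>n<m. y k (u - (int m - 1 - 2 * int (m - Suc n))))"
        by (rule sum.nat_diff_reindex[symmetric])
      also have "\<dots> = - (\<Sum>n<m. qs k (l - u - (int m - 1 - 2 * int n)))"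
        unfolding sum_negf[symmetric] y_def
        by (intro sum.cong refl arg_cong[of _ _ uminus] arg_cong2[of _ _ _ _ fls_nth]) (auto simp: of_nat_diff)
      finally show ?thesis .
    qed
    thus ?thesis
      by (simp add: qc_seq_def sum_negf) (simp add: y_def algebra_simps)
  qed
  hence 1: "qc_seq \<gg> (\<lambda>k v. qs k v - y k v) i u = 0" if "i \<in> I" for i u
    using that l_pos by (auto simp: qc_seq_diff qc_seq_Q)
  have 2: "qs k v - y k v = 0" if "k \<in> I" "v < min b (l - B)" for k v
    using that b[of k v] B[of k "l - v"] by (simp add: y_def)
  have "qs k v - y k v = 0"
    using qc_seq_0[of \<gg> "min b (l - B)" "\<lambda>k v. qs k v - y k v" "v - int (symmetrizer \<gg> k)" k v, OF 2 1 k]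
    by simp
  thus ?thesis by (simp add: y_def)
qed

lemma Q_B: "k \<in> I \<Longrightarrow> qs k v = bs k v - bs k (v - l)"
proof -
  assume "k \<in> I"
  hence "Q k j = (1 - zpow l) * Binv k j"
    using one_minus_zpow_nz j by (simp add: Binv_def)
  thus ?thesis by (simp add: left_diff_distrib nth_zpow_mult)
qed

lemma ct_of_int: "k \<in> I \<Longrightarrow> rat_of_int (quantum_cartan_inverse \<gg> k j v) = bs k v"
  using B_Ints[of k v] unfolding quantum_cartan_inverse_def simple_nodes_def[symmetric] inverse_on_eq
  by (auto elim!: Ints_cases)

lemma ct_nonpos: "k \<in> I \<Longrightarrow> v \<le> 0 \<Longrightarrow> quantum_cartan_inverse \<gg> k j v = 0"
  using ct_of_int[of k v] B_low[of k v] symmetrizer_pos[of \<gg> k] by simp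

text \<open>Consecutive periods of the inverse differ by the coefficient of Q at v + l, which is
  minus that at -v and hence 0.\<close>

lemma ct_periodic:
  assumes "k \<in> I" "v \<ge> 0"
  shows "quantum_cartan_inverse \<gg> k j (v + l) = quantum_cartan_inverse \<gg> k j v"
proof -
  have "qs k (v + l) = - qs k (- v)"
    using Q_antisym[of k "- v"] assms by (simp add: add.commute)
  hence "bs k (v + l) = bs k v"
    using Q_B[of k "v + l"] Q_low[of k "- v"] assms symmetrizer_pos[of \<gg> k] by simp
  thus ?thesis
    using ct_of_int[of k] assms by (metis of_int_eq_iff)
qed

lemma ct_antisym:
  assumes "k \<in> I" "0 \<le> v" "v \<le> l"
  shows "quantum_cartan_inverse \<gg> k j (l - v) = - quantum_cartan_inverse \<gg> k j v"
proof -
  have "bs k (v - l) = 0" "bs k (- v) = 0"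
    using assms symmetrizer_pos[of \<gg> k] by (auto intro!: B_low)
  hence "bs k (l - v) = - bs k v"
    using Q_B[of k v] Q_B[of k "l - v"] Q_antisym[of k v] assms by simp
  hence "rat_of_int (quantum_cartan_inverse \<gg> k j (l - v)) = rat_of_int (- quantum_cartan_inverse \<gg> k j v)"
    using assms by (simp add: ct_of_int)
  thus ?thesis by (simp only: of_int_eq_iff)
qed

text \<open>The derivative of C(z) Q(z) = 1 - z^l at z = 1. Antisymmetry gives Q(1) = 0, so only
  C(1) Q'(1) is left, and C(1) is the Cartan matrix.\<close>

lemma cartan_right_inverse:
  assumes "i \<in> I"
  shows "(\<Sum>k\<in>I. of_int (cartan \<gg> i k) * (\<Sum>v\<in>{0..l}. of_int v * qs k v)) = (if i = j then - of_int l else 0)"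
proof -
  \<comment> \<open>A window that contains the support {0..l} of Q after every shift in the
    recursion. These shifts are at most 3 in absolute value, and 10 is a generous bound.\<close>
  define H where "H = l + 10"
  have supp: "qs k v = 0" if "k \<in> I" "v \<notin> {0..l}" for k v
    using Q_low[of k v] Q_low[of k "l - v"] Q_antisym[of k v] that symmetrizer_pos[of \<gg> k] by force
  have sum0: "(\<Sum>v\<in>{0..l}. qs k v) = 0" if "k \<in> I" for k
  proof -
    have "(\<Sum>v\<in>{0..l}. qs k v) = (\<Sum>v\<in>{0..l}. qs k (l - v))"
      by (rule sum.reindex_bij_witness[of _ "\<lambda>v. l - v" "\<lambda>v. l - v"]) auto
    also have "\<dots> = - (\<Sum>v\<in>{0..l}. qs k v)"
      using that by (simp add: Q_antisym sum_negf)
    finally show ?thesis by simp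
  qed
  have shift: "(\<Sum>u\<in>{-H..H}. of_int u * qs k (u - s)) = (\<Sum>v\<in>{0..l}. of_int v * qs k v)"
    if "k \<in> I" "\<bar>s\<bar> \<le> 10" for k s
  proof -
    have "(\<Sum>u\<in>{-H..H}. of_int u * qs k (u - s)) = (\<Sum>u\<in>{s..l + s}. of_int u * qs k (u - s))"
      using that supp[OF that(1)] l_pos by (intro sum.mono_neutral_right) (auto simp: H_def)
    also have "\<dots> = (\<Sum>v\<in>{0..l}. of_int (v + s) * qs k v)"
      by (rule sum.reindex_bij_witness[of _ "\<lambda>v. v + s" "\<lambda>v. v - s"]) auto
    also have "\<dots> = (\<Sum>v\<in>{0..l}. of_int v * qs k v) + of_int s * (\<Sum>v\<in>{0..l}. qs k v)"
      by (simp add: distrib_right sum.distrib sum_distrib_left)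
    finally show ?thesis using sum0[OF that(1)] by simp
  qed
  have dbound: "symmetrizer \<gg> k \<le> 3" for k
    by (cases \<gg>) auto
  have "(\<Sum>u\<in>{-H..H}. of_int u * qc_seq \<gg> qs i u) = (\<Sum>v\<in>{0..l}. of_int v * qs i v) + (\<Sum>v\<in>{0..l}. of_int v * qs i v)
      - (\<Sum>k\<in>I - {i}. \<Sum>n<off_entry \<gg> i k. \<Sum>v\<in>{0..l}. of_int v * qs k v)"
  proof -
    have "(\<Sum>u\<in>{-H..H}. of_int u * qc_seq \<gg> qs i u) =
       (\<Sum>u\<in>{-H..H}. of_int u * qs i (u - int (symmetrizer \<gg> i))) +
       (\<Sum>u\<in>{-H..H}. of_int u * qs i (u - - int (symmetrizer \<gg> i))) -
       (\<Sum>k\<in>I - {i}. \<Sum>n<off_entry \<gg> i k. \<Sum>u\<in>{-H..H}. of_int u * qs k (u - (int (off_entry \<gg> i k) - 1 - 2 * int n)))"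
    proof -
      have "(\<Sum>u\<in>{-H..H}. \<Sum>k\<in>I - {i}. \<Sum>n<off_entry \<gg> i k. of_int u * qs k (u - (int (off_entry \<gg> i k) - 1 - 2 * int n))) =
        (\<Sum>k\<in>I - {i}. \<Sum>n<off_entry \<gg> i k. \<Sum>u\<in>{-H..H}. of_int u * qs k (u - (int (off_entry \<gg> i k) - 1 - 2 * int n)))"
        by (subst sum.swap) (intro sum.cong refl sum.swap)
      moreover have "of_int u * qc_seq \<gg> qs i u = of_int u * qs i (u - int (symmetrizer \<gg> i)) +
          of_int u * qs i (u - - int (symmetrizer \<gg> i)) -
          (\<Sum>k\<in>I - {i}. \<Sum>n<off_entry \<gg> i k. of_int u * qs k (u - (int (off_entry \<gg> i k) - 1 - 2 * int n)))" for u
        unfolding sum_distrib_left[symmetric] qc_seq_def by (simp add: algebra_simps)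
      ultimately show ?thesis
        by (simp only: sum.distrib sum_subtractf)
    qed
    also have "(\<Sum>k\<in>I - {i}. \<Sum>n<off_entry \<gg> i k. \<Sum>u\<in>{-H..H}. of_int u * qs k (u - (int (off_entry \<gg> i k) - 1 - 2 * int n)))
       = (\<Sum>k\<in>I - {i}. \<Sum>n<off_entry \<gg> i k. \<Sum>v\<in>{0..l}. of_int v * qs k v)"
    proof (rule sum.cong[OF refl], rule sum.cong[OF refl], rule shift)
      fix k n assume "k \<in> I - {i}" "n \<in> {..<off_entry \<gg> i k}"
      thus "k \<in> I" "\<bar>int (off_entry \<gg> i k) - 1 - 2 * int n\<bar> \<le> 10"
        using off_entry_le[of i k \<gg>] dbound[of k] by auto
    qed
    finally show ?thesis
      using shift[OF assms, of "int (symmetrizer \<gg> i)"] shift[OF assms, of "- int (symmetrizer \<gg> i)"] dbound[of i]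
      by simp
  qed
  also have "\<dots> = (\<Sum>k\<in>I. of_int (cartan \<gg> i k) * (\<Sum>v\<in>{0..l}. of_int v * qs k v))"
    by (simp add: sum.remove[OF finite_simple_nodes assms] cartan_diag cartan_offdiag sum_negf)
  also have "(\<Sum>u\<in>{-H..H}. of_int u * qc_seq \<gg> qs i u) = (if i = j then - of_int l else 0)"
  proof (cases "i = j")
    case True
    have "(\<Sum>u\<in>{-H..H}. of_int u * qc_seq \<gg> qs i u) = (\<Sum>u\<in>{-H..H}. if u = l then - of_int l else 0)"
      using True assms l_pos by (intro sum.cong) (auto simp: qc_seq_Q)
    thus ?thesis using True l_pos by (simp add: H_def)
  next
    case False
    thus ?thesis using assms by (simp add: qc_seq_Q)
  qed
  finally show ?thesis ..
qed

end

text \<open>The right inverse of the preceding lemma becomes a left inverse by transposition,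
  because the Cartan matrix is symmetrizable.\<close>

lemma cartan_nonsingular:
  fixes x :: "nat \<Rightarrow> rat"
  assumes sym: "\<And>i j. int (symmetrizer \<gg> i) * cartan \<gg> i j = int (symmetrizer \<gg> j) * cartan \<gg> j i"
    and x: "\<And>i. i \<in> I \<Longrightarrow> (\<Sum>j\<in>I. of_int (cartan \<gg> i j) * x j) = 0" and j: "j \<in> I"
  shows "x j = 0"
proof -
  let ?d = "\<lambda>i. rat_of_nat (symmetrizer \<gg> i)"
  define M where "M k = (\<Sum>v\<in>{0..l}. of_int v * fls_nth (Q k j) v)" for k
  have sym': "?d i * of_int (cartan \<gg> i k) = ?d k * of_int (cartan \<gg> k i)" for i k
    using arg_cong[OF sym[of i k], of rat_of_int] by simp
  have "?d j * x j * - of_int l = (\<Sum>i\<in>I. ?d i * x i * (if i = j then - of_int l else 0))"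
    using j by (simp add: if_distrib[of "(*) _"] cong: if_cong)
  also have "\<dots> = (\<Sum>i\<in>I. ?d i * x i * (\<Sum>k\<in>I. of_int (cartan \<gg> i k) * M k))"
    using cartan_right_inverse[OF j] by (simp add: M_def)
  also have "\<dots> = (\<Sum>k\<in>I. \<Sum>i\<in>I. (?d i * of_int (cartan \<gg> i k)) * x i * M k)"
    unfolding sum_distrib_left by (subst sum.swap) (simp add: mult_ac)
  also have "\<dots> = (\<Sum>k\<in>I. ?d k * M k * (\<Sum>i\<in>I. of_int (cartan \<gg> k i) * x i))"
    unfolding sym' sum_distrib_left by (simp only: mult_ac)
  also have "\<dots> = 0"
    using x by simp
  finally show ?thesis
    using l_pos symmetrizer_pos[of \<gg> j] by simp
qed

end

section \<open>The classical types\<close>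

definition zdiff :: "int \<Rightarrow> rat fls" where
  "zdiff k = zpow k - zpow (- k)"

definition zsum :: "int \<Rightarrow> rat fls" where
  "zsum k = zpow k + zpow (- k)"

lemma zsum_zdiff: "zsum a * zdiff b = zdiff (a + b) - zdiff (a - b)"
  and zsum_zsum: "zsum a * zsum b = zsum (a + b) + zsum (a - b)"
  by (simp_all add: zdiff_def zsum_def algebra_simps zpow_mult)

lemma zdiff_zsum: "zdiff a * zsum b = zdiff (a + b) + zdiff (a - b)"
  by (simp add: zdiff_def zsum_def algebra_simps zpow_mult)

lemma zdiff_0 [simp]: "zdiff 0 = 0" and zdiff_minus [simp]: "zdiff (- k) = - zdiff k" and zsum_minus [simp]: "zsum (- k) = zsum k"
  and zsum_0: "zsum 0 = 2"
  by (simp_all add: zdiff_def zsum_def)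

lemma zdiff_nz: "k \<noteq> 0 \<Longrightarrow> zdiff k \<noteq> 0"
  by (simp add: zdiff_def zpow_inj)

lemma zsum_nz: "zsum k \<noteq> 0"
proof
  assume "zsum k = 0"
  hence "fls_nth (zsum k) k = 0" by simp
  thus False by (simp add: zsum_def nth_zpow split: if_splits)
qed

lemma one_minus_zpow: "1 - zpow (2 * k) = - zpow k * zdiff k"
  by (simp add: zdiff_def algebra_simps zpow_mult flip: mult_2)

lemma zdiff_double: "zdiff (2 * k) = zdiff k * zsum k"
  by (simp add: zdiff_zsum flip: mult_2)

section \<open>Closure properties of Laurent polynomials\<close>

lemma laurent_poly_0 [simp]: "laurent_poly 0" and laurent_poly_zpow [simp]: "laurent_poly (zpow k)"
  by (auto simp: laurent_poly_def nth_zpow)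

lemma laurent_poly_1 [simp]: "laurent_poly 1"
  using laurent_poly_zpow[of 0] by (simp del: laurent_poly_zpow)

lemma laurent_poly_add: "laurent_poly f \<Longrightarrow> laurent_poly g \<Longrightarrow> laurent_poly (f + g)"
proof -
  assume "laurent_poly f" "laurent_poly g"
  then obtain A B where *: "\<And>u. fls_nth f u \<noteq> 0 \<Longrightarrow> \<bar>u\<bar> \<le> A" "\<And>u. fls_nth g u \<noteq> 0 \<Longrightarrow> \<bar>u\<bar> \<le> B"
    unfolding laurent_poly_def by blast
  show ?thesis
    unfolding laurent_poly_def
  proof (intro exI[of _ "max A B"] allI impI)
    fix u assume "fls_nth (f + g) u \<noteq> 0"
    hence "fls_nth f u \<noteq> 0 \<or> fls_nth g u \<noteq> 0" by auto
    thus "\<bar>u\<bar> \<le> max A B" using * by (metis max.coboundedI1 max.coboundedI2)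
  qed
qed

lemma laurent_poly_uminus: "laurent_poly f \<Longrightarrow> laurent_poly (- f)"
  by (simp add: laurent_poly_def)

lemma laurent_poly_diff: "laurent_poly f \<Longrightarrow> laurent_poly g \<Longrightarrow> laurent_poly (f - g)"
  using laurent_poly_add[of f "- g"] by (simp add: laurent_poly_uminus)

lemma laurent_poly_sum: "(\<And>a. a \<in> A \<Longrightarrow> laurent_poly (f a)) \<Longrightarrow> laurent_poly (sum f A)"
  by (induction A rule: infinite_finite_induct) (auto intro: laurent_poly_add)

lemma laurent_poly_const_mult: "laurent_poly f \<Longrightarrow> laurent_poly (fls_const c * f)"
  unfolding laurent_poly_def by (elim exE, rule_tac x = B in exI) auto

lemma laurent_poly_zpow_mult: "laurent_poly f \<Longrightarrow> laurent_poly (zpow k * f)"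
proof -
  assume "laurent_poly f"
  then obtain B where "\<And>u. fls_nth f u \<noteq> 0 \<Longrightarrow> \<bar>u\<bar> \<le> B"
    unfolding laurent_poly_def by blast
  hence "fls_nth (zpow k * f) u \<noteq> 0 \<Longrightarrow> \<bar>u\<bar> \<le> B + \<bar>k\<bar>" for u
    by (force simp: nth_zpow_mult)
  thus ?thesis unfolding laurent_poly_def by blast
qed

lemma laurent_poly_mult:
  assumes "laurent_poly f" "laurent_poly g"
  shows "laurent_poly (f * g)"
proof -
  obtain B where B: "\<And>u. fls_nth f u \<noteq> 0 \<Longrightarrow> \<bar>u\<bar> \<le> B"
    using assms(1) unfolding laurent_poly_def by blast
  have "f = (\<Sum>u\<in>{-B..B}. fls_const (fls_nth f u) * zpow u)"
  proof (rule fls_eqI)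
    fix v
    have "fls_nth (\<Sum>u\<in>{-B..B}. fls_const (fls_nth f u) * zpow u) v = (\<Sum>u\<in>{-B..B}. if u = v then fls_nth f v else 0)"
      unfolding fls_nth_sum by (intro sum.cong refl) (simp add: nth_zpow)
    also have "\<dots> = fls_nth f v"
      using B[of v] by force
    finally show "fls_nth f v = fls_nth (\<Sum>u\<in>{-B..B}. fls_const (fls_nth f u) * zpow u) v" ..
  qed
  hence "f * g = (\<Sum>u\<in>{-B..B}. fls_const (fls_nth f u) * (zpow u * g))"
    by (metis (no_types, lifting) mult.assoc sum.cong sum_distrib_right)
  thus ?thesis
    using assms(2) by (auto intro: laurent_poly_sum laurent_poly_const_mult laurent_poly_zpow_mult)
qed

lemma laurent_poly_zdiff [simp]: "laurent_poly (zdiff k)" and laurent_poly_zsum [simp]: "laurent_poly (zsum k)"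
  by (simp_all add: zdiff_def zsum_def laurent_poly_diff laurent_poly_add)

lemma laurent_poly_zdiff_div: 
  assumes "b dvd a"
  shows "laurent_poly (zdiff a / zdiff b)"
proof -
  have *: "laurent_poly (zdiff (b * int m) / zdiff b)" for m
  proof (cases "b = 0")
    case False
    have "(zpow b - zpow (-b)) * (\<Sum>l<m. zpow (b * (int m - 1 - 2 * int l))) = zpow (b * int m) - zpow (- (b * int m))"
    proof -
      have "(\<Sum>l<m. zpow (k - 2 * b * int l) - zpow (k - 2 * b * int (Suc l))) = zpow k - zpow (k - 2 * b * int m)" for k
        using sum_lessThan_telescope'[of "\<lambda>l. zpow (k - 2 * b * int l)" m] by simp
      from this[of "b * int m"] show ?thesis
        by (simp add: sum_distrib_left left_diff_distrib zpow_mult algebra_simps)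
    qed
    hence "zdiff (b * int m) / zdiff b = (\<Sum>l<m. zpow (b * (int m - 1 - 2 * int l)))"
      using zdiff_nz[OF False] by (simp add: zdiff_def field_simps)
    thus ?thesis by (simp add: laurent_poly_sum)
  qed simp
  obtain k where k: "a = b * k" using assms by blast
  show ?thesis
  proof (cases "k \<ge> 0")
    case True
    thus ?thesis using *[of "nat k"] k by simp
  next
    case False
    hence "zdiff a / zdiff b = - (zdiff (b * int (nat (- k))) / zdiff b)"
      using k by simp
    thus ?thesis using *[of "nat (- k)"] by (simp only: laurent_poly_uminus)
  qed
qed

text \<open>One of two consecutive integers is even. This clears the denominators at the two spin
  nodes of type D.\<close>

lemma laurent_poly_zdiff_zdiff_div_2: "laurent_poly (zdiff k * zdiff (k + 1) / zdiff 2)"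
proof (cases "even k")
  case True
  thus ?thesis
    using laurent_poly_mult[OF laurent_poly_zdiff_div[of 2 k] laurent_poly_zdiff[of "k + 1"]] by simp
next
  case False
  hence "even (k + 1)" by simp
  from laurent_poly_mult[OF laurent_poly_zdiff laurent_poly_zdiff_div[OF this]] show ?thesis by simp
qed

text \<open>F is the inverse of C times a common denominator W. The factor R completes W to 1 - z^l
  and has to cancel whatever denominators it introduces itself.\<close>

lemma qc_certificateI:
  fixes l :: int
  assumes "0 < l"
    and "\<And>i j. i \<in> simple_nodes \<gg> \<Longrightarrow> j \<in> simple_nodes \<gg> \<Longrightarrow>
      (\<Sum>k\<in>simple_nodes \<gg>. quantum_cartan \<gg> i k * F k j) = (if i = j then W else 0)"
    and "\<And>i j. i \<in> simple_nodes \<gg> \<Longrightarrow> j \<in> simple_nodes \<gg> \<Longrightarrow> laurent_poly (F i j * R)"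
    and "W * R = 1 - zpow l"
  shows "qc_certificate \<gg> l (\<lambda>i j. F i j * R)"
proof
  fix i j assume "i \<in> simple_nodes \<gg>" "j \<in> simple_nodes \<gg>"
  thus "(\<Sum>k\<in>simple_nodes \<gg>. quantum_cartan \<gg> i k * (F k j * R)) = (if i = j then 1 - zpow l else 0)"
    using assms(2)[of i j] assms(4) by (simp add: mult.assoc[symmetric] sum_distrib_right[symmetric])
qed (use assms in auto)

section \<open>Certificates for the types A to D\<close>

lemma quantum_cartan_entry:
  assumes "i \<noteq> k"
  shows "off_entry \<gg> i k = 0 \<Longrightarrow> quantum_cartan \<gg> i k = 0"
    and "off_entry \<gg> i k = 1 \<Longrightarrow> quantum_cartan \<gg> i k = - 1"
    and "off_entry \<gg> i k = 2 \<Longrightarrow> quantum_cartan \<gg> i k = - zsum 1"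
    and "off_entry \<gg> i k = 3 \<Longrightarrow> quantum_cartan \<gg> i k = - (zsum 2 + 1)"
  using quantum_cartan_offdiag[OF assms]
  by (simp_all add: zsum_def eval_nat_numeral)

lemma quantum_cartan_diag_zsum: "quantum_cartan \<gg> i i = zsum (int (symmetrizer \<gg> i))"
  by (simp add: quantum_cartan_diag zsum_def)

lemma off_entry_eq:
  "i \<noteq> k \<Longrightarrow> off_entry \<gg> i k = (if dynkin_edge \<gg> i k \<or> dynkin_edge \<gg> k i
     then max (symmetrizer \<gg> i) (symmetrizer \<gg> k) div symmetrizer \<gg> i else 0)"
  by (simp add: off_entry_def cartan_def Let_def zdiv_int[symmetric])

lemma sum_chain:
  fixes f :: "nat \<Rightarrow> 'a :: comm_monoid_add"
  assumes "\<And>k. k \<in> {1..n} \<Longrightarrow> k \<noteq> i - 1 \<Longrightarrow> k \<noteq> i \<Longrightarrow> k \<noteq> i + 1 \<Longrightarrow> f k = 0" "i \<in> {1..n}"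
  shows "(\<Sum>k\<in>{1..n}. f k) = (if 1 < i then f (i - 1) else 0) + f i + (if i < n then f (i + 1) else 0)"
proof -
  have "(\<Sum>k\<in>{1..n}. f k) = (\<Sum>k\<in>{1..n} \<inter> {i - 1, i, i + 1}. f k)"
    using assms by (intro sum.mono_neutral_right) auto
  also have "{1..n} \<inter> {i - 1, i, i + 1} = (if 1 < i then {i - 1} else {}) \<union> {i} \<union> (if i < n then {i + 1} else {})"
    using assms(2) by auto
  also have "sum f \<dots> = (if 1 < i then f (i - 1) else 0) + f i + (if i < n then f (i + 1) else 0)"
    by (auto simp: add_ac)
  finally show ?thesis .
qed

text \<open>F is the Green function of the three-term recurrence with coefficient
  \<open>zsum 1\<close>: \<open>zdiff i\<close> solves it with value 0 at i = 0, and
  \<open>zdiff (n + 1 - i)\<close> with value 0 at i = n + 1. They are glued at i = j, where the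
  Wronskian W = \<open>zdiff 1 * zdiff (n + 1)\<close> appears.\<close>

lemma certificate_A:
  assumes "1 \<le> n"
  shows "\<exists>Q. qc_certificate (TypeA n) (2 * (int n + 1)) Q"
proof -
  define F where "F i j = zdiff (int (min i j)) * zdiff (int n + 1 - int (max i j))" for i j
  have nodes: "simple_nodes (TypeA n) = {1..n}"
    by (simp add: simple_nodes_def)
  have "qc_certificate (TypeA n) (2 * (int n + 1)) (\<lambda>i j. F i j * (- zpow (int n + 1) / zdiff 1))"
  proof (rule qc_certificateI)
    fix i j assume ij: "i \<in> simple_nodes (TypeA n)" "j \<in> simple_nodes (TypeA n)"
    have "(\<Sum>k\<in>simple_nodes (TypeA n). quantum_cartan (TypeA n) i k * F k j) = zsum 1 * F i j - F (i - 1) j - F (i + 1) j"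
      unfolding nodes
      by (subst sum_chain[where i = i])
         (use ij nodes in \<open>auto simp: quantum_cartan_diag_zsum quantum_cartan_entry off_entry_eq F_def max_def min_def\<close>)
    also have "\<dots> = (if i = j then zdiff 1 * zdiff (int n + 1) else 0)"
    proof (cases i j rule: linorder_cases)
      case greater
      hence "min (i - 1) j = j" "max (i - 1) j = i - 1" by auto
      thus ?thesis using greater ij nodes
        by (simp add: F_def of_nat_diff zdiff_def zsum_def algebra_simps zpow_mult)
    qed (use ij nodes in \<open>auto simp: F_def of_nat_diff zdiff_def zsum_def algebra_simps zpow_mult\<close>)
    finally show "(\<Sum>k\<in>simple_nodes (TypeA n). quantum_cartan (TypeA n) i k * F k j) = (if i = j then zdiff 1 * zdiff (int n + 1) else 0)" .
    have "laurent_poly (zdiff (int (min i j)) / zdiff 1 * zdiff (int n + 1 - int (max i j)) * - zpow (int n + 1))"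
      by (intro laurent_poly_mult laurent_poly_zdiff_div laurent_poly_uminus) simp_all
    thus "laurent_poly (F i j * (- zpow (int n + 1) / zdiff 1))"
      by (simp add: F_def)
  next
    show "zdiff 1 * zdiff (int n + 1) * (- zpow (int n + 1) / zdiff 1) = 1 - zpow (2 * (int n + 1))"
      unfolding one_minus_zpow using zdiff_nz[of 1] by simp
  qed simp
  thus ?thesis by blast
qed

lemma certificate_B:
  assumes "2 \<le> n"
  shows "\<exists>Q. qc_certificate (TypeB n) (4 * (2 * int n - 1)) Q"
proof -
  define m where "m = 2 * int n - 1"
  \<comment> \<open>From the left, \<open>zdiff (2 * i)\<close> solves the recurrence with
    coefficient \<open>zsum 2\<close>. From the right, \<open>zsum (m - 2 * i)\<close> meets the
    condition of row n, namely equal values at n - 1 and n, since there m - 2 i is 1 and -1. Column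
    n carries its own scaling.\<close>
  define F where "F i j = (if j = n then zdiff (2 * int i)
      else zdiff (2 * int (min i j)) * zsum (m - 2 * int (max i j)))" for i j
  have nodes: "simple_nodes (TypeB n) = {1..n}"
    by (simp add: simple_nodes_def)
  have "qc_certificate (TypeB n) (2 * (2 * m)) (\<lambda>i j. F i j * (- zpow (2 * m) * zdiff m / zdiff 2))"
  proof (rule qc_certificateI)
    show "0 < 2 * (2 * m)" using assms by (simp add: m_def)
  next
    fix i j assume "i \<in> simple_nodes (TypeB n)" "j \<in> simple_nodes (TypeB n)"
    hence ij: "1 \<le> i" "i \<le> n" "1 \<le> j" "j \<le> n" by (simp_all add: nodes)
    have F0: "F 0 j = 0"
      by (simp add: F_def)
    have sum: "(\<Sum>k\<in>simple_nodes (TypeB n). quantum_cartan (TypeB n) i k * F k j) =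
        (if i = n then zsum 1 * F n j - zsum 1 * F (n - 1) j else zsum 2 * F i j - F (i - 1) j - F (i + 1) j)"
      unfolding nodes
      by (subst sum_chain[where i = i])
         (use ij assms F0 in \<open>auto simp: quantum_cartan_diag_zsum quantum_cartan_entry off_entry_eq\<close>)
    have "\<dots> = (if i = j then zdiff 2 * zsum m else 0)"
    proof (cases "i = n")
      case True
      hence "min (n - 1) j = (if j = n then n - 1 else j)" "max (n - 1) j = (if j = n then n else n - 1)"
        using ij by auto
      thus ?thesis using True ij assms
        by (auto simp: F_def m_def of_nat_diff zdiff_def zsum_def algebra_simps zpow_mult)
    next
      case False
      show ?thesis
      proof (cases i j rule: linorder_cases)
        case greater
        hence "min (i - 1) j = j" "max (i - 1) j = i - 1" by auto
        thus ?thesis using greater ij False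
          by (auto simp: F_def m_def of_nat_diff zdiff_def zsum_def algebra_simps zpow_mult)
      qed (use ij False in \<open>auto simp: F_def m_def of_nat_diff zdiff_def zsum_def algebra_simps zpow_mult\<close>)
    qed
    thus "(\<Sum>k\<in>simple_nodes (TypeB n). quantum_cartan (TypeB n) i k * F k j) = (if i = j then zdiff 2 * zsum m else 0)"
      unfolding sum .
    have "laurent_poly (zdiff (2 * int k) / zdiff 2)" for k
      by (rule laurent_poly_zdiff_div) simp
    hence "laurent_poly (zdiff (2 * int k) / zdiff 2 * (x * (- zpow (2 * m) * zdiff m)))" if "laurent_poly x" for k x
      using that by (intro laurent_poly_mult laurent_poly_uminus) simp_all
    from this[of 1 i] this[of "zsum (m - 2 * int (max i j))" "min i j"]
    show "laurent_poly (F i j * (- zpow (2 * m) * zdiff m / zdiff 2))"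
      by (simp add: F_def mult.assoc)
  next
    show "zdiff 2 * zsum m * (- zpow (2 * m) * zdiff m / zdiff 2) = 1 - zpow (2 * (2 * m))"
      unfolding one_minus_zpow zdiff_double using zdiff_nz[of 2] by simp
  qed
  thus ?thesis by (auto simp: m_def algebra_simps)
qed

lemma quantum_cartan_C:
  assumes "1 \<le> i" "1 \<le> k" "i \<le> n" "k \<le> n"
  shows "quantum_cartan (TypeC n) i k =
    (if i = k then zsum (if i = n then 2 else 1)
     else if i + 1 = n \<and> k = n then - zsum 1 else if k = i + 1 \<or> i = k + 1 then - 1 else 0)"
proof (cases "i = k")
  case False
  have off: "off_entry (TypeC n) i k = (if i + 1 = n \<and> k = n then 2 else if k = i + 1 \<or> i = k + 1 then 1 else 0)"
    using assms False by (simp add: off_entry_eq)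
  consider "i + 1 = n \<and> k = n" | "\<not> (i + 1 = n \<and> k = n)" "k = i + 1 \<or> i = k + 1" | "\<not> (k = i + 1 \<or> i = k + 1)"
    by blast
  thus ?thesis
  proof cases
    case 1
    hence "off_entry (TypeC n) i k = 2" using off by simp
    from quantum_cartan_entry(3)[OF False this] show ?thesis using 1 False by simp
  next
    case 2
    hence "off_entry (TypeC n) i k = 1" using off by presburger
    from quantum_cartan_entry(2)[OF False this] show ?thesis using 2 False by presburger
  next
    case 3
    hence "off_entry (TypeC n) i k = 0" using off by presburger
    from quantum_cartan_entry(1)[OF False this] show ?thesis using 3 False by presburger
  qed
qed (use assms in \<open>simp add: quantum_cartan_diag_zsum\<close>)

lemma zsum_1_zdiff: "zsum 1 * zdiff k = zdiff (k + 1) + zdiff (k - 1)"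
  by (simp add: zdiff_zsum mult.commute[of "zsum 1"])

lemma certificate_C:
  assumes "3 \<le> n"
  shows "\<exists>Q. qc_certificate (TypeC n) (4 * (int n + 1)) Q"
proof -
  define m where "m = int n + 1"
  \<comment> \<open>The solution from the left is \<open>zdiff i\<close> on the short nodes. From
    the right it is \<open>zsum (m - i)\<close> on the short nodes and 1 at the long node n. Here m
    is the dual Coxeter number, and the period is 4 m.\<close>
  define F where "F i j = (if j = n then (if i = n then zdiff (int n) else zsum 1 * zdiff (int i))
      else if i = n then zdiff (int j)
      else if i \<le> j then zdiff (int i) * zsum (m - int j) else zdiff (int j) * zsum (m - int i))" for i j
  have nodes: "simple_nodes (TypeC n) = {1..n}"
    by (simp add: simple_nodes_def)
  have "qc_certificate (TypeC n) (2 * (2 * m)) (\<lambda>i j. F i j * (- zpow (2 * m) * zdiff m / zdiff 1))"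
  proof (rule qc_certificateI)
    show "0 < 2 * (2 * m)" by (simp add: m_def)
  next
    fix i j assume "i \<in> simple_nodes (TypeC n)" "j \<in> simple_nodes (TypeC n)"
    hence ij: "1 \<le> i" "i \<le> n" "1 \<le> j" "j \<le> n" by (simp_all add: nodes)
    have F0: "F 0 j = 0"
      using assms by (simp add: F_def)
    have "(\<Sum>k\<in>simple_nodes (TypeC n). quantum_cartan (TypeC n) i k * F k j) =
        (if 1 < i then quantum_cartan (TypeC n) i (i - 1) * F (i - 1) j else 0) + quantum_cartan (TypeC n) i i * F i j +
        (if i < n then quantum_cartan (TypeC n) i (i + 1) * F (i + 1) j else 0)"
      unfolding nodes using ij by (intro sum_chain) (auto simp: quantum_cartan_C)
    also have "\<dots> = (if i = n then zsum 2 * F n j - F (n - 1) j else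
         zsum 1 * F i j - F (i - 1) j - (if i + 1 = n then zsum 1 * F n j else F (i + 1) j))"
    proof -
      have "n - 1 \<noteq> n" "i - 1 \<noteq> i" "i - 1 \<noteq> n" using ij assms by auto
      thus ?thesis
        using ij assms F0 by (cases "i = 1") (simp_all add: quantum_cartan_C)
    qed
    also have "\<dots> = (if i = j then zdiff 1 * zsum m else 0)"
    proof -
      consider "i = n" | "i + 1 = n" | "i + 1 < n"
        using ij by linarith
      thus ?thesis
      proof cases
        case i: 1
        consider "j + 1 < n" | "j + 1 = n" | "j = n" using ij by linarith
        thus ?thesis
        proof cases
          case 1
          have *: "F n j = zdiff (int j)" "F (n - 1) j = zdiff (int j) * zsum 2"
            using 1 assms by (auto simp: F_def m_def of_nat_diff)
          show ?thesis unfolding * using i 1 by (simp add: zdiff_def zsum_def algebra_simps zpow_mult minus_diff_commute)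
        next
          case 2
          have *: "F n j = zdiff (int j)" "F (n - 1) j = zdiff (int j) * zsum 2"
            using 2 assms by (auto simp: F_def m_def of_nat_diff)
          show ?thesis unfolding * using i 2 by (simp add: zdiff_def zsum_def algebra_simps zpow_mult minus_diff_commute)
        next
          case 3
          have *: "F n j = zdiff (int n)" "F (n - 1) j = zsum 1 * zdiff (int n - 1)"
            using 3 assms by (auto simp: F_def m_def of_nat_diff)
          show ?thesis unfolding * using i 3 by (simp add: m_def zdiff_zsum zsum_zdiff)
        qed
      next
        case i: 2
        consider "j + 1 < i" | "j + 1 = i" | "j = i" | "j = n" using ij i by linarith
        thus ?thesis
        proof cases
          case 1
          have *: "F i j = zdiff (int j) * zsum 2" "F (i - 1) j = zdiff (int j) * zsum 3" "F n j = zdiff (int j)"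
            using i 1 assms by (auto simp: F_def m_def of_nat_diff)
          show ?thesis unfolding * using i 1 by (simp add: zdiff_def zsum_def algebra_simps zpow_mult minus_diff_commute)
        next
          case 2
          have *: "F i j = zdiff (int j) * zsum 2" "F (i - 1) j = zdiff (int j) * zsum 3" "F n j = zdiff (int j)"
            using i 2 assms by (auto simp: F_def m_def of_nat_diff)
          show ?thesis unfolding * using i 2 by (simp add: zdiff_def zsum_def algebra_simps zpow_mult minus_diff_commute)
        next
          case 3
          have *: "F i j = zdiff (m - 2) * zsum 2" "F (i - 1) j = zdiff (m - 3) * zsum 2" "F n j = zdiff (m - 2)"
            using i 3 assms by (auto simp: F_def m_def of_nat_diff)
          show ?thesis unfolding * using i 3 by (simp add: zdiff_def zsum_def algebra_simps zpow_mult minus_diff_commute)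
        next
          case 4
          have *: "F i j = zsum 1 * zdiff (int n - 1)" "F (i - 1) j = zsum 1 * zdiff (int n - 2)" "F n j = zdiff (int n)"
            using i 4 assms by (auto simp: F_def m_def of_nat_diff)
          show ?thesis unfolding * using i 4 by (simp add: zdiff_def zsum_def algebra_simps zpow_mult minus_diff_commute)
        qed
      next
        case i: 3
        consider "i < j" | "i = j" | "j + 1 = i" | "j + 1 < i" by linarith
        thus ?thesis
        proof cases
          case 1
          define y0 where "y0 = (if j = n then zsum 1 else zsum (m - int j))"
          have *: "F i j = zdiff (int i) * y0" "F (i - 1) j = zdiff (int i - 1) * y0" "F (i + 1) j = zdiff (int i + 1) * y0"
            using 1 assms ij i by (auto simp: F_def y0_def of_nat_diff mult.commute add.commute)
          have "zsum 1 * (zdiff (int i) * y0) = zdiff (int i + 1) * y0 + zdiff (int i - 1) * y0"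
            unfolding mult.assoc[symmetric] zsum_1_zdiff by (simp add: distrib_right)
          thus ?thesis unfolding * using 1 i by simp
        next
          case 2
          have *: "F i j = zdiff (int i) * zsum (m - int i)" "F (i - 1) j = zdiff (int i - 1) * zsum (m - int i)"
              "F (i + 1) j = zdiff (int i) * zsum (m - int i - 1)"
            using 2 assms ij i by (auto simp: F_def m_def of_nat_diff)
          show ?thesis unfolding * using 2 i by (simp add: zdiff_def zsum_def algebra_simps zpow_mult minus_diff_commute)
        next
          case 3
          have *: "F i j = zdiff (int j) * zsum (m - int i)" "F (i - 1) j = zdiff (int j) * zsum (m - int i + 1)"
              "F (i + 1) j = zdiff (int j) * zsum (m - int i - 1)"
            using 3 assms ij i by (auto simp: F_def m_def of_nat_diff algebra_simps)
          show ?thesis unfolding * using 3 i by (simp add: zdiff_def zsum_def algebra_simps zpow_mult minus_diff_commute)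
        next
          case 4
          have *: "F i j = zdiff (int j) * zsum (m - int i)" "F (i - 1) j = zdiff (int j) * zsum (m - int i + 1)"
              "F (i + 1) j = zdiff (int j) * zsum (m - int i - 1)"
            using 4 assms ij i by (auto simp: F_def m_def of_nat_diff algebra_simps)
          show ?thesis unfolding * using 4 i by (simp add: zdiff_def zsum_def algebra_simps zpow_mult minus_diff_commute)
        qed
      qed
    qed
    finally show "(\<Sum>k\<in>simple_nodes (TypeC n). quantum_cartan (TypeC n) i k * F k j) = (if i = j then zdiff 1 * zsum m else 0)" .
    have "laurent_poly (zdiff k / zdiff 1)" for k
      by (rule laurent_poly_zdiff_div) simp
    hence *: "laurent_poly (zdiff k / zdiff 1 * (x * (- zpow (2 * m) * zdiff m)))" if "laurent_poly x" for k x
      using that by (intro laurent_poly_mult laurent_poly_uminus) simp_all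
    from *[of 1 "int n"] *[of 1 "int j"] *[of "zsum 1" "int i"] *[of "zsum (m - int j)" "int i"] *[of "zsum (m - int i)" "int j"]
    show "laurent_poly (F i j * (- zpow (2 * m) * zdiff m / zdiff 1))"
      by (auto simp: F_def mult_ac)
  next
    show "zdiff 1 * zsum m * (- zpow (2 * m) * zdiff m / zdiff 1) = 1 - zpow (2 * (2 * m))"
      unfolding one_minus_zpow zdiff_double using zdiff_nz[of 1] by simp
  qed
  thus ?thesis by (auto simp: m_def algebra_simps)
qed

lemma quantum_cartan_D:
  "quantum_cartan (TypeD n) i k =
    (if i = k then zsum 1 else if dynkin_edge (TypeD n) i k \<or> dynkin_edge (TypeD n) k i then - 1 else 0)"
proof (cases "i = k")
  case False
  have off: "off_entry (TypeD n) i k = (if dynkin_edge (TypeD n) i k \<or> dynkin_edge (TypeD n) k i then 1 else 0)"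
    using False by (simp add: off_entry_eq)
  show ?thesis
  proof (cases "dynkin_edge (TypeD n) i k \<or> dynkin_edge (TypeD n) k i")
    case True
    thus ?thesis using quantum_cartan_entry(2)[OF False, of "TypeD n"] False off by presburger
  next
    case nedge: False
    thus ?thesis using quantum_cartan_entry(1)[OF False, of "TypeD n"] False off by presburger
  qed
qed (simp add: quantum_cartan_diag_zsum)

lemma certificate_D:
  assumes "4 \<le> n"
  shows "\<exists>Q. qc_certificate (TypeD n) (4 * (int n - 1)) Q"
proof -
  define m where "m = int n - 1"
  \<comment> \<open>From the right, the solution is \<open>zsum (m - i)\<close> on the chain and 1
    at both spin nodes; the factor \<open>zsum 1\<close> removes a common denominator. The entries
    between spin nodes, \<open>zdiff n\<close> and \<open>zdiff (n - 2)\<close>, add up to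
    \<open>zsum 1 * zdiff m\<close>.\<close>
  define F where "F i j = (if i + 1 < n then
        (if j + 1 < n then zsum 1 * (if i \<le> j then zdiff (int i) * zsum (m - int j) else zdiff (int j) * zsum (m - int i))
         else zsum 1 * zdiff (int i))
      else if j + 1 < n then zsum 1 * zdiff (int j) else if i = j then zdiff (int n) else zdiff (int n - 2))" for i j
  have nodes: "simple_nodes (TypeD n) = {1..n}"
    by (simp add: simple_nodes_def)
  have "qc_certificate (TypeD n) (2 * (2 * m)) (\<lambda>i j. F i j * (- zpow (2 * m) * zdiff m / zdiff 2))"
  proof (rule qc_certificateI)
    show "0 < 2 * (2 * m)" using assms by (simp add: m_def)
  next
    fix i j assume "i \<in> simple_nodes (TypeD n)" "j \<in> simple_nodes (TypeD n)"
    hence ij: "1 \<le> i" "i \<le> n" "1 \<le> j" "j \<le> n" by (simp_all add: nodes)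
    have F0: "F 0 j = 0"
      using assms by (simp add: F_def)
    \<comment> \<open>\<open>N\<close> is the set of neighbours of i. It may contain 0, which stands
      for the missing left neighbour of node 1, as F vanishes there.\<close>
    have sum: "(\<Sum>k\<in>simple_nodes (TypeD n). quantum_cartan (TypeD n) i k * F k j) = zsum 1 * F i j - (\<Sum>k\<in>N. F k j)"
      if N: "i \<notin> N" "finite N" "N \<subseteq> {0..n}"
        and edge: "\<And>k. 1 \<le> k \<Longrightarrow> k \<le> n \<Longrightarrow> dynkin_edge (TypeD n) i k \<or> dynkin_edge (TypeD n) k i \<longleftrightarrow> k \<in> N" for N
    proof -
      have "(\<Sum>k\<in>{1..n}. quantum_cartan (TypeD n) i k * F k j) =
          (\<Sum>k\<in>{1..n}. (if k = i then zsum 1 * F k j else 0) - (if k \<in> N then F k j else 0))"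
        using N(1) edge by (intro sum.cong refl) (auto simp: quantum_cartan_D simp del: dynkin_edge.simps)
      also have "\<dots> = zsum 1 * F i j - (\<Sum>k\<in>{1..n} \<inter> N. F k j)"
        using ij by (simp add: sum_subtractf sum.inter_restrict)
      also have "(\<Sum>k\<in>{1..n} \<inter> N. F k j) = (\<Sum>k\<in>N. F k j)"
      proof (rule sum.mono_neutral_left)
        show "\<forall>k\<in>N - {1..n} \<inter> N. F k j = 0"
        proof
          fix k assume "k \<in> N - {1..n} \<inter> N"
          hence "k = 0" using N(3) by force
          thus "F k j = 0" using F0 by simp
        qed
      qed (use N in auto)
      finally show ?thesis unfolding nodes .
    qed
    have "(\<Sum>k\<in>simple_nodes (TypeD n). quantum_cartan (TypeD n) i k * F k j) =
        zsum 1 * F i j - (if i + 2 < n then F (i - 1) j + F (i + 1) j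
          else if i + 2 = n then F (n - 3) j + F (n - 1) j + F n j else F (n - 2) j)"
    proof -
      consider "i + 2 < n" | "i + 2 = n" | "i + 2 > n" by linarith
      thus ?thesis
      proof cases
        case 1
        thus ?thesis using ij assms F0 by (subst sum[of "{i - 1, i + 1}"]) auto
      next
        case 2
        have "n - 3 \<noteq> n - 1" "n - 3 \<noteq> n" "n - 1 \<noteq> n" using assms by auto
        hence "(\<Sum>k\<in>{n - 3, n - 1, n}. F k j) = F (n - 3) j + F (n - 1) j + F n j"
          by (simp add: add.assoc)
        moreover have "(\<Sum>k\<in>simple_nodes (TypeD n). quantum_cartan (TypeD n) i k * F k j) =
            zsum 1 * F i j - (\<Sum>k\<in>{n - 3, n - 1, n}. F k j)"
          using 2 ij assms by (intro sum) auto
        ultimately show ?thesis using 2 by simp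
      next
        case 3
        thus ?thesis using ij assms F0 by (subst sum[of "{n - 2}"]) auto
      qed
    qed
    also have "\<dots> = (if i = j then zdiff 2 * zsum m else 0)"
    proof -
      consider "i + 2 < n" | "i + 2 = n" | "i + 2 > n" by linarith
      thus ?thesis
      proof cases
        case i: 1
        consider "i < j" | "i = j" | "j + 1 = i" | "j + 1 < i" by linarith
        thus ?thesis
        proof cases
          case 1
          define y0 where "y0 = zsum 1 * (if j + 1 < n then zsum (m - int j) else 1)"
          have *: "F i j = zdiff (int i) * y0" "F (i - 1) j = zdiff (int i - 1) * y0" "F (i + 1) j = zdiff (int i + 1) * y0"
            using 1 assms ij i by (auto simp: F_def y0_def of_nat_diff mult_ac add.commute)
          have "zsum 1 * (zdiff (int i) * y0) = zdiff (int i + 1) * y0 + zdiff (int i - 1) * y0"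
            unfolding mult.assoc[symmetric] zsum_1_zdiff by (simp add: distrib_right)
          thus ?thesis unfolding * using 1 i by simp
        next
          case 2
          have *: "F i j = zsum 1 * (zdiff (int i) * zsum (m - int i))" "F (i - 1) j = zsum 1 * (zdiff (int i - 1) * zsum (m - int i))"
              "F (i + 1) j = zsum 1 * (zdiff (int i) * zsum (m - int i - 1))"
            using 2 assms ij i by (auto simp: F_def m_def of_nat_diff)
          show ?thesis unfolding * using 2 i by (simp add: zdiff_def zsum_def algebra_simps zpow_mult minus_diff_commute)
        next
          case 3
          have *: "F i j = zsum 1 * (zdiff (int j) * zsum (m - int i))" "F (i - 1) j = zsum 1 * (zdiff (int j) * zsum (m - int i + 1))"
              "F (i + 1) j = zsum 1 * (zdiff (int j) * zsum (m - int i - 1))"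
            using 3 assms ij i by (auto simp: F_def m_def of_nat_diff algebra_simps)
          show ?thesis unfolding * using 3 i by (simp add: zdiff_def zsum_def algebra_simps zpow_mult minus_diff_commute)
        next
          case 4
          have *: "F i j = zsum 1 * (zdiff (int j) * zsum (m - int i))" "F (i - 1) j = zsum 1 * (zdiff (int j) * zsum (m - int i + 1))"
              "F (i + 1) j = zsum 1 * (zdiff (int j) * zsum (m - int i - 1))"
            using 4 assms ij i by (auto simp: F_def m_def of_nat_diff algebra_simps)
          show ?thesis unfolding * using 4 i by (simp add: zdiff_def zsum_def algebra_simps zpow_mult minus_diff_commute)
        qed
      next
        case i: 2
        consider "j + 1 < i" | "j + 1 = i" | "i = j" | "i < j" by linarith
        thus ?thesis
        proof cases
          case 1
          have *: "F i j = zsum 1 * (zdiff (int j) * zsum 1)" "F (n - 3) j = zsum 1 * (zdiff (int j) * zsum 2)"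
              "F (n - 1) j = zsum 1 * zdiff (int j)" "F n j = zsum 1 * zdiff (int j)"
            using 1 assms ij i by (auto simp: F_def m_def of_nat_diff)
          show ?thesis unfolding * using 1 i by (simp add: zdiff_def zsum_def algebra_simps zpow_mult minus_diff_commute)
        next
          case 2
          have *: "F i j = zsum 1 * (zdiff (int j) * zsum 1)" "F (n - 3) j = zsum 1 * (zdiff (int j) * zsum 2)"
              "F (n - 1) j = zsum 1 * zdiff (int j)" "F n j = zsum 1 * zdiff (int j)"
            using 2 assms ij i by (auto simp: F_def m_def of_nat_diff)
          show ?thesis unfolding * using 2 i by (simp add: zdiff_def zsum_def algebra_simps zpow_mult minus_diff_commute)
        next
          case 3
          have *: "F i j = zsum 1 * (zdiff (m - 1) * zsum 1)" "F (n - 3) j = zsum 1 * (zdiff (m - 2) * zsum 1)"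
              "F (n - 1) j = zsum 1 * zdiff (m - 1)" "F n j = zsum 1 * zdiff (m - 1)"
            using 3 assms ij i by (auto simp: F_def m_def of_nat_diff)
          show ?thesis unfolding * using 3 i by (simp add: zdiff_def zsum_def algebra_simps zpow_mult minus_diff_commute)
        next
          case 4
          have *: "F i j = zsum 1 * zdiff (m - 1)" "F (n - 3) j = zsum 1 * zdiff (m - 2)"
            using 4 assms ij i by (auto simp: F_def m_def of_nat_diff)
          have "F (n - 1) j + F n j = zdiff (m + 1) + zdiff (m - 1)"
            using 4 assms ij i by (auto simp: F_def m_def of_nat_diff)
          hence **: "F (n - 3) j + F (n - 1) j + F n j = zsum 1 * zdiff (m - 2) + (zdiff (m + 1) + zdiff (m - 1))"
            by (simp only: add.assoc *)
          show ?thesis unfolding ** *(1) using 4 i by (simp add: zdiff_def zsum_def algebra_simps zpow_mult minus_diff_commute)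
        qed
      next
        case i: 3
        consider "j + 2 < n" | "j + 2 = n" | "j + 2 > n" by linarith
        thus ?thesis
        proof cases
          case 1
          have *: "F i j = zsum 1 * zdiff (int j)" "F (n - 2) j = zsum 1 * (zdiff (int j) * zsum 1)"
            using 1 assms ij i by (auto simp: F_def m_def of_nat_diff)
          show ?thesis unfolding * using 1 i by (simp add: mult_ac)
        next
          case 2
          have *: "F i j = zsum 1 * zdiff (int j)" "F (n - 2) j = zsum 1 * (zdiff (int j) * zsum 1)"
            using 2 assms ij i by (auto simp: F_def m_def of_nat_diff)
          show ?thesis unfolding * using 2 i by (simp add: mult_ac)
        next
          case 3
          have *: "F i j = (if i = j then zdiff (m + 1) else zdiff (m - 1))" "F (n - 2) j = zsum 1 * zdiff (m - 1)"
            using 3 assms ij i by (auto simp: F_def m_def of_nat_diff)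
          show ?thesis unfolding * using 3 i by (simp add: zdiff_def zsum_def algebra_simps zpow_mult minus_diff_commute)
        qed
      qed
    qed
    finally show "(\<Sum>k\<in>simple_nodes (TypeD n). quantum_cartan (TypeD n) i k * F k j) = (if i = j then zdiff 2 * zsum m else 0)" .
    have S2: "zdiff 2 = zdiff 1 * zsum 1"
      using zdiff_double[of 1] by simp
    have 1: "laurent_poly (zsum 1 * (zdiff k * x) * (- zpow (2 * m) * zdiff m / zdiff 2))" if "laurent_poly x" for k x
    proof -
      have "laurent_poly (zdiff k / zdiff 1 * (x * (- zpow (2 * m) * zdiff m)))"
        using that by (intro laurent_poly_mult laurent_poly_uminus laurent_poly_zdiff_div) simp_all
      also have "zdiff k / zdiff 1 * (x * (- zpow (2 * m) * zdiff m)) = zsum 1 * (zdiff k * x) * (- zpow (2 * m) * zdiff m / zdiff 2)"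
        unfolding S2 using zsum_nz[of 1] zdiff_nz[of 1] by (simp add: field_simps)
      finally show ?thesis .
    qed
    have 2: "laurent_poly (zdiff (int n) * (- zpow (2 * m) * zdiff m / zdiff 2))" "laurent_poly (zdiff (int n - 2) * (- zpow (2 * m) * zdiff m / zdiff 2))"
      using laurent_poly_mult[OF laurent_poly_zdiff_zdiff_div_2[of m] laurent_poly_uminus[OF laurent_poly_zpow[of "2 * m"]]]
        laurent_poly_mult[OF laurent_poly_zdiff_zdiff_div_2[of "int n - 2"] laurent_poly_uminus[OF laurent_poly_zpow[of "2 * m"]]]
      by (simp_all add: m_def mult_ac)
    from 1[of 1 "int i"] 1[of 1 "int j"] 1[of "zsum (m - int j)" "int i"] 1[of "zsum (m - int i)" "int j"] 2
    show "laurent_poly (F i j * (- zpow (2 * m) * zdiff m / zdiff 2))"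
      by (auto simp: F_def)
  next
    show "zdiff 2 * zsum m * (- zpow (2 * m) * zdiff m / zdiff 2) = 1 - zpow (2 * (2 * m))"
      unfolding one_minus_zpow zdiff_double[of m] using zdiff_nz[of 2] by simp
  qed
  thus ?thesis by (auto simp: m_def algebra_simps)
qed

section \<open>The exceptional types\<close>

text \<open>
  Laurent polynomials invariant under \<open>z \<mapsto> z\<^sup>-\<^sup>1\<close> are represented by their coefficients at
  \<open>1, z + z\<^sup>-\<^sup>1, z\<^sup>2 + z\<^sup>-\<^sup>2, \<dots>\<close>.
\<close>

primrec pal :: "nat \<Rightarrow> int list \<Rightarrow> rat fls" where
  "pal k [] = 0"
| "pal k (x # xs) = of_int x * (if k = 0 then 1 else zsum (int k)) + pal (Suc k) xs"

fun list_add :: "int list \<Rightarrow> int list \<Rightarrow> int list" where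
  "list_add [] ys = ys"
| "list_add xs [] = xs"
| "list_add (x # xs) (y # ys) = (x + y) # list_add xs ys"

text \<open>Multiplication by z + z^(-1): the coefficients are shifted in both directions. The term
  y (z + z^(-1)) meets the constant term twice, whence \<open>2 * y\<close>.\<close>

fun pal_zsum1 :: "int list \<Rightarrow> int list" where
  "pal_zsum1 [] = []"
| "pal_zsum1 [x] = [0, x]"
| "pal_zsum1 (x # y # ys) = list_add (0 # x # y # ys) (2 * y # ys)"

definition pal_zsum2 :: "int list \<Rightarrow> int list" where
  "pal_zsum2 xs = list_add (pal_zsum1 (pal_zsum1 xs)) (map (\<lambda>x. - 2 * x) xs)"

lemma pal_list_add: "pal k (list_add xs ys) = pal k xs + pal k ys"
  by (induction xs ys arbitrary: k rule: list_add.induct) (simp_all add: algebra_simps)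

lemma pal_scale: "pal k (map (\<lambda>x. c * x) xs) = of_int c * pal k xs"
  by (induction xs arbitrary: k) (simp_all add: algebra_simps)

lemma pal_neg: "pal k (map uminus xs) = - pal k xs"
  by (induction xs arbitrary: k) simp_all

lemma pal_zero: "list_all (\<lambda>x. x = 0) xs \<Longrightarrow> pal k xs = 0"
  by (induction xs arbitrary: k) simp_all

lemma laurent_poly_pal: "laurent_poly (pal k xs)"
proof (induction xs arbitrary: k)
  case (Cons x xs)
  have "of_int x = (fls_const (of_int x) * 1 :: rat fls)"
    by (simp add: fls_of_int)
  hence "laurent_poly (of_int x)"
    by (metis laurent_poly_1 laurent_poly_const_mult)
  thus ?case
    using Cons by (auto intro!: laurent_poly_add laurent_poly_mult)
qed simp

lemma zsum1_pal: "2 \<le> k \<Longrightarrow> zsum 1 * pal k xs = pal (Suc k) xs + pal (k - 1) xs"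
proof (induction xs arbitrary: k)
  case (Cons x xs)
  have "zsum 1 * zsum (int k) = zsum (int k + 1) + zsum (int k - 1)"
    using zsum_zsum[of "int k" 1] by (simp add: mult.commute)
  hence "zsum 1 * (of_int x * zsum (int k)) = of_int x * zsum (int k + 1) + of_int x * zsum (int k - 1)"
    by (metis distrib_left mult.left_commute)
  thus ?case
    using Cons.prems Cons.IH[of "Suc k"] by (simp add: distrib_left of_nat_diff algebra_simps)
qed simp

lemma pal_pal_zsum1: "pal 0 (pal_zsum1 xs) = zsum 1 * pal 0 xs"
proof (cases xs rule: pal_zsum1.cases)
  case (3 x y ys)
  have "zsum 1 * zsum 1 = zsum 2 + 2"
    using zsum_zsum[of 1 1] by (simp add: zsum_0)
  hence "zsum 1 * (of_int y * zsum 1) = of_int y * zsum 2 + of_int (2 * y)"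
    by (metis (no_types, lifting) distrib_left mult.left_commute mult.commute of_int_mult of_int_numeral)
  thus ?thesis
    using 3 zsum1_pal[of 2 ys] by (simp add: pal_list_add distrib_left eval_nat_numeral algebra_simps)
qed simp_all

lemma pal_pal_zsum2: "pal 0 (pal_zsum2 xs) = zsum 2 * pal 0 xs"
proof -
  have "zsum 2 = zsum 1 * zsum 1 - 2"
    using zsum_zsum[of 1 1] by (simp add: zsum_0)
  thus ?thesis
    unfolding pal_zsum2_def pal_list_add pal_pal_zsum1 pal_scale by (simp add: left_diff_distrib mult.assoc)
qed

section \<open>Certificates for the exceptional types\<close>

lemma quantum_cartan_E:
  "quantum_cartan (TypeE n) i k =
    (if i = k then zsum 1 else if dynkin_edge (TypeE n) i k \<or> dynkin_edge (TypeE n) k i then - 1 else 0)"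
proof (cases "i = k")
  case False
  have off: "off_entry (TypeE n) i k = (if dynkin_edge (TypeE n) i k \<or> dynkin_edge (TypeE n) k i then 1 else 0)"
    using False by (simp add: off_entry_eq)
  show ?thesis
  proof (cases "dynkin_edge (TypeE n) i k \<or> dynkin_edge (TypeE n) k i")
    case True
    thus ?thesis using quantum_cartan_entry(2)[OF False, of "TypeE n"] False off by presburger
  next
    case nedge: False
    thus ?thesis using quantum_cartan_entry(1)[OF False, of "TypeE n"] False off by presburger
  qed
qed (simp add: quantum_cartan_diag_zsum)

text \<open>Explicit solutions A, W of C(z) A = W times the identity, as verified by evaluation
  below; entry (i, j) is the coefficient list of a symmetric Laurent polynomial. At z = 1 the
  scalars W of E6, E7, E8 and F4 take the values 3, 2, 1 and 1, the determinants of the Cartan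
  matrices.\<close>

definition E6_adj :: "int list list list" where
  "E6_adj =
    [[[0,0,0,1,0,1],[1,0,1],[1,0,1,0,1],[0,2,0,1],[2,0,1],[0,1]],
     [[1,0,1],[0,1,0,1,0,1],[0,2,0,1],[3,0,2,0,1],[0,2,0,1],[1,0,1]],
     [[1,0,1,0,1],[0,2,0,1],[0,2,0,2,0,1],[4,0,3,0,1],[0,3,0,1],[2,0,1]],
     [[0,2,0,1],[3,0,2,0,1],[4,0,3,0,1],[0,5,0,3,0,1],[4,0,3,0,1],[0,2,0,1]],
     [[2,0,1],[0,2,0,1],[0,3,0,1],[4,0,3,0,1],[0,2,0,2,0,1],[1,0,1,0,1]],
     [[0,1],[1,0,1],[2,0,1],[0,2,0,1],[1,0,1,0,1],[0,0,0,1,0,1]]]"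

definition E6_det :: "int list" where
  "E6_det = [-1,0,0,0,1,0,1]"

definition E7_adj :: "int list list list" where
  "E7_adj =
    [[[0,0,0,0,1,0,1],[0,1,0,1],[0,1,0,1,0,1],[2,0,2,0,1],[0,2,0,1],[2,0,1],[0,1]],
     [[0,1,0,1],[1,0,1,0,1,0,1],[2,0,2,0,1],[0,3,0,2,0,1],[3,0,2,0,1],[0,2,0,1],[1,0,1]],
     [[0,1,0,1,0,1],[2,0,2,0,1],[2,0,2,0,2,0,1],[0,4,0,3,0,1],[4,0,3,0,1],[0,3,0,1],[2,0,1]],
     [[2,0,2,0,1],[0,3,0,2,0,1],[0,4,0,3,0,1],[6,0,5,0,3,0,1],[0,5,0,3,0,1],[4,0,3,0,1],[0,2,0,1]],
     [[0,2,0,1],[3,0,2,0,1],[4,0,3,0,1],[0,5,0,3,0,1],[3,0,3,0,2,0,1],[0,2,0,2,0,1],[1,0,1,0,1]],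
     [[2,0,1],[0,2,0,1],[0,3,0,1],[4,0,3,0,1],[0,2,0,2,0,1],[0,0,1,0,2,0,1],[0,0,0,1,0,1]],
     [[0,1],[1,0,1],[2,0,1],[0,2,0,1],[1,0,1,0,1],[0,0,0,1,0,1],[-1,0,0,0,1,0,1]]]"

definition E7_det :: "int list" where
  "E7_det = [0,-1,0,0,0,1,0,1]"

definition E8_adj :: "int list list list" where
  "E8_adj =
    [[[0,0,0,0,0,1,0,1],[1,0,1,0,1],[1,0,1,0,1,0,1],[0,2,0,2,0,1],[2,0,2,0,1],[0,2,0,1],[2,0,1],[0,1]],
     [[1,0,1,0,1],[0,1,0,1,0,1,0,1],[0,2,0,2,0,1],[3,0,3,0,2,0,1],[0,3,0,2,0,1],[3,0,2,0,1],[0,2,0,1],[1,0,1]],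
     [[1,0,1,0,1,0,1],[0,2,0,2,0,1],[0,2,0,2,0,2,0,1],[4,0,4,0,3,0,1],[0,4,0,3,0,1],[4,0,3,0,1],[0,3,0,1],[2,0,1]],
     [[0,2,0,2,0,1],[3,0,3,0,2,0,1],[4,0,4,0,3,0,1],[0,6,0,5,0,3,0,1],[6,0,5,0,3,0,1],[0,5,0,3,0,1],[4,0,3,0,1],[0,2,0,1]],
     [[2,0,2,0,1],[0,3,0,2,0,1],[0,4,0,3,0,1],[6,0,5,0,3,0,1],[0,4,0,3,0,2,0,1],[3,0,3,0,2,0,1],[0,2,0,2,0,1],[1,0,1,0,1]],
     [[0,2,0,1],[3,0,2,0,1],[4,0,3,0,1],[0,5,0,3,0,1],[3,0,3,0,2,0,1],[0,1,0,2,0,2,0,1],[0,0,1,0,2,0,1],[0,0,0,1,0,1]],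
     [[2,0,1],[0,2,0,1],[0,3,0,1],[4,0,3,0,1],[0,2,0,2,0,1],[0,0,1,0,2,0,1],[0,-1,0,1,0,2,0,1],[-1,0,0,0,1,0,1]],
     [[0,1],[1,0,1],[2,0,1],[0,2,0,1],[1,0,1,0,1],[0,0,0,1,0,1],[-1,0,0,0,1,0,1],[0,-1,0,0,0,1,0,1]]]"

definition E8_det :: "int list" where
  "E8_det = [-1,0,-1,0,0,0,1,0,1]"

definition F4_adj :: "int list list list" where
  "F4_adj =
    [[[0,0,0,0,1],[1,0,1],[0,1],[1]],
     [[1,0,1],[2,0,1,0,1],[0,1,0,1],[0,0,1]],
     [[2,0,1],[2,0,2,0,1],[0,1,0,1,0,1],[1,0,0,0,1]],
     [[0,1],[0,1,0,1],[1,0,0,0,1],[0,0,0,0,0,1]]]"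

definition F4_det :: "int list" where
  "F4_det = [-1,0,0,0,0,0,1]"

text \<open>The identity between C, A and W on integer coefficient lists, with nodes enumerated by a
  list, so that it can be decided by evaluation.\<close>

definition E_check :: "nat \<Rightarrow> int list list list \<Rightarrow> int list \<Rightarrow> bool" where
  "E_check n A W \<longleftrightarrow> (\<forall>i\<in>set [1..<n + 1]. \<forall>j\<in>set [1..<n + 1]. list_all (\<lambda>x. x = 0)
     (foldr list_add (map (\<lambda>k. let x = A ! (k - 1) ! (j - 1) in
         if i = k then pal_zsum1 x else if dynkin_edge (TypeE n) i k \<or> dynkin_edge (TypeE n) k i then map uminus x
         else []) [1..<n + 1]) (if i = j then map uminus W else [])))"

lemma E_checkD:
  assumes "E_check n A W" "i \<in> {1..n}" "j \<in> {1..n}"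
  shows "(\<Sum>k\<in>{1..n}. quantum_cartan (TypeE n) i k * pal 0 (A ! (k - 1) ! (j - 1))) = (if i = j then pal 0 W else 0)"
proof -
  let ?f = "\<lambda>k. let x = A ! (k - 1) ! (j - 1) in
         if i = k then pal_zsum1 x else if dynkin_edge (TypeE n) i k \<or> dynkin_edge (TypeE n) k i then map uminus x
         else []"
  have fold: "pal 0 (foldr list_add xss ys) = (\<Sum>xs\<leftarrow>xss. pal 0 xs) + pal 0 ys" for xss ys
    by (induction xss) (simp_all add: pal_list_add)
  have "(\<Sum>k\<in>{1..n}. quantum_cartan (TypeE n) i k * pal 0 (A ! (k - 1) ! (j - 1))) = (\<Sum>k\<in>{1..n}. pal 0 (?f k))"
    by (intro sum.cong refl) (simp add: quantum_cartan_E pal_pal_zsum1 pal_neg Let_def del: dynkin_edge.simps)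
  also have "\<dots> = (\<Sum>xs\<leftarrow>map ?f [1..<n + 1]. pal 0 xs)"
    by (simp add: sum_set_upt_conv_sum_list_nat[symmetric] atLeastLessThanSuc_atLeastAtMost comp_def
        del: upt_Suc)
  also have "\<dots> = pal 0 (foldr list_add (map ?f [1..<n + 1]) (if i = j then map uminus W else [])) + (if i = j then pal 0 W else 0)"
    by (simp add: fold pal_neg del: upt_Suc)
  also have "pal 0 (foldr list_add (map ?f [1..<n + 1]) (if i = j then map uminus W else [])) = 0"
    using assms unfolding E_check_def by (intro pal_zero) (auto simp del: upt_Suc)
  finally show ?thesis by simp
qed

lemma E6_check: "E_check 6 E6_adj E6_det"
  by code_simp

lemma E7_check: "E_check 7 E7_adj E7_det"
  by code_simp

lemma E8_check: "E_check 8 E8_adj E8_det"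
  by code_simp

lemma certificate_E_aux:
  assumes "E_check n A W" "0 < l" "pal 0 W * R = 1 - zpow l" "laurent_poly R"
  shows "\<exists>Q. qc_certificate (TypeE n) l Q"
proof -
  have "qc_certificate (TypeE n) l (\<lambda>i j. pal 0 (A ! (i - 1) ! (j - 1)) * R)"
    by (rule qc_certificateI)
       (use assms E_checkD[OF assms(1)] in \<open>auto simp: simple_nodes_def intro: laurent_poly_mult laurent_poly_pal\<close>)
  thus ?thesis by blast
qed

lemma certificate_E:
  assumes "n \<in> {6, 7, 8}"
  shows "\<exists>Q. qc_certificate (TypeE n) (2 * int (dual_coxeter (TypeE n))) Q"
proof -
  have pal6: "pal 0 E6_det = zsum 6 + zsum 4 - 1"
    by (simp add: E6_det_def eval_nat_numeral)
  \<comment> \<open>The zeros of W are the numbers exp(\<pi> i m / h) for the exponents m and their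
    inverses, all of them 2h-th roots of unity. The second factor is the cofactor in 1 - z^(2h), for
    h = 12; E7 and E8 are analogous with h = 18 and h = 30.\<close>
  have 6: "pal 0 E6_det * (- zpow 12 * (zsum 3 * zsum 2 * zdiff 1)) = 1 - zpow (2 * 12)"
    unfolding pal6 by (simp add: zdiff_def zsum_def algebra_simps zpow_mult)
  have pal7: "pal 0 E7_det = zsum 7 + zsum 5 - zsum 1"
    by (simp add: E7_det_def eval_nat_numeral)
  have 7: "pal 0 E7_det * (- zpow 18 * (zdiff 9 * (zsum 2 - 1))) = 1 - zpow (2 * 18)"
    unfolding pal7 by (simp add: zdiff_def zsum_def algebra_simps zpow_mult)
  have pal8: "pal 0 E8_det = zsum 8 + zsum 6 - zsum 2 - 1"
    by (simp add: E8_det_def eval_nat_numeral)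
  have 8: "pal 0 E8_det * (- zpow 30 * (zdiff 15 * (zsum 4 - zsum 2 + 1) * zsum 3)) = 1 - zpow (2 * 30)"
    unfolding pal8 by (simp add: zdiff_def zsum_def algebra_simps zpow_mult)
  have "laurent_poly (- zpow 12 * (zsum 3 * zsum 2 * zdiff 1))" "laurent_poly (- zpow 18 * (zdiff 9 * (zsum 2 - 1)))"
      "laurent_poly (- zpow 30 * (zdiff 15 * (zsum 4 - zsum 2 + 1) * zsum 3))"
    by (intro laurent_poly_mult laurent_poly_uminus laurent_poly_diff laurent_poly_add laurent_poly_zdiff
        laurent_poly_zsum laurent_poly_zpow laurent_poly_1)+
  thus ?thesis
    using assms certificate_E_aux[OF E6_check _ 6] certificate_E_aux[OF E7_check _ 7] certificate_E_aux[OF E8_check _ 8]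
    by auto
qed

lemma certificate_F4: "\<exists>Q. qc_certificate TypeF4 36 Q"
proof -
  let ?F = "\<lambda>i j. pal 0 (F4_adj ! (i - 1) ! (j - 1))"
  have nodes: "simple_nodes TypeF4 = {1, 2, 3, 4}"
    by (auto simp: simple_nodes_def)
  have W: "pal 0 F4_det = zsum 6 - 1"
    by (simp add: F4_det_def eval_nat_numeral)
  \<comment> \<open>The cofactor comes from \<open>(zsum 6 - 1) * zsum 3 = zsum 9\<close> and
    \<open>zdiff 9 * zsum 9 = zdiff 18\<close>.\<close>
  have "qc_certificate TypeF4 36 (\<lambda>i j. ?F i j * (- zpow 18 * (zdiff 9 * zsum 3)))"
  proof (rule qc_certificateI)
    fix i j assume ij: "i \<in> simple_nodes TypeF4" "j \<in> simple_nodes TypeF4"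
    have qc: "quantum_cartan TypeF4 1 2 = - 1" "quantum_cartan TypeF4 2 1 = - 1" "quantum_cartan TypeF4 2 3 = - 1"
      "quantum_cartan TypeF4 3 2 = - zsum 1" "quantum_cartan TypeF4 3 4 = - 1" "quantum_cartan TypeF4 4 3 = - 1"
      "quantum_cartan TypeF4 1 3 = 0" "quantum_cartan TypeF4 1 4 = 0" "quantum_cartan TypeF4 2 4 = 0"
      "quantum_cartan TypeF4 3 1 = 0" "quantum_cartan TypeF4 4 1 = 0" "quantum_cartan TypeF4 4 2 = 0"
      by (simp_all add: quantum_cartan_entry off_entry_eq)
    have sum: "(\<Sum>k\<in>simple_nodes TypeF4. quantum_cartan TypeF4 i k * f k) =
      (if i = 1 then zsum 2 * f 1 - f 2 else if i = 2 then zsum 2 * f 2 - f 1 - f 3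
       else if i = 3 then zsum 1 * f 3 - zsum 1 * f 2 - f 4 else zsum 1 * f 4 - f 3)" for f
      using ij(1) unfolding nodes by (auto simp: qc[unfolded One_nat_def] quantum_cartan_diag_zsum)
    show "(\<Sum>k\<in>simple_nodes TypeF4. quantum_cartan TypeF4 i k * ?F k j) = (if i = j then pal 0 F4_det else 0)"
      unfolding sum W pal_pal_zsum1[symmetric] pal_pal_zsum2[symmetric] using ij unfolding nodes
      by (auto simp: F4_adj_def pal_zsum2_def eval_nat_numeral)
  next
    show "pal 0 F4_det * (- zpow 18 * (zdiff 9 * zsum 3)) = 1 - zpow 36"
      unfolding W by (simp add: zdiff_def zsum_def algebra_simps zpow_mult)
  qed (auto intro!: laurent_poly_mult laurent_poly_uminus laurent_poly_pal)
  thus ?thesis by blast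
qed

lemma certificate_G2: "\<exists>Q. qc_certificate TypeG2 24 Q"
proof -
  define F where "F i j = (if i = 1 then (if j = 1 then zsum 3 else zsum 2 + 1) else if j = 1 then 1 else zsum 1)"
    for i j :: nat
  have nodes: "simple_nodes TypeG2 = {1, 2}"
    by (auto simp: simple_nodes_def)
  \<comment> \<open>The cofactor comes from \<open>(zsum 4 - 1) * zsum 2 = zsum 6\<close> and
    \<open>zdiff 6 * zsum 6 = zdiff 12\<close>.\<close>
  have "qc_certificate TypeG2 24 (\<lambda>i j. F i j * (- zpow 12 * (zdiff 6 * zsum 2)))"
  proof (rule qc_certificateI)
    fix i j assume "i \<in> simple_nodes TypeG2" "j \<in> simple_nodes TypeG2"
    moreover have "quantum_cartan TypeG2 (Suc 0) 2 = - (zsum 2 + 1)" "quantum_cartan TypeG2 2 (Suc 0) = - 1"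
      by (simp_all add: quantum_cartan_entry off_entry_eq)
    ultimately show "(\<Sum>k\<in>simple_nodes TypeG2. quantum_cartan TypeG2 i k * F k j) = (if i = j then zsum 4 - 1 else 0)"
      unfolding nodes
      by (auto simp: F_def quantum_cartan_diag_zsum zsum_zsum zsum_0 distrib_left distrib_right left_diff_distrib)
    show "laurent_poly (F i j * (- zpow 12 * (zdiff 6 * zsum 2)))"
      by (auto simp: F_def intro!: laurent_poly_mult laurent_poly_uminus laurent_poly_add)
  next
    show "(zsum 4 - 1) * (- zpow 12 * (zdiff 6 * zsum 2)) = 1 - zpow 24"
      by (simp add: zdiff_def zsum_def algebra_simps zpow_mult)
  qed simp
  thus ?thesis by blast
qed

theorem certificate_exists:
  assumes "is_simple_type \<gg>"
  shows "\<exists>Q. qc_certificate \<gg> (2 * int (lacing \<gg>) * int (dual_coxeter \<gg>)) Q"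
  using assms certificate_A certificate_B certificate_C certificate_D certificate_E certificate_F4 certificate_G2
  by (cases \<gg>) (auto simp: of_nat_diff algebra_simps)

section \<open>Affine Cartan matrices\<close>

lemma symmetrizer_cases: "symmetrizer \<gg> i = 1 \<or> symmetrizer \<gg> i = lacing \<gg>"
  by (cases \<gg>) auto

lemma lacing_pos: "0 < lacing \<gg>"
  by (cases \<gg>) auto

lemma cartan_sym: "int (symmetrizer \<gg> i) * cartan \<gg> i j = int (symmetrizer \<gg> j) * cartan \<gg> j i"
proof -
  have "symmetrizer \<gg> i dvd max (symmetrizer \<gg> i) (symmetrizer \<gg> j)" for i j
    using symmetrizer_cases[of \<gg> i] symmetrizer_cases[of \<gg> j] lacing_pos[of \<gg>] by (auto simp: max_def)
  hence "int (symmetrizer \<gg> i) * int (max (symmetrizer \<gg> i) (symmetrizer \<gg> j) div symmetrizer \<gg> i) =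
      int (max (symmetrizer \<gg> i) (symmetrizer \<gg> j))" for i j
    unfolding of_nat_mult[symmetric] by (simp only: dvd_mult_div_cancel)
  from this[of i j] this[of j i] show ?thesis
    unfolding cartan_def Let_def by (auto simp: max.commute)
qed

text \<open>The value of the i-th simple coroot on the highest root \<theta>.\<close>

definition theta_coroot :: "cartan_type \<Rightarrow> nat \<Rightarrow> int" where
  "theta_coroot \<gg> i = (\<Sum>t\<leftarrow>theta_word \<gg>. cartan \<gg> i t)"

lemma sum_list_rev_map: "(\<Sum>x\<leftarrow>rev xs. f x) = (\<Sum>x\<leftarrow>xs. f x :: int)"
  by (simp add: rev_map[symmetric])

lemma sum_list_chain:
  fixes f :: "nat \<Rightarrow> int"
  assumes "0 < i" "\<And>t. t \<in> {a..<b} \<Longrightarrow> f t = (if t = i then x else 0) + (if t = i + 1 then u else 0) + (if t = i - 1 then l else 0)"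
  shows "(\<Sum>t\<leftarrow>[a..<b]. f t) = (if a \<le> i \<and> i < b then x else 0) + (if a \<le> i + 1 \<and> i + 1 < b then u else 0)
     + (if a \<le> i - 1 \<and> i - 1 < b then l else 0)"
proof -
  have "(\<Sum>t\<leftarrow>[a..<b]. f t) = (\<Sum>t\<in>{a..<b}. (if t = i then x else 0) + (if t = i + 1 then u else 0) + (if t = i - 1 then l else 0))"
    unfolding interv_sum_list_conv_sum_set_nat set_upt by (intro sum.cong refl assms)
  thus ?thesis by (simp add: sum.distrib)
qed

text \<open>Nonnegativity says that \<theta> is dominant, so that the affine off-diagonal entries
  have the right sign. Divisibility says that the \<open>div\<close> in \<open>affine_cartan\<close>
  is exact, which is needed for its symmetrizability.\<close>

lemma theta_coroot:
  assumes "is_simple_type \<gg>" "i \<in> {1..lie_rank \<gg>}"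
  shows "0 \<le> theta_coroot \<gg> i \<and> int (lacing \<gg>) dvd int (symmetrizer \<gg> i) * theta_coroot \<gg> i"
proof (cases \<gg>)
  case (TypeA n)
  have "(\<Sum>t\<leftarrow>[1..<n + 1]. cartan (TypeA n) i t) = 2 + (if i + 1 < n + 1 then - 1 else 0) + (if 1 \<le> i - 1 \<and> i - 1 < n + 1 then - 1 else 0)"
    using assms unfolding TypeA by (subst sum_list_chain[where i = i and x = 2 and u = "- 1" and l = "- 1"]) (auto simp: cartan_def Let_def)
  thus ?thesis by (simp add: TypeA theta_coroot_def del: upt_Suc)
next
  case (TypeB n)
  let ?l = "if i = n then - 2 else - 1 :: int"
  have c: "cartan (TypeB n) i t = (if t = i then 2 else 0) + (if t = i + 1 then - 1 else 0) + (if t = i - 1 then ?l else 0)"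
    if "t \<in> {1..n}" for t
    using that assms unfolding TypeB by (auto simp: cartan_def Let_def)
  have "(\<Sum>t\<leftarrow>[1..<n + 1]. cartan (TypeB n) i t) = 2 + (if i + 1 < n + 1 then - 1 else 0) + (if 1 \<le> i - 1 \<and> i - 1 < n + 1 then ?l else 0)"
    "(\<Sum>t\<leftarrow>[2..<n + 1]. cartan (TypeB n) i t) = (if 2 \<le> i then 2 else 0) + (if i + 1 < n + 1 then - 1 else 0) + (if 2 \<le> i - 1 \<and> i - 1 < n + 1 then ?l else 0)"
    using assms unfolding TypeB
    by (subst sum_list_chain[where i = i and x = 2 and u = "- 1" and l = ?l, OF _ c]; auto)+
  moreover have "n \<ge> 2" "1 \<le> i" "i \<le> n" using assms by (simp_all add: TypeB)
  ultimately show ?thesis by (auto simp: TypeB theta_coroot_def sum_list_rev_map simp del: upt_Suc)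
next
  case (TypeC n)
  let ?u = "if i + 1 = n then - 2 else - 1 :: int"
  have c: "cartan (TypeC n) i t = (if t = i then 2 else 0) + (if t = i + 1 then ?u else 0) + (if t = i - 1 then - 1 else 0)"
    if "t \<in> {1..n}" for t
    using that assms unfolding TypeC by (auto simp: cartan_def Let_def)
  have s: "(\<Sum>t\<leftarrow>[1..<b]. cartan (TypeC n) i t) = (if i < b then 2 else 0) + (if i + 1 < b then ?u else 0) + (if 1 \<le> i - 1 \<and> i - 1 < b then - 1 else 0)"
    if "b \<le> n + 1" for b
    using assms that unfolding TypeC
    by (subst sum_list_chain[where i = i and x = 2 and u = ?u and l = "- 1", OF _ c]; auto)
  have n: "n \<ge> 3" "1 \<le> i" "i \<le> n" using assms by (simp_all add: TypeC)
  have "theta_coroot (TypeC n) i = (\<Sum>t\<leftarrow>[1..<n + 1]. cartan (TypeC n) i t) + (\<Sum>t\<leftarrow>[1..<n]. cartan (TypeC n) i t)"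
    by (simp add: theta_coroot_def sum_list_rev_map del: upt_Suc)
  also have "\<dots> = (if i = 1 then 2 else 0)"
  proof -
    obtain k where k: "i = Suc k" using n by (cases i) auto
    have "Suc k \<le> n" "3 \<le> n" using n k by auto
    then consider "n = Suc k" "0 < k" | "n = Suc (Suc k)" "0 < k" | "0 < k" "Suc (Suc k) < n" | "k = 0" "Suc (Suc k) < n"
      by linarith
    thus ?thesis
      unfolding s[OF order_refl] s[OF le_add1] unfolding k by cases simp_all
  qed
  finally show ?thesis by (simp add: TypeC)
next
  case (TypeD n)
  have n: "n \<ge> 4" "1 \<le> i" "i \<le> n" using assms by (simp_all add: TypeD)
  have upt: "[1..<n + 1] = [1..<n] @ [n]" using n by simp
  \<comment> \<open>Along 1, ..., n - 1 the diagram is a chain, but node n is attached to n - 2. So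
    for i = n the chain terms are set to 0 and the branch enters as a separate fourth term.\<close>
  let ?x = "if i = n then 0 else 2 :: int" and ?l = "if i = n then 0 else - 1 :: int"
  have c: "cartan (TypeD n) i t = (if t = i then ?x else 0) + (if t = i + 1 then - 1 else 0) + (if t = i - 1 then ?l else 0)
     + (if t = n - 2 \<and> i = n then - 1 else 0)"
    if "t \<in> {1..<n}" for t
  proof -
    consider "t = i" | "t = i + 1" | "t = i - 1" "t \<noteq> i" "i = t + 1" | "t \<noteq> i" "t \<noteq> i + 1" "t \<noteq> i - 1" "i \<noteq> t + 1"
      using n by linarith
    thus ?thesis
      by cases (use that n in \<open>auto simp: cartan_def Let_def\<close>)
  qed
  have s: "(\<Sum>t\<leftarrow>[a..<b]. cartan (TypeD n) i t) = (if a \<le> i \<and> i < b then ?x else 0) + (if a \<le> i + 1 \<and> i + 1 < b then - 1 else 0)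
     + (if a \<le> i - 1 \<and> i - 1 < b then ?l else 0) + (if a \<le> n - 2 \<and> n - 2 < b \<and> i = n then - 1 else 0)"
    if "1 \<le> a" "b \<le> n" for a b
  proof -
    have "(\<Sum>t\<leftarrow>[a..<b]. cartan (TypeD n) i t) = (\<Sum>t\<in>{a..<b}. ((if t = i then ?x else 0) + (if t = i + 1 then - 1 else 0) + (if t = i - 1 then ?l else 0))
       + (if t = n - 2 then if i = n then - 1 else 0 else 0))"
      unfolding interv_sum_list_conv_sum_set_nat set_upt using that by (intro sum.cong refl) (subst c, auto)
    thus ?thesis by (simp add: sum.distrib)
  qed
  have "cartan (TypeD n) i n = (if i = n then 2 else if i = n - 2 then - 1 else 0)"
    using n by (auto simp: cartan_def Let_def)
  hence "theta_coroot (TypeD n) i = (\<Sum>t\<leftarrow>[1..<n]. cartan (TypeD n) i t) + (if i = n then 2 else if i = n - 2 then - 1 else 0)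
      + (\<Sum>t\<leftarrow>[2..<n - 1]. cartan (TypeD n) i t)"
    unfolding theta_coroot_def theta_word.simps upt by (simp add: sum_list_rev_map del: upt_Suc)
  also have "0 \<le> \<dots>"
  proof -
    obtain k where k: "i = Suc k" using n by (cases i) auto
    obtain m where m: "n = Suc (Suc m)" using n by (cases n; cases "n - 1") auto
    have "k \<le> Suc m" "2 \<le> m" using n k m by auto
    then consider "k = Suc m" | "k = m" | "m = Suc k" "1 < k" | "m = Suc k" "1 = k" | "1 < k" "Suc k < m" | "k = 1" "Suc k < m" | "k = 0" "Suc k < m"
      by linarith
    thus ?thesis
      unfolding s[OF order_refl order_refl] s[OF one_le_numeral diff_le_self] unfolding k m by cases (use \<open>2 \<le> m\<close> in simp_all)
  qed
  finally show ?thesis by (simp add: TypeD)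
next
  case (TypeE n)
  have "\<forall>i\<in>set [1..<7]. 0 \<le> theta_coroot (TypeE 6) i" "\<forall>i\<in>set [1..<8]. 0 \<le> theta_coroot (TypeE 7) i"
    "\<forall>i\<in>set [1..<9]. 0 \<le> theta_coroot (TypeE 8) i"
    by code_simp+
  thus ?thesis using assms by (auto simp: TypeE)
next
  case TypeF4
  have "\<forall>i\<in>set [1..<5]. 0 \<le> theta_coroot TypeF4 i \<and> even (int (symmetrizer TypeF4 i) * theta_coroot TypeF4 i)"
    by code_simp
  thus ?thesis using assms by (auto simp: TypeF4)
next
  case TypeG2
  have "\<forall>i\<in>set [1..<3]. 0 \<le> theta_coroot TypeG2 i \<and> 3 dvd (int (symmetrizer TypeG2 i) * theta_coroot TypeG2 i)"
    by code_simp
  thus ?thesis using assms by (auto simp: TypeG2)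
qed

lemma symmetrizer_0: "is_simple_type \<gg> \<Longrightarrow> symmetrizer \<gg> 0 = lacing \<gg>"
  by (cases \<gg>) auto

lemma affine_cartan_diag: "affine_cartan \<gg> i i = 2"
  by (simp add: affine_cartan_def cartan_diag)

lemma affine_cartan_0_right: "0 < i \<Longrightarrow> affine_cartan \<gg> i 0 = - theta_coroot \<gg> i"
  by (simp add: affine_cartan_def theta_coroot_def)

lemma affine_cartan_0_left:
  "0 < i \<Longrightarrow> affine_cartan \<gg> 0 i = - (int (symmetrizer \<gg> i) * theta_coroot \<gg> i div int (lacing \<gg>))"
  by (simp add: affine_cartan_def theta_coroot_def cartan_sym[of \<gg> _ i] sum_list_const_mult)

lemma affine_cartan_simple: "0 < i \<Longrightarrow> 0 < j \<Longrightarrow> affine_cartan \<gg> i j = cartan \<gg> i j"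
  by (simp add: affine_cartan_def)

lemma affine_cartan_offdiag:
  assumes "is_simple_type \<gg>" "i \<le> lie_rank \<gg>" "j \<le> lie_rank \<gg>" "i \<noteq> j"
  shows "affine_cartan \<gg> i j \<le> 0"
proof -
  have th: "0 \<le> theta_coroot \<gg> k" if "0 < k" "k \<le> lie_rank \<gg>" for k
    using theta_coroot[OF assms(1), of k] that by auto
  consider "i = 0" "0 < j" | "j = 0" "0 < i" | "0 < i" "0 < j" using assms by auto
  thus ?thesis
    by cases (use assms th in \<open>auto simp: affine_cartan_0_left affine_cartan_0_right affine_cartan_simple
      cartan_offdiag lacing_pos pos_imp_zdiv_nonneg_iff intro!: mult_nonneg_nonneg\<close>)
qed

lemma affine_cartan_sym:
  assumes "is_simple_type \<gg>" "i \<le> lie_rank \<gg>" "j \<le> lie_rank \<gg>"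
  shows "int (symmetrizer \<gg> i) * affine_cartan \<gg> i j = int (symmetrizer \<gg> j) * affine_cartan \<gg> j i"
proof -
  have th: "int (lacing \<gg>) * (int (symmetrizer \<gg> k) * theta_coroot \<gg> k div int (lacing \<gg>)) = int (symmetrizer \<gg> k) * theta_coroot \<gg> k"
    if "0 < k" "k \<le> lie_rank \<gg>" for k
    using theta_coroot[OF assms(1), of k] that by (auto intro: dvd_mult_div_cancel)
  consider "i = j" | "i = 0" "0 < j" | "j = 0" "0 < i" | "0 < i" "0 < j" using assms by auto
  thus ?thesis
    by cases (use assms th[of i] th[of j] cartan_sym[of \<gg> i j] in \<open>simp_all add: affine_cartan_0_left affine_cartan_0_right
      affine_cartan_simple symmetrizer_0\<close>)
qed

section \<open>Infinite products\<close>

lemma power_int_fps_mult: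
  fixes x y :: "'a :: field fps"
  shows "(x * y) powi n = x powi n * y powi n"
  by (simp add: power_int_def power_mult_distrib fps_inverse_mult)

lemma power_int_fps_prod:
  fixes f :: "'b \<Rightarrow> 'a :: field fps"
  shows "(\<Prod>a\<in>A. f a) powi n = (\<Prod>a\<in>A. f a powi n)"
proof -
  have "1 powi n = (1 :: 'a fps)"
    by (simp add: power_int_def)
  thus ?thesis
    by (induction A rule: infinite_finite_induct) (simp_all add: power_int_fps_mult)
qed

text \<open>Expresses a coefficient of the inverse through lower ones, so that coefficientwise
  limits of inverses follow by induction.\<close>

lemma fps_nth_inverse_rec:
  fixes f :: "'a :: field fps"
  assumes "fps_nth f 0 = 1"
  shows "fps_nth (inverse f) n = (if n = 0 then 1 else - (\<Sum>i=1..n. fps_nth f i * fps_nth (inverse f) (n - i)))"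
proof (cases n)
  case (Suc m)
  have "f * inverse f = 1"
    using assms by (simp add: inverse_mult_eq_1')
  hence "(\<Sum>i=0..n. fps_nth f i * fps_nth (inverse f) (n - i)) = 0"
    using Suc unfolding fps_mult_nth[symmetric] by simp
  hence "fps_nth (inverse f) n + (\<Sum>i=1..n. fps_nth f i * fps_nth (inverse f) (n - i)) = 0"
    using assms by (simp add: sum.atLeast_Suc_atMost del: fps_inverse_0_iff)
  moreover have "n \<noteq> 0" using Suc by simp
  ultimately show ?thesis
    by (simp only: eq_neg_iff_add_eq_0 if_False)
qed (use assms in simp)

definition lin_fps :: "'a :: field \<Rightarrow> 'a fps" where
  "lin_fps a = 1 - fps_const a * fps_X"

definition scale_fps :: "'a :: field \<Rightarrow> 'a fps \<Rightarrow> 'a fps" where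
  "scale_fps a f = fps_compose f (fps_const a * fps_X)"

lemma nth_scale_fps [simp]: "fps_nth (scale_fps a f) n = a ^ n * fps_nth f n"
  by (simp add: scale_fps_def fps_compose_linear)

lemma scale_fps_mult: "scale_fps a (f * g) = scale_fps a f * scale_fps a g"
  by (simp add: scale_fps_def fps_compose_mult_distrib)

lemma scale_fps_1 [simp]: "scale_fps a 1 = 1"
  by (simp add: scale_fps_def)

lemma scale_fps_power: "scale_fps a (f ^ n) = scale_fps a f ^ n"
  by (induction n) (simp_all add: scale_fps_mult)

lemma scale_fps_prod: "scale_fps a (\<Prod>i\<in>A. f i) = (\<Prod>i\<in>A. scale_fps a (f i))"
  by (induction A rule: infinite_finite_induct) (simp_all add: scale_fps_mult)

lemma scale_fps_scale_fps: "scale_fps a (scale_fps b f) = scale_fps (a * b) f"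
  by (rule fps_ext) (simp add: power_mult_distrib)

lemma nth_lin_fps: "fps_nth (lin_fps a) n = (if n = 0 then 1 else if n = 1 then - a else 0)"
  by (auto simp: lin_fps_def fps_mult_left_const_nth)

lemma scale_lin_fps: "scale_fps a (lin_fps b) = lin_fps (a * b)"
  by (rule fps_ext) (auto simp: nth_lin_fps)

lemma lin_fps_0 [simp]: "fps_nth (lin_fps a) 0 = 1"
  by (simp add: nth_lin_fps)

lemma lin_fps_conv_poly: "lin_fps a = fps_of_poly [:1, - a:]"
  by (rule fps_ext) (auto simp: nth_lin_fps coeff_pCons split: nat.splits)

section \<open>Convergence with respect to the q-adic valuation\<close>

context quantum_loop_algebra
begin

lemma qpow_1: "qpow 1 = q_gen" and qpow_add: "qpow (x + y) = qpow x * qpow y"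
  and val_mult: "a \<noteq> 0 \<Longrightarrow> b \<noteq> 0 \<Longrightarrow> val (a * b) = val a + val b"
  and val_add: "a \<noteq> 0 \<Longrightarrow> b \<noteq> 0 \<Longrightarrow> a + b \<noteq> 0 \<Longrightarrow> min (val a) (val b) \<le> val (a + b)"
  and val_q: "val q_gen = 1"
  using puiseux unfolding puiseux_data_def by blast+

lemma q_gen_nz [simp]: "q_gen \<noteq> 0"
  by (simp add: q_gen_def Zero_fract_def eq_fract)

lemma qpow_nz [simp]: "qpow x \<noteq> 0"
proof
  assume "qpow x = 0"
  hence "qpow 1 = 0"
    using qpow_add[of x "1 - x"] by simp
  thus False by (simp add: qpow_1)
qed

lemma qpow_0: "qpow 0 = 1"
  using qpow_add[of 0 0] by simp

lemma qpow_of_nat_mult: "qpow (of_nat n * x) = qpow x ^ n"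
  by (induction n) (simp_all add: qpow_0 qpow_add distrib_right)

lemma val_1 [simp]: "val 1 = 0"
  using val_mult[of 1 1] by simp

lemma val_minus_1 [simp]: "val (- 1) = 0"
  using val_mult[of "-1" "-1"] by simp

lemma val_uminus [simp]: "val (- x) = val x"
  by (cases "x = 0") (use val_mult[of "-1" x] in auto)

lemma val_power: "x \<noteq> 0 \<Longrightarrow> val (x ^ n) = of_nat n * val x"
  by (induction n) (auto simp: val_mult algebra_simps)

lemma val_inverse: "x \<noteq> 0 \<Longrightarrow> val (inverse x) = - val x"
  using val_mult[of x "inverse x"] by simp

lemma val_powi: "x \<noteq> 0 \<Longrightarrow> val (x powi n) = of_int n * val x"
  by (auto simp: power_int_def val_power val_inverse)

definition val_ge :: "rat \<Rightarrow> kk \<Rightarrow> bool" where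
  "val_ge B x \<longleftrightarrow> x = 0 \<or> B \<le> val x"

lemma val_ge_0 [simp]: "val_ge B 0"
  by (simp add: val_ge_def)

lemma val_ge_add: "val_ge B x \<Longrightarrow> val_ge B y \<Longrightarrow> val_ge B (x + y)"
  using val_add[of x y] unfolding val_ge_def by fastforce

lemma val_ge_uminus [simp]: "val_ge B (- x) \<longleftrightarrow> val_ge B x"
  by (simp add: val_ge_def)

lemma val_ge_mult: "val_ge A x \<Longrightarrow> val_ge B y \<Longrightarrow> val_ge (A + B) (x * y)"
  unfolding val_ge_def by (metis add_mono mult_eq_0_iff val_mult)

lemma val_ge_mono: "val_ge B x \<Longrightarrow> A \<le> B \<Longrightarrow> val_ge A x"
  by (auto simp: val_ge_def)

lemma val_ge_ex: "\<exists>B. val_ge B x"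
  by (auto simp: val_ge_def)

lemma val_limit_altdef: "val_limit s l \<longleftrightarrow> (\<forall>B. \<exists>N0. \<forall>N\<ge>N0. val_ge B (s N - l))"
  by (simp add: val_limit_def val_ge_def)

lemma val_limit_unique:
  assumes "val_limit s l" "val_limit s l'"
  shows "l = l'"
proof (rule ccontr)
  assume "l \<noteq> l'"
  define B where "B = val (l' - l) + 1"
  obtain N0 N1 where "\<forall>N\<ge>N0. val_ge B (s N - l)" "\<forall>N\<ge>N1. val_ge B (s N - l')"
    using assms unfolding val_limit_altdef by blast
  hence "val_ge B (s (max N0 N1) - l)" "val_ge B (- (s (max N0 N1) - l'))"
    unfolding val_ge_uminus by (metis max.cobounded1, metis max.cobounded2)
  from val_ge_add[OF this] have "val_ge B (l' - l)"
    by simp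
  thus False using \<open>l \<noteq> l'\<close> by (simp add: val_ge_def B_def)
qed

lemma val_limit_const: "val_limit (\<lambda>_. l) l"
  by (simp add: val_limit_altdef)

lemma val_limit_add:
  assumes "val_limit s l" "val_limit t m"
  shows "val_limit (\<lambda>N. s N + t N) (l + m)"
  unfolding val_limit_altdef
proof
  fix B
  obtain N0 N1 where *: "\<forall>N\<ge>N0. val_ge B (s N - l)" "\<forall>N\<ge>N1. val_ge B (t N - m)"
    using assms unfolding val_limit_altdef by blast
  have "val_ge B (s N + t N - (l + m))" if "N \<ge> max N0 N1" for N
    using val_ge_add[of B "s N - l" "t N - m"] * that by (simp add: algebra_simps)
  thus "\<exists>N0. \<forall>N\<ge>N0. val_ge B (s N + t N - (l + m))" by blast
qed

lemma val_limit_mult: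
  assumes "val_limit s l" "val_limit t m"
  shows "val_limit (\<lambda>N. s N * t N) (l * m)"
  unfolding val_limit_altdef
proof
  fix B
  obtain b1 b2 where b: "val_ge b1 l" "val_ge b2 m" using val_ge_ex by metis
  define b where "b = min b1 b2"
  have b': "val_ge b l" "val_ge b m"
    using b by (auto intro: val_ge_mono simp: b_def)
  obtain N0 where N0: "\<And>N. N \<ge> N0 \<Longrightarrow> val_ge (max b (B - b)) (s N - l)"
    using assms(1) unfolding val_limit_altdef by blast
  obtain N1 where N1: "\<And>N. N \<ge> N1 \<Longrightarrow> val_ge (B - b) (t N - m)"
    using assms(2) unfolding val_limit_altdef by blast
  have "val_ge B (s N * t N - l * m)" if "N \<ge> max N0 N1" for N
  proof -
    have 1: "val_ge b (s N - l)" "val_ge (B - b) (s N - l)"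
      using val_ge_mono[OF N0[of N]] that by auto
    from val_ge_add[OF this(1) b'(1)] have "val_ge b (s N)" by simp
    from val_ge_mult[OF this N1[of N]] val_ge_mult[OF 1(2) b'(2)]
    have "val_ge (b + (B - b)) (s N * (t N - m))" "val_ge ((B - b) + b) ((s N - l) * m)"
      using that by auto
    from val_ge_add[OF this(1)[simplified] this(2)[simplified]] show ?thesis
      by (simp add: algebra_simps)
  qed
  thus "\<exists>N0. \<forall>N\<ge>N0. val_ge B (s N * t N - l * m)" by blast
qed

lemma val_limit_uminus: "val_limit s l \<Longrightarrow> val_limit (\<lambda>N. - s N) (- l)"
  using val_limit_mult[OF val_limit_const[of "-1"], of s l] by simp

lemma val_limit_sum:
  "(\<And>a. a \<in> A \<Longrightarrow> val_limit (s a) (l a)) \<Longrightarrow> val_limit (\<lambda>N. \<Sum>a\<in>A. s a N) (\<Sum>a\<in>A. l a)"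
  by (induction A rule: infinite_finite_induct) (auto intro: val_limit_const val_limit_add)

lemma val_limit_subseq:
  assumes "val_limit s l" "\<And>N. N \<le> g N"
  shows "val_limit (\<lambda>N. s (g N)) l"
  using assms unfolding val_limit_altdef by (meson order_trans)

definition fps_conv :: "(nat \<Rightarrow> kk fps) \<Rightarrow> kk fps \<Rightarrow> bool" where
  "fps_conv f F \<longleftrightarrow> (\<forall>n. val_limit (\<lambda>N. fps_nth (f N) n) (fps_nth F n))"

lemma has_infprod_altdef: "has_infprod f F \<longleftrightarrow> fps_conv (\<lambda>N. \<Prod>k<N. f k) F"
  by (simp add: has_infprod_def fps_conv_def)

lemma fps_conv_unique: "fps_conv f F \<Longrightarrow> fps_conv f G \<Longrightarrow> F = G"
  unfolding fps_conv_def by (intro fps_ext) (blast intro: val_limit_unique)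

lemma fps_conv_const: "fps_conv (\<lambda>_. F) F"
  by (simp add: fps_conv_def val_limit_const)

lemma fps_conv_subseq: "fps_conv f F \<Longrightarrow> (\<And>N. N \<le> g N) \<Longrightarrow> fps_conv (\<lambda>N. f (g N)) F"
  unfolding fps_conv_def by (intro allI val_limit_subseq[where g = g]) auto

lemma fps_conv_mult: "fps_conv f F \<Longrightarrow> fps_conv g G \<Longrightarrow> fps_conv (\<lambda>N. f N * g N) (F * G)"
  unfolding fps_conv_def fps_mult_nth by (auto intro!: val_limit_sum val_limit_mult)

lemma fps_conv_power: "fps_conv f F \<Longrightarrow> fps_conv (\<lambda>N. f N ^ n) (F ^ n)"
  by (induction n) (simp_all add: fps_conv_const fps_conv_mult)

lemma fps_conv_prod:
  "(\<And>a. a \<in> A \<Longrightarrow> fps_conv (f a) (F a)) \<Longrightarrow> fps_conv (\<lambda>N. \<Prod>a\<in>A. f a N) (\<Prod>a\<in>A. F a)"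
  by (induction A rule: infinite_finite_induct) (auto intro: fps_conv_const fps_conv_mult)

lemma fps_conv_inverse:
  assumes "fps_conv f F" "\<And>N. fps_nth (f N) 0 = 1" "fps_nth F 0 = 1"
  shows "fps_conv (\<lambda>N. inverse (f N)) (inverse F)"
  unfolding fps_conv_def
proof
  fix n
  show "val_limit (\<lambda>N. fps_nth (inverse (f N)) n) (fps_nth (inverse F) n)"
  proof (induction n rule: less_induct)
    case (less n)
    show ?case
    proof (cases "n = 0")
      case True
      thus ?thesis using assms by (simp add: val_limit_const)
    next
      case False
      have "val_limit (\<lambda>N. - (\<Sum>i=1..n. fps_nth (f N) i * fps_nth (inverse (f N)) (n - i)))
        (- (\<Sum>i=1..n. fps_nth F i * fps_nth (inverse F) (n - i)))"
        using assms(1) less False unfolding fps_conv_def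
        by (intro val_limit_uminus val_limit_sum val_limit_mult) auto
      thus ?thesis
        using False by (subst (1 2) fps_nth_inverse_rec) (simp_all add: assms)
    qed
  qed
qed

lemma fps_conv_power_int:
  assumes "fps_conv f F" "\<And>N. fps_nth (f N) 0 = 1" "fps_nth F 0 = 1"
  shows "fps_conv (\<lambda>N. f N powi n) (F powi n)"
  unfolding power_int_def using fps_conv_power[OF assms(1)] fps_conv_power[OF fps_conv_inverse[OF assms]]
  by auto

lemma fps_conv_scale: "fps_conv f F \<Longrightarrow> fps_conv (\<lambda>N. scale_fps a (f N)) (scale_fps a F)"
  unfolding fps_conv_def by (auto intro!: val_limit_mult val_limit_const)

section \<open>The series \<phi> as an infinite product\<close>

abbreviation h :: nat where "h \<equiv> dual_coxeter \<gg>"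

lemma h_pos: "0 < h"
  using simple_type by (cases \<gg>) auto

definition q2h :: kk where
  "q2h = q_gen ^ (2 * h)"

lemma q2h_nz [simp]: "q2h \<noteq> 0"
  by (simp add: q2h_def)

lemma val_q2h: "val q2h = of_nat (2 * h)"
  by (simp add: q2h_def val_power val_q)

lemma q2h_power_neq_1: "0 < n \<Longrightarrow> q2h ^ n \<noteq> 1"
proof
  assume "0 < n" "q2h ^ n = 1"
  hence "val (q2h ^ n) = 0" by simp
  thus False using \<open>0 < n\<close> h_pos by (simp add: val_power val_q2h)
qed

text \<open>Euler's expansion of the product of the 1 - p^k z for p = q^(2h). The recursion compares
  coefficients in \<phi>(z) = (1 - z) \<phi>(p z).\<close>

primrec phi_coeff :: "nat \<Rightarrow> kk" where
  "phi_coeff 0 = 1"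
| "phi_coeff (Suc n) = - (q2h ^ n / (1 - q2h ^ Suc n) * phi_coeff n)"

definition phi :: "kk fps" where
  "phi = Abs_fps phi_coeff"

lemma phi_0 [simp]: "fps_nth phi 0 = 1"
  by (simp add: phi_def)

lemma phi_functional: "phi = lin_fps 1 * scale_fps q2h phi"
proof (rule fps_ext)
  fix n
  have "fps_nth (lin_fps 1 * scale_fps q2h phi) n = fps_nth (scale_fps q2h phi) n - (if n = 0 then 0 else fps_nth (scale_fps q2h phi) (n - 1))"
    by (simp add: lin_fps_def left_diff_distrib)
  also have "\<dots> = fps_nth phi n"
  proof (cases n)
    case (Suc k)
    have "1 - q2h ^ Suc k \<noteq> 0" using q2h_power_neq_1[of "Suc k"] by simp
    hence "(1 - q2h ^ Suc k) * phi_coeff (Suc k) = - (q2h ^ k * phi_coeff k)"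
      by simp
    thus ?thesis
      unfolding Suc phi_def by (simp del: phi_coeff.simps power_Suc add: algebra_simps)
  qed simp
  finally show "fps_nth phi n = fps_nth (lin_fps 1 * scale_fps q2h phi) n" ..
qed

lemma phi_a_functional: "scale_fps a phi = lin_fps a * scale_fps q2h (scale_fps a phi)"
proof -
  have "scale_fps a phi = scale_fps a (lin_fps 1 * scale_fps q2h phi)"
    by (rule arg_cong[OF phi_functional])
  also have "\<dots> = lin_fps a * scale_fps q2h (scale_fps a phi)"
    by (simp add: scale_fps_mult scale_lin_fps scale_fps_scale_fps mult.commute)
  finally show ?thesis .
qed

lemma phi_partial_prod: "phi = (\<Prod>k<N. lin_fps (q2h ^ k)) * scale_fps (q2h ^ N) phi"
proof (induction N)
  case (Suc N)
  have "scale_fps (q2h ^ N) phi = lin_fps (q2h ^ N) * scale_fps (q2h ^ Suc N) phi"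
    using phi_a_functional[of "q2h ^ N"] by (simp add: scale_fps_scale_fps)
  thus ?case using Suc by (simp add: mult.assoc)
qed (simp add: scale_fps_def)

text \<open>The partial product of length N is \<phi>(z) divided by \<phi>(p^N z) for p = q^(2h).
  The divisor tends to 1, because p has positive valuation.\<close>

lemma phi_infprod: "fps_conv (\<lambda>N. \<Prod>k<N. lin_fps (q2h ^ k)) phi"
proof -
  have "val_limit (\<lambda>N. (q2h ^ N) ^ n * phi_coeff n) (if n = 0 then 1 else 0)" for n
  proof (cases "n = 0 \<or> phi_coeff n = 0")
    case False
    show ?thesis
      unfolding val_limit_altdef
    proof
      fix B
      obtain N0 where N0: "of_nat N0 \<ge> B - val (phi_coeff n)"
        using real_arch_simple by blast
      have "val_ge B ((q2h ^ N) ^ n * phi_coeff n)" if "N \<ge> N0" for N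
      proof -
        have "N \<le> n * (N * (2 * h))"
          using False h_pos by (simp add: mult.left_commute[of n])
        hence "rat_of_nat N \<le> of_nat n * (of_nat N * of_nat (2 * h))"
          unfolding of_nat_mult[symmetric] of_nat_le_iff .
        hence "B \<le> val ((q2h ^ N) ^ n * phi_coeff n)"
          using N0 that False by (simp add: val_mult val_power val_q2h)
        thus ?thesis by (simp add: val_ge_def)
      qed
      thus "\<exists>N0. \<forall>N\<ge>N0. val_ge B ((q2h ^ N) ^ n * phi_coeff n - (if n = 0 then 1 else 0))"
        using False by auto
    qed
  next
    case True
    hence "(\<lambda>N. (q2h ^ N) ^ n * phi_coeff n) = (\<lambda>_. if n = 0 then 1 else 0)" by auto
    thus ?thesis by (simp only: val_limit_const)
  qed
  hence "fps_conv (\<lambda>N. scale_fps (q2h ^ N) phi) 1"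
    by (simp add: fps_conv_def phi_def)
  hence "fps_conv (\<lambda>N. inverse (scale_fps (q2h ^ N) phi)) (inverse 1)"
    by (rule fps_conv_inverse) simp_all
  from fps_conv_mult[OF fps_conv_const[of phi] this] have "fps_conv (\<lambda>N. phi * inverse (scale_fps (q2h ^ N) phi)) phi"
    by simp
  moreover have "phi * inverse (scale_fps (q2h ^ N) phi) = (\<Prod>k<N. lin_fps (q2h ^ k))" for N
  proof -
    have "scale_fps (q2h ^ N) phi * inverse (scale_fps (q2h ^ N) phi) = 1"
      by (rule inverse_mult_eq_1') simp
    hence "(\<Prod>k<N. lin_fps (q2h ^ k)) * scale_fps (q2h ^ N) phi * inverse (scale_fps (q2h ^ N) phi) = (\<Prod>k<N. lin_fps (q2h ^ k))"
      by (simp add: mult.assoc)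
    thus ?thesis
      unfolding phi_partial_prod[of N, symmetric] .
  qed
  ultimately show ?thesis by simp
qed

lemma phi_series_eq: "\<phi>_series = phi"
proof -
  have *: "(\<lambda>k. 1 - fps_const (q_gen ^ (2 * k * h)) * fps_X) = (\<lambda>k. lin_fps (q2h ^ k))"
    by (simp add: lin_fps_def q2h_def power_mult[symmetric] mult_ac)
  show ?thesis
    unfolding \<phi>_series_def * has_infprod_altdef
    by (rule the_equality, rule phi_infprod) (rule fps_conv_unique[OF _ phi_infprod])
qed

lemma phi_a_infprod: "fps_conv (\<lambda>N. \<Prod>k<N. lin_fps (a * q2h ^ k)) (scale_fps a phi)"
  using fps_conv_scale[OF phi_infprod, of a] by (simp add: scale_fps_prod scale_lin_fps)

end

section \<open>The degree of a Laurent series\<close>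

lemma fps_nth_prod_0: "fps_nth (\<Prod>a\<in>A. f a :: 'a :: comm_ring_1 fps) 0 = (\<Prod>a\<in>A. fps_nth (f a) 0)"
  by (induction A rule: infinite_finite_induct) simp_all

lemma fps_to_fls_prod: "fps_to_fls (\<Prod>a\<in>A. f a :: 'a :: field fps) = (\<Prod>a\<in>A. fps_to_fls (f a))"
  by (induction A rule: infinite_finite_induct) (simp_all add: fls_times_fps_to_fls)

context quantum_loop_algebra
begin

text \<open>\<open>Deg\<close> is linear in the exponents \<mu>; this is the coefficient with which
  the exponent at a enters.\<close>

definition deg_weight :: "kk \<Rightarrow> int" where
  "deg_weight a = (if \<exists>k\<le>0. a = q_gen powi (2 * k * int h) then 1
            else if \<exists>k>0. a = q_gen powi (2 * k * int h) then - 1 else 0)"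

definition phi_fls :: "kk \<Rightarrow> kk fls" where
  "phi_fls a = fps_to_fls (scale_fps a phi)"

lemma phi_fls_nz [simp]: "phi_fls a \<noteq> 0"
proof -
  have "fps_nth (scale_fps a phi) 0 = 1" by simp
  hence "scale_fps a phi \<noteq> 0" by (metis fps_zero_nth zero_neq_one)
  thus ?thesis by (simp add: phi_fls_def)
qed

lemma G_element_eq:
  assumes "finite S" "{a. \<mu> a \<noteq> 0} \<subseteq> S"
  shows "G_element c m \<mu> = fls_const c * fls_X_intpow m * (\<Prod>a\<in>S. phi_fls a powi \<mu> a)"
proof -
  have "(\<Prod>a | \<mu> a \<noteq> 0. phi_fls a powi \<mu> a) = (\<Prod>a\<in>S. phi_fls a powi \<mu> a)"
    using assms by (intro prod.mono_neutral_left) auto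
  thus ?thesis
    unfolding G_element_def phi_series_eq scale_fps_def[symmetric] phi_fls_def[symmetric] by simp
qed

text \<open>A relation instead of the function \<open>Deg\<close>: additivity is evident from the
  representations, and their uniqueness enters only once, in \<open>Deg_eqI\<close>.\<close>

definition has_deg :: "kk fls \<Rightarrow> int \<Rightarrow> bool" where
  "has_deg f D \<longleftrightarrow> (\<exists>c m \<mu>. c \<noteq> 0 \<and> finite {a. \<mu> a \<noteq> 0} \<and> \<mu> 0 = 0 \<and> f = G_element c m \<mu> \<and>
     D = (\<Sum>a | \<mu> a \<noteq> 0. \<mu> a * deg_weight a))"

lemma has_degI:
  assumes "c \<noteq> 0" "finite S" "{a. \<mu> a \<noteq> 0} \<subseteq> S" "\<mu> 0 = 0"
    "f = fls_const c * fls_X_intpow m * (\<Prod>a\<in>S. phi_fls a powi \<mu> a)" "D = (\<Sum>a\<in>S. \<mu> a * deg_weight a)"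
  shows "has_deg f D"
proof -
  have "D = (\<Sum>a | \<mu> a \<noteq> 0. \<mu> a * deg_weight a)"
    unfolding assms(6) using assms by (intro sum.mono_neutral_right) auto
  thus ?thesis
    unfolding has_deg_def using assms G_element_eq[OF assms(2,3)] finite_subset[OF assms(3,2)]
    by (intro exI[of _ c] exI[of _ m] exI[of _ \<mu>] conjI) simp_all
qed

lemma has_degE:
  assumes "has_deg f D"
  obtains c m \<mu> S where "c \<noteq> 0" "finite S" "{a. \<mu> a \<noteq> 0} \<subseteq> S" "\<mu> 0 = 0"
    "f = fls_const c * fls_X_intpow m * (\<Prod>a\<in>S. phi_fls a powi \<mu> a)" "D = (\<Sum>a\<in>S. \<mu> a * deg_weight a)"
proof -
  obtain c m \<mu> where *: "c \<noteq> 0" "finite {a. \<mu> a \<noteq> 0}" "\<mu> 0 = 0" "f = G_element c m \<mu>"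
     "D = (\<Sum>a | \<mu> a \<noteq> 0. \<mu> a * deg_weight a)"
    using assms unfolding has_deg_def by blast
  show thesis
    by (rule that[OF *(1,2) order_refl *(3)]) (use * G_element_eq[OF *(2) order_refl] in simp_all)
qed

lemma has_deg_mult:
  assumes "has_deg f D" "has_deg g E"
  shows "has_deg (f * g) (D + E)"
proof -
  from assms(1) obtain c m \<mu> S where f: "c \<noteq> 0" "finite S" "{a. \<mu> a \<noteq> 0} \<subseteq> S" "\<mu> 0 = 0"
    "f = fls_const c * fls_X_intpow m * (\<Prod>a\<in>S. phi_fls a powi \<mu> a)" "D = (\<Sum>a\<in>S. \<mu> a * deg_weight a)"
    by (rule has_degE)
  from assms(2) obtain c' m' \<mu>' S' where g: "c' \<noteq> 0" "finite S'" "{a. \<mu>' a \<noteq> 0} \<subseteq> S'" "\<mu>' 0 = 0"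
    "g = fls_const c' * fls_X_intpow m' * (\<Prod>a\<in>S'. phi_fls a powi \<mu>' a)" "E = (\<Sum>a\<in>S'. \<mu>' a * deg_weight a)"
    by (rule has_degE)
  let ?S = "S \<union> S'"
  have 0: "\<mu> a = 0" if "a \<notin> S" for a using f(3) that by blast
  have 00: "\<mu>' a = 0" if "a \<notin> S'" for a using g(3) that by blast
  have 1: "(\<Prod>a\<in>S. phi_fls a powi \<mu> a) = (\<Prod>a\<in>?S. phi_fls a powi \<mu> a)" "(\<Prod>a\<in>S'. phi_fls a powi \<mu>' a) = (\<Prod>a\<in>?S. phi_fls a powi \<mu>' a)"
    using f(2) g(2) 0 00 by (auto intro!: prod.mono_neutral_left)
  have 2: "D = (\<Sum>a\<in>?S. \<mu> a * deg_weight a)" "E = (\<Sum>a\<in>?S. \<mu>' a * deg_weight a)"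
    unfolding f(6) g(6) using f(2) g(2) 0 00 by (auto intro!: sum.mono_neutral_left)
  have 3: "(fls_X_intpow (m + m') :: kk fls) = fls_X_intpow m * fls_X_intpow m'"
    by (simp only: fls_X_intpow_times_fls_X_intpow)
  have "f * g = fls_const (c * c') * fls_X_intpow (m + m') * (\<Prod>a\<in>?S. phi_fls a powi (\<mu> a + \<mu>' a))"
    unfolding f(5) g(5) 1 3 fls_const_mult_const[symmetric]
    by (simp add: power_int_add prod.distrib mult_ac del: fls_const_mult_const)
  thus ?thesis
    using f(1-4) g(1-4) 0 00
    by (intro has_degI[of "c * c'" ?S "\<lambda>a. \<mu> a + \<mu>' a" _ "m + m'"])
      (auto simp: sum.distrib distrib_right 2)
qed

lemma has_deg_inverse:
  assumes "has_deg f D"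
  shows "has_deg (inverse f) (- D)"
proof -
  from assms(1) obtain c m \<mu> S where f: "c \<noteq> 0" "finite S" "{a. \<mu> a \<noteq> 0} \<subseteq> S" "\<mu> 0 = 0"
    "f = fls_const c * fls_X_intpow m * (\<Prod>a\<in>S. phi_fls a powi \<mu> a)" "D = (\<Sum>a\<in>S. \<mu> a * deg_weight a)"
    by (rule has_degE)
  have "inverse f = fls_const (inverse c) * fls_X_intpow (- m) * (\<Prod>a\<in>S. phi_fls a powi (- \<mu> a))"
    unfolding f(5) fls_X_power_int[symmetric]
    by (simp add: power_int_minus prod_inversef[symmetric] fls_inverse_const del: fls_X_power_int)
  thus ?thesis
    using f by (intro has_degI[of "inverse c" S "\<lambda>a. - \<mu> a" _ "- m"]) (auto simp: sum_negf)
qed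

lemma has_deg_divide: "has_deg f D \<Longrightarrow> has_deg g E \<Longrightarrow> has_deg (f / g) (D - E)"
  using has_deg_mult[OF _ has_deg_inverse, of f D g E] by (simp add: divide_inverse)

lemma has_deg_const: "c \<noteq> 0 \<Longrightarrow> has_deg (fls_const c) 0"
  by (rule has_degI[of c "{}" "\<lambda>_. 0" _ 0]) auto

lemma has_deg_1: "has_deg 1 0"
  using has_deg_const[of 1] by simp

lemma has_deg_X: "has_deg fls_X 0"
  by (rule has_degI[of 1 "{}" "\<lambda>_. 0" _ 1]) (simp_all flip: fls_X_power_int)

lemma has_deg_phi_fls: "a \<noteq> 0 \<Longrightarrow> has_deg (phi_fls a) (deg_weight a)"
  by (rule has_degI[of 1 "{a}" "\<lambda>b. if b = a then 1 else 0" _ 0]) auto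

lemma has_deg_power: "has_deg f D \<Longrightarrow> has_deg (f ^ n) (int n * D)"
  by (induction n) (auto simp: has_deg_1 algebra_simps dest: has_deg_mult[of f D "f ^ _"])

lemma has_deg_power_int: "has_deg f D \<Longrightarrow> has_deg (f powi n) (n * D)"
  using has_deg_power[of f D "nat n"] has_deg_power[OF has_deg_inverse[of f D], of "nat (- n)"]
  by (auto simp: power_int_def)

lemma has_deg_prod:
  "finite A \<Longrightarrow> (\<And>a. a \<in> A \<Longrightarrow> has_deg (f a) (D a)) \<Longrightarrow> has_deg (\<Prod>a\<in>A. f a) (\<Sum>a\<in>A. D a)"
  by (induction A rule: finite_induct) (auto simp: has_deg_1 intro: has_deg_mult)

lemma q_powi_inj: "q_gen powi m = q_gen powi n \<longleftrightarrow> m = n"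
proof
  assume "q_gen powi m = q_gen powi n"
  hence "val (q_gen powi m) = val (q_gen powi n)" by simp
  thus "m = n" by (simp add: val_powi val_q)
qed simp

text \<open>Along a progression with ratio q^(2h) the weight is constant except for the jump from 1
  to -1 between a = 1 and a = q^(2h). This jump is the origin of the factor 2 in front of the order
  of vanishing at 1.\<close>

lemma deg_weight_shift: "deg_weight a - deg_weight (a * q2h) = (if a = 1 then 2 else 0)"
proof (cases "\<exists>k. a = q_gen powi (2 * k * int h)")
  case True
  have deg_weight: "deg_weight (q_gen powi (2 * k * int h)) = (if k \<le> 0 then 1 else - 1)" for k
    using h_pos by (auto simp: deg_weight_def q_powi_inj)
  from True obtain k where k: "a = q_gen powi (2 * k * int h)" ..
  have "q2h = q_gen powi (2 * 1 * int h)"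
    unfolding q2h_def power_int_of_nat[symmetric] by simp
  hence "a * q2h = q_gen powi (2 * (k + 1) * int h)"
    unfolding k by (simp add: power_int_add[symmetric] algebra_simps)
  moreover have "a = 1 \<longleftrightarrow> k = 0"
    using q_powi_inj[of "2 * k * int h" 0] h_pos by (simp add: k)
  ultimately show ?thesis
    using deg_weight[of k] deg_weight[of "k + 1"] k by auto
next
  case False
  have "\<not> (\<exists>k. a * q2h = q_gen powi (2 * k * int h))"
  proof
    assume "\<exists>k. a * q2h = q_gen powi (2 * k * int h)"
    then obtain k where "a * q2h = q_gen powi (2 * k * int h)" ..
    moreover have "q2h = q_gen powi (2 * int h)"
      unfolding q2h_def power_int_of_nat[symmetric] by simp
    moreover have "q_gen powi (2 * k * int h) = q_gen powi (2 * (k - 1) * int h) * q_gen powi (2 * int h)"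
      by (simp add: power_int_add[symmetric] algebra_simps)
    ultimately have "a = q_gen powi (2 * (k - 1) * int h)"
      by simp
    thus False using False by blast
  qed
  moreover have "a \<noteq> 1"
    using False by (metis mult_zero_left mult_zero_right power_int_0_right)
  ultimately show ?thesis
    using False by (auto simp: deg_weight_def)
qed

lemma has_deg_lin: 
  assumes "a \<noteq> 0"
  shows "has_deg (fps_to_fls (lin_fps a)) (if a = 1 then 2 else 0)"
proof -
  have "phi_fls a = fps_to_fls (lin_fps a) * phi_fls (a * q2h)"
    unfolding phi_fls_def using phi_a_functional[of a]
    by (simp add: scale_fps_scale_fps mult.commute[of q2h] flip: fls_times_fps_to_fls)
  hence "fps_to_fls (lin_fps a) = phi_fls a / phi_fls (a * q2h)"
    by simp
  thus ?thesis
    using has_deg_divide[OF has_deg_phi_fls[of a] has_deg_phi_fls[of "a * q2h"]] assms deg_weight_shift[of a] by simp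
qed

lemma has_deg_poly:
  assumes "p \<noteq> 0"
  shows "has_deg (fps_to_fls (fps_of_poly p)) (2 * int (order 1 p))"
proof -
  have lin: "has_deg (fps_to_fls (fps_of_poly [:- x, 1:])) (2 * (if x = 1 then 1 else 0))" for x
  proof (cases "x = 0")
    case True
    have "fps_to_fls (fps_of_poly [:0, 1:]) = (fls_X :: kk fls)"
      by (simp add: fps_of_poly_pCons fls_X_def)
    thus ?thesis using True has_deg_X by simp
  next
    case False
    have "fps_of_poly [:- x, 1:] = fps_const (- x) * lin_fps (inverse x)"
      using False by (intro fps_ext) (auto simp: nth_lin_fps coeff_pCons split: nat.splits)
    hence eq: "fps_to_fls (fps_of_poly [:- x, 1:]) = fls_const (- x) * fps_to_fls (lin_fps (inverse x))"
      by (simp add: fls_times_fps_to_fls)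
    have "inverse x = 1 \<longleftrightarrow> x = 1"
      by (metis inverse_1 inverse_inverse_eq)
    hence "(if inverse x = 1 then 2 else 0) = (2 * (if x = 1 then 1 else 0) :: int)"
      by simp
    moreover have "has_deg (fls_const (- x) * fps_to_fls (lin_fps (inverse x))) (0 + (if inverse x = 1 then 2 else 0))"
      using False by (intro has_deg_mult has_deg_const has_deg_lin) auto
    ultimately show ?thesis
      unfolding eq by simp
  qed
  obtain A where A: "size A = Polynomial.degree p" "p = Polynomial.smult (Polynomial.lead_coeff p) (\<Prod>x\<in>#A. [:- x, 1:])"
    using alg_closed_imp_factorization[OF assms] by blast
  have "has_deg (fps_to_fls (fps_of_poly (\<Prod>x\<in>#A. [:- x, 1:]))) (2 * int (order 1 (\<Prod>x\<in>#A. [:- x, 1:])))"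
  proof (induction A)
    case (add x A)
    have nz: "(\<Prod>x\<in>#A. [:- x, 1:]) \<noteq> (0 :: kk poly)"
      by auto
    have "order 1 [:- x, 1:] = (if x = 1 then 1 else 0)"
      using order_power_n_n[of "1 :: kk" 1] by (auto intro: order_0I)
    moreover have "order 1 ([:- x, 1:] * (\<Prod>x\<in>#A. [:- x, 1:])) = order 1 [:- x, 1:] + order 1 (\<Prod>x\<in>#A. [:- x, 1:])"
      using nz by (intro order_mult) (simp del: mult_pCons_left)
    ultimately have "2 * int (order 1 ([:- x, 1:] * (\<Prod>x\<in>#A. [:- x, 1:]))) =
        2 * (if x = 1 then 1 else 0) + 2 * int (order 1 (\<Prod>x\<in>#A. [:- x, 1:]))"
      by (cases "x = 1") (simp_all del: mult_pCons_left)
    thus ?case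
      using has_deg_mult[OF lin[of x] add]
      by (simp only: image_mset_add_mset prod_mset.add_mset fps_of_poly_mult fls_times_fps_to_fls)
  qed (simp add: has_deg_1)
  moreover have "fps_to_fls (fps_of_poly p) = fls_const (Polynomial.lead_coeff p) * fps_to_fls (fps_of_poly (\<Prod>x\<in>#A. [:- x, 1:]))"
    by (subst A(2)) (simp add: fps_of_poly_smult fls_times_fps_to_fls)
  moreover have "order 1 p = order 1 (\<Prod>x\<in>#A. [:- x, 1:])"
    using assms by (subst A(2)) (simp add: order_smult)
  ultimately show ?thesis
    using has_deg_mult[OF has_deg_const[of "Polynomial.lead_coeff p"]] assms by fastforce
qed

text \<open>Multiplicative independence of the series \<phi>(a z). Dividing the identity by its
  image under z \<mapsto> q^(2h) z leaves an identity of polynomials with factors 1 - a z, and the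
  two sides have disjoint sets of zeros.\<close>

lemma lin_prod_unique:
  fixes A B :: "kk set" and f g :: "kk \<Rightarrow> nat"
  assumes "finite A" "finite B" "A \<inter> B = {}" "0 \<notin> A" "\<And>a. a \<in> A \<Longrightarrow> 0 < f a"
    and eq: "(\<Prod>a\<in>A. scale_fps a phi ^ f a) = (\<Prod>a\<in>B. scale_fps a phi ^ g a)"
  shows "A = {}"
proof (rule ccontr)
  assume "A \<noteq> {}"
  then obtain a where a: "a \<in> A" by blast
  have fun_eq: "(\<Prod>a\<in>S. scale_fps a phi ^ f a) =
      (\<Prod>a\<in>S. lin_fps a ^ f a) * scale_fps q2h (\<Prod>a\<in>S. scale_fps a phi ^ f a)" for S f
  proof -
    have "(\<Prod>a\<in>S. scale_fps a phi ^ f a) = (\<Prod>a\<in>S. lin_fps a ^ f a * scale_fps q2h (scale_fps a phi) ^ f a)"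
      by (intro prod.cong refl) (metis phi_a_functional power_mult_distrib)
    also have "\<dots> = (\<Prod>a\<in>S. lin_fps a ^ f a) * scale_fps q2h (\<Prod>a\<in>S. scale_fps a phi ^ f a)"
      by (simp add: prod.distrib scale_fps_prod scale_fps_power)
    finally show ?thesis .
  qed
  let ?P = "\<Prod>a\<in>A. scale_fps a phi ^ f a"
  have a0: "a \<noteq> 0" using a assms by auto
  have "fps_nth (scale_fps q2h ?P) 0 = 1"
    by (simp add: fps_nth_prod_0 fps_power_zeroth)
  hence nz: "scale_fps q2h ?P \<noteq> 0"
    by (metis fps_zero_nth zero_neq_one)
  have "(\<Prod>a\<in>A. lin_fps a ^ f a) * scale_fps q2h ?P = (\<Prod>a\<in>B. lin_fps a ^ g a) * scale_fps q2h ?P"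
    using fun_eq[where S = A and f = f] fun_eq[where S = B and f = g] eq by simp
  hence "(\<Prod>a\<in>A. lin_fps a ^ f a) = (\<Prod>a\<in>B. lin_fps a ^ g a)"
    using nz by simp
  hence "fps_of_poly (\<Prod>a\<in>A. [:1, - a:] ^ f a) = fps_of_poly (\<Prod>a\<in>B. [:1, - a:] ^ g a)"
    by (simp add: fps_of_poly_prod fps_of_poly_power lin_fps_conv_poly)
  hence "(\<Prod>a\<in>A. [:1, - a:] ^ f a) = (\<Prod>a\<in>B. [:1, - a:] ^ g a)"
    by (simp only: fps_of_poly_eq_iff)
  hence "poly (\<Prod>a\<in>A. [:1, - a:] ^ f a) (inverse a) = poly (\<Prod>a\<in>B. [:1, - a:] ^ g a) (inverse a)"
    by simp
  hence "(\<Prod>b\<in>A. (1 - inverse a * b) ^ f b) = (\<Prod>b\<in>B. (1 - inverse a * b) ^ g b)"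
    by (simp add: poly_prod)
  moreover have "(\<Prod>b\<in>A. (1 - inverse a * b) ^ f b) = 0"
    using a a0 assms by (intro prod_zero bexI[of _ a]) (auto simp: zero_power)
  moreover have "(\<Prod>b\<in>B. (1 - inverse a * b) ^ g b) \<noteq> 0"
    using a a0 assms by (auto simp: field_simps)
  ultimately show False by simp
qed

text \<open>The difference of the exponents is split into its positive and negative part to obtain
  honest powers. The order at z = 0 identifies the powers of z and the constant term identifies the
  constants; then \<open>lin_prod_unique\<close> excludes both parts.\<close>

lemma G_element_unique:
  assumes "c \<noteq> 0" "finite {a. \<mu> a \<noteq> 0}" "\<mu> 0 = 0" "c' \<noteq> 0" "finite {a. \<mu>' a \<noteq> 0}" "\<mu>' 0 = 0"
    and eq: "G_element c m \<mu> = G_element c' m' \<mu>'"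
  shows "\<mu> = \<mu>'"
proof -
  define S where "S = {a. \<mu> a \<noteq> 0} \<union> {a. \<mu>' a \<noteq> 0}"
  define \<nu> where "\<nu> a = \<mu> a - \<mu>' a" for a
  define A where "A = {a\<in>S. \<nu> a > 0}"
  define B where "B = {a\<in>S. \<nu> a < 0}"
  have "finite S"
    using assms by (simp add: S_def)
  hence fin: "finite S" "finite A" "finite B"
    by (simp_all add: A_def B_def)
  have split: "(\<Prod>a\<in>S. phi_fls a powi \<mu> a) * (\<Prod>a\<in>B. phi_fls a ^ nat (- \<nu> a)) =
      (\<Prod>a\<in>S. phi_fls a powi \<mu>' a) * (\<Prod>a\<in>A. phi_fls a ^ nat (\<nu> a))"
  proof -
    have 1: "(\<Prod>a\<in>B. phi_fls a ^ nat (- \<nu> a)) = (\<Prod>a\<in>S. if \<nu> a < 0 then phi_fls a ^ nat (- \<nu> a) else 1)"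
      "(\<Prod>a\<in>A. phi_fls a ^ nat (\<nu> a)) = (\<Prod>a\<in>S. if \<nu> a > 0 then phi_fls a ^ nat (\<nu> a) else 1)"
      unfolding A_def B_def by (intro prod.inter_filter fin(1))+
    show ?thesis
      unfolding 1 prod.distrib[symmetric]
    proof (intro prod.cong refl)
      fix a
      have "phi_fls a powi \<mu> a = phi_fls a powi \<mu>' a * phi_fls a powi \<nu> a"
        by (simp add: power_int_add[symmetric] \<nu>_def)
      thus "phi_fls a powi \<mu> a * (if \<nu> a < 0 then phi_fls a ^ nat (- \<nu> a) else 1) =
          phi_fls a powi \<mu>' a * (if \<nu> a > 0 then phi_fls a ^ nat (\<nu> a) else 1)"
        by (cases "\<nu> a" "0 :: int" rule: linorder_cases) (auto simp: power_int_def power_inverse)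
    qed
  qed
  let ?fA = "\<Prod>a\<in>A. scale_fps a phi ^ nat (\<nu> a)"
  let ?fB = "\<Prod>a\<in>B. scale_fps a phi ^ nat (- \<nu> a)"
  let ?P = "(\<Prod>a\<in>S. phi_fls a powi \<mu>' a)"
  have eqS: "fls_const c * fls_X_intpow m * (\<Prod>a\<in>S. phi_fls a powi \<mu> a) = fls_const c' * fls_X_intpow m' * ?P"
    using eq G_element_eq[OF fin(1), of \<mu> c m] G_element_eq[OF fin(1), of \<mu>' c' m'] by (simp add: S_def)
  have "fls_const c * fls_X_intpow m * (\<Prod>a\<in>A. phi_fls a ^ nat (\<nu> a)) * ?P =
     fls_const c * fls_X_intpow m * ((\<Prod>a\<in>S. phi_fls a powi \<mu> a) * (\<Prod>a\<in>B. phi_fls a ^ nat (- \<nu> a)))"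
    unfolding split by (simp only: mult_ac)
  also have "\<dots> = fls_const c' * fls_X_intpow m' * (\<Prod>a\<in>B. phi_fls a ^ nat (- \<nu> a)) * ?P"
    unfolding mult.assoc[symmetric] eqS by (simp only: mult_ac)
  finally have "fls_const c * fls_X_intpow m * (\<Prod>a\<in>A. phi_fls a ^ nat (\<nu> a)) =
      fls_const c' * fls_X_intpow m' * (\<Prod>a\<in>B. phi_fls a ^ nat (- \<nu> a))"
    using fin by simp
  hence fls: "fls_const c * fls_X_intpow m * fps_to_fls ?fA = fls_const c' * fls_X_intpow m' * fps_to_fls ?fB"
    by (simp add: phi_fls_def fps_to_fls_prod fps_to_fls_power)
  have c0: "fps_nth ?fA 0 = 1" "fps_nth ?fB 0 = 1"
    by (simp_all add: fps_nth_prod_0 fps_power_zeroth)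
  have sub: "fls_subdegree (fls_const k * fls_X_intpow n * fps_to_fls F) = n"
    if "k \<noteq> 0" "fps_nth F 0 = 1" for k :: kk and n F
  proof -
    have "F \<noteq> 0"
      using that by (metis fps_zero_nth zero_neq_one)
    moreover have "subdegree F = 0"
      using that by simp
    moreover have "fls_const k * fls_X_intpow n * fps_to_fls F = fls_X_intpow n * fps_to_fls (fps_const k * F)"
      by (simp add: fls_times_fps_to_fls mult_ac)
    ultimately show ?thesis
      using that fls_subdegree_mult_fls_X_intpow(1)[of "fps_to_fls (fps_const k * F)" n]
      by (simp add: fls_subdegree_fls_to_fps)
  qed
  have m: "m = m'"
    using sub[OF assms(1) c0(1), of m] sub[OF assms(4) c0(2), of m'] fls by simp
  have cancel: "k * y * x = k' * y * x' \<Longrightarrow> y \<noteq> 0 \<Longrightarrow> k * x = k' * x'" for k k' y x x' :: "kk fls"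
    by (simp add: mult.commute[of _ y] mult.assoc)
  have "fls_const c * fps_to_fls ?fA = fls_const c' * fps_to_fls ?fB"
    using fls unfolding m by (rule cancel) (rule fls_X_intpow_nonzero)
  hence "fps_to_fls (fps_const c * ?fA) = fps_to_fls (fps_const c' * ?fB)"
    by (simp add: fls_times_fps_to_fls)
  hence "fps_const c * ?fA = fps_const c' * ?fB"
    by (simp only: fps_to_fls_eq_iff)
  moreover from arg_cong[OF this, of "\<lambda>F. fps_nth F 0"] have "c = c'"
    using c0 by simp
  ultimately have fps: "?fA = ?fB"
    using assms(1) by simp
  have "A = {}"
    by (rule lin_prod_unique[OF fin(2,3) _ _ _ fps]) (use assms in \<open>auto simp: A_def B_def \<nu>_def S_def\<close>)
  moreover have "B = {}"
    by (rule lin_prod_unique[OF fin(3,2) _ _ _ fps[symmetric]]) (use assms in \<open>auto simp: A_def B_def \<nu>_def S_def\<close>)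
  ultimately have "\<not> 0 < \<nu> a" "\<not> \<nu> a < 0" if "a \<in> S" for a
    using that unfolding A_def B_def by blast+
  hence "\<mu> a = \<mu>' a" if "a \<in> S" for a
    using that by (force simp: \<nu>_def)
  moreover have "\<mu> a = \<mu>' a" if "a \<notin> S" for a
    using that by (simp add: S_def)
  ultimately show ?thesis by blast
qed

lemma Deg_eqI:
  assumes "has_deg f D"
  shows "Deg f = D"
proof -
  have eq: "(\<Sum>a | \<mu> a \<noteq> 0 \<and> (\<exists>k\<le>0. a = q_gen powi (2 * k * int h)). \<mu> a)
       - (\<Sum>a | \<mu> a \<noteq> 0 \<and> (\<exists>k>0. a = q_gen powi (2 * k * int h)). \<mu> a) = (\<Sum>a | \<mu> a \<noteq> 0. \<mu> a * deg_weight a)"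
    if "finite {a. \<mu> a \<noteq> 0}" for \<mu> :: "kk \<Rightarrow> int"
  proof -
    define A B where "A a \<longleftrightarrow> (\<exists>k\<le>0. a = q_gen powi (2 * k * int h))"
      and "B a \<longleftrightarrow> (\<exists>k>0. a = q_gen powi (2 * k * int h))" for a
    have AB: "\<not> (A a \<and> B a)" for a
      using h_pos by (auto simp: A_def B_def q_powi_inj)
    have "(\<Sum>a | \<mu> a \<noteq> 0 \<and> A a. \<mu> a) = (\<Sum>a | \<mu> a \<noteq> 0. if A a then \<mu> a else 0)"
      "(\<Sum>a | \<mu> a \<noteq> 0 \<and> B a. \<mu> a) = (\<Sum>a | \<mu> a \<noteq> 0. if B a then \<mu> a else 0)"
      using sum.inter_filter[OF that, of \<mu> A] sum.inter_filter[OF that, of \<mu> B] by simp_all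
    moreover have "deg_weight a = (if A a then 1 else if B a then - 1 else 0)" for a
      unfolding deg_weight_def A_def B_def ..
    ultimately show ?thesis
      unfolding A_def[symmetric] B_def[symmetric] using AB
      by (auto simp: sum_subtractf[symmetric] intro!: sum.cong)
  qed
  obtain c m \<mu> where g: "c \<noteq> 0" "finite {a. \<mu> a \<noteq> 0}" "\<mu> 0 = 0" "f = G_element c m \<mu>"
     "D = (\<Sum>a | \<mu> a \<noteq> 0. \<mu> a * deg_weight a)"
    using assms unfolding has_deg_def by blast
  show ?thesis
    unfolding Deg_def
  proof (rule the_equality)
    show "\<exists>c m \<mu>. c \<noteq> 0 \<and> finite {a. \<mu> a \<noteq> 0} \<and> \<mu> 0 = 0 \<and> f = G_element c m \<mu> \<and>
     D = (\<Sum>a | \<mu> a \<noteq> 0 \<and> (\<exists>k\<le>0. a = q_gen powi (2 * k * int (dual_coxeter \<gg>))). \<mu> a)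
       - (\<Sum>a | \<mu> a \<noteq> 0 \<and> (\<exists>k>0. a = q_gen powi (2 * k * int (dual_coxeter \<gg>))). \<mu> a)"
      using g eq[OF g(2)] by (intro exI[of _ c] exI[of _ m] exI[of _ \<mu>]) simp
  next
    fix D' assume "\<exists>c m \<mu>. c \<noteq> 0 \<and> finite {a. \<mu> a \<noteq> 0} \<and> \<mu> 0 = 0 \<and> f = G_element c m \<mu> \<and>
     D' = (\<Sum>a | \<mu> a \<noteq> 0 \<and> (\<exists>k\<le>0. a = q_gen powi (2 * k * int (dual_coxeter \<gg>))). \<mu> a)
       - (\<Sum>a | \<mu> a \<noteq> 0 \<and> (\<exists>k>0. a = q_gen powi (2 * k * int (dual_coxeter \<gg>))). \<mu> a)"
    then obtain c' m' \<mu>' where g': "c' \<noteq> 0" "finite {a. \<mu>' a \<noteq> 0}" "\<mu>' 0 = 0" "f = G_element c' m' \<mu>'"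
      "D' = (\<Sum>a | \<mu>' a \<noteq> 0 \<and> (\<exists>k\<le>0. a = q_gen powi (2 * k * int (dual_coxeter \<gg>))). \<mu>' a)
       - (\<Sum>a | \<mu>' a \<noteq> 0 \<and> (\<exists>k>0. a = q_gen powi (2 * k * int (dual_coxeter \<gg>))). \<mu>' a)"
      by blast
    have "\<mu>' = \<mu>"
      using G_element_unique[OF g'(1-3) g(1-3)] g(4) g'(4) by metis
    thus "D' = D"
      using g(5) g'(5) eq[OF g(2)] by simp
  qed
qed

end

section \<open>Universal coefficients for fundamental modules\<close>

lemma fps_inverse_prod: "inverse (\<Prod>a\<in>A. f a :: 'a :: field fps) = (\<Prod>a\<in>A. inverse (f a))"
  by (induction A rule: infinite_finite_induct) (simp_all add: fps_inverse_mult)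

context quantum_loop_algebra
begin

definition period :: nat where
  "period = 2 * r * h"

lemma r_pos: "0 < r"
  by (cases \<gg>) auto

lemma period_pos: "0 < period"
  using r_pos h_pos by (simp add: period_def)

lemma certificate: "\<exists>B. qc_certificate \<gg> (int period) B"
  using certificate_exists[OF simple_type] by (simp add: period_def)

lemma simple_nodes_eq: "simple_nodes \<gg> = nodes"
  by (simp add: simple_nodes_def)

lemma qs_nz [simp]: "qs \<noteq> 0"
  by (simp add: qs_def)

lemma qs_r: "qs ^ r = q_gen"
  using qpow_of_nat_mult[of r "1 / of_nat r"] r_pos by (simp add: qs_def qpow_1)

lemma val_qs: "val qs = 1 / of_nat r"
proof -
  have "of_nat r * val qs = 1"
    using val_power[of qs r] by (simp add: qs_r val_q)
  thus ?thesis using r_pos by (simp add: field_simps)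
qed

lemma qs_powi_inj: "qs powi x = qs powi y \<longleftrightarrow> x = y"
proof
  assume "qs powi x = qs powi y"
  hence "val (qs powi x) = val (qs powi y)" by simp
  thus "x = y" using r_pos by (simp add: val_powi val_qs)
qed simp

lemma qs_powi_period: "qs powi (int period * k) = q_gen powi (2 * k * int h)"
proof -
  have "int period * k = int r * (2 * k * int h)" by (simp add: period_def)
  hence "qs powi (int period * k) = (qs powi int r) powi (2 * k * int h)"
    by (simp only: power_int_mult)
  thus ?thesis by (simp add: qs_r)
qed

lemma q2h_power: "q2h ^ k = qs powi (int period * int k)"
  unfolding qs_powi_period q2h_def power_int_of_nat[symmetric] power_int_mult[symmetric] by (simp add: mult_ac)

lemma deg_weight_qs: "deg_weight (qs powi w) = (if int period dvd w then (if w \<le> 0 then 1 else - 1) else 0)"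
proof -
  have eq: "qs powi w = q_gen powi (2 * k * int h) \<longleftrightarrow> w = int period * k" for k
    unfolding qs_powi_period[symmetric] by (rule qs_powi_inj)
  have "(\<exists>k\<le>0. w = int period * k) \<longleftrightarrow> int period dvd w \<and> w \<le> 0"
    using period_pos by (auto simp: dvd_def mult_le_0_iff)
  moreover have "(\<exists>k>0. w = int period * k) \<longleftrightarrow> int period dvd w \<and> w > 0"
    using period_pos by (auto simp: dvd_def zero_less_mult_iff)
  ultimately show ?thesis
    unfolding deg_weight_def eq by auto
qed

text \<open>The factors are grouped by their index modulo \<open>period\<close>. Within a class the
  exponent is constant and the arguments form a progression with ratio q^(2h), as q_s to the power
  \<open>period\<close> is q^(2h). So each class converges to a quotient of two series
  \<phi>.\<close>

lemma periodic_infprod: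
  assumes period: "\<And>u. c (u + period) = c u"
    and F: "has_infprod (\<lambda>u. (lin_fps (qs powi (x + int u)) / lin_fps (qs powi (y + int u))) powi c u) F"
  shows "F = (\<Prod>m<period. (scale_fps (qs powi (x + int m)) phi * inverse (scale_fps (qs powi (y + int m)) phi)) powi c m)"
proof -
  let ?f = "\<lambda>u. (lin_fps (qs powi (x + int u)) * inverse (lin_fps (qs powi (y + int u)))) powi c u"
  let ?P = "\<lambda>z m K. \<Prod>k<K. lin_fps (qs powi (z + int m) * q2h ^ k)"
  have c: "c (m + k * period) = c m" for m k
  proof (induction k)
    case (Suc k)
    thus ?case using period[of "m + k * period"] by (simp add: algebra_simps)
  qed simp
  have shift: "qs powi (z + int (m + k * period)) = qs powi (z + int m) * q2h ^ k" for z m k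
    unfolding q2h_power by (simp add: power_int_add[symmetric] algebra_simps)
  have prod: "(\<Prod>u<K * period. ?f u) = (\<Prod>m<period. (?P x m K * inverse (?P y m K)) powi c m)" for K
  proof -
    have "(\<Prod>u<K * period. ?f u) = (\<Prod>k<K. \<Prod>u = k * period..<k * period + period. ?f u)"
      by (rule prod.nat_group[symmetric])
    also have "\<dots> = (\<Prod>k<K. \<Prod>m<period. ?f (m + k * period))"
      using prod.shift_bounds_nat_ivl[of ?f 0 _ period]
      by (simp add: add.commute[of _ period] atLeast0LessThan)
    also have "\<dots> = (\<Prod>m<period. \<Prod>k<K. ?f (m + k * period))"
      by (rule prod.swap)
    also have "\<dots> = (\<Prod>m<period. (?P x m K * inverse (?P y m K)) powi c m)"
      unfolding shift c fps_inverse_prod prod.distrib[symmetric] power_int_fps_prod ..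
    finally show ?thesis .
  qed
  have 0: "fps_nth (?P z m K) 0 = 1" for z m K
    by (simp add: fps_nth_prod_0)
  have "fps_conv (\<lambda>K. \<Prod>m<period. (?P x m K * inverse (?P y m K)) powi c m)
     (\<Prod>m<period. (scale_fps (qs powi (x + int m)) phi * inverse (scale_fps (qs powi (y + int m)) phi)) powi c m)"
    using 0 by (intro fps_conv_prod fps_conv_power_int fps_conv_mult fps_conv_inverse phi_a_infprod) auto
  \<comment> \<open>Partial products whose length is a multiple of the period form a subsequence of
    all partial products, so they have the same limit.\<close>
  moreover have "fps_conv (\<lambda>K. \<Prod>u<K * period. ?f u) F"
  proof (rule fps_conv_subseq)
    show "fps_conv (\<lambda>N. prod ?f {..<N}) F"
      using F unfolding has_infprod_altdef by (simp add: fps_divide_unit)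
  next
    fix N show "N \<le> N * period" using period_pos by simp
  qed
  ultimately show ?thesis
    unfolding prod by (blast intro: fps_conv_unique)
qed

text \<open>Only the residue m of -y modulo the period has nonzero weight. For y \<le> 0 periodicity
  turns its coefficient into the one at -y; for y > 0 antisymmetry turns it into minus the one at y,
  which compensates the weight -1. The other summand on the right vanishes in each case.\<close>

lemma sum_deg_weight_qs:
  assumes "qc_certificate \<gg> (int period) B" "i \<in> nodes" "j \<in> nodes"
  shows "(\<Sum>m<period. ct i j (int m) * deg_weight (qs powi (y + int m))) = ct i j y + ct i j (- y)"
proof -
  have j: "j \<in> simple_nodes \<gg>" "i \<in> simple_nodes \<gg>"
    using assms by (auto simp: simple_nodes_eq)
  note nonpos = qc_certificate.ct_nonpos[OF assms(1) j]
    and periodic = qc_certificate.ct_periodic[OF assms(1) j]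
    and antisym = qc_certificate.ct_antisym[OF assms(1) j]
  define m0 where "m0 = (- y) mod int period"
  have m0: "0 \<le> m0" "m0 < int period"
    using period_pos by (simp_all add: m0_def)
  have dvd: "int period dvd y + int m \<longleftrightarrow> m = nat m0" if "m < period" for m
  proof -
    have "int period dvd y + int m \<longleftrightarrow> (int m) mod int period = m0"
      unfolding m0_def mod_eq_dvd_iff by (simp add: add.commute)
    thus ?thesis using that m0 by auto
  qed
  have many: "ct i j (v + int k * int period) = ct i j v" if "0 \<le> v" for v k
  proof (induction k)
    case (Suc k)
    have "ct i j (v + int k * int period + int period) = ct i j (v + int k * int period)"
      using that by (intro periodic) simp
    thus ?case using Suc by (simp add: algebra_simps)
  qed simp
  have "(\<Sum>m<period. ct i j (int m) * deg_weight (qs powi (y + int m))) =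
      (\<Sum>m<period. if m = nat m0 then ct i j m0 * (if y + m0 \<le> 0 then 1 else - 1) else 0)"
    unfolding deg_weight_qs using m0 dvd by (intro sum.cong refl) auto
  also have "\<dots> = ct i j m0 * (if y + m0 \<le> 0 then 1 else - 1)"
    using m0 by (simp add: nat_less_iff)
  also have "\<dots> = ct i j y + ct i j (- y)"
  proof (cases "y \<le> 0")
    case True
    define k where "k = (- y) div int period"
    have k: "- y = k * int period + m0" "0 \<le> k"
      using True period_pos unfolding k_def m0_def
      by (simp_all only: div_mult_mod_eq pos_imp_zdiv_nonneg_iff)
    hence "ct i j (- y) = ct i j m0"
      using many[OF m0(1), of "nat k"] by (simp add: add.commute)
    moreover have "y + m0 \<le> 0"
    proof -
      have "0 \<le> k * int period" using k(2) by simp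
      thus ?thesis using k(1) by linarith
    qed
    moreover have "ct i j y = 0" using True by (rule nonpos)
    ultimately show ?thesis by simp
  next
    case False
    define k where "k = - ((- y) div int period) - 1"
    have "- y = (- y) div int period * int period + m0"
      unfolding m0_def by (simp only: div_mult_mod_eq)
    hence k: "y = (int period - m0) + k * int period"
      unfolding k_def by (simp add: left_diff_distrib) 
    have "0 \<le> k"
    proof (rule ccontr)
      assume "\<not> 0 \<le> k"
      hence "k * int period \<le> (- 1) * int period" by (intro mult_right_mono) auto
      thus False using k m0 False by linarith
    qed
    hence "ct i j y = ct i j (int period - m0)"
      unfolding k using many[of "int period - m0" "nat k"] m0 by simp
    also have "\<dots> = - ct i j m0"
      using m0 by (intro antisym) auto
    finally have "ct i j y = - ct i j m0" .
    moreover have "ct i j (- y) = 0" using False by (intro nonpos) simp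
    moreover have "\<not> y + m0 \<le> 0" using False m0 by linarith
    ultimately show ?thesis by simp
  qed
  finally show ?thesis .
qed

text \<open>The numerators start at the exponent s - p - d_i and the denominators at s - p + d_i.
  Each contributes the coefficients at plus and minus its starting exponent, which gives the four
  terms of the pairing, with opposite sign.\<close>

lemma has_deg_fundamental:
  assumes fr: "frenkel_reshetikhin" and ij: "i \<in> nodes" "j \<in> nodes"
  shows "has_deg (fps_to_fls (universal_coeff (L (fundamental_poly i (qs powi p))) (L (fundamental_poly j (qs powi s)))))
     (- pairing_Y \<gg> (i, p) (j, s))"
proof -
  obtain B where B: "qc_certificate \<gg> (int period) B" using certificate by blast
  let ?x = "s - p - int (d i)" and ?y = "s - p + int (d i)"
  have t: "qs powi u * (qs powi s / qs powi p) = qs powi (s - p + u)" for u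
    by (simp add: power_int_add power_int_diff)
  obtain F where F: "has_infprod (\<lambda>u.
               ((1 - fps_const (qs powi (int u - int (d i)) * (qs powi s / qs powi p)) * fps_X) /
                (1 - fps_const (qs powi (int u + int (d i)) * (qs powi s / qs powi p)) * fps_X))
               powi ct i j (int u)) F"
    and uc: "universal_coeff (L (fundamental_poly i (qs powi p))) (L (fundamental_poly j (qs powi s))) =
               fps_const (qpow (of_nat (d i) / of_nat r * cartan_inverse \<gg> i j)) * F"
    using fr ij unfolding frenkel_reshetikhin_def by (meson power_int_not_zero qs_nz)
  have 1: "s - p + (int u - int (d i)) = ?x + int u" "s - p + (int u + int (d i)) = ?y + int u" for u
    by simp_all
  have F': "has_infprod (\<lambda>u. (lin_fps (qs powi (?x + int u)) / lin_fps (qs powi (?y + int u))) powi ct i j (int u)) F"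
    using F unfolding t 1 lin_fps_def .
  have "ct i j (int (u + period)) = ct i j (int u)" for u
    using qc_certificate.ct_periodic[OF B, of j i "int u"] ij by (simp add: simple_nodes_eq)
  from periodic_infprod[OF this F']
  have "fps_to_fls F = (\<Prod>m<period. (phi_fls (qs powi (?x + int m)) / phi_fls (qs powi (?y + int m))) powi ct i j (int m))"
  proof -
    have inv: "fps_to_fls (inverse (scale_fps a phi)) = inverse (phi_fls a)" for a
      by (simp add: phi_fls_def fls_inverse_fps_to_fls)
    have *: "fps_to_fls (f powi n) = fps_to_fls f powi n" if "fps_nth f 0 \<noteq> 0" for f :: "kk fps" and n
      using that by (simp add: power_int_def fps_to_fls_power fls_inverse_fps_to_fls)
    show ?thesis
      unfolding \<open>F = _\<close> fps_to_fls_prod 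
      by (intro prod.cong refl, subst *) (simp_all add: fls_times_fps_to_fls inv divide_inverse flip: phi_fls_def)
  qed
  moreover have "has_deg \<dots> (\<Sum>m<period. ct i j (int m) * (deg_weight (qs powi (?x + int m)) - deg_weight (qs powi (?y + int m))))"
    by (intro has_deg_prod has_deg_power_int has_deg_divide has_deg_phi_fls) simp_all
  moreover have "(\<Sum>m<period. ct i j (int m) * (deg_weight (qs powi (?x + int m)) - deg_weight (qs powi (?y + int m)))) =
      - pairing_Y \<gg> (i, p) (j, s)"
    unfolding right_diff_distrib sum_subtractf sum_deg_weight_qs[OF B ij]
    by (simp add: Let_def algebra_simps)
  ultimately have "has_deg (fps_to_fls F) (- pairing_Y \<gg> (i, p) (j, s))"
    by metis
  from has_deg_mult[OF has_deg_const this] show ?thesis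
    unfolding uc by (simp add: fls_times_fps_to_fls)
qed

end

section \<open>Universal coefficients for monomials\<close>

lemma sum_mset_conv_count:
  fixes f :: "'a \<Rightarrow> int"
  assumes "finite A" "set_mset m \<subseteq> A"
  shows "(\<Sum>x\<in>#m. f x) = (\<Sum>x\<in>A. int (count m x) * f x)"
  using assms(2)
proof (induction m)
  case (add x m)
  have "(\<Sum>y\<in>A. int (count (add_mset x m) y) * f y) = (\<Sum>y\<in>A. int (count m y) * f y + (if y = x then f x else 0))"
    by (intro sum.cong refl) (auto simp: distrib_right)
  also have "\<dots> = (\<Sum>y\<in>A. int (count m y) * f y) + f x"
    using add.prems assms(1) by (simp add: sum.distrib)
  finally show ?case using add by simp
qed simp

lemma pairing_monomial_conv_sum_mset:
  "pairing_monomial \<gg> m m' = (\<Sum>x\<in>#m. \<Sum>y\<in>#m'. pairing_Y \<gg> x y)"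
proof -
  have "(\<Sum>x\<in>#m. \<Sum>y\<in>#m'. pairing_Y \<gg> x y) =
      (\<Sum>x\<in>set_mset m. int (count m x) * (\<Sum>y\<in>set_mset m'. int (count m' y) * pairing_Y \<gg> x y))"
    using sum_mset_conv_count[of "set_mset m'" m'] sum_mset_conv_count[of "set_mset m" m] by simp
  thus ?thesis
    by (simp add: pairing_monomial_def sum_distrib_left mult.assoc)
qed

context quantum_loop_algebra
begin

lemma has_deg_nz: "has_deg f D \<Longrightarrow> f \<noteq> 0"
  by (elim has_degE) (auto simp: fls_X_intpow_nonzero)

abbreviation uc :: "(nat \<Rightarrow> kk poly) \<Rightarrow> (nat \<Rightarrow> kk poly) \<Rightarrow> kk fps" where
  "uc P P' \<equiv> universal_coeff (L P) (L P')"

lemma drinfeld_one: "(\<lambda>_. 1) \<in> drinfeld_polys"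
  by (simp add: drinfeld_polys_def)

lemma drinfeld_mult: "P \<in> drinfeld_polys \<Longrightarrow> P' \<in> drinfeld_polys \<Longrightarrow> (\<lambda>i. P i * P' i) \<in> drinfeld_polys"
  by (simp add: drinfeld_polys_def coeff_mult)

lemma drinfeld_fundamental: "fundamental_poly i a \<in> drinfeld_polys"
  by (simp add: drinfeld_polys_def fundamental_poly_def)

lemma monomial_poly_empty: "monomial_poly {#} = (\<lambda>_. 1)"
  by (simp add: monomial_poly_def)

lemma monomial_poly_add:
  "monomial_poly (add_mset (i, p) m) = (\<lambda>j. fundamental_poly i (qs powi p) j * monomial_poly m j)"
  by (simp add: monomial_poly_def)

lemma drinfeld_monomial: "monomial_poly m \<in> drinfeld_polys"
  by (induction m) (auto simp: monomial_poly_empty monomial_poly_add drinfeld_one drinfeld_fundamental intro!: drinfeld_mult)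

lemma
  assumes fr: frenkel_reshetikhin and P: "P1 \<in> drinfeld_polys" "P2 \<in> drinfeld_polys" "P3 \<in> drinfeld_polys"
  shows uc_mult_left: "uc (\<lambda>i. P1 i * P2 i) P3 = uc P1 P3 * uc P2 P3"
    and uc_mult_right: "uc P1 (\<lambda>i. P2 i * P3 i) = uc P1 P2 * uc P1 P3"
  using fr P unfolding frenkel_reshetikhin_def by blast+

text \<open>The empty monomial is handled by cancellation in the multiplicativity law. This takes
  some nonzero coefficient, and any series that has a degree is nonzero.\<close>

lemma uc_one_left:
  assumes fr: frenkel_reshetikhin and P: "P \<in> drinfeld_polys" "P' \<in> drinfeld_polys" "uc P' P \<noteq> 0"
  shows "uc (\<lambda>_. 1) P = 1"
  using uc_mult_left[OF fr drinfeld_one P(2,1)] P(3) by simp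

lemma uc_one_right:
  assumes fr: frenkel_reshetikhin and P: "P \<in> drinfeld_polys" "P' \<in> drinfeld_polys" "uc P P' \<noteq> 0"
  shows "uc P (\<lambda>_. 1) = 1"
  using uc_mult_right[OF fr P(1) drinfeld_one P(2)] P(3) by simp

lemma has_deg_fundamental_monomial:
  assumes fr: frenkel_reshetikhin and i: "i \<in> nodes" and m: "set_mset m \<subseteq> nodes \<times> UNIV"
  shows "has_deg (fps_to_fls (uc (fundamental_poly i (qs powi p)) (monomial_poly m))) (- (\<Sum>y\<in>#m. pairing_Y \<gg> (i, p) y))"
  using m
proof (induction m)
  case empty
  have "uc (fundamental_poly i (qs powi p)) (fundamental_poly i (qs powi p)) \<noteq> 0"
    using has_deg_nz[OF has_deg_fundamental[OF fr i i]] by auto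
  hence "uc (fundamental_poly i (qs powi p)) (\<lambda>_. 1) = 1"
    by (intro uc_one_right[OF fr drinfeld_fundamental drinfeld_fundamental])
  thus ?case by (simp add: monomial_poly_empty has_deg_1)
next
  case (add y m)
  obtain j s where y: "y = (j, s)" by (cases y)
  have j: "j \<in> nodes" using add.prems by (auto simp: y)
  show ?case
    unfolding y monomial_poly_add uc_mult_right[OF fr drinfeld_fundamental drinfeld_fundamental drinfeld_monomial]
    using has_deg_mult[OF has_deg_fundamental[OF fr i j] add.IH] add.prems by (simp add: fls_times_fps_to_fls)
qed

lemma has_deg_monomial:
  assumes fr: frenkel_reshetikhin and m: "set_mset m \<subseteq> nodes \<times> UNIV" "set_mset m' \<subseteq> nodes \<times> UNIV"
  shows "has_deg (fps_to_fls (uc (monomial_poly m) (monomial_poly m'))) (- pairing_monomial \<gg> m m')"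
  unfolding pairing_monomial_conv_sum_mset using m(1)
proof (induction m)
  case empty
  have 1: "1 \<in> nodes" using simple_type by (cases \<gg>) auto
  have "uc (fundamental_poly 1 (qs powi 0)) (monomial_poly m') \<noteq> 0"
    using has_deg_nz[OF has_deg_fundamental_monomial[OF fr 1 m(2)]] by (metis fps_zero_to_fls)
  hence "uc (\<lambda>_. 1) (monomial_poly m') = 1"
    by (intro uc_one_left[OF fr drinfeld_monomial drinfeld_fundamental])
  thus ?case by (simp add: monomial_poly_empty has_deg_1)
next
  case (add x m)
  obtain i p where x: "x = (i, p)" by (cases x)
  have i: "i \<in> nodes" using add.prems by (auto simp: x)
  show ?case
    unfolding x monomial_poly_add uc_mult_left[OF fr drinfeld_fundamental drinfeld_monomial drinfeld_monomial]
    using has_deg_mult[OF has_deg_fundamental_monomial[OF fr i m(2)] add.IH] add.prems by (simp add: fls_times_fps_to_fls)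
qed

section \<open>Existence and uniqueness of the denominator\<close>

lemma laurent_polys_add:
  assumes "f \<in> laurent_polys" "g \<in> laurent_polys"
  shows "f + g \<in> laurent_polys"
proof -
  obtain p n p' n' where "f = Fract p (monom 1 n)" "g = Fract p' (monom 1 n')"
    using assms unfolding laurent_polys_def by blast
  hence "f + g = Fract (p * monom 1 n' + p' * monom 1 n) (monom 1 (n + n'))"
    by (simp add: mult_monom)
  thus ?thesis unfolding laurent_polys_def by blast
qed

lemma laurent_polys_mult_poly:
  assumes "f \<in> laurent_polys"
  shows "Fract p 1 * f \<in> laurent_polys"
proof -
  obtain p' n where "f = Fract p' (monom 1 n)"
    using assms unfolding laurent_polys_def by blast
  hence "Fract p 1 * f = Fract (p * p') (monom 1 n)" by simp
  thus ?thesis unfolding laurent_polys_def by blast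
qed

lemma clears_denominators_add:
  assumes "clears_denominators V W p" "clears_denominators V W p'"
  shows "clears_denominators V W (p + p')"
proof -
  have "Fract (p + p') 1 * x = Fract p 1 * x + Fract p' 1 * x" for x :: kz
    unfolding distrib_right[symmetric] by simp
  thus ?thesis
    using assms laurent_polys_add unfolding clears_denominators_def by simp
qed

lemma clears_denominators_mult:
  assumes "clears_denominators V W p"
  shows "clears_denominators V W (p' * p)"
proof -
  have "Fract (p' * p) 1 * x = Fract p' 1 * (Fract p 1 * x)" for x :: kz
    by (simp add: mult.assoc[symmetric])
  thus ?thesis
    using assms laurent_polys_mult_poly unfolding clears_denominators_def by metis
qed

lemma clears_denominators_exists: "\<exists>p\<noteq>0. clears_denominators V W p"
proof -
  have "\<exists>p\<noteq>0. \<forall>x\<in>S. Fract p 1 * x \<in> laurent_polys" if "finite S" for S :: "kz set"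
    using that
  proof (induction S)
    case (insert x S)
    then obtain p where p: "p \<noteq> 0" "\<forall>x\<in>S. Fract p 1 * x \<in> laurent_polys" by blast
    obtain a b where x: "x = Fract a b" "b \<noteq> 0" by (cases x)
    have "Fract (p * b) 1 * y \<in> laurent_polys" if "y \<in> insert x S" for y
    proof (cases "y = x")
      case True
      have "Fract (p * b) 1 * x = Fract (p * a) (monom 1 0)"
        using x by (simp add: eq_fract monom_0)
      thus ?thesis unfolding True laurent_polys_def mem_Collect_eq by (intro exI)
    next
      case False
      have "Fract (p * b) 1 * y = Fract b 1 * (Fract p 1 * y)"
        unfolding mult.assoc[symmetric] by (simp add: mult.commute[of p])
      moreover have "Fract p 1 * y \<in> laurent_polys" using False that p by blast
      ultimately show ?thesis using laurent_polys_mult_poly by metis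
    qed
    thus ?case using p x by (intro exI[of _ "p * b"]) simp
  qed (auto intro: exI[of _ 1])
  from this[of "(\<lambda>(i, j). Rnorm V W $$ (i, j)) ` ({..<rep_dim W * rep_dim V} \<times> {..<rep_dim V * rep_dim W})"]
  show ?thesis unfolding clears_denominators_def by auto
qed

text \<open>The polynomials that clear the denominators of finitely many rational functions form a
  nonzero ideal. Its monic element of least degree is unique: the difference of two of them would
  have smaller degree and, once made monic, contradict minimality. So the \<open>THE\<close> is
  well-defined and yields a monic polynomial.\<close>

lemma denominator_nz: "denominator V W \<noteq> 0"
proof -
  let ?C = "\<lambda>p. Polynomial.lead_coeff p = 1 \<and> clears_denominators V W p"
  have monic: "?C (Polynomial.smult (inverse (Polynomial.lead_coeff p)) p)" if "p \<noteq> 0" "clears_denominators V W p" for p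
    using clears_denominators_mult[OF that(2), of "[:inverse (Polynomial.lead_coeff p):]"] that by simp
  then obtain p0 where "?C p0"
    using clears_denominators_exists by blast
  define p where "p = arg_min Polynomial.degree ?C"
  have p: "?C p" and min: "Polynomial.degree p \<le> Polynomial.degree p'" if "?C p'" for p'
    unfolding p_def using arg_min_natI[of ?C p0] arg_min_nat_le[of ?C p'] \<open>?C p0\<close> that by simp_all
  have "denominator V W = p"
    unfolding denominator_def
  proof (rule the_equality)
    show "Polynomial.lead_coeff p = 1 \<and> clears_denominators V W p \<and>
      (\<forall>p'. Polynomial.lead_coeff p' = 1 \<longrightarrow> clears_denominators V W p' \<longrightarrow> Polynomial.degree p \<le> Polynomial.degree p')"
      using p[OF \<open>?C p0\<close>] min by blast
  next
    fix p' assume p': "Polynomial.lead_coeff p' = 1 \<and> clears_denominators V W p' \<and>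
      (\<forall>p''. Polynomial.lead_coeff p'' = 1 \<longrightarrow> clears_denominators V W p'' \<longrightarrow> Polynomial.degree p' \<le> Polynomial.degree p'')"
    have pC: "?C p" using p[OF \<open>?C p0\<close>] .
    have deg: "Polynomial.degree p' = Polynomial.degree p"
      using p' pC min by (meson le_antisym)
    show "p' = p"
    proof (rule ccontr)
      assume neq: "p' \<noteq> p"
      have "clears_denominators V W (p' + [:- 1:] * p)"
        using p' pC by (intro clears_denominators_add clears_denominators_mult) auto
      hence clr: "clears_denominators V W (p' - p)" by simp
      have "p' - p \<noteq> 0" using neq by simp
      hence "inverse (Polynomial.lead_coeff (p' - p)) \<noteq> 0"
        by (simp only: nonzero_imp_inverse_nonzero leading_coeff_neq_0 not_False_eq_True)
      with min[OF monic[OF \<open>p' - p \<noteq> 0\<close> clr]] have le: "Polynomial.degree p \<le> Polynomial.degree (p' - p)"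
        by (simp only: degree_smult_eq if_False)
      have "Polynomial.degree (p' - p) \<le> Polynomial.degree p"
        using degree_diff_le[of p' "Polynomial.degree p" p] deg by simp
      with le have eq: "Polynomial.degree (p' - p) = Polynomial.degree p" by simp
      have "Polynomial.lead_coeff (p' - p) = 0"
        unfolding eq using p' pC deg by simp
      thus False using \<open>p' - p \<noteq> 0\<close> by (simp only: leading_coeff_0_iff)
    qed
  qed
  thus ?thesis using p[OF \<open>?C p0\<close>] by auto
qed

lemma has_deg_denominator: "has_deg (fps_to_fls (fps_of_poly (denominator V W))) (2 * int (order 1 (denominator V W)))"
  by (intro has_deg_poly denominator_nz)

end

section \<open>Dual bases\<close>

lemma sum_atMost_first: "(\<Sum>k\<le>M. f k) = (f (0 :: nat) :: 'a :: comm_monoid_add) + (\<Sum>k=1..M. f k)"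
  using sum.atLeast1_atMost_eq[of f M] by (simp add: sum.atMost_shift)

lemma sum_atMost_Suc_shift_last: "(\<Sum>k\<le>M. f (Suc k)) = (\<Sum>k=1..M. f k) + (f (Suc M) :: 'a :: comm_monoid_add)"
  using sum.atLeast1_atMost_eq[of f M] by (simp add: lessThan_Suc_atMost[symmetric])

context cartan_form
begin

text \<open>The skew derivation as a sum over positions, which is the shape of the recursion of
  \<open>word_pairing\<close>.\<close>

lemma dLw_sum:
  "dLw i w = (\<Sum>t<length w. if w ! t = i then sm (inverse (P i (take t w))) (wrd (take t w @ drop (Suc t) w)) else 0)"
proof (induction w)
  case (Cons j w)
  have "sm (inverse (p i j)) (e j * dLw i w) =
      (\<Sum>t<length w. if w ! t = i then sm (inverse (P i (j # take t w))) (wrd (j # take t w @ drop (Suc t) w)) else 0)"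
    unfolding Cons wrd_Cons[of j "_ @ _"] sum_distrib_left sm_sum
    by (auto simp: sm_mult_right mult.commute intro!: sum.cong)
  thus ?case
    by (simp add: sum.lessThan_Suc_shift eq_commute[of i j] del: sum.lessThan_Suc P_Cons cong: if_cong)
qed simp

text \<open>A q-binomial theorem, as left and twisted right multiplication by e_i commute up to a
  power of q_i. The coefficients are abstract solutions of the q-Pascal rule, to be replaced by
  Gaussian binomials. At M = 1 - \<open>a i j\<close> the exponent \<open>int M - 1 + a i j\<close>
  is 0, so that exactly the coefficients of the quantum Serre relation remain.\<close>

lemma funpow_qad_expansion:
  fixes B :: "nat \<Rightarrow> nat \<Rightarrow> 'k"
  assumes B0: "\<And>M. B M 0 = 1" "\<And>M. B M M = 1"
    and Pascal: "\<And>M k. 0 < k \<Longrightarrow> k \<le> M \<Longrightarrow>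
      B (Suc M) k = v powi (- int (d i) * int k) * B M k + v powi (int (d i) * (int M + 1 - int k)) * B M (k - 1)"
  shows "(qad i ^^ M) (e j) =
    (\<Sum>k\<le>M. sm ((- 1) ^ k * B M k * v powi (int (d i) * int k * (int M - 1 + a i j))) (e i ^ (M - k) * e j * e i ^ k))"
proof (induction M)
  case 0
  show ?case by (simp add: B0)
next
  case (Suc M)
  let ?u = "\<lambda>M k. e i ^ (M - k) * e j * e i ^ k"
  let ?C = "\<lambda>M k. (- 1) ^ k * B M k * v powi (int (d i) * int k * (int M - 1 + a i j))"
  let ?g = "\<lambda>n. v powi (int (d i) * n)"
  have g_add: "?g x * ?g y = ?g (x + y)" for x y
    by (simp add: power_int_add[symmetric] v_nz distrib_left)
  have twist_e: "twist i 1 (e i ^ k) = sm (?g (2 * int k)) (e i ^ k)" for k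
  proof -
    have "p i i ^ k = ?g (2 * int k)"
      unfolding p_def a_diag power_int_of_nat[symmetric] power_int_mult[symmetric] by (simp add: mult_ac)
    thus ?thesis
      by (simp add: twist_power twist_e sm_power)
  qed
  have u: "qad i (?u M k) = ?u (Suc M) k - sm (?g (2 * int M + a i j)) (?u (Suc M) (Suc k))" if "k \<le> M" for k
  proof -
    have "?g (2 * int (M - k)) * (?g (a i j) * ?g (2 * int k)) = ?g (2 * int M + a i j)"
      unfolding g_add using that by (simp add: of_nat_diff algebra_simps)
    hence "twist i 1 (?u M k) = sm (?g (2 * int M + a i j)) (?u M k)"
      by (simp add: twist_mult twist_e sm_mult_left sm_mult_right mult.assoc cartan_form.twist_e[OF cartan_form_axioms] p_def)
        (simp add: mult_ac)
    moreover have "e i * ?u M k = ?u (Suc M) k"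
      using that by (simp add: Suc_diff_le mult.assoc)
    moreover have "?u M k * e i = ?u (Suc M) (Suc k)"
      by (simp add: mult.assoc power_commutes)
    ultimately show ?thesis
      by (simp add: qad_def sm_mult_left)
  qed
  have rec: "?C (Suc M) k = ?C M k - ?g (2 * int M + a i j) * ?C M (k - 1)" if "0 < k" "k \<le> M" for k
  proof -
    have "?C (Suc M) k = (- 1) ^ k * (B M k * (?g (- int k) * ?g (int k * (int M + a i j))) +
       B M (k - 1) * (?g (int M + 1 - int k) * ?g (int k * (int M + a i j))))"
      by (simp add: Pascal[OF that] algebra_simps)
    also have "?g (- int k) * ?g (int k * (int M + a i j)) = ?g (int k * (int M - 1 + a i j))"
      unfolding g_add by (simp add: algebra_simps)
    also have "?g (int M + 1 - int k) * ?g (int k * (int M + a i j)) =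
        ?g (2 * int M + a i j) * ?g (int (k - 1) * (int M - 1 + a i j))"
      unfolding g_add using that by (simp add: of_nat_diff algebra_simps)
    also have "(- 1) ^ k = - ((- 1 :: 'k) ^ (k - 1))"
      using that by (cases k) auto
    finally show ?thesis
      using that by (cases k) (simp_all add: algebra_simps)
  qed
  have "(qad i ^^ Suc M) (e j) = (\<Sum>k\<le>M. sm (?C M k) (qad i (?u M k)))"
    by (simp add: Suc.IH flin_sum[OF flin_qad])
  also have "\<dots> = (\<Sum>k\<le>M. sm (?C M k) (?u (Suc M) k)) - (\<Sum>k\<le>M. sm (?g (2 * int M + a i j) * ?C M k) (?u (Suc M) (Suc k)))"
    using u by (simp add: sm_diff sum_subtractf mult.commute)
  also have "(\<Sum>k\<le>M. sm (?C M k) (?u (Suc M) k)) = sm (?C M 0) (?u (Suc M) 0) + (\<Sum>k=1..M. sm (?C M k) (?u (Suc M) k))"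
    by (rule sum_atMost_first)
  also have "(\<Sum>k\<le>M. sm (?g (2 * int M + a i j) * ?C M k) (?u (Suc M) (Suc k))) =
      (\<Sum>k=1..M. sm (?g (2 * int M + a i j) * ?C M (k - 1)) (?u (Suc M) k)) + sm (?g (2 * int M + a i j) * ?C M M) (?u (Suc M) (Suc M))"
    using sum_atMost_Suc_shift_last[of "\<lambda>k. sm (?g (2 * int M + a i j) * ?C M (k - 1)) (?u (Suc M) k)" M]
    by (simp only: diff_Suc_1)
  also have "sm (?C M 0) (?u (Suc M) 0) + (\<Sum>k=1..M. sm (?C M k) (?u (Suc M) k)) -
      ((\<Sum>k=1..M. sm (?g (2 * int M + a i j) * ?C M (k - 1)) (?u (Suc M) k)) + sm (?g (2 * int M + a i j) * ?C M M) (?u (Suc M) (Suc M))) =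
      sm (?C (Suc M) 0) (?u (Suc M) 0) + (\<Sum>k=1..M. sm (?C (Suc M) k) (?u (Suc M) k)) + sm (?C (Suc M) (Suc M)) (?u (Suc M) (Suc M))"
  proof -
    have "(\<Sum>k=1..M. sm (?C (Suc M) k) (?u (Suc M) k)) = 
       (\<Sum>k=1..M. sm (?C M k) (?u (Suc M) k)) - (\<Sum>k=1..M. sm (?g (2 * int M + a i j) * ?C M (k - 1)) (?u (Suc M) k))"
      unfolding sum_subtractf[symmetric] sm_diff_left[symmetric]
      by (intro sum.cong refl) (subst rec, auto)
    moreover have "?C M 0 = ?C (Suc M) 0" by (simp add: B0)
    moreover have "?C (Suc M) (Suc M) = - (?g (2 * int M + a i j) * ?C M M)"
    proof -
      have "?g (2 * int M + a i j) * ?g (int M * (int M - 1 + a i j)) = ?g (int (Suc M) * (int (Suc M) - 1 + a i j))"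
        unfolding g_add by (simp add: algebra_simps)
      thus ?thesis by (simp add: B0 mult.assoc)
    qed
    ultimately have "sm (?C (Suc M) 0) (?u (Suc M) 0) = sm (?C M 0) (?u (Suc M) 0)"
      "sm (?C (Suc M) (Suc M)) (?u (Suc M) (Suc M)) = - sm (?g (2 * int M + a i j) * ?C M M) (?u (Suc M) (Suc M))"
      and s: "(\<Sum>k=1..M. sm (?C (Suc M) k) (?u (Suc M) k)) = 
       (\<Sum>k=1..M. sm (?C M k) (?u (Suc M) k)) - (\<Sum>k=1..M. sm (?g (2 * int M + a i j) * ?C M (k - 1)) (?u (Suc M) k))"
      by (simp_all only: sm_minus_left)
    note this(1,2)
    thus ?thesis unfolding s by (simp only: diff_conv_add_uminus minus_add_distrib add.assoc add.left_commute)
  qed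
  also have "\<dots> = (\<Sum>k\<le>Suc M. sm (?C (Suc M) k) (?u (Suc M) k))"
    unfolding sum.atMost_Suc sum_atMost_first[of _ M] ..
  finally show ?case .
qed

end

section \<open>Gaussian binomials and the Serre relations among Chevalley generators\<close>

lemma qint_pascal:
  assumes "g \<noteq> 0" "k \<le> M"
  shows "qint g (int (Suc M)) = g powi (- int k) * qint g (int (Suc M - k)) + g powi (int M + 1 - int k) * qint g (int k)"
proof -
  have "g powi (- int k) * (g powi (int (Suc M - k)) - g powi (- int (Suc M - k))) + g powi (int M + 1 - int k) * (g powi int k - g powi (- int k)) =
     g powi (int (Suc M)) - g powi (- int (Suc M))"
  proof -
    have *: "g powi x * g powi y = g powi (x + y)" for x y
      using assms by (simp add: power_int_add)
    show ?thesis
      unfolding right_diff_distrib * using assms(2) by (simp add: of_nat_diff algebra_simps)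
  qed
  thus ?thesis
    unfolding qint_def by (simp add: add_divide_distrib[symmetric])
qed

lemma qbinom_0: 
  assumes "\<And>n. 0 < n \<Longrightarrow> qint g (int n) \<noteq> 0"
  shows "qbinom g M 0 = 1" "qbinom g M M = 1"
proof -
  have "qfact g n \<noteq> 0" for n
    using assms by (simp add: qfact_def)
  thus "qbinom g M 0 = 1" "qbinom g M M = 1"
    by (simp_all add: qbinom_def) (simp_all add: qfact_def)
qed

lemma qbinom_pascal:
  assumes "g \<noteq> 0" "\<And>n. 0 < n \<Longrightarrow> qint g (int n) \<noteq> 0" "0 < k" "k \<le> M"
  shows "qbinom g (Suc M) k = g powi (- int k) * qbinom g M k + g powi (int M + 1 - int k) * qbinom g M (k - 1)"
proof -
  have nz: "qfact g n \<noteq> 0" for n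
    using assms by (simp add: qfact_def)
  have Suc: "qfact g (Suc n) = qfact g n * qint g (int (Suc n))" for n
    by (simp add: qfact_def)
  define D where "D = qfact g M / (qfact g k * qfact g (Suc M - k))"
  have k: "qfact g k = qfact g (k - 1) * qint g (int k)"
    using assms(3) Suc[of "k - 1"] by simp
  have Mk: "qfact g (Suc M - k) = qfact g (M - k) * qint g (int (Suc M - k))"
    using assms(4) Suc[of "M - k"] by (simp only: Suc_diff_le)
  have "qint g (int k) \<noteq> 0" "qint g (int (Suc M - k)) \<noteq> 0"
    by (rule assms(2), use assms(3,4) in simp)+
  hence "qbinom g M k = D * qint g (int (Suc M - k))" 
    using nz unfolding D_def qbinom_def Mk by (simp add: field_simps del: of_nat_diff)
  moreover have "M - (k - 1) = Suc M - k"
    using assms(3,4) by simp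
  hence "qbinom g M (k - 1) = D * qint g (int k)"
    using nz \<open>qint g (int k) \<noteq> 0\<close> unfolding D_def qbinom_def k by (simp add: field_simps)
  moreover have "qbinom g (Suc M) k = D * qint g (int (Suc M))"
    unfolding D_def qbinom_def Suc by simp
  ultimately show ?thesis
    unfolding qint_pascal[OF assms(1,4)] by (simp add: algebra_simps)
qed

lemma two_sided_ideal_subset: "x \<in> R \<Longrightarrow> x \<in> two_sided_ideal R"
  and two_sided_ideal_0: "0 \<in> two_sided_ideal R"
  and two_sided_ideal_add: "x \<in> two_sided_ideal R \<Longrightarrow> y \<in> two_sided_ideal R \<Longrightarrow> x + y \<in> two_sided_ideal R"
  and two_sided_ideal_mult: "x \<in> two_sided_ideal R \<Longrightarrow> a * x * b \<in> two_sided_ideal R"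
  unfolding two_sided_ideal_def by auto

context quantum_loop_algebra
begin

text \<open>Numbers outside the affine nodes become isolated nodes of type A1, which turns the
  affine Cartan matrix into one indexed by all natural numbers.\<close>

definition ext_cartan :: "nat \<Rightarrow> nat \<Rightarrow> int" where
  "ext_cartan i j = (if i \<in> affine_nodes \<and> j \<in> affine_nodes then affine_cartan \<gg> i j else if i = j then 2 else 0)"

definition ext_symmetrizer :: "nat \<Rightarrow> nat" where
  "ext_symmetrizer i = (if i \<in> affine_nodes then d i else 1)"

lemma qs_power_neq_1: "0 < n \<Longrightarrow> qs ^ n \<noteq> 1"
proof
  assume "0 < n" "qs ^ n = 1"
  hence "qs powi int n = qs powi 0" by simp
  thus False using \<open>0 < n\<close> unfolding qs_powi_inj by simp
qed

sublocale CF: cartan_form ext_cartan ext_symmetrizer qs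
proof
  show "ext_cartan i i = 2" for i
    by (simp add: ext_cartan_def affine_cartan_diag)
  show "i \<noteq> j \<Longrightarrow> ext_cartan i j \<le> 0" for i j
    using affine_cartan_offdiag[OF simple_type] by (auto simp: ext_cartan_def)
  show "0 < ext_symmetrizer i" for i
    by (simp add: ext_symmetrizer_def symmetrizer_pos)
  show "int (ext_symmetrizer i) * ext_cartan i j = int (ext_symmetrizer j) * ext_cartan j i" for i j
    using affine_cartan_sym[OF simple_type] by (auto simp: ext_cartan_def ext_symmetrizer_def)
qed (simp_all add: qs_power_neq_1)

lemma CF_p: "i \<in> affine_nodes \<Longrightarrow> j \<in> affine_nodes \<Longrightarrow> CF.p i j = qi i powi affine_cartan \<gg> i j"
  unfolding CF.p_def qi_def ext_cartan_def ext_symmetrizer_def by (simp add: power_int_mult)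

lemma CF_c: "i \<in> affine_nodes \<Longrightarrow> CF.c i = qi i - inverse (qi i)"
  unfolding CF.c_def qi_def ext_symmetrizer_def by simp

lemma qi_nz [simp]: "qi i \<noteq> 0"
  by (simp add: qi_def)

lemma qi_powi: "qi i powi n = qs powi (int (d i) * n)"
  unfolding qi_def power_int_mult by simp

lemma CF_P: 
  assumes "i \<in> affine_nodes" "set w \<subseteq> affine_nodes"
  shows "CF.P i w = qi i powi (\<Sum>j\<leftarrow>w. affine_cartan \<gg> i j)"
  using assms(2) by (induction w) (use assms(1) in \<open>simp_all add: CF_p power_int_add\<close>)

lemma word_pairing_conv:
  assumes "set w \<subseteq> affine_nodes" "set u \<subseteq> affine_nodes"
  shows "word_pairing w u = CF.word_form u (wrd w)"
  using assms
proof (induction u arbitrary: w)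
  case Nil
  show ?case by simp
next
  case (Cons i u)
  have i: "i \<in> affine_nodes" using Cons.prems by simp
  have P: "inverse (CF.P i (take t w)) = qi i powi (- (\<Sum>s<t. affine_cartan \<gg> i (w ! s)))" if "t < length w" for t
  proof -
    have "(\<Sum>j\<leftarrow>take t w. affine_cartan \<gg> i j) = (\<Sum>s<t. affine_cartan \<gg> i (w ! s))"
      using that unfolding sum_list_sum_nth by (simp add: atLeast0LessThan)
    moreover have "set (take t w) \<subseteq> affine_nodes"
      using Cons.prems set_take_subset[of t w] by blast
    ultimately show ?thesis
      by (simp only: CF_P[OF i] power_int_minus)
  qed
  have sub: "set (take t w @ drop (Suc t) w) \<subseteq> affine_nodes" for t
    using Cons.prems set_take_subset[of t w] set_drop_subset[of "Suc t" w] by auto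
  have dL: "CF.dL i (wrd w) = CF.dLw i w"
    by (simp add: CF.dL_def)
  have "CF.word_form u (CF.dL i (wrd w)) = (\<Sum>t<length w. if w ! t = i
      then qi i powi (- (\<Sum>s<t. affine_cartan \<gg> i (w ! s))) * word_pairing (take t w @ drop (Suc t) w) u else 0)"
    unfolding dL CF.dLw_sum CF.word_form_sum
    by (intro sum.cong refl) (use Cons sub P in \<open>auto simp: CF.word_form_sm\<close>)
  thus ?case
    by (simp add: CF_c[OF i])
qed

section \<open>Translation between words of indices and words of generators\<close>

lemma gn_wrd: "gn g = wrd [g]"
  by (simp add: gn_def wrd_def)

lemma scal_mult: "scal c * x = sm c x"
  by (simp add: scal_def sm_def)

text \<open>Words with a letter outside the affine nodes go to 0, so that the map is multiplicative
  and sends the whole Serre ideal into the ideal of the Chevalley relations.\<close>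

definition to_gens :: "(nat \<Rightarrow> gen) \<Rightarrow> (nat, kk) fa \<Rightarrow> free_alg" where
  "to_gens g = lin (\<lambda>w. if set w \<subseteq> affine_nodes then wrd (map g w) else 0)"

definition from_gens :: "free_alg \<Rightarrow> (nat, kk) fa" where
  "from_gens = lin (\<lambda>w. wrd (map chev_index w))"

lemma flin_to_gens [simp]: "flin (to_gens g)" and flin_from_gens [simp]: "flin from_gens"
  by (simp_all add: to_gens_def from_gens_def)

lemmas to_gens_lin = flin_0[OF flin_to_gens] flin_add[OF flin_to_gens] flin_sm[OF flin_to_gens] flin_diff[OF flin_to_gens]
  flin_sum[OF flin_to_gens]
lemmas from_gens_lin = flin_0[OF flin_from_gens] flin_add[OF flin_from_gens] flin_sm[OF flin_from_gens]

lemma to_gens_wrd: "to_gens g (wrd w) = (if set w \<subseteq> affine_nodes then wrd (map g w) else 0)"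
  by (simp add: to_gens_def)

lemma from_gens_wrd: "from_gens (wrd w) = wrd (map chev_index w)"
  by (simp add: from_gens_def)

lemma to_gens_mult: "to_gens g (x * y) = to_gens g x * to_gens g y"
proof (induction x rule: fa_induct_wrd)
  case (wrd u)
  show ?case
    by (induction y rule: fa_induct_wrd)
      (simp_all add: to_gens_lin to_gens_wrd wrd_append[symmetric] distrib_left sm_mult_right)
qed (simp_all add: to_gens_lin distrib_right sm_mult_left)

lemma to_gens_1: "to_gens g 1 = 1"
  using to_gens_wrd[of g "[]"] by simp

lemma to_gens_power: "to_gens g (x ^ n) = to_gens g x ^ n"
  by (induction n) (simp_all add: to_gens_1 to_gens_mult)

lemma to_gens_e: "to_gens g (CF.e i) = (if i \<in> affine_nodes then gn (g i) else 0)"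
  by (simp add: to_gens_wrd gn_wrd)

lemma qi_power_neq_1: "0 < n \<Longrightarrow> qi i powi n \<noteq> 1"
proof -
  assume "0 < n"
  moreover have "(1 :: kk) = qs powi 0" by simp
  ultimately show ?thesis
    using symmetrizer_pos[of \<gg> i] unfolding qi_powi by (metis mult_eq_0_iff of_nat_0_eq_iff less_irrefl qs_powi_inj)
qed

lemma qint_nz: "0 < n \<Longrightarrow> qint (qi i) (int n) \<noteq> 0"
proof
  assume n: "0 < n" and 0: "qint (qi i) (int n) = 0"
  have *: "qi i powi k \<noteq> qi i powi (- k)" if "0 < k" for k
  proof
    assume "qi i powi k = qi i powi (- k)"
    hence "qi i powi (k + k) = 1"
      unfolding power_int_add[OF disjI1[OF qi_nz]] by (metis power_int_minus right_inverse power_int_not_zero qi_nz)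
    thus False using qi_power_neq_1[of "k + k" i] that by simp
  qed
  show False
    using 0 *[of "int n"] *[of 1] n unfolding qint_def by (simp add: power_int_minus)
qed

lemma to_gens_serre:
  assumes "i \<noteq> j" "g = Chev_E \<or> g = Chev_F"
  shows "to_gens g (CF.serre i j) \<in> two_sided_ideal chevalley_relations"
proof (cases "i \<in> affine_nodes \<and> j \<in> affine_nodes")
  case True
  define s where "s = nat (1 - ext_cartan i j)"
  have a: "ext_cartan i j = affine_cartan \<gg> i j" "ext_symmetrizer i = d i"
    using True by (simp_all add: ext_cartan_def ext_symmetrizer_def)
  have s: "int s = 1 - affine_cartan \<gg> i j"
    using CF.a_off[OF assms(1)] by (simp add: s_def a)
  have "CF.serre i j = (\<Sum>k\<le>s. sm ((- 1) ^ k * qbinom (qi i) s k * qs powi (int (ext_symmetrizer i) * int k * (int s - 1 + ext_cartan i j)))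
      (CF.e i ^ (s - k) * CF.e j * CF.e i ^ k))"
    unfolding CF.serre_def s_def[symmetric]
  proof (rule CF.funpow_qad_expansion)
    fix M k :: nat assume "0 < k" "k \<le> M"
    from qbinom_pascal[OF qi_nz qint_nz this, of i]
    show "qbinom (qi i) (Suc M) k = qs powi (- int (ext_symmetrizer i) * int k) * qbinom (qi i) M k +
        qs powi (int (ext_symmetrizer i) * (int M + 1 - int k)) * qbinom (qi i) M (k - 1)"
      unfolding qi_powi a(2) by simp
  qed (simp_all add: qbinom_0 qint_nz)
  hence "to_gens g (CF.serre i j) =
      (\<Sum>k\<le>s. scal ((- 1) ^ k * qbinom (qi i) s k) * gn (g i) ^ (s - k) * gn (g j) * gn (g i) ^ k)"
    using True by (simp add: to_gens_lin to_gens_mult to_gens_power to_gens_e scal_mult s a(1) mult.assoc sm_mult_left)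
  also have "\<dots> \<in> two_sided_ideal chevalley_relations"
  proof (rule two_sided_ideal_subset)
    have "\<exists>x\<in>{\<lambda>i. gE i, \<lambda>i. gF i}. \<forall>i. gn (g i) = x i"
      using assms(2) by auto
    then obtain x where x: "x \<in> {\<lambda>i. gE i, \<lambda>i. gF i}" "\<And>i. gn (g i) = x i" by blast
    show "(\<Sum>k\<le>s. scal ((- 1) ^ k * qbinom (qi i) s k) * gn (g i) ^ (s - k) * gn (g j) * gn (g i) ^ k) \<in> chevalley_relations"
      unfolding chevalley_relations_def x(2)
    proof (rule UnI2, unfold mem_Collect_eq, rule exI[of _ i], rule exI[of _ j], rule exI[of _ s], rule exI[of _ x], intro conjI)
      show "s = nat (1 - affine_cartan \<gg> i j)" by (simp add: s_def a)
    qed (use True assms(1) x(1) in auto)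
  qed
  finally show ?thesis .
next
  case False
  have "to_gens g (CF.serre i j) = 0"
  proof (cases "i \<in> affine_nodes")
    case True
    have "to_gens g ((CF.qad i ^^ m) (CF.e j)) = 0" for m
    proof -
      have *: "to_gens g x = 0" if "supp (\<lambda>w. j \<in> set w) x" for x
        using that by (induction rule: supp_induct) (use False True in \<open>auto simp: to_gens_lin to_gens_wrd\<close>)
      have "supp (\<lambda>w. j \<in> set w) ((CF.qad i ^^ m) (CF.e j))"
      proof (induction m)
        case (Suc m)
        have "supp (\<lambda>w. j \<in> set w) (CF.twist i 1 x)" if "supp (\<lambda>w. j \<in> set w) x" for x
          using that by (induction rule: supp_induct) (auto simp: CF.twist_wrd intro: supp_add supp_sm)
        moreover have "supp (\<lambda>w. j \<in> set w) (CF.e i * x)" if "supp (\<lambda>w. j \<in> set w) x" for x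
          by (rule supp_mult[where Q = "\<lambda>_. True", OF _ that]) simp_all
        moreover have "supp (\<lambda>w. j \<in> set w) (x * CF.e i)" if "supp (\<lambda>w. j \<in> set w) x" for x
          by (rule supp_mult[where Q' = "\<lambda>_. True", OF that]) simp_all
        ultimately show ?case
          using Suc by (simp add: CF.qad_def supp_diff)
      qed simp
      thus ?thesis by (rule *)
    qed
    thus ?thesis by (simp add: CF.serre_def)
  next
    case False
    have "nat (1 - ext_cartan i j) = Suc (nat (- ext_cartan i j))"
      using CF.a_off[OF assms(1)] by simp
    thus ?thesis
      using False by (simp add: CF.serre_def CF.qad_def to_gens_lin to_gens_mult to_gens_e)
  qed
  thus ?thesis by (simp add: two_sided_ideal_0)
qed

lemma to_gens_serre_ideal:
  assumes "x \<in> CF.serre_ideal" "g = Chev_E \<or> g = Chev_F"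
  shows "to_gens g x \<in> two_sided_ideal chevalley_relations"
  using assms(1)
  by (induction rule: CF.serre_ideal.induct)
    (auto simp: to_gens_lin to_gens_mult two_sided_ideal_0 intro!: two_sided_ideal_add two_sided_ideal_mult to_gens_serre assms(2))

lemma half_component_altdef: "half_component g \<beta> = {x. supp (\<lambda>w. \<exists>is. w = map g is \<and> mset is = \<beta>) x}"
  by (simp add: half_component_def supp_def)

context
  fixes g :: "nat \<Rightarrow> gen"
  assumes g: "g = Chev_E \<or> g = Chev_F"
begin

lemma chev_index_g: "map chev_index (map g is) = is"
  using g by (induction "is") auto

lemma homog_from_gens: "x \<in> half_component g \<beta> \<Longrightarrow> homog \<beta> (from_gens x)"
  unfolding half_component_altdef mem_Collect_eq from_gens_def
  by (erule supp_lin) (auto simp: chev_index_g simp del: mset_map map_map)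

lemma to_gens_half_component: "homog \<beta> x \<Longrightarrow> to_gens g x \<in> half_component g \<beta>"
  unfolding half_component_altdef mem_Collect_eq to_gens_def
  by (erule supp_lin) auto

lemma to_gens_from_gens:
  assumes "x \<in> half_component g \<beta>" "set_mset \<beta> \<subseteq> affine_nodes"
  shows "to_gens g (from_gens x) = x"
proof -
  have "supp (\<lambda>w. \<exists>is. w = map g is \<and> mset is = \<beta>) x"
    using assms(1) by (simp add: half_component_altdef)
  thus ?thesis
  proof (induction rule: supp_induct)
    case (wrd w)
    then obtain "is" where "w = map g is" "mset is = \<beta>" by blast
    moreover from this(2) have "set is \<subseteq> affine_nodes" using assms(2) by auto
    ultimately show ?case by (simp add: from_gens_wrd chev_index_g to_gens_wrd del: map_map)
  qed (simp_all add: to_gens_lin from_gens_lin)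
qed

lemma from_gens_to_gens:
  assumes "homog \<beta> x" "set_mset \<beta> \<subseteq> affine_nodes"
  shows "from_gens (to_gens g x) = x"
  using assms(1)
proof (induction rule: supp_induct)
  case (wrd w)
  have "set w \<subseteq> affine_nodes" using wrd assms(2) by auto
  thus ?case by (simp add: from_gens_wrd chev_index_g to_gens_wrd del: map_map)
qed (simp_all add: to_gens_lin from_gens_lin)

text \<open>Here the theorem on the radical enters: an expansion that is correct up to the radical
  of the form is correct modulo the defining relations.\<close>

lemma dual_basis_span:
  assumes x: "x \<in> half_component g \<beta>" and \<beta>: "set_mset \<beta> \<subseteq> affine_nodes"
    and b: "\<And>\<nu>. \<nu> < N \<Longrightarrow> homog \<beta> (b \<nu>)"
    and radical: "CF.radical (from_gens x - (\<Sum>\<nu><N. sm (c \<nu>) (b \<nu>)))"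
  shows "x - (\<Sum>\<nu><N. scal (c \<nu>) * to_gens g (b \<nu>)) \<in> two_sided_ideal chevalley_relations"
proof -
  have "homog \<beta> (from_gens x - (\<Sum>\<nu><N. sm (c \<nu>) (b \<nu>)))"
    using b by (intro supp_diff supp_sum supp_sm homog_from_gens x) auto
  from to_gens_serre_ideal[OF CF.radical_imp_serre_ideal[OF this radical] g] show ?thesis
    by (simp add: to_gens_lin to_gens_from_gens[OF x \<beta>] scal_mult)
qed

end

lemma hopf_pairing_conv:
  assumes "x \<in> half_component Chev_E \<beta>" "y \<in> half_component Chev_F \<beta>" "set_mset \<beta> \<subseteq> affine_nodes"
  shows "hopf_pairing x y = CF.form (from_gens x) (from_gens y)"
proof -
  have nodes: "set (map chev_index (letters w)) \<subseteq> affine_nodes"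
    if w: "w \<in> Poly_Mapping.keys x" "x \<in> half_component g \<beta>" "g = Chev_E \<or> g = Chev_F" for w x g
  proof -
    obtain "is" where "letters w = map g is" "mset is = \<beta>"
      using w(1,2) unfolding half_component_def by blast
    thus ?thesis
      using assms(3) chev_index_g[OF w(3)] by (metis set_mset_mset)
  qed
  have "CF.form (from_gens x) (from_gens y) =
    (\<Sum>w\<in>Poly_Mapping.keys x. \<Sum>u\<in>Poly_Mapping.keys y. Poly_Mapping.lookup x w * (Poly_Mapping.lookup y u *
      CF.form (wrd (map chev_index (letters w))) (wrd (map chev_index (letters u)))))"
    unfolding from_gens_def lin_def CF.form_sum CF.form_sum_left CF.form_sm CF.form_sm_left
    by (subst sum.swap) (simp add: sum_distrib_left mult.left_commute)
  also have "\<dots> = hopf_pairing x y"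
    unfolding hopf_pairing_def CF.form_wrd
    using assms nodes[of _ x Chev_E] nodes[of _ y Chev_F]
    by (intro sum.cong refl) (simp add: word_pairing_conv)
  finally show ?thesis ..
qed

lemma dual_bases_exist:
  assumes \<beta>: "set_mset \<beta> \<subseteq> affine_nodes"
  shows "\<exists>N b b'. dual_bases \<beta> N b b'"
proof -
  obtain N b b' where fam: "CF.dual_fam \<beta> N b b'"
    and left: "\<And>x. homog \<beta> x \<Longrightarrow> CF.radical (x - (\<Sum>\<nu><N. sm (CF.form x (b' \<nu>)) (b \<nu>)))"
    and right: "\<And>y. homog \<beta> y \<Longrightarrow> CF.radical (y - (\<Sum>\<nu><N. sm (CF.form (b \<nu>) y) (b' \<nu>)))"
    by (rule CF.dual_fam_exists[of \<beta>]) blast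
  have homog: "homog \<beta> (b \<nu>)" "homog \<beta> (b' \<nu>)" if "\<nu> < N" for \<nu>
    using fam that by (simp_all add: CF.dual_fam_def)
  have half: "to_gens Chev_E (b \<nu>) \<in> half_component Chev_E \<beta>" "to_gens Chev_F (b' \<nu>) \<in> half_component Chev_F \<beta>" if "\<nu> < N" for \<nu>
    using homog[OF that] by (simp_all add: to_gens_half_component)
  have pairing: "hopf_pairing (to_gens Chev_E (b \<nu>)) (to_gens Chev_F (b' \<mu>)) = (if \<nu> = \<mu> then 1 else 0)"
    if "\<nu> < N" "\<mu> < N" for \<nu> \<mu>
    using fam that by (simp add: hopf_pairing_conv[OF half(1) half(2) \<beta>] from_gens_to_gens[OF _ homog(1) \<beta>]
      from_gens_to_gens[OF _ homog(2) \<beta>] CF.dual_fam_def)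
  have "\<exists>c. x - (\<Sum>\<nu><N. scal (c \<nu>) * to_gens Chev_E (b \<nu>)) \<in> two_sided_ideal chevalley_relations"
    if "x \<in> half_component Chev_E \<beta>" for x
    by (rule exI, rule dual_basis_span[OF _ that \<beta> homog(1) left[OF homog_from_gens[OF _ that]]]) simp_all
  moreover have "\<exists>c. x - (\<Sum>\<nu><N. scal (c \<nu>) * to_gens Chev_F (b' \<nu>)) \<in> two_sided_ideal chevalley_relations"
    if "x \<in> half_component Chev_F \<beta>" for x
    by (rule exI, rule dual_basis_span[OF _ that \<beta> homog(2) right[OF homog_from_gens[OF _ that]]]) simp_all
  ultimately have "dual_bases \<beta> N (\<lambda>\<nu>. to_gens Chev_E (b \<nu>)) (\<lambda>\<nu>. to_gens Chev_F (b' \<nu>))"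
    unfolding dual_bases_def using half pairing by blast
  thus ?thesis by blast
qed

end

section \<open>Isomorphic representations\<close>

text \<open>
  Unlike in the library, the number of columns of \<open>A\<close> is arbitrary: being isomorphic to a module does not
  determine the number of columns of the matrices of a representation.
\<close>

lemma mult_mat_vec_assoc:
  fixes A B :: "'a :: comm_ring mat"
  assumes "dim_vec v = dim_col B"
  shows "(A * B) *\<^sub>v v = A *\<^sub>v (B *\<^sub>v v)"
proof (rule eq_vecI)
  fix i assume "i < dim_vec (A *\<^sub>v (B *\<^sub>v v))"
  hence i: "i < dim_row A" by simp
  have "((A * B) *\<^sub>v v) $ i = (\<Sum>j<dim_col B. (\<Sum>k<dim_row B. row A i $ k * B $$ (k, j)) * v $ j)"
    using i assms by (simp add: scalar_prod_def atLeast0LessThan)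
  also have "\<dots> = (\<Sum>k<dim_row B. row A i $ k * (\<Sum>j<dim_col B. B $$ (k, j) * v $ j))"
    unfolding sum_distrib_left sum_distrib_right by (subst sum.swap) (simp add: mult.assoc)
  also have "\<dots> = (A *\<^sub>v (B *\<^sub>v v)) $ i"
    using i assms by (simp add: scalar_prod_def atLeast0LessThan)
  finally show "((A * B) *\<^sub>v v) $ i = (A *\<^sub>v (B *\<^sub>v v)) $ i" .
qed simp

lemma dim_kron_vec [simp]: "dim_vec (kron_vec v w) = dim_vec v * dim_vec w"
  by (simp add: kron_vec_def)

lemma sum_div_mod:
  fixes f g :: "nat \<Rightarrow> 'a :: comm_semiring_0"
  shows "(\<Sum>k<a * b. f (k div b) * g (k mod b)) = (\<Sum>i<a. f i) * (\<Sum>j<b. g j)"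
proof -
  have "(\<Sum>k<a * b. f (k div b) * g (k mod b)) = (\<Sum>i<a. \<Sum>k=i * b..<i * b + b. f (k div b) * g (k mod b))"
    by (rule sum.nat_group[symmetric])
  also have "\<dots> = (\<Sum>i<a. \<Sum>j<b. f i * g j)"
  proof (rule sum.cong[OF refl])
    fix i
    have "(\<Sum>k=i * b..<i * b + b. f (k div b) * g (k mod b)) = (\<Sum>j<b. f ((i * b + j) div b) * g ((i * b + j) mod b))"
      using sum.shift_bounds_nat_ivl[of "\<lambda>k. f (k div b) * g (k mod b)" 0 "i * b" b]
      by (simp add: atLeast0LessThan add.commute)
    thus "(\<Sum>k=i * b..<i * b + b. f (k div b) * g (k mod b)) = (\<Sum>j<b. f i * g j)"
      by simp
  qed
  finally show ?thesis
    by (simp add: sum_product)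
qed

lemma kron_mat_mult_vec:
  fixes A B :: "'a :: comm_ring mat"
  assumes "dim_vec v = dim_col A" "dim_vec w = dim_col B"
  shows "kron_mat A B *\<^sub>v kron_vec v w = kron_vec (A *\<^sub>v v) (B *\<^sub>v w)"
proof (rule eq_vecI)
  fix i assume "i < dim_vec (kron_vec (A *\<^sub>v v) (B *\<^sub>v w))"
  hence i: "i < dim_row A * dim_row B" by simp
  hence B: "0 < dim_row B" by (cases "dim_row B") auto
  have i': "i div dim_row B < dim_row A" "i mod dim_row B < dim_row B"
    using i B by (simp_all add: less_mult_imp_div_less)
  have "(kron_mat A B *\<^sub>v kron_vec v w) $ i = (\<Sum>k<dim_col A * dim_col B.
     (A $$ (i div dim_row B, k div dim_col B) * v $ (k div dim_col B)) * (B $$ (i mod dim_row B, k mod dim_col B) * w $ (k mod dim_col B)))"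
    using i assms by (simp add: kron_mat_def kron_vec_def scalar_prod_def atLeast0LessThan mult_ac)
  also have "\<dots> = (\<Sum>k<dim_col A. A $$ (i div dim_row B, k) * v $ k) * (\<Sum>k<dim_col B. B $$ (i mod dim_row B, k) * w $ k)"
    by (rule sum_div_mod)
  also have "\<dots> = kron_vec (A *\<^sub>v v) (B *\<^sub>v w) $ i"
    using i i' assms by (simp add: kron_vec_def scalar_prod_def atLeast0LessThan)
  finally show "(kron_mat A B *\<^sub>v kron_vec v w) $ i = kron_vec (A *\<^sub>v v) (B *\<^sub>v w) $ i" .
qed (simp add: kron_mat_def kron_vec_def)

text \<open>The finiteness assumption is essential: \<open>Sum_any\<close> is 0 on a function of
  infinite support, while linear combinations of such functions may have finite support.\<close>

lemma Sum_any_sum_mult: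
  fixes f :: "'b \<Rightarrow> 'a \<Rightarrow> 'c :: comm_ring"
  assumes "finite R" "\<And>l. l \<in> R \<Longrightarrow> finite {x. f l x \<noteq> 0}"
  shows "Sum_any (\<lambda>x. \<Sum>l\<in>R. c l * f l x) = (\<Sum>l\<in>R. c l * Sum_any (f l))"
proof -
  let ?A = "\<Union>l\<in>R. {x. f l x \<noteq> 0}"
  have fin: "finite ?A" using assms by blast
  have "{x. (\<Sum>l\<in>R. c l * f l x) \<noteq> 0} \<subseteq> ?A"
    by (force intro: sum.neutral)
  hence "Sum_any (\<lambda>x. \<Sum>l\<in>R. c l * f l x) = (\<Sum>x\<in>?A. \<Sum>l\<in>R. c l * f l x)"
    by (rule Sum_any.expand_superset[OF fin])
  also have "\<dots> = (\<Sum>l\<in>R. c l * (\<Sum>x\<in>?A. f l x))"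
    by (subst sum.swap) (simp add: sum_distrib_left)
  also have "\<dots> = (\<Sum>l\<in>R. c l * Sum_any (f l))"
    using fin by (intro sum.cong refl arg_cong[where f = "(*) _"] Sum_any.expand_superset[symmetric]) auto
  finally show ?thesis .
qed

definition word_act :: "loop_rep \<Rightarrow> gen list \<Rightarrow> kk vec \<Rightarrow> kk vec" where
  "word_act V w v = foldr (\<lambda>g u. rep_gen V g *\<^sub>v u) w v"

lemma word_act_Nil [simp]: "word_act V [] v = v"
  and word_act_Cons [simp]: "word_act V (g # w) v = rep_gen V g *\<^sub>v word_act V w v"
  by (simp_all add: word_act_def)

context quantum_loop_algebra
begin

text \<open>Only the number of rows is recorded, since an isomorphism determines it for the other
  module, in contrast to the number of columns. For the same reason \<open>rep_iso\<close> expresses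
  intertwining through vectors.\<close>

definition dim_gens :: "loop_rep \<Rightarrow> bool" where
  "dim_gens V \<longleftrightarrow> (\<forall>g\<in>gens. dim_row (rep_gen V g) = rep_dim V)"

lemma word_act_carrier:
  assumes "dim_gens V" "set w \<subseteq> gens" "v \<in> carrier_vec (rep_dim V)"
  shows "word_act V w v \<in> carrier_vec (rep_dim V)"
  using assms by (cases w) (auto simp: dim_gens_def intro!: carrier_vecI)

lemma word_mat_carrier:
  assumes "dim_gens V" "set w \<subseteq> gens"
  shows "word_mat V w \<in> carrier_mat (rep_dim V) (rep_dim V)"
proof -
  have "dim_col (word_mat V w) = rep_dim V" for w
    by (induction w) (simp_all add: word_mat_def)
  thus ?thesis
    using assms by (cases w) (auto simp: dim_gens_def word_mat_def intro!: carrier_matI)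
qed

lemma word_mat_mult_vec:
  assumes "dim_gens V" "set w \<subseteq> gens" "v \<in> carrier_vec (rep_dim V)"
  shows "word_mat V w *\<^sub>v v = word_act V w v"
  using assms(2)
proof (induction w)
  case Nil
  thus ?case using assms(3) by (simp add: word_mat_def)
next
  case (Cons g w)
  have "dim_vec v = dim_col (word_mat V w)"
    using word_mat_carrier[OF assms(1), of w] Cons.prems assms(3) by (auto dest: carrier_matD carrier_vecD)
  from mult_mat_vec_assoc[OF this, of "rep_gen V g"] show ?case
    using Cons by (simp add: word_mat_def)
qed

abbreviation in_gens :: "free_alg \<Rightarrow> bool" where
  "in_gens \<equiv> supp (\<lambda>w. set w \<subseteq> gens)"

lemma act_mult_vec:
  assumes "dim_gens V" "in_gens x" "v \<in> carrier_vec (rep_dim V)"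
  shows "act V x *\<^sub>v v = vec (rep_dim V) (\<lambda>i. linf (\<lambda>w. word_act V w v $ i) x)"
proof (rule eq_vecI)
  let ?n = "rep_dim V"
  fix i assume "i < dim_vec (vec ?n (\<lambda>i. linf (\<lambda>w. word_act V w v $ i) x))"
  hence i: "i < ?n" by simp
  have gens: "set (letters w) \<subseteq> gens" if "w \<in> Poly_Mapping.keys x" for w
    using assms(2) that by (simp add: supp_def)
  have "(act V x *\<^sub>v v) $ i = (\<Sum>j<?n. (\<Sum>w\<in>Poly_Mapping.keys x. Poly_Mapping.lookup x w * word_mat V (letters w) $$ (i, j)) * v $ j)"
    using i assms(3) by (simp add: act_def scalar_prod_def atLeast0LessThan)
  also have "\<dots> = (\<Sum>w\<in>Poly_Mapping.keys x. Poly_Mapping.lookup x w * (\<Sum>j<?n. word_mat V (letters w) $$ (i, j) * v $ j))"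
    unfolding sum_distrib_right sum_distrib_left by (subst sum.swap) (simp add: mult.assoc)
  also have "\<dots> = (\<Sum>w\<in>Poly_Mapping.keys x. Poly_Mapping.lookup x w * word_act V (letters w) v $ i)"
  proof (intro sum.cong refl arg_cong[where f = "(*) _"])
    fix w assume w: "w \<in> Poly_Mapping.keys x"
    have "(\<Sum>j<?n. word_mat V (letters w) $$ (i, j) * v $ j) = (word_mat V (letters w) *\<^sub>v v) $ i"
      using i assms(3) word_mat_carrier[OF assms(1) gens[OF w]] by (simp add: scalar_prod_def atLeast0LessThan)
    thus "(\<Sum>j<?n. word_mat V (letters w) $$ (i, j) * v $ j) = word_act V (letters w) v $ i"
      by (simp only: word_mat_mult_vec[OF assms(1) gens[OF w] assms(3)])
  qed
  finally show "(act V x *\<^sub>v v) $ i = vec ?n (\<lambda>i. linf (\<lambda>w. word_act V w v $ i) x) $ i"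
    using i by (simp add: linf_def)
qed (simp add: act_def)

lemma act_carrier: "act V x \<in> carrier_mat (rep_dim V) (rep_dim V)"
  by (simp add: act_def)

definition rep_iso :: "loop_rep \<Rightarrow> loop_rep \<Rightarrow> kk mat \<Rightarrow> kk mat \<Rightarrow> bool" where
  "rep_iso V V' M M' \<longleftrightarrow> rep_dim V' = rep_dim V \<and> M \<in> carrier_mat (rep_dim V) (rep_dim V) \<and>
     M' \<in> carrier_mat (rep_dim V) (rep_dim V) \<and> M * M' = 1\<^sub>m (rep_dim V) \<and> M' * M = 1\<^sub>m (rep_dim V) \<and>
     dim_gens V \<and> dim_gens V' \<and>
     (\<forall>g\<in>gens. \<forall>v\<in>carrier_vec (rep_dim V). rep_gen V' g *\<^sub>v (M *\<^sub>v v) = M *\<^sub>v (rep_gen V g *\<^sub>v v))"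

lemma rep_iso_inverse:
  assumes "rep_iso V V' M M'" "v \<in> carrier_vec (rep_dim V)"
  shows "M' *\<^sub>v (M *\<^sub>v v) = v" "M *\<^sub>v (M' *\<^sub>v v) = v"
proof -
  have "M \<in> carrier_mat (rep_dim V) (rep_dim V)" "M' \<in> carrier_mat (rep_dim V) (rep_dim V)"
    "M * M' = 1\<^sub>m (rep_dim V)" "M' * M = 1\<^sub>m (rep_dim V)"
    using assms by (simp_all add: rep_iso_def)
  thus "M' *\<^sub>v (M *\<^sub>v v) = v" "M *\<^sub>v (M' *\<^sub>v v) = v"
    using assms(2) assoc_mult_mat_vec[of M' _ _ M _ v] assoc_mult_mat_vec[of M _ _ M' _ v] by simp_all
qed

lemma rep_iso_carrier:
  assumes "rep_iso V V' M M'"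
  shows "M *\<^sub>v v \<in> carrier_vec (rep_dim V')"
  using assms by (auto simp: rep_iso_def intro!: carrier_vecI)

lemma rep_iso_sym:
  assumes iso: "rep_iso V V' M M'"
  shows "rep_iso V' V M' M"
proof -
  let ?n = "rep_dim V"
  have M: "M \<in> carrier_mat ?n ?n" "M' \<in> carrier_mat ?n ?n" and dim: "rep_dim V' = ?n" "dim_gens V" "dim_gens V'"
    using iso by (simp_all add: rep_iso_def)
  have "rep_gen V g *\<^sub>v (M' *\<^sub>v v) = M' *\<^sub>v (rep_gen V' g *\<^sub>v v)" if "g \<in> gens" "v \<in> carrier_vec ?n" for g v
  proof -
    have M'v: "M' *\<^sub>v v \<in> carrier_vec ?n" using M that by simp
    have "rep_gen V' g *\<^sub>v (M *\<^sub>v (M' *\<^sub>v v)) = M *\<^sub>v (rep_gen V g *\<^sub>v (M' *\<^sub>v v))"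
      using iso M'v that unfolding rep_iso_def by blast
    hence eq: "rep_gen V' g *\<^sub>v v = M *\<^sub>v (rep_gen V g *\<^sub>v (M' *\<^sub>v v))"
      by (simp only: rep_iso_inverse(2)[OF iso that(2)])
    have "rep_gen V g *\<^sub>v (M' *\<^sub>v v) \<in> carrier_vec ?n"
      using dim that by (auto simp: dim_gens_def intro!: carrier_vecI)
    thus ?thesis
      unfolding eq using rep_iso_inverse(1)[OF iso] by simp
  qed
  thus ?thesis
    using iso unfolding rep_iso_def dim by blast
qed

lemma rep_iso_word_act:
  assumes iso: "rep_iso V V' M M'" and "set w \<subseteq> gens" "v \<in> carrier_vec (rep_dim V)"
  shows "word_act V' w (M *\<^sub>v v) = M *\<^sub>v word_act V w v"
  using assms(2)
proof (induction w)
  case (Cons g w)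
  have "word_act V w v \<in> carrier_vec (rep_dim V)"
    using iso Cons.prems assms(3) by (intro word_act_carrier) (auto simp: rep_iso_def)
  thus ?case
    using Cons iso by (simp add: rep_iso_def)
qed simp

lemma linf_sum_right: "linf (\<lambda>w. \<Sum>j\<in>A. c j * f j w) x = (\<Sum>j\<in>A. c j * linf (f j) x)"
  unfolding linf_def sum_distrib_left by (subst sum.swap) (simp add: mult.left_commute)

lemma rep_iso_act:
  assumes iso: "rep_iso V V' M M'" and x: "in_gens x" and v: "v \<in> carrier_vec (rep_dim V)"
  shows "act V' x *\<^sub>v (M *\<^sub>v v) = M *\<^sub>v (act V x *\<^sub>v v)"
proof -
  let ?n = "rep_dim V"
  have M: "M \<in> carrier_mat ?n ?n" and dim: "rep_dim V' = ?n" "dim_gens V" "dim_gens V'"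
    using iso by (simp_all add: rep_iso_def)
  show ?thesis
  proof (rule eq_vecI)
    fix i assume "i < dim_vec (M *\<^sub>v (act V x *\<^sub>v v))"
    hence i: "i < ?n" using M by simp
    have "(act V' x *\<^sub>v (M *\<^sub>v v)) $ i = linf (\<lambda>w. word_act V' w (M *\<^sub>v v) $ i) x"
      using act_mult_vec[OF dim(3) x rep_iso_carrier[OF iso]] i dim by simp
    also have "\<dots> = linf (\<lambda>w. \<Sum>j<?n. M $$ (i, j) * word_act V w v $ j) x"
      unfolding linf_def
    proof (intro sum.cong refl arg_cong[where f = "(*) _"])
      fix w assume "w \<in> Poly_Mapping.keys x"
      hence w: "set (letters w) \<subseteq> gens" using x by (simp add: supp_def)
      show "word_act V' (letters w) (M *\<^sub>v v) $ i = (\<Sum>j<?n. M $$ (i, j) * word_act V (letters w) v $ j)"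
        using i M word_act_carrier[OF dim(2) w v] unfolding rep_iso_word_act[OF iso w v]
        by (simp add: scalar_prod_def atLeast0LessThan)
    qed
    also have "\<dots> = (M *\<^sub>v (act V x *\<^sub>v v)) $ i"
      unfolding linf_sum_right act_mult_vec[OF dim(2) x v] using i M by (simp add: scalar_prod_def atLeast0LessThan)
    finally show "(act V' x *\<^sub>v (M *\<^sub>v v)) $ i = (M *\<^sub>v (act V x *\<^sub>v v)) $ i" .
  qed (use M dim in \<open>simp add: act_def\<close>)
qed

lemma rep_iso_from_isomorphic:
  assumes V: "is_module V" and iso: "isomorphic V V'"
  shows "\<exists>M M'. rep_iso V V' M M'"
proof -
  let ?n = "rep_dim V"
  obtain M where dim: "rep_dim V' = ?n" and M: "M \<in> carrier_mat ?n ?n" "invertible_mat M"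
    and comm: "\<And>g. g \<in> gens \<Longrightarrow> M * rep_gen V g = rep_gen V' g * M"
    using iso unfolding isomorphic_def by auto
  obtain M' where M': "M * M' = 1\<^sub>m (dim_row M)" "M' * M = 1\<^sub>m (dim_row M')"
    using M(2) unfolding invertible_mat_def inverts_mat_def by blast
  have "dim_col M' = ?n" "dim_row M' = ?n"
    using M(1) arg_cong[OF M'(1), of dim_col] arg_cong[OF M'(2), of dim_col] by simp_all
  hence M'c: "M' \<in> carrier_mat ?n ?n" by (rule carrier_matI[rotated])
  have gV: "rep_gen V g \<in> carrier_mat ?n ?n" if "g \<in> gens" for g
    using V that by (simp add: is_module_def)
  have "dim_row (rep_gen V' g) = ?n" if "g \<in> gens" for g
    using arg_cong[OF comm[OF that], of dim_row] M by simp
  moreover have "rep_gen V' g *\<^sub>v (M *\<^sub>v v) = M *\<^sub>v (rep_gen V g *\<^sub>v v)" if "g \<in> gens" "v \<in> carrier_vec ?n" for g v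
  proof -
    have "rep_gen V' g *\<^sub>v (M *\<^sub>v v) = (rep_gen V' g * M) *\<^sub>v v"
      using that M(1) by (intro mult_mat_vec_assoc[symmetric]) simp
    also have "\<dots> = M *\<^sub>v (rep_gen V g *\<^sub>v v)"
      unfolding comm[OF that(1), symmetric] using that gV[OF that(1)] by (intro mult_mat_vec_assoc) simp
    finally show ?thesis .
  qed
  ultimately have "rep_iso V V' M M'"
    using M M' M'c carrier_matD(1)[OF gV] dim unfolding rep_iso_def dim_gens_def by auto
  thus ?thesis by blast
qed


section \<open>Transport of highest weight vectors and of the universal R-matrix along
  isomorphisms\<close>

lemma in_gens_gn [simp]: "in_gens (gn g) \<longleftrightarrow> g \<in> gens"
  by (simp add: gn_wrd)

lemma in_gens_mult: "in_gens x \<Longrightarrow> in_gens y \<Longrightarrow> in_gens (x * y)"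
  by (erule (1) supp_mult) simp

lemma in_gens_scal: "in_gens (scal c)"
  using supp_sm[of "\<lambda>w. set w \<subseteq> gens" 1 c] by (simp add: scal_mult[symmetric])

lemma affine_gens: "i \<in> affine_nodes \<Longrightarrow> Chev_E i \<in> gens" "i \<in> affine_nodes \<Longrightarrow> Chev_F i \<in> gens"
  "i \<in> affine_nodes \<Longrightarrow> Chev_K i \<in> gens" "i \<in> affine_nodes \<Longrightarrow> Chev_Kinv i \<in> gens"
  by (auto simp: gens_def chevalley_gens_def)

lemma in_gens_phi_coeff:
  assumes "i \<in> nodes" "\<sigma> \<in> {1, -1}"
  shows "in_gens (\<phi>_coeff \<sigma> i m)"
proof -
  have h: "in_gens (fps_nth (h_series \<sigma> i) l)" for l
  proof (cases "l = 0")
    case False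
    hence "Drin_H i (\<sigma> * int l) \<in> gens"
      using assms unfolding gens_def by (intro UnI2 UN_I[of i]) auto
    thus ?thesis
      using False by (simp add: h_series_def in_gens_mult in_gens_scal)
  qed (simp add: h_series_def)
  have "in_gens (fps_nth (h_series \<sigma> i ^ t) l)" for t l
  proof (induction t arbitrary: l)
    case (Suc t)
    thus ?case
      using h by (auto simp: fps_mult_nth intro!: supp_sum in_gens_mult)
  qed simp
  thus ?thesis
    using assms affine_gens[of i] by (auto simp: \<phi>_coeff_def intro!: in_gens_mult supp_sum in_gens_scal)
qed

lemma in_gens_half_component:
  assumes "x \<in> half_component g \<beta>" "set_mset \<beta> \<subseteq> affine_nodes" "g = Chev_E \<or> g = Chev_F"
  shows "in_gens x"
proof -
  have "supp (\<lambda>w. \<exists>is. w = map g is \<and> mset is = \<beta>) x"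
    using assms(1) by (simp add: half_component_altdef)
  thus ?thesis
    by (rule supp_mono) (use assms(2,3) affine_gens(1,2) in fastforce)
qed

lemma rep_iso_l_highest_weight_vector:
  assumes iso: "rep_iso V V' M M'" and v: "l_highest_weight_vector V P v"
  shows "l_highest_weight_vector V' P (M *\<^sub>v v)"
proof -
  let ?n = "rep_dim V"
  have M: "M \<in> carrier_mat ?n ?n" and dim: "rep_dim V' = ?n"
    using iso by (simp_all add: rep_iso_def)
  have vc: "v \<in> carrier_vec ?n" and v0: "v \<noteq> 0\<^sub>v ?n"
    using v by (simp_all add: l_highest_weight_vector_def)
  have M0: "M *\<^sub>v 0\<^sub>v ?n = 0\<^sub>v ?n"
    using M by (intro eq_vecI) (simp_all add: scalar_prod_def)
  have "M *\<^sub>v v \<noteq> 0\<^sub>v ?n"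
  proof
    assume "M *\<^sub>v v = 0\<^sub>v ?n"
    hence "M' *\<^sub>v 0\<^sub>v ?n = v"
      using rep_iso_inverse(1)[OF iso vc] by simp
    moreover have "M' *\<^sub>v 0\<^sub>v ?n = 0\<^sub>v ?n"
      using iso by (intro eq_vecI) (auto simp: scalar_prod_def rep_iso_def)
    ultimately show False using v0 by simp
  qed
  moreover have "rep_gen V' (Drin_Xp i k) *\<^sub>v (M *\<^sub>v v) = 0\<^sub>v ?n" if "i \<in> nodes" for i k
  proof -
    have "rep_gen V' (Drin_Xp i k) *\<^sub>v (M *\<^sub>v v) = M *\<^sub>v (rep_gen V (Drin_Xp i k) *\<^sub>v v)"
      using iso vc that unfolding rep_iso_def gens_def by blast
    thus ?thesis using v that M0 by (simp add: l_highest_weight_vector_def)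
  qed
  moreover have "act V' (\<phi>_coeff \<sigma> i m) *\<^sub>v (M *\<^sub>v v) = c \<cdot>\<^sub>v (M *\<^sub>v v)"
    if "act V (\<phi>_coeff \<sigma> i m) *\<^sub>v v = c \<cdot>\<^sub>v v" "i \<in> nodes" "\<sigma> \<in> {1, - 1}" for \<sigma> i m c
    using rep_iso_act[OF iso in_gens_phi_coeff[OF that(2,3)] vc, of m] that(1) mult_mat_vec[OF M vc] by simp
  moreover have "M *\<^sub>v v \<in> carrier_vec ?n" using M by (auto intro!: carrier_vecI)
  ultimately show ?thesis
    using v unfolding l_highest_weight_vector_def dim Let_def by auto
qed

lemma rep_iso_weight_vector:
  assumes iso: "rep_iso V V' M M'" and v: "weight_vector V \<mu> v"
  shows "weight_vector V' \<mu> (M *\<^sub>v v)"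
proof -
  have vc: "v \<in> carrier_vec (rep_dim V)" and M: "M \<in> carrier_mat (rep_dim V) (rep_dim V)"
    using v iso by (simp_all add: weight_vector_def rep_iso_def)
  have "rep_gen V' (Chev_K i) *\<^sub>v (M *\<^sub>v v) = (qi i powi \<mu> i) \<cdot>\<^sub>v (M *\<^sub>v v)" if "i \<in> nodes" for i
  proof -
    have "rep_gen V' (Chev_K i) *\<^sub>v (M *\<^sub>v v) = M *\<^sub>v (rep_gen V (Chev_K i) *\<^sub>v v)"
      using iso vc that affine_gens(3)[of i] unfolding rep_iso_def by simp
    thus ?thesis
      using v that mult_mat_vec[OF M vc] by (simp add: weight_vector_def)
  qed
  thus ?thesis
    using rep_iso_carrier[OF iso] by (simp add: weight_vector_def)
qed

text \<open>The choice of dual bases involves \<beta> only and no module, so both pairs of modules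
  are evaluated with the same bases. That the chosen families are dual bases depends on
  \<open>dual_bases_exist\<close>.\<close>

lemma canonical_term_cases:
  assumes "set_mset \<beta> \<subseteq> affine_nodes"
  obtains N b b' where "dual_bases \<beta> N b b'"
    "\<And>V W v w. canonical_term V W v w \<beta> = vec (rep_dim W * rep_dim V)
          (\<lambda>k. \<Sum>\<nu><N. kron_vec (act W (b \<nu>) *\<^sub>v w) (act V (b' \<nu>) *\<^sub>v v) $ k)"
proof -
  obtain N b b' where Nb: "(SOME (N, b, b'). dual_bases \<beta> N b b') = (N, b, b')"
    by (metis prod_cases3)
  have "\<exists>t. case t of (N, b, b') \<Rightarrow> dual_bases \<beta> N b b'"
    using dual_bases_exist[OF assms] by auto
  from someI_ex[OF this] have "dual_bases \<beta> N b b'"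
    unfolding Nb by simp
  thus thesis
    by (rule that) (simp add: canonical_term_def Nb)
qed

lemma rep_iso_canonical_term:
  assumes isoV: "rep_iso V V' M M'" and isoW: "rep_iso W W' U U'"
    and v: "v \<in> carrier_vec (rep_dim V)" and w: "w \<in> carrier_vec (rep_dim W)" and \<beta>: "set_mset \<beta> \<subseteq> affine_nodes"
  shows "canonical_term V' W' (M *\<^sub>v v) (U *\<^sub>v w) \<beta> = kron_mat U M *\<^sub>v canonical_term V W v w \<beta>"
proof -
  have M: "M \<in> carrier_mat (rep_dim V) (rep_dim V)" "rep_dim V' = rep_dim V"
    and U: "U \<in> carrier_mat (rep_dim W) (rep_dim W)" "rep_dim W' = rep_dim W"
    using isoV isoW by (simp_all add: rep_iso_def)
  obtain N b b' where b: "dual_bases \<beta> N b b'"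
    and ct: "\<And>V W v w. canonical_term V W v w \<beta> = vec (rep_dim W * rep_dim V)
          (\<lambda>k. \<Sum>\<nu><N. kron_vec (act W (b \<nu>) *\<^sub>v w) (act V (b' \<nu>) *\<^sub>v v) $ k)"
    by (rule canonical_term_cases[OF \<beta>]) blast
  have gens: "in_gens (b \<nu>)" "in_gens (b' \<nu>)" if "\<nu> < N" for \<nu>
    using b that in_gens_half_component[OF _ \<beta>] unfolding dual_bases_def by blast+
  let ?n = "rep_dim W * rep_dim V"
  let ?k = "\<lambda>\<nu>. kron_vec (act W (b \<nu>) *\<^sub>v w) (act V (b' \<nu>) *\<^sub>v v)"
  have kdim: "dim_row (kron_mat U M) = ?n" "dim_col (kron_mat U M) = ?n"
    using M U by (simp_all add: kron_mat_def)
  have k: "kron_vec (act W' (b \<nu>) *\<^sub>v (U *\<^sub>v w)) (act V' (b' \<nu>) *\<^sub>v (M *\<^sub>v v)) = kron_mat U M *\<^sub>v ?k \<nu>" if "\<nu> < N" for \<nu>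
    unfolding rep_iso_act[OF isoV gens(2)[OF that] v] rep_iso_act[OF isoW gens(1)[OF that] w]
    using M U act_carrier by (intro kron_mat_mult_vec[symmetric]) (simp_all add: act_def)
  have kd: "dim_vec (?k \<nu>) = ?n" for \<nu> by (simp add: act_def)
  show ?thesis
  proof (rule eq_vecI)
    fix i assume "i < dim_vec (kron_mat U M *\<^sub>v canonical_term V W v w \<beta>)"
    hence i: "i < ?n" by (simp add: kdim)
    have "canonical_term V' W' (M *\<^sub>v v) (U *\<^sub>v w) \<beta> $ i = (\<Sum>\<nu><N. (kron_mat U M *\<^sub>v ?k \<nu>) $ i)"
      using i k by (simp add: ct M U)
    also have "\<dots> = (\<Sum>\<nu><N. \<Sum>j<?n. kron_mat U M $$ (i, j) * ?k \<nu> $ j)"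
      using i by (simp add: scalar_prod_def kdim kd atLeast0LessThan del: dim_kron_vec)
    also have "\<dots> = (kron_mat U M *\<^sub>v canonical_term V W v w \<beta>) $ i"
      using i by (subst sum.swap) (simp add: scalar_prod_def kdim ct sum_distrib_left atLeast0LessThan)
    finally show "canonical_term V' W' (M *\<^sub>v v) (U *\<^sub>v w) \<beta> $ i = (kron_mat U M *\<^sub>v canonical_term V W v w \<beta>) $ i" .
  qed (simp add: kdim ct M U)
qed

definition canonical_finite :: "loop_rep \<Rightarrow> loop_rep \<Rightarrow> kk vec \<Rightarrow> kk vec \<Rightarrow> bool" where
  "canonical_finite V W v w \<longleftrightarrow> (\<forall>N. \<forall>k<rep_dim W * rep_dim V.
     finite {\<beta>. set_mset \<beta> \<subseteq> affine_nodes \<and> count \<beta> 0 = N \<and> canonical_term V W v w \<beta> $ k \<noteq> 0})"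

lemma dim_canonical_term: "dim_vec (canonical_term V W v w \<beta>) = rep_dim W * rep_dim V"
  by (simp add: canonical_term_def split: prod.split)

lemma rep_iso_Runiv_coeff:
  assumes isoV: "rep_iso V V' M M'" and isoW: "rep_iso W W' U U'"
    and v: "v \<in> carrier_vec (rep_dim V)" and w: "w \<in> carrier_vec (rep_dim W)" and fin: "canonical_finite V W v w"
  shows "Runiv_coeff V' W' \<kappa> \<mu> (M *\<^sub>v v) (U *\<^sub>v w) N = kron_mat U M *\<^sub>v Runiv_coeff V W \<kappa> \<mu> v w N"
    and "canonical_finite V' W' (M *\<^sub>v v) (U *\<^sub>v w)"
proof -
  have M: "M \<in> carrier_mat (rep_dim V) (rep_dim V)" "rep_dim V' = rep_dim V"
    and U: "U \<in> carrier_mat (rep_dim W) (rep_dim W)" "rep_dim W' = rep_dim W"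
    using isoV isoW by (simp_all add: rep_iso_def)
  let ?n = "rep_dim W * rep_dim V"
  let ?C = "\<lambda>N \<beta>. set_mset \<beta> \<subseteq> affine_nodes \<and> count \<beta> 0 = N"
  let ?c = "\<lambda>N k \<beta>. if ?C N \<beta> then canonical_term V W v w \<beta> $ k else 0"
  let ?c' = "\<lambda>N k \<beta>. if ?C N \<beta> then canonical_term V' W' (M *\<^sub>v v) (U *\<^sub>v w) \<beta> $ k else 0"
  have kdim: "dim_row (kron_mat U M) = ?n" "dim_col (kron_mat U M) = ?n"
    using M U by (simp_all add: kron_mat_def)
  have c': "?c' N i = (\<lambda>\<beta>. \<Sum>j<?n. kron_mat U M $$ (i, j) * ?c N j \<beta>)" if "i < ?n" for i N
  proof
    fix \<beta>
    show "?c' N i \<beta> = (\<Sum>j<?n. kron_mat U M $$ (i, j) * ?c N j \<beta>)"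
    proof (cases "?C N \<beta>")
      case True
      hence "canonical_term V' W' (M *\<^sub>v v) (U *\<^sub>v w) \<beta> = kron_mat U M *\<^sub>v canonical_term V W v w \<beta>"
        by (intro rep_iso_canonical_term[OF isoV isoW v w]) simp
      thus ?thesis
        using that True by (simp add: kdim scalar_prod_def atLeast0LessThan dim_canonical_term)
    next
      case False
      thus ?thesis by (simp only: if_False mult_zero_right sum.neutral_const)
    qed
  qed
  have fin': "finite {\<beta>. ?c N j \<beta> \<noteq> 0}" if "j < ?n" for j N
  proof -
    have "{\<beta>. ?c N j \<beta> \<noteq> 0} = {\<beta>. set_mset \<beta> \<subseteq> affine_nodes \<and> count \<beta> 0 = N \<and> canonical_term V W v w \<beta> $ j \<noteq> 0}"
      by auto
    thus ?thesis
      using fin that by (simp add: canonical_finite_def)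
  qed
  have sum: "Sum_any (?c' N i) = (\<Sum>j<?n. kron_mat U M $$ (i, j) * Sum_any (?c N j))" if "i < ?n" for i N
    unfolding c'[OF that] by (rule Sum_any_sum_mult) (use fin' in auto)
  show "Runiv_coeff V' W' \<kappa> \<mu> (M *\<^sub>v v) (U *\<^sub>v w) N = kron_mat U M *\<^sub>v Runiv_coeff V W \<kappa> \<mu> v w N"
  proof (rule eq_vecI)
    fix i assume "i < dim_vec (kron_mat U M *\<^sub>v Runiv_coeff V W \<kappa> \<mu> v w N)"
    hence i: "i < ?n" by (simp add: kdim)
    thus "Runiv_coeff V' W' \<kappa> \<mu> (M *\<^sub>v v) (U *\<^sub>v w) N $ i = (kron_mat U M *\<^sub>v Runiv_coeff V W \<kappa> \<mu> v w N) $ i"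
      using sum[OF i, of N] M U
      by (simp add: Runiv_coeff_def kdim scalar_prod_def atLeast0LessThan sum_distrib_left mult.left_commute)
  qed (simp add: Runiv_coeff_def kdim M U)
  show "canonical_finite V' W' (M *\<^sub>v v) (U *\<^sub>v w)"
    unfolding canonical_finite_def
  proof (intro allI impI)
    fix N k assume "k < rep_dim W' * rep_dim V'"
    hence k: "k < ?n" using M U by simp
    have "{\<beta>. ?c' N k \<beta> \<noteq> 0} \<subseteq> (\<Union>j<?n. {\<beta>. ?c N j \<beta> \<noteq> 0})"
    proof (rule subsetI, rule ccontr)
      fix \<beta> assume \<beta>: "\<beta> \<in> {\<beta>. ?c' N k \<beta> \<noteq> 0}" "\<beta> \<notin> (\<Union>j<?n. {\<beta>. ?c N j \<beta> \<noteq> 0})"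
      hence 0: "?c N j \<beta> = 0" if "j < ?n" for j using that by blast
      have "?c' N k \<beta> = 0"
        unfolding fun_cong[OF c'[OF k]] by (intro sum.neutral ballI) (simp only: lessThan_iff 0 mult_zero_right)
      thus False using \<beta> by blast
    qed
    moreover have "finite (\<Union>j<?n. {\<beta>. ?c N j \<beta> \<noteq> 0})"
      using fin' by blast
    ultimately have "finite {\<beta>. ?c' N k \<beta> \<noteq> 0}"
      by (rule finite_subset)
    moreover have "{\<beta>. set_mset \<beta> \<subseteq> affine_nodes \<and> count \<beta> 0 = N \<and> canonical_term V' W' (M *\<^sub>v v) (U *\<^sub>v w) \<beta> $ k \<noteq> 0} = {\<beta>. ?c' N k \<beta> \<noteq> 0}"
      by auto
    ultimately show "finite {\<beta>. set_mset \<beta> \<subseteq> affine_nodes \<and> count \<beta> 0 = N \<and> canonical_term V' W' (M *\<^sub>v v) (U *\<^sub>v w) \<beta> $ k \<noteq> 0}"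
      by simp
  qed
qed

end

section \<open>The invariant\<close>

lemma finite_eigenvalues:
  fixes A :: "'a :: field mat"
  assumes "A \<in> carrier_mat n n"
  shows "finite {k. \<exists>v\<in>carrier_vec n. v \<noteq> 0\<^sub>v n \<and> A *\<^sub>v v = k \<cdot>\<^sub>v v}"
proof (rule finite_subset)
  show "{k. \<exists>v\<in>carrier_vec n. v \<noteq> 0\<^sub>v n \<and> A *\<^sub>v v = k \<cdot>\<^sub>v v} \<subseteq> {k. poly (char_poly A) k = 0}"
    using assms eigenvalue_root_char_poly[OF assms] by (auto simp: eigenvalue_def eigenvector_def)
  have "char_poly A \<noteq> 0"
    using degree_monic_char_poly[OF assms] by auto
  thus "finite {k. poly (char_poly A) k = 0}"
    by (rule poly_roots_finite)
qed

context quantum_loop_algebra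
begin

section \<open>Only finitely many weights contribute to a coefficient of the universal
  R-matrix\<close>

lemma is_module_dim_gens: "is_module V \<Longrightarrow> dim_gens V"
  by (auto simp: is_module_def dim_gens_def dest: carrier_matD)

lemma K_E_commute:
  assumes V: "is_module V" and ij: "i \<in> affine_nodes" "j \<in> affine_nodes" and v: "v \<in> carrier_vec (rep_dim V)"
  shows "rep_gen V (Chev_K i) *\<^sub>v (rep_gen V (Chev_E j) *\<^sub>v v) =
    (qi i powi affine_cartan \<gg> i j) \<cdot>\<^sub>v (rep_gen V (Chev_E j) *\<^sub>v (rep_gen V (Chev_K i) *\<^sub>v v))"
proof -
  let ?c = "qi i powi affine_cartan \<gg> i j" and ?n = "rep_dim V"
  define x where "x = gK i * gE j - scal ?c * gE j * gK i"
  have x: "x = wrd [Chev_K i, Chev_E j] + sm (- ?c) (wrd [Chev_E j, Chev_K i])"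
    by (simp add: x_def gn_wrd wrd_append[symmetric] scal_mult sm_mult_left mult.assoc sm_minus_left)
  have xg: "in_gens x"
    unfolding x using ij by (intro supp_add supp_sm) (simp_all add: affine_gens)
  have "x \<in> loop_relations"
    using ij unfolding x_def loop_relations_def chevalley_relations_def by blast
  hence "act V x *\<^sub>v v = 0\<^sub>m ?n ?n *\<^sub>v v"
    using V by (simp add: is_module_def)
  also have "\<dots> = 0\<^sub>v ?n"
    using v by (intro eq_vecI) (simp_all add: scalar_prod_def)
  finally have *: "vec ?n (\<lambda>l. linf (\<lambda>w. word_act V w v $ l) x) = 0\<^sub>v ?n"
    unfolding act_mult_vec[OF is_module_dim_gens[OF V] xg v] .
  have dim: "dim_row (rep_gen V g) = ?n" if "g \<in> gens" for g
    using is_module_dim_gens[OF V] that by (simp add: dim_gens_def)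
  show ?thesis
  proof (rule eq_vecI)
    fix l assume "l < dim_vec (?c \<cdot>\<^sub>v (rep_gen V (Chev_E j) *\<^sub>v (rep_gen V (Chev_K i) *\<^sub>v v)))"
    hence l: "l < ?n" using ij by (simp add: dim affine_gens)
    have "linf (\<lambda>w. word_act V w v $ l) x = 0"
      using arg_cong[OF *, of "\<lambda>u. vec_index u l"] l by simp
    thus "(rep_gen V (Chev_K i) *\<^sub>v (rep_gen V (Chev_E j) *\<^sub>v v)) $ l = (?c \<cdot>\<^sub>v (rep_gen V (Chev_E j) *\<^sub>v (rep_gen V (Chev_K i) *\<^sub>v v))) $ l"
      unfolding x linf_add linf_sm linf_wrd using l ij by (simp add: dim affine_gens)
  qed (use ij in \<open>simp add: dim affine_gens\<close>)
qed

lemma weight_word_act: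
  assumes V: "is_module V" and v: "weight_vector V \<mu> v" and i: "i \<in> nodes" and "set is \<subseteq> affine_nodes"
  shows "rep_gen V (Chev_K i) *\<^sub>v word_act V (map Chev_E is) v =
    (qi i powi (\<mu> i + (\<Sum>j\<leftarrow>is. affine_cartan \<gg> i j))) \<cdot>\<^sub>v word_act V (map Chev_E is) v"
  using assms(4)
proof (induction "is")
  case Nil
  thus ?case using v i by (simp add: weight_vector_def)
next
  case (Cons j "is")
  let ?u = "word_act V (map Chev_E is) v"
  have j: "j \<in> affine_nodes" "set (map Chev_E is) \<subseteq> gens"
    using Cons.prems affine_gens by auto
  have u: "?u \<in> carrier_vec (rep_dim V)"
    using v by (intro word_act_carrier is_module_dim_gens V j) (simp add: weight_vector_def)
  have E: "rep_gen V (Chev_E j) \<in> carrier_mat (rep_dim V) (rep_dim V)"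
    using V j(1) affine_gens by (simp add: is_module_def)
  have i': "i \<in> affine_nodes" using i by auto
  have "rep_gen V (Chev_K i) *\<^sub>v ?u = (qi i powi (\<mu> i + (\<Sum>j\<leftarrow>is. affine_cartan \<gg> i j))) \<cdot>\<^sub>v ?u"
    using Cons by simp
  thus ?case
    using K_E_commute[OF V i' j(1) u] mult_mat_vec[OF E u]
    by (simp add: smult_smult_assoc power_int_add mult_ac)
qed

lemma weight_act:
  assumes V: "is_module V" and v: "weight_vector V \<mu> v" and i: "i \<in> nodes"
    and x: "x \<in> half_component Chev_E \<beta>" and \<beta>: "set_mset \<beta> \<subseteq> affine_nodes"
  shows "rep_gen V (Chev_K i) *\<^sub>v (act V x *\<^sub>v v) =
    (qi i powi (\<mu> i + (\<Sum>j\<in>#\<beta>. affine_cartan \<gg> i j))) \<cdot>\<^sub>v (act V x *\<^sub>v v)"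
proof (rule eq_vecI)
  let ?n = "rep_dim V" and ?K = "rep_gen V (Chev_K i)" and ?c = "qi i powi (\<mu> i + (\<Sum>j\<in>#\<beta>. affine_cartan \<gg> i j))"
  have vc: "v \<in> carrier_vec ?n" using v by (simp add: weight_vector_def)
  have xg: "in_gens x" using in_gens_half_component[OF x \<beta>] by simp
  have K: "?K \<in> carrier_mat ?n ?n"
    using V i affine_gens(3)[of i] by (simp add: is_module_def)
  have act: "act V x *\<^sub>v v = vec ?n (\<lambda>l. linf (\<lambda>w. word_act V w v $ l) x)"
    by (rule act_mult_vec[OF is_module_dim_gens[OF V] xg vc])
  show "dim_vec (?K *\<^sub>v (act V x *\<^sub>v v)) = dim_vec (?c \<cdot>\<^sub>v (act V x *\<^sub>v v))"
    using K by (simp add: act_def)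
  fix l assume "l < dim_vec (?c \<cdot>\<^sub>v (act V x *\<^sub>v v))"
  hence l: "l < ?n" by (simp add: act_def)
  have "(?K *\<^sub>v (act V x *\<^sub>v v)) $ l = linf (\<lambda>w. \<Sum>k<?n. ?K $$ (l, k) * word_act V w v $ k) x"
    unfolding act linf_sum_right using K l by (simp add: scalar_prod_def atLeast0LessThan)
  also have "\<dots> = linf (\<lambda>w. ?c * word_act V w v $ l) x"
    unfolding linf_def
  proof (intro sum.cong refl arg_cong[where f = "(*) _"])
    fix w assume w: "w \<in> Poly_Mapping.keys x"
    obtain "is" where "is": "letters w = map Chev_E is" "mset is = \<beta>"
      using x w unfolding half_component_def by blast
    have sum: "(\<Sum>j\<leftarrow>is. affine_cartan \<gg> i j) = (\<Sum>j\<in>#\<beta>. affine_cartan \<gg> i j)"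
      unfolding "is"(2)[symmetric] mset_map[symmetric] sum_mset_sum_list ..
    have set: "set is \<subseteq> affine_nodes" using \<beta> "is"(2) by auto
    have "set (letters w) \<subseteq> gens" using xg w by (simp add: supp_def)
    hence g: "word_act V (letters w) v \<in> carrier_vec ?n"
      by (intro word_act_carrier is_module_dim_gens V vc)
    have "(\<Sum>k<?n. ?K $$ (l, k) * word_act V (letters w) v $ k) = (?K *\<^sub>v word_act V (letters w) v) $ l"
      using K l g by (simp add: scalar_prod_def atLeast0LessThan)
    also have "\<dots> = ?c * word_act V (letters w) v $ l"
      using weight_word_act[OF V v i set] l g unfolding "is"(1) sum by simp
    finally show "(\<Sum>k<?n. ?K $$ (l, k) * word_act V (letters w) v $ k) = ?c * word_act V (letters w) v $ l" .
  qed
  also have "\<dots> = (?c \<cdot>\<^sub>v (act V x *\<^sub>v v)) $ l"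
    unfolding act using l by (simp add: linf_def sum_distrib_left mult.left_commute)
  finally show "(?K *\<^sub>v (act V x *\<^sub>v v)) $ l = (?c \<cdot>\<^sub>v (act V x *\<^sub>v v)) $ l" .
qed

text \<open>The affine Cartan matrix is singular, but prescribing the multiplicity of node 0 removes
  the kernel: what remains is a linear system for the finite Cartan matrix, which is
  invertible.\<close>

lemma cartan_sums_inj:
  assumes "set_mset \<beta> \<subseteq> affine_nodes" "set_mset \<beta>' \<subseteq> affine_nodes" "count \<beta> 0 = count \<beta>' 0"
    and eq: "\<And>i. i \<in> nodes \<Longrightarrow> (\<Sum>j\<in>#\<beta>. affine_cartan \<gg> i j) = (\<Sum>j\<in>#\<beta>'. affine_cartan \<gg> i j)"
  shows "\<beta> = \<beta>'"
proof (rule multiset_eqI)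
  fix j
  define x where "x j = rat_of_nat (count \<beta> j) - rat_of_nat (count \<beta>' j)" for j
  obtain B where B: "qc_certificate \<gg> (int period) B" using certificate by blast
  have ins: "affine_nodes = insert 0 nodes" by auto
  have "(\<Sum>j\<in>nodes. of_int (cartan \<gg> i j) * x j) = 0" if i: "i \<in> nodes" for i
  proof -
    have "(\<Sum>j\<in>affine_nodes. int (count \<beta> j) * affine_cartan \<gg> i j) = (\<Sum>j\<in>affine_nodes. int (count \<beta>' j) * affine_cartan \<gg> i j)"
      using eq[OF i] assms(1,2) by (simp add: sum_mset_conv_count[of affine_nodes])
    hence "(\<Sum>j\<in>nodes. int (count \<beta> j) * affine_cartan \<gg> i j) = (\<Sum>j\<in>nodes. int (count \<beta>' j) * affine_cartan \<gg> i j)"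
      unfolding ins using assms(3) by simp
    hence "(\<Sum>j\<in>nodes. int (count \<beta> j) * cartan \<gg> i j) = (\<Sum>j\<in>nodes. int (count \<beta>' j) * cartan \<gg> i j)"
      using i by (simp add: affine_cartan_simple)
    hence "rat_of_int (\<Sum>j\<in>nodes. int (count \<beta> j) * cartan \<gg> i j) = rat_of_int (\<Sum>j\<in>nodes. int (count \<beta>' j) * cartan \<gg> i j)"
      by simp
    thus ?thesis
      by (simp add: x_def right_diff_distrib sum_subtractf mult.commute)
  qed
  hence "x j = 0" if "j \<in> nodes"
    using qc_certificate.cartan_nonsingular[OF B cartan_sym, of x j] that by (simp add: simple_nodes_eq)
  moreover have "count \<beta> j = 0" "count \<beta>' j = 0" if "j \<notin> affine_nodes"
    using assms(1,2) that by (auto simp: count_eq_zero_iff)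
  ultimately show "count \<beta> j = count \<beta>' j"
    using assms(3) by (cases "j \<in> nodes"; cases "j = 0") (auto simp: x_def)
qed

text \<open>A contributing \<beta> produces a nonzero vector of W that is an eigenvector of every
  K_i, with an exponent shifted by the value of the coroot on \<beta>. There are finitely many
  eigenvalues, and the exponents together with the multiplicity N of node 0 determine
  \<beta>.\<close>

lemma canonical_finite_weight_vector:
  assumes W: "is_module W" and w: "weight_vector W \<mu> w"
  shows "canonical_finite V W v w"
  unfolding canonical_finite_def
proof (intro allI impI)
  fix N k assume k: "k < rep_dim W * rep_dim V"
  define R where "R = {\<beta>. set_mset \<beta> \<subseteq> affine_nodes \<and> count \<beta> 0 = N \<and> canonical_term V W v w \<beta> $ k \<noteq> 0}"
  define z where "z \<beta> i = (\<Sum>j\<in>#\<beta>. affine_cartan \<gg> i j)" for \<beta> i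
  have "finite ((\<lambda>\<beta>. z \<beta> i) ` R)" if i: "i \<in> nodes" for i
  proof (rule finite_subset)
    let ?E = "{c. \<exists>u\<in>carrier_vec (rep_dim W). u \<noteq> 0\<^sub>v (rep_dim W) \<and> rep_gen W (Chev_K i) *\<^sub>v u = c \<cdot>\<^sub>v u}"
    have "rep_gen W (Chev_K i) \<in> carrier_mat (rep_dim W) (rep_dim W)"
      using W i affine_gens(3)[of i] by (simp add: is_module_def)
    hence "finite ?E" by (rule finite_eigenvalues)
    moreover have "inj (\<lambda>n. qi i powi (\<mu> i + n))"
      using symmetrizer_pos[of \<gg> i] by (intro injI) (simp add: qi_powi qs_powi_inj)
    ultimately show "finite ((\<lambda>n. qi i powi (\<mu> i + n)) -` ?E)"
      by (rule finite_vimageI)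
    show "(\<lambda>\<beta>. z \<beta> i) ` R \<subseteq> (\<lambda>n. qi i powi (\<mu> i + n)) -` ?E"
    proof (rule image_subsetI)
      fix \<beta> assume "\<beta> \<in> R"
      hence \<beta>: "set_mset \<beta> \<subseteq> affine_nodes" and nz: "canonical_term V W v w \<beta> $ k \<noteq> 0"
        by (simp_all add: R_def)
      obtain N b b' where b: "dual_bases \<beta> N b b'"
        and ct: "\<And>V W v w. canonical_term V W v w \<beta> = vec (rep_dim W * rep_dim V)
          (\<lambda>k. \<Sum>\<nu><N. kron_vec (act W (b \<nu>) *\<^sub>v w) (act V (b' \<nu>) *\<^sub>v v) $ k)"
        by (rule canonical_term_cases[OF \<beta>]) blast
      have "(\<Sum>\<nu><N. kron_vec (act W (b \<nu>) *\<^sub>v w) (act V (b' \<nu>) *\<^sub>v v) $ k) \<noteq> 0"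
        using nz k by (simp add: ct)
      then obtain \<nu> where \<nu>: "\<nu> < N" "kron_vec (act W (b \<nu>) *\<^sub>v w) (act V (b' \<nu>) *\<^sub>v v) $ k \<noteq> 0"
        by (meson sum.neutral lessThan_iff)
      have "act W (b \<nu>) *\<^sub>v w \<noteq> 0\<^sub>v (rep_dim W)"
      proof
        assume "act W (b \<nu>) *\<^sub>v w = 0\<^sub>v (rep_dim W)"
        thus False
          using \<nu>(2) k by (simp add: kron_vec_def act_def less_mult_imp_div_less)
      qed
      moreover have "act W (b \<nu>) *\<^sub>v w \<in> carrier_vec (rep_dim W)"
        by (intro carrier_vecI) (simp add: act_def)
      moreover have "b \<nu> \<in> half_component Chev_E \<beta>"
        using b \<nu>(1) by (simp add: dual_bases_def)
      from weight_act[OF W w i this \<beta>]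
      have "rep_gen W (Chev_K i) *\<^sub>v (act W (b \<nu>) *\<^sub>v w) = (qi i powi (\<mu> i + z \<beta> i)) \<cdot>\<^sub>v (act W (b \<nu>) *\<^sub>v w)"
        by (simp add: z_def)
      ultimately show "z \<beta> i \<in> (\<lambda>n. qi i powi (\<mu> i + n)) -` ?E"
        by blast
    qed
  qed
  hence "finite (PiE nodes (\<lambda>i. (\<lambda>\<beta>. z \<beta> i) ` R))"
    by (intro finite_PiE) auto
  moreover have "(\<lambda>\<beta>. restrict (z \<beta>) nodes) ` R \<subseteq> PiE nodes (\<lambda>i. (\<lambda>\<beta>. z \<beta> i) ` R)"
    by auto
  ultimately have "finite ((\<lambda>\<beta>. restrict (z \<beta>) nodes) ` R)"
    by (rule rev_finite_subset)
  moreover have "inj_on (\<lambda>\<beta>. restrict (z \<beta>) nodes) R"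
  proof (rule inj_onI)
    fix \<beta> \<beta>' assume *: "\<beta> \<in> R" "\<beta>' \<in> R" "restrict (z \<beta>) nodes = restrict (z \<beta>') nodes"
    have "z \<beta> i = z \<beta>' i" if "i \<in> nodes" for i
      using fun_cong[OF *(3), of i] that by simp
    thus "\<beta> = \<beta>'"
      using *(1,2) by (intro cartan_sums_inj) (simp_all add: R_def z_def)
  qed
  ultimately have "finite R" by (rule finite_imageD)
  thus "finite {\<beta>. set_mset \<beta> \<subseteq> affine_nodes \<and> count \<beta> 0 = N \<and> canonical_term V W v w \<beta> $ k \<noteq> 0}"
    by (simp add: R_def)
qed

section \<open>Invariance of the universal coefficient, and the formula for \<Lambda>\<close>

definition is_universal_coeff :: "loop_rep \<Rightarrow> loop_rep \<Rightarrow> kk fps \<Rightarrow> bool" where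
  "is_universal_coeff V W a \<longleftrightarrow> (\<exists>P Q v w \<kappa> \<mu>.
     l_highest_weight_vector V P v \<and> l_highest_weight_vector W Q w \<and>
     weight_vector V \<kappa> v \<and> weight_vector W \<mu> w \<and>
     (\<forall>N. Runiv_coeff V W \<kappa> \<mu> v w N = fps_nth a N \<cdot>\<^sub>v kron_vec w v))"

lemma rep_iso_is_universal_coeff:
  assumes isoV: "rep_iso V V' M M'" and isoW: "rep_iso W W' U U'"
    and fin: "\<And>v w \<mu>. v \<in> carrier_vec (rep_dim V) \<Longrightarrow> weight_vector W \<mu> w \<Longrightarrow> canonical_finite V W v w"
    and a: "is_universal_coeff V W a"
  shows "is_universal_coeff V' W' a"
proof -
  obtain P P' v w \<kappa> \<mu> where *: "l_highest_weight_vector V P v" "l_highest_weight_vector W P' w"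
     "weight_vector V \<kappa> v" "weight_vector W \<mu> w"
     "\<And>N. Runiv_coeff V W \<kappa> \<mu> v w N = fps_nth a N \<cdot>\<^sub>v kron_vec w v"
    using a unfolding is_universal_coeff_def by blast
  have vw: "v \<in> carrier_vec (rep_dim V)" "w \<in> carrier_vec (rep_dim W)"
    using *(1,2) by (simp_all add: l_highest_weight_vector_def)
  have M: "M \<in> carrier_mat (rep_dim V) (rep_dim V)" "U \<in> carrier_mat (rep_dim W) (rep_dim W)"
    using isoV isoW by (simp_all add: rep_iso_def)
  have "Runiv_coeff V' W' \<kappa> \<mu> (M *\<^sub>v v) (U *\<^sub>v w) N = fps_nth a N \<cdot>\<^sub>v kron_vec (U *\<^sub>v w) (M *\<^sub>v v)" for N
  proof -
    have "Runiv_coeff V' W' \<kappa> \<mu> (M *\<^sub>v v) (U *\<^sub>v w) N = kron_mat U M *\<^sub>v (fps_nth a N \<cdot>\<^sub>v kron_vec w v)"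
      using rep_iso_Runiv_coeff(1)[OF isoV isoW vw fin[OF vw(1) *(4)]] *(5) by simp
    also have "\<dots> = fps_nth a N \<cdot>\<^sub>v (kron_mat U M *\<^sub>v kron_vec w v)"
      using M vw by (intro mult_mat_vec[of _ "rep_dim W * rep_dim V" "rep_dim W * rep_dim V"])
        (auto simp: kron_mat_def intro!: carrier_vecI)
    also have "kron_mat U M *\<^sub>v kron_vec w v = kron_vec (U *\<^sub>v w) (M *\<^sub>v v)"
      using M vw by (intro kron_mat_mult_vec) auto
    finally show ?thesis .
  qed
  thus ?thesis
    unfolding is_universal_coeff_def
    using rep_iso_l_highest_weight_vector[OF isoV *(1)] rep_iso_l_highest_weight_vector[OF isoW *(2)]
      rep_iso_weight_vector[OF isoV *(3)] rep_iso_weight_vector[OF isoW *(4)] by blast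
qed

lemma universal_coeff_isomorphic:
  assumes V: "is_module V" "isomorphic V V'" and W: "is_module W" "isomorphic W W'"
  shows "universal_coeff V W = universal_coeff V' W'"
proof -
  obtain M M' where isoV: "rep_iso V V' M M'" using rep_iso_from_isomorphic[OF V] by blast
  obtain U U' where isoW: "rep_iso W W' U U'" using rep_iso_from_isomorphic[OF W] by blast
  \<comment> \<open>The weight argument is available for W, which is a module by assumption.
    Finiteness for W' is obtained by pulling the vectors back and transporting the result along the
    isomorphisms.\<close>
  have fin: "canonical_finite V' W' v' w'" if "v' \<in> carrier_vec (rep_dim V')" "weight_vector W' \<mu> w'" for v' w' \<mu>
  proof -
    have v: "M' *\<^sub>v v' \<in> carrier_vec (rep_dim V)" "M *\<^sub>v (M' *\<^sub>v v') = v'"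
      using rep_iso_carrier[OF rep_iso_sym[OF isoV]] rep_iso_inverse(1)[OF rep_iso_sym[OF isoV]] that by auto
    have w: "weight_vector W \<mu> (U' *\<^sub>v w')" "U *\<^sub>v (U' *\<^sub>v w') = w'"
      using rep_iso_weight_vector[OF rep_iso_sym[OF isoW] that(2)] rep_iso_inverse(1)[OF rep_iso_sym[OF isoW]] that
      by (auto simp: weight_vector_def)
    from w(1) have "U' *\<^sub>v w' \<in> carrier_vec (rep_dim W)"
      by (simp add: weight_vector_def)
    from rep_iso_Runiv_coeff(2)[OF isoV isoW v(1) this canonical_finite_weight_vector[OF W(1) w(1)]]
    show ?thesis unfolding v w .
  qed
  have "is_universal_coeff V W a \<Longrightarrow> is_universal_coeff V' W' a" for a
    \<comment> \<open>With both implications the defining predicates are equivalent for every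
      series, which identifies the two descriptions by \<open>THE\<close>.\<close>
    by (rule rep_iso_is_universal_coeff[OF isoV isoW canonical_finite_weight_vector[OF W(1)]])
  moreover have "is_universal_coeff V' W' a \<Longrightarrow> is_universal_coeff V W a" for a
    by (rule rep_iso_is_universal_coeff[OF rep_iso_sym[OF isoV] rep_iso_sym[OF isoW] fin])
  ultimately have "is_universal_coeff V W a \<longleftrightarrow> is_universal_coeff V' W' a" for a
    by blast
  thus ?thesis
    unfolding universal_coeff_def is_universal_coeff_def by simp
qed

lemma simple_in_C0_monomial:
  assumes "simple_in_C0 \<epsilon> V"
  shows "is_module V" "set_mset (monomial_of \<epsilon> V) \<subseteq> nodes \<times> UNIV" "isomorphic V (L (monomial_poly (monomial_of \<epsilon> V)))"
proof -
  have "\<exists>m. m \<in> monomials \<gg> \<epsilon> \<and> isomorphic V (L (monomial_poly m))"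
    using assms unfolding simple_in_C0_def by blast
  from someI_ex[OF this]
  have "monomial_of \<epsilon> V \<in> monomials \<gg> \<epsilon>" "isomorphic V (L (monomial_poly (monomial_of \<epsilon> V)))"
    unfolding monomial_of_def by blast+
  thus "set_mset (monomial_of \<epsilon> V) \<subseteq> nodes \<times> UNIV" "isomorphic V (L (monomial_poly (monomial_of \<epsilon> V)))"
    by (auto simp: monomials_def I_hat_def)
  show "is_module V"
    using assms by (simp add: simple_in_C0_def is_simple_def in_C_def)
qed

lemma Lambda_eq:
  assumes fr: frenkel_reshetikhin and V: "simple_in_C0 \<epsilon> V" and W: "simple_in_C0 \<epsilon> W"
  shows "Lambda V W = 2 * int (order 1 (denominator V W)) + pairing_N \<epsilon> V W"
proof -
  note V' = simple_in_C0_monomial[OF V] and W' = simple_in_C0_monomial[OF W]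
  have "has_deg (fps_to_fls (universal_coeff V W)) (- pairing_N \<epsilon> V W)"
    unfolding universal_coeff_isomorphic[OF V'(1,3) W'(1,3)] pairing_N_def
    by (rule has_deg_monomial[OF fr V'(2) W'(2)])
  from has_deg_divide[OF has_deg_denominator this] show ?thesis
    unfolding Lambda_def by (simp add: Deg_eqI)
qed

end

theorem corollary5p15:
  fixes \<gg> :: cartan_type and qpow :: "rat \<Rightarrow> kk" and val :: "kk \<Rightarrow> rat"
    and \<epsilon> :: "nat \<Rightarrow> int" and V W :: loop_rep
  assumes "quantum_loop_algebra \<gg> qpow val"
    and "parity_function \<gg> \<epsilon>"
    and "quantum_loop_algebra.frenkel_reshetikhin \<gg> qpow val"
    and "quantum_loop_algebra.simple_in_C0 \<gg> qpow \<epsilon> V"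
    and "quantum_loop_algebra.simple_in_C0 \<gg> qpow \<epsilon> W"
  shows "quantum_loop_algebra.Lambda \<gg> qpow val V W =
           2 * int (order 1 (quantum_loop_algebra.denominator \<gg> qpow V W)) +
           quantum_loop_algebra.pairing_N \<gg> qpow \<epsilon> V W
       \<and> (quantum_loop_algebra.left_pre_commutative \<gg> qpow V W \<longrightarrow>
           quantum_loop_algebra.Lambda \<gg> qpow val V W =
           quantum_loop_algebra.pairing_N \<gg> qpow \<epsilon> V W)"
  using quantum_loop_algebra.Lambda_eq[OF assms(1,3-5)]
  by (simp add: quantum_loop_algebra.left_pre_commutative_def[OF assms(1)])

end
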